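(* Let $p\ge2$ and $s\in(\frac{p-2}{p},1)$. Then, for any locally bounded, local weak solution $u\in W^{s,p}_{\rm loc}(\Omega)\cap L^{p-1}_{sp}(\mathbb{R}^N)$ of $(-\Delta_p)^s u=0$ in $\Omega$, we have $$u\in W^{1,p}_{\rm loc}(\Omega).$$ Moreover, there exists a constant $C=C(N,p,s)$ (depending only on these parameters) such that for any ball $B_R\equiv B_R(x_o)\Subset\Omega$ we have $$\|\nabla u\|_{L^p(B_{\frac12R})}\le\frac CR\Big[R^{s}(1-s)^{\frac1p}[u]_{W^{s,p}(B_R)}+R^{\frac Np}\big(\|u\|_{L^\infty(B_R)}+\mathrm{Tail}(u;R)\big)\Big].$$ The constant $C$ is stable as $s\uparrow1$ and blows up as $s\downarrow\frac{p-2}{p}$.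
   Context: $N\ge2$ and $\Omega\subset\mathbb{R}^N$ is a bounded open set. $B_R(x_o)$ is the ball of radius $R$ and center $x_o$; balls written without center are concentric with center $x_o$. $B_R(x_o)\Subset\Omega$ means that the closure of the ball is contained in $\Omega$. For $q\in[1,\infty)$, $\gamma\in(0,1)$ and an open set $E$, $W^{\gamma,q}(E)$ is the space of measurable $w:E\to\mathbb{R}$ with $\|w\|_{L^q(E)}+[w]_{W^{\gamma,q}(E)}<\infty$, where $[w]_{W^{\gamma,q}(E)}:=\big[\iint_{E\times E}\frac{|w(x)-w(y)|^q}{|x-y|^{N+\gamma q}}\,dx\,dy\big]^{1/q}$; $w\in W^{\gamma,q}_{\rm loc}(\Omega)$ means $w\in W^{\gamma,q}(B)$ for every ball $B\Subset\Omega$. $L^{p-1}_{sp}(\mathbb{R}^N)$ is the set of $w\in L^{p-1}_{\rm loc}(\mathbb{R}^N)$ with $\int_{\mathbb{R}^N}\frac{|w(x)|^{p-1}}{(1+|x|)^{N+sp}}\,dx<\infty$. The tail is $\mathrm{Tail}(u;R)\equiv\mathrm{Tail}(u;x_o,R):=\big[R^{sp}\int_{\mathbb{R}^N\setminus B_R(x_o)}\frac{|u(x)|^{p-1}}{|x-x_o|^{N+sp}}\,dx\big]^{\frac1{p-1}}$, where $x_o$ is the center of the ball under consideration. A function $u\in W^{s,p}_{\rm loc}(\Omega)\cap L^{p-1}_{sp}(\mathbb{R}^N)$ is a local weak solution of $(-\Delta_p)^su=0$ in $\Omega$ if $\iint_{\mathbb{R}^N\times\mathbb{R}^N}\frac{|u(x)-u(y)|^{p-2}(u(x)-u(y))(\varphi(x)-\varphi(y))}{|x-y|^{N+sp}}\,dx\,dy=0$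 for every $\varphi\in W^{s,p}(\Omega)$ compactly supported in $\Omega$ and extended by $0$ outside $\Omega$. "Locally bounded" means $u\in L^\infty_{\rm loc}(\Omega)$. A constant is "stable as $s\uparrow1$" if it can be chosen to remain bounded as $s\uparrow1$ with the other parameters fixed. Saying that it "blows up" refers to the admissible constant provided by the result (it is not asserted to stay bounded in the indicated limit); no lower bound on the optimal constant is meant. *)

theory Defs
  imports "HOL-Analysis.Analysis" "HOL-Probability.Essential_Supremum"
begin

text \<open>
  Function spaces are sets of total functions on the Euclidean space \<open>'a\<close>, restricted implicitly
  to the domain \<open>E\<close>; values outside \<open>E\<close> do not matter for membership, and functions are
  not identified almost everywhere. Measurability is Lebesgue measurability, and double integrals
  are Lebesgue integrals over the product space \<open>'a \<times> 'a\<close>.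
\<close>

definition Lp_space :: "real \<Rightarrow> 'a::euclidean_space set \<Rightarrow> ('a \<Rightarrow> 'b::euclidean_space) set" where
  "Lp_space q E = {w. w \<in> borel_measurable (lebesgue_on E) \<and>
                      set_integrable lebesgue E (\<lambda>x. norm (w x) powr q)}"

definition Lp_norm :: "real \<Rightarrow> 'a::euclidean_space set \<Rightarrow> ('a \<Rightarrow> 'b::euclidean_space) \<Rightarrow> real" where
  "Lp_norm q E w = (LINT x:E|lebesgue. norm (w x) powr q) powr (1 / q)"

definition Linf_space :: "'a::euclidean_space set \<Rightarrow> ('a \<Rightarrow> real) set" where
  "Linf_space E = {w. w \<in> borel_measurable (lebesgue_on E) \<and>
                      esssup (lebesgue_on E) (\<lambda>x. ereal \<bar>w x\<bar>) < \<infinity>}"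

definition Linf_norm :: "'a::euclidean_space set \<Rightarrow> ('a \<Rightarrow> real) \<Rightarrow> real" where
  "Linf_norm E w = real_of_ereal (esssup (lebesgue_on E) (\<lambda>x. ereal \<bar>w x\<bar>))"

text \<open>The local version of a space \<open>X\<close>: membership in \<open>X B\<close> for every ball \<open>B\<close> whose closure
  lies in \<open>E\<close>.\<close>

definition local_space ::
    "('a::euclidean_space set \<Rightarrow> ('a \<Rightarrow> 'b) set) \<Rightarrow> 'a set \<Rightarrow> ('a \<Rightarrow> 'b) set" where
  "local_space X E = {w. \<forall>x r. 0 < r \<and> cball x r \<subseteq> E \<longrightarrow> w \<in> X (ball x r)}"

text \<open>On the diagonal the Gagliardo kernel is \<open>0\<close> by the convention \<open>t / 0 = 0\<close>;
  the diagonal is a null set.\<close>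

definition gagliardo_kernel ::
    "real \<Rightarrow> real \<Rightarrow> ('a::euclidean_space \<Rightarrow> real) \<Rightarrow> 'a \<times> 'a \<Rightarrow> real" where
  "gagliardo_kernel \<gamma> q w =
     (\<lambda>(x, y). \<bar>w x - w y\<bar> powr q / norm (x - y) powr (real DIM('a) + \<gamma> * q))"

definition gagliardo_seminorm ::
    "real \<Rightarrow> real \<Rightarrow> 'a::euclidean_space set \<Rightarrow> ('a \<Rightarrow> real) \<Rightarrow> real" where
  "gagliardo_seminorm \<gamma> q E w =
     (LINT z:E \<times> E|lebesgue. gagliardo_kernel \<gamma> q w z) powr (1 / q)"

definition frac_sobolev ::
    "real \<Rightarrow> real \<Rightarrow> 'a::euclidean_space set \<Rightarrow> ('a \<Rightarrow> real) set" where
  "frac_sobolev \<gamma> q E =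
     {w \<in> Lp_space q E. set_integrable lebesgue (E \<times> E) (gagliardo_kernel \<gamma> q w)}"

definition tail_space :: "real \<Rightarrow> real \<Rightarrow> ('a::euclidean_space \<Rightarrow> real) set" where
  "tail_space s p =
     {w \<in> local_space (Lp_space (p - 1)) UNIV.
        integrable lebesgue
          (\<lambda>x. \<bar>w x\<bar> powr (p - 1) / (1 + norm x) powr (real DIM('a) + s * p))}"

definition Tail :: "real \<Rightarrow> real \<Rightarrow> ('a::euclidean_space \<Rightarrow> real) \<Rightarrow> 'a \<Rightarrow> real \<Rightarrow> real" where
  "Tail s p u x0 R =
     (R powr (s * p) *
        (LINT x:- ball x0 R|lebesgue.
           \<bar>u x\<bar> powr (p - 1) / norm (x - x0) powr (real DIM('a) + s * p))) powr (1 / (p - 1))"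

definition compactly_supported_in :: "'a::euclidean_space set \<Rightarrow> ('a \<Rightarrow> real) \<Rightarrow> bool" where
  "compactly_supported_in E \<phi> \<longleftrightarrow>
     compact (closure {x. \<phi> x \<noteq> 0}) \<and> closure {x. \<phi> x \<noteq> 0} \<subseteq> E"

text \<open>A test function is zero on the whole complement of \<open>\<Omega>\<close> by
  \<^const>\<open>compactly_supported_in\<close>, which accounts for the extension by \<open>0\<close>.
  The double integral converges absolutely for all \<open>u\<close> and \<open>\<phi>\<close> considered, so
  \<^const>\<open>has_bochner_integral\<close> only states that its value is \<open>0\<close>.\<close>

definition local_weak_solution ::
    "real \<Rightarrow> real \<Rightarrow> 'a::euclidean_space set \<Rightarrow> ('a \<Rightarrow> real) \<Rightarrow> bool" where
  "local_weak_solution s p \<Omega> u \<longleftrightarrow>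
     u \<in> local_space (frac_sobolev s p) \<Omega> \<inter> tail_space s p \<and>
     (\<forall>\<phi>. \<phi> \<in> frac_sobolev s p \<Omega> \<and> compactly_supported_in \<Omega> \<phi> \<longrightarrow>
        has_bochner_integral lebesgue
          (\<lambda>(x, y). \<bar>u x - u y\<bar> powr (p - 2) * (u x - u y) * (\<phi> x - \<phi> y)
                      / norm (x - y) powr (real DIM('a) + s * p)) 0)"

text \<open>\<open>k\<close>-fold continuous differentiability on the whole space, via partial derivatives.\<close>

fun cont_diff :: "nat \<Rightarrow> ('a::euclidean_space \<Rightarrow> real) \<Rightarrow> bool" where
  "cont_diff 0 f \<longleftrightarrow> continuous_on UNIV f"
| "cont_diff (Suc k) f \<longleftrightarrow>
     f differentiable_on UNIV \<and> (\<forall>i\<in>Basis. cont_diff k (\<lambda>x. frechet_derivative f (at x) i))"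

definition smooth_test_function :: "'a::euclidean_space set \<Rightarrow> ('a \<Rightarrow> real) \<Rightarrow> bool" where
  "smooth_test_function E \<phi> \<longleftrightarrow> (\<forall>k. cont_diff k \<phi>) \<and> compactly_supported_in E \<phi>"

definition has_weak_gradient ::
    "('a::euclidean_space \<Rightarrow> real) \<Rightarrow> ('a \<Rightarrow> 'a) \<Rightarrow> 'a set \<Rightarrow> bool" where
  "has_weak_gradient u g E \<longleftrightarrow>
     u \<in> local_space (Lp_space 1) E \<and> g \<in> local_space (Lp_space 1) E \<and>
     (\<forall>\<phi>. smooth_test_function E \<phi> \<longrightarrow>
        (\<forall>i\<in>Basis. (LINT x:E|lebesgue. u x * frechet_derivative \<phi> (at x) i)
                     = - (LINT x:E|lebesgue. (g x \<bullet> i) * \<phi> x)))"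

definition sobolev_W1 :: "real \<Rightarrow> 'a::euclidean_space set \<Rightarrow> ('a \<Rightarrow> real) set" where
  "sobolev_W1 q E = {u \<in> Lp_space q E. \<exists>g. has_weak_gradient u g E \<and> g \<in> Lp_space q E}"

end

theory Submission
  imports Defs
begin

text \<open>
  The proof differentiates the equation by finite differences. Write \<open>J t = \<bar>t\<bar> powr (p - 2) * t\<close>, let \<open>N\<close> be the
  dimension, let \<open>K\<close> be the kernel \<open>norm z powr (- (N + s * p))\<close>, and write \<open>d\<^sub>h u\<close> for \<open>u (x + h) - u x\<close>. By
  translation and scaling the ball becomes the unit ball, and \<open>u\<close> is normalised there: it is bounded by
  1, its tail is at most 1 and \<open>1 - s\<close> times the \<open>p\<close>-th power of its seminorm is at most 1 (\<open>unit_solution\<close>).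

  Subtract the equation for \<open>u\<close> from the one for its translate by \<open>h\<close> and test with \<open>d\<^sub>h u\<close> times the
  square of a cutoff. Monotonicity of \<open>J\<close> makes the main term control the fractional energy of \<open>d\<^sub>h u\<close>.
  The errors come from the cutoff and from the far part of the kernel, and both are quadratic in \<open>d\<^sub>h u\<close>
  and \<open>h\<close>. Hence, if \<open>d\<^sub>h u\<close> has size \<open>\<bar>h\<bar> powr \<sigma>\<close> in \<open>L\<^sup>p\<close> with \<open>\<sigma> \<le> 1\<close>, then on a smaller ball \<open>1 - s\<close> times
  the \<open>p\<close>-th power of the seminorm of \<open>d\<^sub>h u\<close> has size \<open>\<bar>h\<bar> powr (2 * \<sigma>)\<close> (\<open>energy_estimate\<close>). A function with
  finite energy has differences of size \<open>\<bar>h\<bar> powr s\<close> in \<open>L\<^sup>p\<close> (\<open>gagliardo_imp_difference\<close>). Applied to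
  \<open>d\<^sub>h u\<close> itself, this gives second differences of size \<open>\<bar>h\<bar> powr (s + 2 * \<sigma> / p)\<close>.

  The hypothesis \<open>(p - 2) / p < s\<close> enters here: since \<open>\<sigma> \<le> 1\<close>, the new exponent exceeds \<open>\<sigma>\<close> by at least
  the fixed amount \<open>s - (p - 2) / p\<close>. As long as the exponent stays below 1, first differences inherit
  the rate of second differences (\<open>marchaud_sublinear\<close>) and the step can be repeated. After finitely
  many steps the second differences decay with an exponent \<open>\<tau> > 1\<close> (\<open>second_difference_rate_superlinear\<close>);
  their number, and with it the constant obtained, is not bounded as \<open>s\<close> decreases to \<open>(p - 2) / p\<close>.

  From \<open>\<tau> > 1\<close> two things follow. First differences are of order \<open>\<bar>h\<bar>\<close> in \<open>L\<^sup>p\<close> (\<open>marchaud_superlinear\<close>).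
  Consecutive dyadic difference quotients differ by a second difference divided by the step, so their
  distances in \<open>L\<^sup>1\<close> form a convergent geometric series; the limit is a weak derivative, and Fatou's lemma
  bounds its \<open>L\<^sup>p\<close> norm (\<open>directional_weak_derivative\<close>).

  All constants depend only on \<open>N\<close>, \<open>p\<close>, the radii and a lower bound \<open>s0\<close> for \<open>s\<close>. The integral of
  \<open>min 1 (norm z) powr p\<close> against \<open>K\<close>, which measures every cutoff error, grows at most like
  \<open>1 / (1 - s)\<close>, and the factor \<open>1 - s\<close> in front of the energies compensates this. One constant therefore
  serves all \<open>s \<ge> s0\<close>, which is stability as \<open>s\<close> tends to 1. Finally the estimate passes from
  the constructed gradient to an arbitrary weak gradient because both agree almost everywhere
  (\<open>weak_gradient_unique\<close>).
\<close>

section \<open>Monotonicity and elementary inequalities for powers\<close>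

text \<open>
  The nonlinearity of the equation. For \<open>p = 2\<close> it is the identity, also at \<open>t = 0\<close>: there
  \<open>0 powr 0 = 0\<close>, and the factor \<open>t\<close> vanishes anyway.
\<close>

definition Jp :: "real \<Rightarrow> real \<Rightarrow> real" where
  "Jp p t = \<bar>t\<bar> powr (p - 2) * t"

lemma Jp_minus [simp]: "Jp p (- t) = - Jp p t"
  by (simp add: Jp_def)

lemma Jp_abs: "\<bar>Jp p t\<bar> = \<bar>t\<bar> powr (p - 1)"
proof (cases "t = 0")
  case False
  have "\<bar>t\<bar> powr (p - 1) = \<bar>t\<bar> powr (p - 2) * \<bar>t\<bar> powr 1"
    unfolding powr_add [symmetric] by simp
  with False show ?thesis by (simp add: Jp_def abs_mult)
qed (simp add: Jp_def)

lemma powr_sum_le: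
  fixes a b q :: real
  assumes "0 \<le> a" "0 \<le> b" "0 \<le> q"
  shows "(a + b) powr q \<le> 2 powr q * (a powr q + b powr q)"
proof -
  have "(a + b) powr q \<le> (2 * max a b) powr q"
    using assms by (intro powr_mono2) auto
  also have "\<dots> = 2 powr q * (max a b) powr q"
    using assms by (simp add: powr_mult)
  also have "\<dots> \<le> 2 powr q * (a powr q + b powr q)"
    by (intro mult_left_mono) (auto simp: max_def)
  finally show ?thesis .
qed

text \<open>
  With \<open>A = \<bar>a\<bar> powr (p - 2)\<close> and \<open>B = \<bar>b\<bar> powr (p - 2)\<close> the right-hand side equals
  \<open>(A + B) / 2 * (a - b)\<^sup>2 + (A - B) * (a\<^sup>2 - b\<^sup>2) / 2\<close>, and the last term is nonnegative because
  \<open>t powr (p - 2)\<close> increases. The weight \<open>(\<bar>a\<bar> + \<bar>b\<bar>) powr (p - 2)\<close> is kept because \<open>Jp_lipschitz\<close> carries the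
  same weight: errors estimated by the latter can then be absorbed by the former.
\<close>

lemma Jp_monotone:
  assumes "2 \<le> p"
  shows "2 powr (1 - p) * (\<bar>a\<bar> + \<bar>b\<bar>) powr (p - 2) * (a - b)\<^sup>2 \<le> (Jp p a - Jp p b) * (a - b)"
proof -
  define A B where "A = \<bar>a\<bar> powr (p - 2)" and "B = \<bar>b\<bar> powr (p - 2)"
  have eq: "(Jp p a - Jp p b) * (a - b) = (A + B) / 2 * (a - b)\<^sup>2 + (A - B) * (a\<^sup>2 - b\<^sup>2) / 2"
    unfolding Jp_def A_def [symmetric] B_def [symmetric]
    by (simp add: field_simps power2_eq_square)
  have "0 \<le> (A - B) * (a\<^sup>2 - b\<^sup>2)"
  proof (cases "\<bar>a\<bar> \<le> \<bar>b\<bar>")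
    case True
    then have "A \<le> B" "a\<^sup>2 \<le> b\<^sup>2"
      unfolding A_def B_def using assms by (auto intro: powr_mono2 simp: abs_le_square_iff)
    then show ?thesis by (simp add: mult_nonpos_nonpos)
  next
    case False
    then have "B \<le> A" "b\<^sup>2 \<le> a\<^sup>2"
      unfolding A_def B_def using assms by (auto intro: powr_mono2 simp: abs_le_square_iff)
    then show ?thesis by simp
  qed
  moreover have "2 powr (1 - p) * (\<bar>a\<bar> + \<bar>b\<bar>) powr (p - 2) \<le> (A + B) / 2"
  proof -
    have "2 powr (1 - p) * (\<bar>a\<bar> + \<bar>b\<bar>) powr (p - 2)
        \<le> 2 powr (1 - p) * (2 powr (p - 2) * (A + B))"
      unfolding A_def B_def using assms by (intro mult_left_mono powr_sum_le) auto
    also have "\<dots> = (2 powr (1 - p) * 2 powr (p - 2)) * (A + B)" by simp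
    also have "2 powr (1 - p) * 2 powr (p - 2) = (1/2 :: real)"
      by (simp add: powr_add [symmetric] powr_minus_divide)
    finally show ?thesis by simp
  qed
  then have "2 powr (1 - p) * (\<bar>a\<bar> + \<bar>b\<bar>) powr (p - 2) * (a - b)\<^sup>2 \<le> (A + B) / 2 * (a - b)\<^sup>2"
    by (intro mult_right_mono) auto
  ultimately show ?thesis unfolding eq by linarith
qed

text \<open>
  The mean value theorem for \<open>t powr q\<close>; the factor \<open>m\<close> on the left tames the derivative
  \<open>q * z powr (q - 1)\<close> near 0 when \<open>q < 1\<close>.
\<close>

lemma powr_diff_le:
  fixes m M q :: real
  assumes "0 \<le> m" "m \<le> M" "0 \<le> q"
  shows "m * (M powr q - m powr q) \<le> q * M powr q * (M - m)"
proof (cases "m = 0 \<or> m = M")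
  case True
  then show ?thesis using assms by auto
next
  case False
  then have m: "0 < m" "m < M" using assms by auto
  have "\<exists>z>m. z < M \<and> M powr q - m powr q = (M - m) * (q * z powr (q - 1))"
    using m by (intro MVT2) (auto intro!: derivative_eq_intros)
  then obtain z where z: "m < z" "z < M" "M powr q - m powr q = (M - m) * (q * z powr (q - 1))"
    by blast
  have "m * z powr (q - 1) \<le> z * z powr (q - 1)"
    using z m by (intro mult_right_mono) auto
  also have "\<dots> = z powr q" using z m by (simp add: powr_mult_base)
  also have "\<dots> \<le> M powr q" using z m assms by (intro powr_mono2) auto
  finally have "q * (M - m) * (m * z powr (q - 1)) \<le> q * (M - m) * M powr q"
    using m assms by (intro mult_left_mono) auto
  then show ?thesis unfolding z(3) by (simp add: algebra_simps)
qed

lemma Jp_lipschitz: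
  assumes p: "2 \<le> p"
  shows "\<bar>Jp p a - Jp p b\<bar> \<le> (p - 1) * (\<bar>a\<bar> + \<bar>b\<bar>) powr (p - 2) * \<bar>a - b\<bar>"
proof -
  have *: "\<bar>Jp p a - Jp p b\<bar> \<le> (p - 1) * (\<bar>a\<bar> + \<bar>b\<bar>) powr (p - 2) * \<bar>a - b\<bar>"
    if le: "\<bar>b\<bar> \<le> \<bar>a\<bar>" for a b
  proof -
    define A B where "A = \<bar>a\<bar> powr (p - 2)" and "B = \<bar>b\<bar> powr (p - 2)"
    have BA: "B \<le> A" unfolding A_def B_def using le p by (intro powr_mono2) auto
    have "Jp p a - Jp p b = A * (a - b) + b * (A - B)"
      unfolding Jp_def A_def B_def by (simp add: algebra_simps)
    then have "\<bar>Jp p a - Jp p b\<bar> \<le> \<bar>A * (a - b)\<bar> + \<bar>b * (A - B)\<bar>"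
      by (simp add: abs_triangle_ineq)
    also have "\<dots> = A * \<bar>a - b\<bar> + \<bar>b\<bar> * (A - B)"
      using BA by (simp add: abs_mult A_def)
    also have "\<bar>b\<bar> * (A - B) \<le> (p - 2) * A * (\<bar>a\<bar> - \<bar>b\<bar>)"
      unfolding A_def B_def using le p by (intro powr_diff_le) auto
    also have "(p - 2) * A * (\<bar>a\<bar> - \<bar>b\<bar>) \<le> (p - 2) * A * \<bar>a - b\<bar>"
      using p by (intro mult_left_mono) (auto simp: A_def)
    also have "A * \<bar>a - b\<bar> + (p - 2) * A * \<bar>a - b\<bar> = (p - 1) * A * \<bar>a - b\<bar>"
      by (simp add: algebra_simps)
    also have "\<dots> \<le> (p - 1) * (\<bar>a\<bar> + \<bar>b\<bar>) powr (p - 2) * \<bar>a - b\<bar>"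
      unfolding A_def using p by (intro mult_right_mono mult_left_mono powr_mono2) auto
    finally show ?thesis by simp
  qed
  show ?thesis
    using *[of b a] *[of a b] by (cases "\<bar>b\<bar> \<le> \<bar>a\<bar>") (auto simp: abs_minus_commute add.commute)
qed

text \<open>
  A pointwise replacement for Hoelder's inequality with exponents \<open>p / (p - 2)\<close> and \<open>p / 2\<close>, in a form
  that includes \<open>p = 2\<close>. If the \<open>p\<close>-th powers of \<open>a\<close> and \<open>b\<close> have integrals of order 1 and \<open>t powr p\<close>, both
  terms on the right have order \<open>t\<^sup>2\<close>; later \<open>t = norm h powr \<sigma>\<close>.
\<close>

lemma powr_young:
  fixes a b t p :: real
  assumes "0 \<le> a" "0 \<le> b" "0 < t" "2 \<le> p"
  shows "a powr (p - 2) * b\<^sup>2 \<le> t\<^sup>2 * a powr p + t powr (2 - p) * b powr p"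
proof (cases "b \<le> t * a")
  case True
  have "a powr (p - 2) * b\<^sup>2 \<le> a powr (p - 2) * (t * a)\<^sup>2"
    using True assms by (intro mult_left_mono power_mono) auto
  also have "\<dots> = t\<^sup>2 * (a powr (p - 2) * a\<^sup>2)" by (simp add: power_mult_distrib)
  also have "a powr (p - 2) * a\<^sup>2 = a powr p"
    using assms by (cases "a = 0") (auto simp: powr_numeral [symmetric] powr_add [symmetric] simp del: powr_numeral)
  finally show ?thesis using assms by (simp add: add_increasing2)
next
  case False
  then have b: "0 < b" "a \<le> b / t" using assms by (auto simp: field_simps less_le_trans mult_nonneg_nonneg)
      (smt (verit) mult_nonneg_nonneg)
  have "a powr (p - 2) * b\<^sup>2 \<le> (b / t) powr (p - 2) * b\<^sup>2"
    using b assms by (intro mult_right_mono powr_mono2) auto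
  also have "\<dots> = t powr (2 - p) * (b powr (p - 2) * b powr 2)"
    using b assms by (simp add: powr_divide powr_diff field_simps)
  also have "b powr (p - 2) * b powr 2 = b powr p"
    by (simp add: powr_add [symmetric])
  finally show ?thesis using assms by (simp add: add_increasing)
qed

lemma sq_le_powr:
  fixes x t p :: real
  assumes "0 \<le> x" "0 < t" "2 \<le> p"
  shows "x\<^sup>2 \<le> t\<^sup>2 + t powr (2 - p) * x powr p"
  using powr_young[of 1 x t p] assms by simp

text \<open>
  The integrand of the difference of two equations. Here \<open>a\<close> and \<open>b\<close> are the increments, between two
  points, of the translated and of the original function, \<open>X\<close> and \<open>Y\<close> the values of the difference of the
  two functions at these points, and \<open>e\<close> and \<open>f\<close> the values of the cutoff. Split
  \<open>e\<^sup>2 * X - f\<^sup>2 * Y = (e\<^sup>2 + f\<^sup>2) / 2 * (X - Y) + (e - f) * (e + f) * (X + Y) / 2\<close>. Monotonicity makes the first part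
  coercive; the second is estimated by the Lipschitz bound with the same weight \<open>G\<close>, and Young's
  inequality absorbs half of the coercive term.
\<close>

lemma energy_pointwise:
  fixes a b X Y e f p :: real
  assumes p: "2 \<le> p" and eq: "a - b = X - Y" and e: "0 \<le> e" and f: "0 \<le> f"
  defines "G \<equiv> (\<bar>a\<bar> + \<bar>b\<bar>) powr (p - 2)"
  shows "2 powr (-1 - p) * (e\<^sup>2 + f\<^sup>2) * \<bar>X - Y\<bar> powr p
     \<le> (Jp p a - Jp p b) * (e\<^sup>2 * X - f\<^sup>2 * Y)
        + (p - 1)\<^sup>2 * 2 powr (p - 2) * G * (\<bar>e - f\<bar> * (\<bar>X\<bar> + \<bar>Y\<bar>))\<^sup>2"
proof -
  define A where "A = Jp p a - Jp p b"
  define c where "c = 2 powr (1 - p)"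
  define C where "C = p - 1"
  have c: "0 < c" unfolding c_def by simp
  have G: "0 \<le> G" by (simp add: G_def)
  have mono: "c * G * (X - Y)\<^sup>2 \<le> A * (X - Y)"
    using Jp_monotone[OF p, of a b] eq by (simp add: A_def c_def G_def)
  have lip: "\<bar>A\<bar> \<le> C * G * \<bar>X - Y\<bar>"
    using Jp_lipschitz[OF p, of a b] eq by (simp add: A_def C_def G_def)
  define S T where "S = \<bar>X - Y\<bar> * (e + f)" and "T = \<bar>e - f\<bar> * (\<bar>X\<bar> + \<bar>Y\<bar>)"
  have split: "A * (e\<^sup>2 * X - f\<^sup>2 * Y) = (e\<^sup>2 + f\<^sup>2) / 2 * (A * (X - Y)) + A * ((e - f) * (e + f) * (X + Y)) / 2"
    by (simp add: field_simps power2_eq_square)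
  have "\<bar>A * ((e - f) * (e + f) * (X + Y))\<bar> = \<bar>A\<bar> * ((e + f) * (\<bar>e - f\<bar> * \<bar>X + Y\<bar>))"
    using e f by (simp add: abs_mult)
  also have "\<dots> \<le> (C * G * \<bar>X - Y\<bar>) * ((e + f) * T)"
    unfolding T_def using e f lip by (intro mult_mono mult_left_mono) auto
  also have "\<dots> = C * G * (S * T)" by (simp add: S_def)
  finally have cross: "- (C * G * (S * T)) / 2 \<le> A * ((e - f) * (e + f) * (X + Y)) / 2"
    by (simp add: abs_le_iff)
  have "0 \<le> (c * S - 2 * C * T)\<^sup>2" by simp
  then have "4 * c * C * (S * T) \<le> c\<^sup>2 * S\<^sup>2 + 4 * C\<^sup>2 * T\<^sup>2"
    by (simp add: power2_eq_square algebra_simps)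
  then have "(4 * c * C * (S * T)) / (8 * c) \<le> (c\<^sup>2 * S\<^sup>2 + 4 * C\<^sup>2 * T\<^sup>2) / (8 * c)"
    using c by (intro divide_right_mono) auto
  then have young: "C * (S * T) / 2 \<le> c / 8 * S\<^sup>2 + C\<^sup>2 / (2 * c) * T\<^sup>2"
    using c by (simp add: field_simps power2_eq_square)
  have S2: "S\<^sup>2 \<le> 2 * (e\<^sup>2 + f\<^sup>2) * (X - Y)\<^sup>2"
  proof -
    have "(e + f)\<^sup>2 \<le> 2 * (e\<^sup>2 + f\<^sup>2)"
      using zero_le_power2[of "e - f"] by (simp add: power2_eq_square algebra_simps)
    then show ?thesis unfolding S_def
      by (simp add: power_mult_distrib mult.commute mult_left_mono)
  qed
  define P where "P = (e\<^sup>2 + f\<^sup>2) * (G * (X - Y)\<^sup>2)"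
  have "G * (C * (S * T) / 2) \<le> G * (c / 8 * (2 * (e\<^sup>2 + f\<^sup>2) * (X - Y)\<^sup>2) + C\<^sup>2 / (2 * c) * T\<^sup>2)"
  proof (intro mult_left_mono G)
    have "c / 8 * S\<^sup>2 \<le> c / 8 * (2 * (e\<^sup>2 + f\<^sup>2) * (X - Y)\<^sup>2)"
      using S2 c by (intro mult_left_mono) auto
    with young show "C * (S * T) / 2 \<le> c / 8 * (2 * (e\<^sup>2 + f\<^sup>2) * (X - Y)\<^sup>2) + C\<^sup>2 / (2 * c) * T\<^sup>2"
      by linarith
  qed
  then have y2: "C * G * (S * T) / 2 \<le> c / 4 * P + C\<^sup>2 / (2 * c) * G * T\<^sup>2"
    by (simp add: P_def algebra_simps)
  have m2: "c / 2 * P \<le> (e\<^sup>2 + f\<^sup>2) / 2 * (A * (X - Y))"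
    using mult_left_mono[OF mono, of "(e\<^sup>2 + f\<^sup>2) / 2"] by (simp add: P_def mult_ac)
  have pw: "\<bar>X - Y\<bar> powr p \<le> G * (X - Y)\<^sup>2"
  proof (cases "X = Y")
    case False
    have "\<bar>X - Y\<bar> powr p = \<bar>X - Y\<bar> powr (p - 2) * \<bar>X - Y\<bar> powr 2"
      unfolding powr_add [symmetric] by simp
    also have "\<dots> = \<bar>X - Y\<bar> powr (p - 2) * (X - Y)\<^sup>2" using False by simp
    also have "\<dots> \<le> G * (X - Y)\<^sup>2"
      unfolding G_def using p eq by (intro mult_right_mono powr_mono2) auto
    finally show ?thesis .
  qed simp
  have "c / 4 * (e\<^sup>2 + f\<^sup>2) * \<bar>X - Y\<bar> powr p \<le> c / 4 * (e\<^sup>2 + f\<^sup>2) * (G * (X - Y)\<^sup>2)"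
    using c pw by (intro mult_left_mono) auto
  also have "\<dots> = c / 4 * P" by (simp add: P_def)
  also have "\<dots> \<le> A * (e\<^sup>2 * X - f\<^sup>2 * Y) + C\<^sup>2 / (2 * c) * G * T\<^sup>2"
    unfolding split using m2 y2 cross by linarith
  also have "C\<^sup>2 / (2 * c) = (p - 1)\<^sup>2 * 2 powr (p - 2)"
    by (simp add: C_def c_def powr_diff field_simps power2_eq_square)
  also have "c / 4 = 2 powr (-1 - p)"
    by (simp add: c_def powr_diff powr_minus)
  finally show ?thesis by (simp add: A_def T_def)
qed

text \<open>
  Convexity of \<open>t powr p\<close> at the convex combination \<open>\<theta> * (x / \<theta>) + (1 - \<theta>) * (y / (1 - \<theta>))\<close>.
\<close>

lemma powr_convex_split:
  fixes x y \<theta> p :: real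
  assumes "0 \<le> x" "0 \<le> y" "0 < \<theta>" "\<theta> < 1" "1 \<le> p"
  shows "(x + y) powr p \<le> \<theta> powr (1 - p) * x powr p + (1 - \<theta>) powr (1 - p) * y powr p"
proof -
  have sc: "\<theta> powr (1 - p) * x powr p = \<theta> * (x / \<theta>) powr p" if "0 < \<theta>" "0 \<le> x" for x \<theta> :: real
    using that by (simp add: powr_divide powr_diff)
  show ?thesis
  proof (cases "x = 0 \<or> y = 0")
    case True
    have *: "z powr p \<le> t powr (1 - p) * z powr p" if "0 < t" "t < 1" for z t :: real
    proof -
      have "1 \<le> t powr (1 - p)"
        using that assms by (smt (verit) powr_mono' powr_zero_eq_one)
      then show ?thesis by (simp add: mult_le_cancel_right1)
    qed
    show ?thesis using True *[of \<theta> x] *[of "1 - \<theta>" y] assms by auto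
  next
    case False
    then have pos: "0 < x" "0 < y" using assms by auto
    have "((1 - \<theta>) *\<^sub>R (y / (1 - \<theta>)) + \<theta> *\<^sub>R (x / \<theta>)) powr p
       \<le> (1 - \<theta>) * (y / (1 - \<theta>)) powr p + \<theta> * (x / \<theta>) powr p"
      using pos assms by (intro convex_onD[OF powr_convex]) auto
    then show ?thesis
      using assms pos by (simp add: sc add.commute)
  qed
qed

text \<open>
  Minkowski's inequality for upper bounds of the norms. The weight \<open>\<theta> = a / (a + b)\<close> in
  \<open>powr_convex_split\<close> is the optimal one and gives the sharp constant. Sharpness matters: \<open>marchaud\<close> iterates
  this inequality along arbitrarily many scales.
\<close>

lemma powr_minkowski:
  assumes [measurable]: "f \<in> borel_measurable M" "g \<in> borel_measurable M"
    and p: "1 \<le> p" and ab: "0 < a" "0 < b"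
    and f: "(\<integral>\<^sup>+x. ennreal (\<bar>f x\<bar> powr p) \<partial>M) \<le> ennreal (a powr p)"
    and g: "(\<integral>\<^sup>+x. ennreal (\<bar>g x\<bar> powr p) \<partial>M) \<le> ennreal (b powr p)"
  shows "(\<integral>\<^sup>+x. ennreal (\<bar>f x + g x\<bar> powr p) \<partial>M) \<le> ennreal ((a + b) powr p)"
proof -
  define \<theta> where "\<theta> = a / (a + b)"
  have \<theta>: "0 < \<theta>" "\<theta> < 1" "1 - \<theta> = b / (a + b)" using ab by (auto simp: \<theta>_def field_simps)
  have "(\<integral>\<^sup>+x. ennreal (\<bar>f x + g x\<bar> powr p) \<partial>M)
     \<le> (\<integral>\<^sup>+x. ennreal (\<theta> powr (1 - p)) * ennreal (\<bar>f x\<bar> powr p)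
              + ennreal ((1 - \<theta>) powr (1 - p)) * ennreal (\<bar>g x\<bar> powr p) \<partial>M)"
  proof (rule nn_integral_mono)
    fix x
    have "\<bar>f x + g x\<bar> powr p \<le> (\<bar>f x\<bar> + \<bar>g x\<bar>) powr p"
      using p by (intro powr_mono2) auto
    also have "\<dots> \<le> \<theta> powr (1 - p) * \<bar>f x\<bar> powr p + (1 - \<theta>) powr (1 - p) * \<bar>g x\<bar> powr p"
      using p \<theta> by (intro powr_convex_split) auto
    finally show "ennreal (\<bar>f x + g x\<bar> powr p) \<le> ennreal (\<theta> powr (1 - p)) * ennreal (\<bar>f x\<bar> powr p)
              + ennreal ((1 - \<theta>) powr (1 - p)) * ennreal (\<bar>g x\<bar> powr p)"
      by (simp add: ennreal_mult' [symmetric] ennreal_plus [symmetric] del: ennreal_plus)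
  qed
  also have "\<dots> = ennreal (\<theta> powr (1 - p)) * (\<integral>\<^sup>+x. ennreal (\<bar>f x\<bar> powr p) \<partial>M)
              + ennreal ((1 - \<theta>) powr (1 - p)) * (\<integral>\<^sup>+x. ennreal (\<bar>g x\<bar> powr p) \<partial>M)"
    by (simp add: nn_integral_add nn_integral_cmult)
  also have "\<dots> \<le> ennreal (\<theta> powr (1 - p)) * ennreal (a powr p)
              + ennreal ((1 - \<theta>) powr (1 - p)) * ennreal (b powr p)"
    by (intro add_mono mult_left_mono f g) auto
  also have "\<dots> = ennreal (\<theta> powr (1 - p) * a powr p + (1 - \<theta>) powr (1 - p) * b powr p)"
    by (simp add: ennreal_mult')
  also have "\<theta> powr (1 - p) * a powr p + (1 - \<theta>) powr (1 - p) * b powr p = (a + b) powr p"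
  proof -
    have *: "(z / (a + b)) powr (1 - p) * z powr p = (a + b) powr (p - 1) * z" if "0 < z" for z
    proof -
      have "(z / (a + b)) powr (1 - p) * z powr p = z powr (1 - p) * z powr p / (a + b) powr (1 - p)"
        using that ab by (simp add: powr_divide)
      also have "z powr (1 - p) * z powr p = z"
        unfolding powr_add [symmetric] using that by simp
      also have "z / (a + b) powr (1 - p) = (a + b) powr (p - 1) * z"
        using powr_minus_divide[of "a + b" "1 - p"] by simp
      finally show ?thesis .
    qed
    have "(a + b) powr (p - 1) * a + (a + b) powr (p - 1) * b = (a + b) powr (p - 1) * (a + b)"
      by (simp add: algebra_simps)
    also have "\<dots> = (a + b) powr p" using ab by (simp add: powr_diff)
    finally show ?thesis unfolding \<theta>(3) using ab *[of a] *[of b] by (simp add: \<theta>_def)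
  qed
  finally show ?thesis .
qed

section \<open>Affine changes of variables\<close>

lemma nn_integral_affine:
  fixes f :: "'a::euclidean_space \<Rightarrow> ennreal"
  assumes [measurable]: "f \<in> borel_measurable borel" and c: "c \<noteq> 0"
  shows "(\<integral>\<^sup>+x. f x \<partial>lborel) = ennreal (\<bar>c\<bar> ^ DIM('a)) * (\<integral>\<^sup>+x. f (t + c *\<^sub>R x) \<partial>lborel)"
  by (subst lborel_affine[OF c, of t])
     (simp add: nn_integral_density nn_integral_distr nn_integral_cmult)

lemma nn_integral_shift:
  fixes f :: "'a::euclidean_space \<Rightarrow> ennreal"
  assumes [measurable]: "f \<in> borel_measurable borel"
  shows "(\<integral>\<^sup>+x. f (x + t) \<partial>lborel) = (\<integral>\<^sup>+x. f x \<partial>lborel)"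
  using nn_integral_affine[OF assms, of 1 t] by (simp add: add.commute)

lemma nn_integral_reflect:
  fixes f :: "'a::euclidean_space \<Rightarrow> ennreal"
  assumes [measurable]: "f \<in> borel_measurable borel"
  shows "(\<integral>\<^sup>+x. f (t - x) \<partial>lborel) = (\<integral>\<^sup>+x. f x \<partial>lborel)"
  using nn_integral_affine[OF assms, of "-1" t] by (simp add: add.commute)

lemma has_bochner_integral_affine:
  fixes f :: "'a::euclidean_space \<Rightarrow> real"
  assumes "has_bochner_integral lborel f I" and c: "c \<noteq> 0"
  shows "has_bochner_integral lborel (\<lambda>x. f (t + c *\<^sub>R x)) (I / \<bar>c\<bar> ^ DIM('a))"
proof -
  have [measurable]: "f \<in> borel_measurable borel"
    using assms by (auto dest: has_bochner_integral_implies_finite_norm borel_measurable_has_bochner_integral)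
  have "has_bochner_integral (density (distr lborel borel (\<lambda>x. t + c *\<^sub>R x)) (\<lambda>_. ennreal (\<bar>c\<bar>^DIM('a)))) f I"
    using assms lborel_affine[OF c, of t] by simp
  then have "has_bochner_integral lborel (\<lambda>x. \<bar>c\<bar> ^ DIM('a) *\<^sub>R f (t + c *\<^sub>R x)) I"
    by (auto simp: has_bochner_integral_iff integrable_density integral_density
        integrable_distr_eq integral_distr)
  then have "has_bochner_integral lborel (\<lambda>x. (\<bar>c\<bar> ^ DIM('a) *\<^sub>R f (t + c *\<^sub>R x)) / \<bar>c\<bar> ^ DIM('a)) (I / \<bar>c\<bar> ^ DIM('a))"
    by (intro has_bochner_integral_divide_zero) auto
  then show ?thesis using c by simp
qed

section \<open>The fractional kernel\<close>

text \<open>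
  At the origin the value is 0, since \<open>0 powr a = 0\<close>. The diagonal therefore contributes nothing to the
  double integrals below, without any case distinction.
\<close>

definition kern :: "real \<Rightarrow> real \<Rightarrow> 'a::euclidean_space \<Rightarrow> real" where
  "kern s p z = norm z powr (- (real DIM('a) + s * p))"

lemma kern_measurable [measurable]: "kern s p \<in> borel_measurable borel"
  unfolding kern_def by measurable

lemma kern_nonneg [simp]: "0 \<le> kern s p z"
  by (simp add: kern_def)

lemma kern_zero [simp]: "kern s p 0 = 0"
  by (simp add: kern_def)

lemma kern_minus: "kern s p (- z) = kern s p z"
  by (simp add: kern_def)

lemma kern_commute: "kern s p (x - y) = kern s p (y - x)"
  by (simp add: kern_def norm_minus_commute)

lemma kern_scale:
  assumes "0 < c"
  shows "kern s p (c *\<^sub>R z :: 'a::euclidean_space) = c powr (- (real DIM('a) + s * p)) * kern s p z"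
  using assms by (simp add: kern_def powr_mult)

lemma nn_integral_shell_scale:
  fixes f :: "'a::euclidean_space \<Rightarrow> ennreal"
  assumes [measurable]: "f \<in> borel_measurable borel" and c: "0 < c"
  shows "(\<integral>\<^sup>+z\<in>{z. c * a \<le> norm z \<and> norm z < c * b}. f z \<partial>lborel)
      = ennreal (c ^ DIM('a)) * (\<integral>\<^sup>+z\<in>{z. a \<le> norm z \<and> norm z < b}. f (c *\<^sub>R z) \<partial>lborel)"
proof -
  have "(\<integral>\<^sup>+z\<in>{z. c * a \<le> norm z \<and> norm z < c * b}. f z \<partial>lborel)
    = ennreal (\<bar>c\<bar> ^ DIM('a)) * (\<integral>\<^sup>+z. f (0 + c *\<^sub>R z) * indicator {z. c * a \<le> norm z \<and> norm z < c * b} (0 + c *\<^sub>R z) \<partial>lborel)"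
    using c by (intro nn_integral_affine) auto
  also have "(\<lambda>z. f (0 + c *\<^sub>R z) * indicator {z. c * a \<le> norm z \<and> norm z < c * b} (0 + c *\<^sub>R z))
    = (\<lambda>z. f (c *\<^sub>R z) * indicator {z. a \<le> norm z \<and> norm z < b} z)"
    using c by (auto simp: indicator_def fun_eq_iff)
  finally show ?thesis using c by simp
qed

text \<open>
  The dyadic shells of radius at most \<open>t\<close>, half open so that they are disjoint. The kernel is homogeneous, hence
  its integrals over successive shells form geometric sequences.
\<close>

definition shell :: "real \<Rightarrow> nat \<Rightarrow> 'a::euclidean_space set" where
  "shell t k = {z. (1/2) ^ k * (t / 2) \<le> norm z \<and> norm z < (1/2) ^ k * t}"

lemma shell_measurable [measurable]: "shell t k \<in> sets borel"
  unfolding shell_def by measurable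

lemma half_power_less:
  fixes t :: real assumes "k < l" "0 < t"
  shows "(1/2) ^ l * t \<le> (1/2) ^ k * (t / 2)"
proof -
  have "(1/2) ^ l \<le> ((1/2) ^ Suc k :: real)"
    using assms by (intro power_decreasing) auto
  then have "(1/2) ^ l * t \<le> (1/2) ^ Suc k * t" using assms by (intro mult_right_mono) auto
  then show ?thesis by simp
qed

lemma disjoint_shell:
  assumes "0 < t" shows "disjoint_family (shell t :: nat \<Rightarrow> 'a::euclidean_space set)"
proof -
  have *: "shell t k \<inter> (shell t l :: 'a set) = {}" if "k < l" for k l
    using half_power_less[OF that assms] by (auto simp: shell_def)
  have "shell t k \<inter> (shell t l :: 'a set) = {}" if "k \<noteq> l" for k l
    using *[of k l] *[of l k] that by (cases "k < l") (auto simp: Int_commute)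
  then show ?thesis by (auto simp: disjoint_family_on_def)
qed

lemma nn_integral_shell:
  fixes f :: "'a::euclidean_space \<Rightarrow> ennreal"
  assumes [measurable]: "f \<in> borel_measurable borel"
  shows "(\<integral>\<^sup>+z\<in>shell t k. f z \<partial>lborel)
     = ennreal (((1/2) ^ k) ^ DIM('a)) * (\<integral>\<^sup>+z\<in>shell t 0. f ((1/2) ^ k *\<^sub>R z) \<partial>lborel)"
  using nn_integral_shell_scale[OF assms, of "(1/2)^k" "t/2" t] by (simp add: shell_def)

lemma UN_shell: "(\<Union>k. shell 1 k) = (ball 0 1 - {0} :: 'a::euclidean_space set)"
proof (intro equalityI subsetI)
  fix z :: 'a assume "z \<in> (\<Union>k. shell 1 k)"
  then obtain k where k: "(1/2) ^ k * (1 / 2) \<le> norm z" "norm z < (1/2) ^ k" by (auto simp: shell_def)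
  have "(1/2::real) ^ k \<le> 1" by (simp add: power_le_one)
  moreover have "(0::real) < (1/2) ^ k * (1 / 2)" by simp
  ultimately have "norm z < 1" "0 < norm z" using k by linarith+
  then show "z \<in> ball 0 1 - {0}" by auto
next
  fix z :: 'a assume "z \<in> ball 0 1 - {0}"
  then have z: "norm z < 1" "0 < norm z" by auto
  obtain n where "(1/2) ^ n < norm z" using real_arch_pow_inv[of "norm z" "1/2"] z by auto
  then have ex: "\<exists>n. (1/2) ^ n \<le> norm z" by (auto intro: less_imp_le)
  define n where "n = (LEAST n. (1/2) ^ n \<le> norm z)"
  have n: "(1/2) ^ n \<le> norm z" unfolding n_def using ex by (rule LeastI_ex)
  have "n \<noteq> 0" using n z by (cases n) auto
  then obtain k where k: "n = Suc k" by (cases n) auto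
  have "\<not> (1/2) ^ k \<le> norm z" using not_less_Least[of k "\<lambda>n. (1/2) ^ n \<le> norm z"] k n_def by auto
  then have "z \<in> shell 1 k" using n k by (auto simp: shell_def)
  then show "z \<in> (\<Union>k. shell 1 k)" by auto
qed

text \<open>
  The dyadic shells outside the unit ball; the factor 1 keeps the form \<open>c * a \<le> norm z \<and> norm z < c * b\<close>
  of \<open>nn_integral_shell_scale\<close>.
\<close>

definition oshell :: "nat \<Rightarrow> 'a::euclidean_space set" where
  "oshell k = {z. 2 ^ k * 1 \<le> norm z \<and> norm z < 2 ^ k * 2}"

lemma oshell_measurable [measurable]: "oshell k \<in> sets borel"
  unfolding oshell_def by measurable

lemma nn_integral_oshell:
  fixes f :: "'a::euclidean_space \<Rightarrow> ennreal"
  assumes [measurable]: "f \<in> borel_measurable borel"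
  shows "(\<integral>\<^sup>+z\<in>oshell k. f z \<partial>lborel)
     = ennreal ((2 ^ k) ^ DIM('a)) * (\<integral>\<^sup>+z\<in>oshell 0. f (2 ^ k *\<^sub>R z) \<partial>lborel)"
  using nn_integral_shell_scale[OF assms, of "2^k" 1 2] by (simp add: oshell_def)

lemma UN_oshell: "- ball 0 1 \<subseteq> (\<Union>k. oshell k :: 'a::euclidean_space set)"
proof
  fix z :: 'a assume "z \<in> - ball 0 1"
  then have z: "1 \<le> norm z" by auto
  have ex: "\<exists>n. norm z < 2 ^ n" using real_arch_pow[of 2 "norm z"] by auto
  define n where "n = (LEAST n. norm z < 2 ^ n)"
  have n: "norm z < 2 ^ n" unfolding n_def using ex by (rule LeastI_ex)
  have "n \<noteq> 0" using n z by (cases n) auto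
  then obtain k where k: "n = Suc k" by (cases n) auto
  have "\<not> norm z < 2 ^ k" using not_less_Least[of k "\<lambda>n. norm z < 2 ^ n"] k n_def by auto
  then have "z \<in> oshell k" using n k by (auto simp: oshell_def)
  then show "z \<in> (\<Union>k. oshell k)" by auto
qed

lemma disjoint_oshell: "disjoint_family (oshell :: nat \<Rightarrow> 'a::euclidean_space set)"
proof -
  have *: "oshell k \<inter> (oshell l :: 'a set) = {}" if "k < l" for k l
  proof -
    have "(2::real) ^ Suc k \<le> 2 ^ l" using that by (intro power_increasing) auto
    then show ?thesis by (auto simp: oshell_def)
  qed
  have "oshell k \<inter> (oshell l :: 'a set) = {}" if "k \<noteq> l" for k l
    using *[of k l] *[of l k] that by (cases "k < l") (auto simp: Int_commute)
  then show ?thesis by (auto simp: disjoint_family_on_def)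
qed

lemma geometric_ennreal:
  assumes "0 \<le> q" "q < 1"
  shows "(\<Sum>k. ennreal (q ^ k)) = ennreal (1 / (1 - q))"
  using assms by (subst suminf_ennreal2) (auto simp: suminf_geometric summable_geometric)

text \<open>
  A geometric series of ratio \<open>2 powr (- x)\<close> has a sum of order \<open>1 / x\<close>. With \<open>x\<close> a multiple of \<open>1 - s\<close>, this
  and the next lemma produce all factors \<open>1 / (1 - s)\<close> and \<open>1 - s\<close>.
\<close>

lemma one_minus_two_powr_lower:
  fixes x :: real assumes "0 < x" "x \<le> 1"
  shows "x / 3 \<le> 1 - 2 powr (- x)"
proof -
  have ln2: "1 / 2 \<le> ln (2::real)" 
  proof -
    have "1 + (- (1/2)) \<le> exp (- (1/2::real))" by (rule exp_ge_add_one_self)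
    then have "exp (1/2::real) \<le> 2" by (simp add: exp_minus field_simps)
    then have "ln (exp (1/2::real)) \<le> ln 2" by (subst ln_le_cancel_iff) auto
    then show ?thesis by simp
  qed
  have "1 + x / 2 \<le> 1 + x * ln 2" using ln2 assms by simp
  also have "\<dots> \<le> exp (x * ln 2)" by (rule exp_ge_add_one_self)
  also have "\<dots> = 2 powr x" by (simp add: powr_def)
  finally have "2 powr (- x) \<le> 1 / (1 + x / 2)"
    using assms by (simp add: powr_minus_divide frac_le)
  also have "\<dots> \<le> 1 - x / 3"
    using assms by (simp add: divide_simps) (simp add: algebra_simps mult_left_le)
  finally show ?thesis by simp
qed

lemma one_minus_two_powr_upper:
  fixes x :: real assumes "0 \<le> x"
  shows "1 - 2 powr (- x) \<le> x"
proof -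
  have "ln (2::real) \<le> 1" using ln_bound[of 2] ln_add_one_self_le_self[of 1] by simp
  then have "x * ln 2 \<le> x * 1" using assms by (intro mult_left_mono) auto
  moreover have "1 + (- (x * ln 2)) \<le> exp (- (x * ln 2))" by (rule exp_ge_add_one_self)
  ultimately show ?thesis by (simp add: powr_def)
qed

text \<open>
  Halving \<open>z\<close> multiplies the integral over a shell by \<open>2 powr (- p * (1 - s))\<close>, because the volume element, the
  kernel and \<open>norm z powr p\<close> are homogeneous of degrees \<open>N\<close>, \<open>-(N + s * p)\<close> and \<open>p\<close>. Summing the geometric
  series over the shells gives the order \<open>1 / (1 - s)\<close>.
\<close>

lemma kernel_inner_integral:
  fixes s p :: real
  assumes s: "0 < s" "s < 1" and p: "1 \<le> p"
  shows "(\<integral>\<^sup>+z\<in>ball 0 1. ennreal (norm z powr p * kern s p (z::'a::euclidean_space)) \<partial>lborel)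
     \<le> ennreal (2 powr (real DIM('a) + p) * measure lborel (ball (0::'a) 1) * 3 / (1 - s))"
proof -
  define f where "f = (\<lambda>z::'a. ennreal (norm z powr p * kern s p z))"
  have fm [measurable]: "f \<in> borel_measurable borel" unfolding f_def by measurable
  define \<alpha> where "\<alpha> = p * (1 - s)"
  have \<alpha>: "1 - s \<le> \<alpha>" "0 < \<alpha>" using s p by (auto simp: \<alpha>_def)
  define I0 where "I0 = (\<integral>\<^sup>+z\<in>shell 1 0. f z \<partial>lborel)"
  define q where "q = 2 powr (- \<alpha>)"
  have q: "0 < q" "q < 1" using \<alpha> by (auto simp: q_def powr_less_one)
  have fs: "f ((1/2) ^ k *\<^sub>R z) = ennreal (((1/2) ^ k) powr (p - (real DIM('a) + s * p))) * f z" for k z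
  proof -
    define c :: real where "c = (1/2) ^ k"
    have c: "0 < c" by (simp add: c_def)
    have "norm (c *\<^sub>R z) powr p * kern s p (c *\<^sub>R z)
        = c powr p * c powr (- (real DIM('a) + s * p)) * (norm z powr p * kern s p z)"
      using c by (simp add: kern_scale powr_mult)
    also have "c powr p * c powr (- (real DIM('a) + s * p)) = c powr (p - (real DIM('a) + s * p))"
      unfolding powr_add [symmetric] by (simp add: algebra_simps)
    finally show ?thesis unfolding f_def c_def [symmetric] by (simp add: ennreal_mult')
  qed
  have c: "((1/2::real) ^ k) ^ DIM('a) * ((1/2) ^ k) powr (p - (real DIM('a) + s * p)) = q ^ k" for k
  proof -
    have "((1/2::real) ^ k) ^ DIM('a) = ((1/2) ^ k) powr (real DIM('a))"
      by (subst powr_realpow) auto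
    then have "((1/2::real) ^ k) ^ DIM('a) * ((1/2) ^ k) powr (p - (real DIM('a) + s * p)) = ((1/2) ^ k) powr \<alpha>"
      by (simp add: powr_add [symmetric] \<alpha>_def algebra_simps)
    also have "\<dots> = (1/2) powr (real k * \<alpha>)" by (simp add: powr_realpow [symmetric] powr_powr)
    also have "\<dots> = ((1/2) powr \<alpha>) powr real k" by (simp add: powr_powr mult.commute)
    also have "(1/2) powr \<alpha> = q" by (simp add: q_def powr_minus_divide powr_divide)
    finally show ?thesis using q by (simp add: powr_realpow)
  qed
  have Ik: "(\<integral>\<^sup>+z\<in>shell 1 k. f z \<partial>lborel) = ennreal (q ^ k) * I0" for k
    unfolding I0_def
    by (subst nn_integral_shell) (auto simp: fs mult.assoc nn_integral_cmult c [symmetric] ennreal_mult')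
  have "(\<integral>\<^sup>+z\<in>ball 0 1. f z \<partial>lborel) = (\<integral>\<^sup>+z\<in>(\<Union>k. shell 1 k). f z \<partial>lborel)"
    unfolding UN_shell by (intro nn_integral_cong) (auto simp: indicator_def f_def)
  also have "\<dots> = (\<Sum>k. ennreal (q ^ k) * I0)"
    by (subst nn_integral_disjoint_family) (auto simp: Ik disjoint_shell)
  also have "\<dots> = ennreal (1 / (1 - q)) * I0"
    using q by (simp only: ennreal_suminf_multc geometric_ennreal)
  also have "I0 \<le> (\<integral>\<^sup>+z. ennreal (2 powr (real DIM('a) + p)) * indicator (ball 0 1) z \<partial>(lborel::'a measure))"
    unfolding I0_def
  proof (rule nn_integral_mono)
    fix z :: 'a
    show "f z * indicator (shell 1 0) z \<le> ennreal (2 powr (real DIM('a) + p)) * indicator (ball 0 1) z"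
    proof (cases "z \<in> shell 1 0")
      case True
      then have z: "1/2 \<le> norm z" "norm z < 1" by (auto simp: shell_def)
      have "norm z powr p * kern s p z \<le> 1 * 2 powr (real DIM('a) + p)"
      proof (rule mult_mono)
        show "norm z powr p \<le> 1" using z p by (intro powr_le1) auto
        have "kern s p z \<le> (1/2) powr (- (real DIM('a) + s * p))"
          unfolding kern_def using z s p mult_nonneg_nonneg[of s p]
          by (intro powr_mono2') (auto simp del: mult_nonneg_nonneg)
        also have "\<dots> = 2 powr (real DIM('a) + s * p)"
          by (simp only: powr_minus_divide powr_divide) simp
        also have "\<dots> \<le> 2 powr (real DIM('a) + p)"
          using s p by (intro powr_mono) auto
        finally show "kern s p z \<le> 2 powr (real DIM('a) + p)" .
      qed auto
      then show ?thesis using True z by (auto simp: f_def intro!: ennreal_leI)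
    qed auto
  qed
  also have "\<dots> = ennreal (2 powr (real DIM('a) + p) * measure lborel (ball (0::'a) 1))"
    by (subst nn_integral_cmult_indicator)
       (auto simp: ennreal_mult' emeasure_ball content_ball)
  also have "ennreal (1 / (1 - q)) * \<dots> \<le> ennreal (3 / (1 - s)) * \<dots>"
  proof (intro mult_right_mono ennreal_leI)
    have "(1 - s) / 3 \<le> 1 - 2 powr (- (1 - s))"
      using s by (intro one_minus_two_powr_lower) auto
    also have "\<dots> \<le> 1 - q" unfolding q_def using \<alpha> by simp
    finally show "1 / (1 - q) \<le> 3 / (1 - s)" using q s by (simp add: divide_simps mult.commute)
  qed auto
  finally show ?thesis using s
    by (simp add: f_def ennreal_mult' [symmetric] mult.commute mult.left_commute mult_right_mono)
qed

text \<open>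
  The same computation on growing shells has ratio \<open>2 powr (- s * p)\<close>, which stays away from 1 for \<open>s \<ge> s0\<close>.
\<close>

lemma kernel_outer_integral:
  fixes s p s0 :: real
  assumes s: "0 < s0" "s0 \<le> s" "s < 1" and p: "1 \<le> p"
  shows "(\<integral>\<^sup>+z\<in>- ball 0 1. ennreal (kern s p (z::'a::euclidean_space)) \<partial>lborel)
     \<le> ennreal (measure lborel (ball (0::'a) 2) * 3 / s0)"
proof -
  define f where "f = (\<lambda>z::'a. ennreal (kern s p z))"
  have fm [measurable]: "f \<in> borel_measurable borel" unfolding f_def by measurable
  define \<alpha> where "\<alpha> = s * p"
  have \<alpha>: "s0 \<le> \<alpha>" "0 < \<alpha>" using s p mult_mono[of s0 s 1 p] by (auto simp: \<alpha>_def)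
  define I0 where "I0 = (\<integral>\<^sup>+z\<in>oshell 0. f z \<partial>lborel)"
  define q where "q = 2 powr (- \<alpha>)"
  have q: "0 < q" "q < 1" using \<alpha> by (auto simp: q_def powr_less_one)
  have fs: "f (2 ^ k *\<^sub>R z) = ennreal ((2 ^ k) powr (- (real DIM('a) + s * p))) * f z" for k z
    unfolding f_def by (subst kern_scale) (auto simp: ennreal_mult' [symmetric])
  have c: "((2::real) ^ k) ^ DIM('a) * (2 ^ k) powr (- (real DIM('a) + s * p)) = q ^ k" for k
  proof -
    have "((2::real) ^ k) ^ DIM('a) = (2 ^ k) powr (real DIM('a))"
      by (subst powr_realpow) auto
    then have "((2::real) ^ k) ^ DIM('a) * (2 ^ k) powr (- (real DIM('a) + s * p)) = (2 ^ k) powr (- \<alpha>)"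
      by (simp add: powr_add [symmetric] \<alpha>_def)
    also have "\<dots> = 2 powr (real k * - \<alpha>)" by (simp add: powr_realpow [symmetric] powr_powr)
    also have "\<dots> = q powr real k" by (simp add: q_def powr_powr mult.commute)
    finally show ?thesis using q by (simp add: powr_realpow)
  qed
  have Ik: "(\<integral>\<^sup>+z\<in>oshell k. f z \<partial>lborel) = ennreal (q ^ k) * I0" for k
    unfolding I0_def
    by (subst nn_integral_oshell) (auto simp: fs mult.assoc nn_integral_cmult c [symmetric] ennreal_mult')
  have "(\<integral>\<^sup>+z\<in>- ball 0 1. f z \<partial>lborel) \<le> (\<integral>\<^sup>+z\<in>(\<Union>k. oshell k). f z \<partial>lborel)"
    using UN_oshell by (intro nn_integral_mono) (auto simp: indicator_def)
  also have "\<dots> = (\<Sum>k. ennreal (q ^ k) * I0)"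
    by (subst nn_integral_disjoint_family) (auto simp: Ik disjoint_oshell)
  also have "\<dots> = ennreal (1 / (1 - q)) * I0"
    using q by (simp only: ennreal_suminf_multc geometric_ennreal)
  also have "I0 \<le> (\<integral>\<^sup>+z. 1 * indicator (ball 0 2) z \<partial>(lborel::'a measure))"
    unfolding I0_def
  proof (rule nn_integral_mono)
    fix z :: 'a
    show "f z * indicator (oshell 0) z \<le> 1 * indicator (ball 0 2) z"
    proof (cases "z \<in> oshell 0")
      case True
      then have z: "1 \<le> norm z" "norm z < 2" by (auto simp: oshell_def)
      have "kern s p z \<le> 1 powr (- (real DIM('a) + s * p))"
        unfolding kern_def using z \<alpha> by (intro powr_mono2') (auto simp: \<alpha>_def)
      then show ?thesis using True z by (auto simp: f_def ennreal_le_1)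
    qed auto
  qed
  also have "\<dots> = ennreal (measure lborel (ball (0::'a) 2))"
    by (subst nn_integral_cmult_indicator) (auto simp: emeasure_ball content_ball)
  also have "ennreal (1 / (1 - q)) * \<dots> \<le> ennreal (3 / s0) * \<dots>"
  proof (intro mult_right_mono ennreal_leI)
    have "s0 / 3 \<le> 1 - 2 powr (- s0)"
      using s by (intro one_minus_two_powr_lower) auto
    also have "\<dots> \<le> 1 - q" unfolding q_def using \<alpha> by simp
    finally show "1 / (1 - q) \<le> 3 / s0" using q s by (simp add: divide_simps mult.commute)
  qed auto
  finally show ?thesis using s
    by (simp add: f_def ennreal_mult' [symmetric] mult.commute mult_right_mono)
qed

text \<open>
  A bounded Lipschitz function has increments of size \<open>min 1 (norm z)\<close>, so this integral bounds its
  energy density. The rate \<open>1 / (1 - s)\<close> is what the factor \<open>1 - s\<close> in front of the energies compensates.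
\<close>

lemma kernel_integral:
  fixes p s0 :: real
  assumes "0 < s0" "1 \<le> p"
  obtains C where "0 < C" "\<And>s. s0 \<le> s \<Longrightarrow> s < 1 \<Longrightarrow>
     (\<integral>\<^sup>+z. ennreal (min 1 (norm z) powr p * kern s p (z::'a::euclidean_space)) \<partial>lborel) \<le> ennreal (C / (1 - s))"
proof
  define C1 where "C1 = 2 powr (real DIM('a) + p) * measure lborel (ball (0::'a) 1) * 3"
  define C2 where "C2 = measure lborel (ball (0::'a) 2) * 3 / s0"
  have C: "0 < C1" "0 < C2" using assms by (auto simp: C1_def C2_def)
  show "0 < C1 + C2" using C by simp
  fix s assume s: "s0 \<le> s" "s < 1"
  have "(\<integral>\<^sup>+z. ennreal (min 1 (norm z) powr p * kern s p (z::'a)) \<partial>lborel)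
    \<le> (\<integral>\<^sup>+z. ennreal (norm z powr p * kern s p z) * indicator (ball 0 1) z
         + ennreal (kern s p z) * indicator (- ball 0 1) z \<partial>(lborel :: 'a measure))"
    by (intro nn_integral_mono) (auto simp: indicator_def min_def)
  also have "\<dots> = (\<integral>\<^sup>+z\<in>ball 0 1. ennreal (norm z powr p * kern s p (z::'a)) \<partial>lborel)
      + (\<integral>\<^sup>+z\<in>- ball 0 1. ennreal (kern s p (z::'a)) \<partial>lborel)"
  proof (rule nn_integral_add)
    have [measurable]: "ball (0::'a) 1 \<in> sets borel" by simp
    show "(\<lambda>z::'a. ennreal (norm z powr p * kern s p z) * indicator (ball 0 1) z) \<in> borel_measurable lborel"
      by measurable
    show "(\<lambda>z::'a. ennreal (kern s p z) * indicator (- ball 0 1) z) \<in> borel_measurable lborel"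
      by measurable
  qed
  also have "\<dots> \<le> ennreal (C1 / (1 - s)) + ennreal C2"
    unfolding C1_def C2_def using s assms by (intro add_mono kernel_inner_integral kernel_outer_integral) auto
  also have "\<dots> = ennreal (C1 / (1 - s) + C2)" using C s by simp
  also have "\<dots> \<le> ennreal ((C1 + C2) / (1 - s))"
  proof (rule ennreal_leI)
    have "C2 \<le> C2 / (1 - s)" using C s assms by (simp add: field_simps)
    then show "C1 / (1 - s) + C2 \<le> (C1 + C2) / (1 - s)" by (simp add: add_divide_distrib)
  qed
  finally show "(\<integral>\<^sup>+z. ennreal (min 1 (norm z) powr p * kern s p (z::'a)) \<partial>lborel) \<le> ennreal ((C1 + C2) / (1 - s))" .
qed

section \<open>From the Gagliardo seminorm to differences\<close>

text \<open>
  Both \<open>x\<close> and \<open>x + z\<close> are restricted to \<open>B\<close>, so that integrating against the kernel gives back the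
  Gagliardo seminorm of \<open>B\<close> (\<open>gagliardo_eq_diff_mass\<close>).
\<close>

definition diff_mass :: "real \<Rightarrow> 'a::euclidean_space set \<Rightarrow> ('a \<Rightarrow> real) \<Rightarrow> 'a \<Rightarrow> ennreal" where
  "diff_mass p B w z =
     (\<integral>\<^sup>+x. ennreal (indicator B x * indicator B (x + z) * \<bar>w (x + z) - w x\<bar> powr p) \<partial>lborel)"

text \<open>
  The \<open>p\<close>-th power of the Gagliardo seminorm, with values in the extended nonnegative reals. Tonelli's
  theorem and monotonicity then apply before finiteness is known.
\<close>

definition gagliardo :: "real \<Rightarrow> real \<Rightarrow> 'a::euclidean_space set \<Rightarrow> ('a \<Rightarrow> real) \<Rightarrow> ennreal" where
  "gagliardo s p B w =
     (\<integral>\<^sup>+(x, y). ennreal (indicator B x * indicator B y * \<bar>w x - w y\<bar> powr p * kern s p (x - y))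
        \<partial>(lborel \<Otimes>\<^sub>M lborel))"

lemma diff_mass_measurable [measurable]:
  assumes [measurable]: "B \<in> sets borel" "w \<in> borel_measurable borel"
  shows "diff_mass p B w \<in> borel_measurable borel"
  unfolding diff_mass_def by measurable

lemma gagliardo_eq_diff_mass:
  assumes [measurable]: "B \<in> sets borel" "w \<in> borel_measurable borel"
  shows "gagliardo s p B w = (\<integral>\<^sup>+z. diff_mass p B w z * ennreal (kern s p z) \<partial>lborel)"
proof -
  have "gagliardo s p B w = (\<integral>\<^sup>+x. \<integral>\<^sup>+y. ennreal (indicator B x * indicator B y * \<bar>w x - w y\<bar> powr p * kern s p (x - y)) \<partial>lborel \<partial>lborel)"
    unfolding gagliardo_def by (subst lborel.nn_integral_fst [symmetric]) auto
  also have "\<dots> = (\<integral>\<^sup>+x. \<integral>\<^sup>+z. ennreal (indicator B x * indicator B (z + x) * \<bar>w x - w (z + x)\<bar> powr p * kern s p (x - (z + x))) \<partial>lborel \<partial>lborel)"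
    by (intro nn_integral_cong nn_integral_shift [symmetric]) measurable
  also have "\<dots> = (\<integral>\<^sup>+x. \<integral>\<^sup>+z. ennreal (indicator B x * indicator B (x + z) * \<bar>w (x + z) - w x\<bar> powr p) * ennreal (kern s p z) \<partial>lborel \<partial>lborel)"
    by (intro nn_integral_cong) (simp add: ennreal_mult' [symmetric] kern_minus abs_minus_commute add.commute)
  also have "\<dots> = (\<integral>\<^sup>+z. \<integral>\<^sup>+x. ennreal (indicator B x * indicator B (x + z) * \<bar>w (x + z) - w x\<bar> powr p) * ennreal (kern s p z) \<partial>lborel \<partial>lborel)"
    by (intro lborel_pair.Fubini') measurable
  also have "\<dots> = (\<integral>\<^sup>+z. diff_mass p B w z * ennreal (kern s p z) \<partial>lborel)"
    unfolding diff_mass_def by (intro nn_integral_cong nn_integral_multc) measurable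
  finally show ?thesis .
qed

text \<open>
  A convex set contains the midpoint \<open>x + z\<close> of \<open>x\<close> and \<open>x + 2z\<close>, so the difference over \<open>2z\<close> is the sum of two
  differences over \<open>z\<close> inside \<open>B\<close>.
\<close>

lemma diff_mass_double:
  assumes [measurable]: "B \<in> sets borel" "w \<in> borel_measurable borel" and B: "convex B" and p: "1 \<le> p"
  shows "diff_mass p B w (2 *\<^sub>R z) \<le> ennreal (2 powr p) * diff_mass p B w z"
proof -
  define D where "D = (\<lambda>x. indicator B x * indicator B (x + z) * \<bar>w (x + z) - w x\<bar> powr p)"
  have "diff_mass p B w (2 *\<^sub>R z) \<le> (\<integral>\<^sup>+x. ennreal (2 powr (p - 1)) * (ennreal (D (x + z)) + ennreal (D x)) \<partial>lborel)"
    unfolding diff_mass_def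
  proof (rule nn_integral_mono)
    fix x
    have "indicator B x * indicator B (x + 2 *\<^sub>R z) * \<bar>w (x + 2 *\<^sub>R z) - w x\<bar> powr p
        \<le> 2 powr (p - 1) * (D (x + z) + D x)"
    proof (cases "x \<in> B \<and> x + 2 *\<^sub>R z \<in> B")
      case True
      then have "x + z \<in> B"
        using convexD[OF B, of x "x + 2 *\<^sub>R z" "1/2" "1/2"] by (simp add: algebra_simps flip: scaleR_add_left)
      have "\<bar>w (x + 2 *\<^sub>R z) - w x\<bar> powr p \<le> (\<bar>w (x + 2 *\<^sub>R z) - w (x + z)\<bar> + \<bar>w (x + z) - w x\<bar>) powr p"
        using p by (intro powr_mono2) auto
      also have "\<dots> \<le> (1/2) powr (1 - p) * \<bar>w (x + 2 *\<^sub>R z) - w (x + z)\<bar> powr p + (1 - 1/2) powr (1 - p) * \<bar>w (x + z) - w x\<bar> powr p"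
        using p by (intro powr_convex_split) auto
      also have "(1/2) powr (1 - p) = 2 powr (p - 1)"
        using powr_minus_divide[of 2 "1 - p"] by (simp add: powr_divide)
      finally show ?thesis using True \<open>x + z \<in> B\<close>
        using powr_minus_divide[of 2 "1 - p"]
        by (simp add: D_def scaleR_2 add.assoc powr_divide distrib_left)
    qed (auto simp: D_def)
    then show "ennreal (indicator B x * indicator B (x + 2 *\<^sub>R z) * \<bar>w (x + 2 *\<^sub>R z) - w x\<bar> powr p)
        \<le> ennreal (2 powr (p - 1)) * (ennreal (D (x + z)) + ennreal (D x))"
      by (simp add: D_def ennreal_mult' [symmetric] ennreal_plus [symmetric] del: ennreal_plus)
  qed
  also have "\<dots> = ennreal (2 powr (p - 1)) * ((\<integral>\<^sup>+x. ennreal (D (x + z)) \<partial>lborel) + (\<integral>\<^sup>+x. ennreal (D x) \<partial>lborel))"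
    unfolding D_def by (simp add: nn_integral_cmult nn_integral_add)
  also have "(\<integral>\<^sup>+x. ennreal (D (x + z)) \<partial>lborel) = (\<integral>\<^sup>+x. ennreal (D x) \<partial>lborel)"
    unfolding D_def by (rule nn_integral_shift[of "\<lambda>x. ennreal (indicator B x * indicator B (x + z) * \<bar>w (x + z) - w x\<bar> powr p)"]) measurable
  also have "(\<integral>\<^sup>+x. ennreal (D x) \<partial>lborel) = diff_mass p B w z"
    by (simp add: diff_mass_def D_def)
  also have "ennreal (2 powr (p - 1)) * (diff_mass p B w z + diff_mass p B w z) = ennreal (2 powr p) * diff_mass p B w z"
  proof -
    have "ennreal (2 powr p) = ennreal (2 powr (p - 1)) * 2"
      by (simp add: powr_diff ennreal_mult' [symmetric] flip: ennreal_numeral)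
    then show ?thesis by (simp add: mult.assoc mult_2)
  qed
  finally show ?thesis .
qed

lemma ennreal_le_multD:
  fixes x y :: ennreal
  assumes "0 < c" "ennreal c * x \<le> y" shows "x \<le> ennreal (1 / c) * y"
proof -
  have "ennreal (1 / c) * (ennreal c * x) \<le> ennreal (1 / c) * y"
    by (intro mult_left_mono assms) auto
  then show ?thesis
    using assms(1) by (simp add: mult.assoc [symmetric] ennreal_mult' [symmetric])
qed

text \<open>
  Let \<open>I k\<close> be the part of the energy that comes from the \<open>k\<close>-th shell. By \<open>diff_mass_double\<close> and homogeneity,
  \<open>I k \<le> 2 powr (p * (1 - s)) * I (Suc k)\<close>: towards the origin the shells lose energy at most at a rate
  that tends to 1 with \<open>s\<close>. Summing over all shells, a single one carries at most the fraction
  \<open>p * (1 - s)\<close> of the energy.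
\<close>

lemma shell_diff_mass_le:
  assumes [measurable]: "B \<in> sets borel" "w \<in> borel_measurable borel" and B: "convex B" and p: "1 \<le> p"
    and s: "0 < s" "s < 1" and t: "0 < t"
  shows "(\<integral>\<^sup>+z\<in>shell t 0. diff_mass p B w z * ennreal (kern s p z) \<partial>lborel)
     \<le> ennreal (p * (1 - s)) * gagliardo s p B w"
proof -
  define f where "f = (\<lambda>z. diff_mass p B w z * ennreal (kern s p z))"
  have fm [measurable]: "f \<in> borel_measurable borel" unfolding f_def by measurable
  define \<alpha> where "\<alpha> = p * (1 - s)"
  have \<alpha>: "0 < \<alpha>" using s p by (auto simp: \<alpha>_def)
  define q where "q = 2 powr (- \<alpha>)"
  have q: "0 < q" "q < 1" using \<alpha> by (auto simp: q_def powr_less_one)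
  define I where "I k = (\<integral>\<^sup>+z\<in>shell t k. f z \<partial>lborel)" for k
  define \<beta> where "\<beta> = real DIM('a) + s * p"
  have half: "f z \<le> ennreal (2 powr (p - \<beta>)) * f ((1/2) *\<^sub>R z)" for z
  proof -
    have "f z \<le> ennreal (2 powr p) * diff_mass p B w ((1/2) *\<^sub>R z) * ennreal (kern s p z)"
      unfolding f_def using diff_mass_double[OF assms(1,2) B p, of "(1/2) *\<^sub>R z"] by (intro mult_right_mono) auto
    also have "kern s p z = 2 powr (- \<beta>) * kern s p ((1/2) *\<^sub>R z)"
      using kern_scale[of 2 s p "(1/2) *\<^sub>R z"] by (simp add: \<beta>_def)
    also have "ennreal (2 powr p) * diff_mass p B w ((1/2) *\<^sub>R z) * ennreal (2 powr (- \<beta>) * kern s p ((1/2) *\<^sub>R z))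
        = ennreal (2 powr p * 2 powr (- \<beta>)) * f ((1/2) *\<^sub>R z)"
      by (simp add: f_def ennreal_mult' mult_ac)
    also have "2 powr p * 2 powr (- \<beta>) = 2 powr (p - \<beta>)"
      unfolding powr_add [symmetric] by simp
    finally show ?thesis .
  qed
  have step: "I k \<le> ennreal (1 / q) * I (Suc k)" for k
  proof -
    have sh: "shell t k = {z. (1/2) ^ k * (t / 2) \<le> norm z \<and> norm z < (1/2) ^ k * t}" by (simp add: shell_def)
    have sh': "shell t (Suc k) = {z. 1/2 * ((1/2) ^ k * (t / 2)) \<le> norm z \<and> norm z < 1/2 * ((1/2) ^ k * t)}"
      by (simp add: shell_def)
    have "I (Suc k) = ennreal ((1/2) ^ DIM('a)) * (\<integral>\<^sup>+z\<in>shell t k. f ((1/2) *\<^sub>R z) \<partial>lborel)"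
      unfolding I_def sh sh' by (rule nn_integral_shell_scale) auto
    moreover have "I k \<le> ennreal (2 powr (p - \<beta>)) * (\<integral>\<^sup>+z\<in>shell t k. f ((1/2) *\<^sub>R z) \<partial>lborel)"
      unfolding I_def using half
      by (subst nn_integral_cmult [symmetric]) (auto intro!: nn_integral_mono simp: mult.assoc [symmetric] mult_right_mono)
    moreover have "1 / q * (1/2) ^ DIM('a) = 2 powr (p - \<beta>)"
      by (simp add: q_def \<alpha>_def \<beta>_def powr_diff powr_minus powr_add powr_realpow algebra_simps power_divide divide_simps)
    ultimately show ?thesis using q
      by (simp add: mult.assoc [symmetric] ennreal_mult' [symmetric])
  qed
  have "ennreal (q ^ k) * I 0 \<le> I k" for k
  proof (induction k)
    case (Suc k)
    have "ennreal (q ^ Suc k) * I 0 = ennreal q * (ennreal (q ^ k) * I 0)"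
      using q by (simp add: ennreal_mult' mult.assoc)
    also have "\<dots> \<le> ennreal q * I k" by (intro mult_left_mono Suc) auto
    also have "\<dots> \<le> ennreal q * (ennreal (1 / q) * I (Suc k))" by (intro mult_left_mono step) auto
    also have "\<dots> = I (Suc k)" using q by (simp add: mult.assoc [symmetric] ennreal_mult' [symmetric])
    finally show ?case .
  qed auto
  then have "(\<Sum>k. ennreal (q ^ k) * I 0) \<le> (\<Sum>k. I k)" by (intro suminf_le) auto
  also have "\<dots> = (\<integral>\<^sup>+z\<in>(\<Union>k. shell t k). f z \<partial>lborel)"
    unfolding I_def using disjoint_shell[OF t] by (subst nn_integral_disjoint_family) auto
  also have "\<dots> \<le> (\<integral>\<^sup>+z. f z \<partial>lborel)"
    by (intro nn_integral_mono) (auto simp: indicator_def)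
  also have "\<dots> = gagliardo s p B w" unfolding f_def by (rule gagliardo_eq_diff_mass [symmetric]) auto
  finally have "ennreal (1 / (1 - q)) * I 0 \<le> gagliardo s p B w"
    using q by (simp only: ennreal_suminf_multc geometric_ennreal)
  then have "I 0 \<le> ennreal (1 - q) * gagliardo s p B w"
    using ennreal_le_multD[of "1 / (1 - q)"] q by simp
  also have "\<dots> \<le> ennreal (p * (1 - s)) * gagliardo s p B w"
    using one_minus_two_powr_upper[of \<alpha>] \<alpha> by (intro mult_right_mono ennreal_leI) (auto simp: q_def \<alpha>_def)
  finally show ?thesis by (simp add: I_def f_def)
qed

text \<open>
  The difference over \<open>h\<close> is split at \<open>x + z\<close> and averaged over all \<open>z\<close> in a ball of radius \<open>norm h / 4\<close>
  around \<open>h / 2\<close>. Then both \<open>z\<close> and \<open>h - z\<close> have norm between \<open>norm h / 4\<close> and \<open>norm h\<close>, so only two dyadic shells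
  are involved, and \<open>shell_diff_mass_le\<close> contributes the factor \<open>1 - s\<close>.
\<close>

lemma gagliardo_imp_difference:
  fixes w :: "'a::euclidean_space \<Rightarrow> real"
  assumes wm [measurable]: "w \<in> borel_measurable borel" and p: "1 \<le> p"
    and s: "0 < s" "s < 1" and h: "h \<noteq> 0" and r: "0 < r" "r + norm h \<le> \<rho>"
  shows "(\<integral>\<^sup>+x\<in>ball 0 r. ennreal (\<bar>w (x + h) - w x\<bar> powr p) \<partial>lborel)
     \<le> ennreal (2 powr (p + 2) * p * 4 ^ DIM('a) / measure lborel (ball (0::'a) 1)
           * norm h powr (s * p) * (1 - s)) * gagliardo s p (ball 0 \<rho>) w"
proof -
  define B where "B = ball (0::'a) \<rho>"
  have [measurable]: "B \<in> sets borel" by (simp add: B_def)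
  have B: "convex B" by (simp add: B_def)
  define D where "D = diff_mass p B w"
  have [measurable]: "D \<in> borel_measurable borel" unfolding D_def by measurable
  define t where "t = norm h"
  have t: "0 < t" using h by (simp add: t_def)
  \<comment> \<open>This ball is invariant under the reflection that maps z to h - z, so both parts of the
    split difference have the same average.\<close>
  define A where "A = ball ((1/2) *\<^sub>R h) (t / 4)"
  have [measurable]: "A \<in> sets borel" by (simp add: A_def)
  have A: "t / 4 < norm z \<and> norm z < t" if "z \<in> A" for z
  proof -
    have "dist ((1/2) *\<^sub>R h) z < t / 4" using that by (simp add: A_def)
    moreover have "norm ((1/2) *\<^sub>R h) = t / 2" by (simp add: t_def)
    ultimately show ?thesis using norm_triangle_ineq2[of "(1/2) *\<^sub>R h" z] norm_triangle_ineq2[of z "(1/2) *\<^sub>R h"]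
      by (simp add: dist_norm norm_minus_commute)
  qed
  have A_refl: "h - z \<in> A \<longleftrightarrow> z \<in> A" for z
  proof -
    have eq: "(1/2) *\<^sub>R h - (h - z) = - ((1/2) *\<^sub>R h - z)"
      using scaleR_add_left[of "1/2" "1/2" h] by (simp add: algebra_simps)
    show ?thesis by (simp only: A_def mem_ball dist_norm eq norm_minus_cancel)
  qed
  define F where "F = (\<integral>\<^sup>+x\<in>ball 0 r. ennreal (\<bar>w (x + h) - w x\<bar> powr p) \<partial>lborel)"
  have Fz: "F \<le> ennreal (2 powr p) * (D (h - z) + D z)" if z: "z \<in> A" for z
  proof -
    define f where "f = (\<lambda>x. ennreal (indicator B x * indicator B (x + (h - z)) * \<bar>w (x + (h - z)) - w x\<bar> powr p))"
    define g where "g = (\<lambda>x. ennreal (indicator B x * indicator B (x + z) * \<bar>w (x + z) - w x\<bar> powr p))"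
    have [measurable]: "f \<in> borel_measurable borel" "g \<in> borel_measurable borel"
      unfolding f_def g_def by measurable
    have "F \<le> (\<integral>\<^sup>+x. ennreal (2 powr p) * (f (x + z) + g x) \<partial>lborel)"
      unfolding F_def
    proof (rule nn_integral_mono)
      fix x
      show "ennreal (\<bar>w (x + h) - w x\<bar> powr p) * indicator (ball 0 r) x \<le> ennreal (2 powr p) * (f (x + z) + g x)"
      proof (cases "x \<in> ball 0 r")
        case True
        then have "norm x < r" by simp
        then have "x \<in> B" "x + z \<in> B" "x + h \<in> B"
          using r A[OF z] norm_triangle_ineq[of x z] norm_triangle_ineq[of x h] t
          by (auto simp: B_def t_def)
        moreover have "\<bar>w (x + h) - w x\<bar> powr p \<le> (\<bar>w (x + h) - w (x + z)\<bar> + \<bar>w (x + z) - w x\<bar>) powr p"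
          using p by (intro powr_mono2) auto
        moreover have "\<dots> \<le> 2 powr p * (\<bar>w (x + h) - w (x + z)\<bar> powr p + \<bar>w (x + z) - w x\<bar> powr p)"
          using p by (intro powr_sum_le) auto
        ultimately show ?thesis using True
          by (simp add: f_def g_def ennreal_mult' [symmetric] ennreal_plus [symmetric] del: ennreal_plus)
      qed simp
    qed
    also have "\<dots> = ennreal (2 powr p) * ((\<integral>\<^sup>+x. f (x + z) \<partial>lborel) + (\<integral>\<^sup>+x. g x \<partial>lborel))"
      by (simp add: nn_integral_cmult nn_integral_add)
    also have "(\<integral>\<^sup>+x. f (x + z) \<partial>lborel) = D (h - z)"
      by (subst nn_integral_shift) (auto simp: D_def diff_mass_def f_def)
    also have "(\<integral>\<^sup>+x. g x \<partial>lborel) = D z"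
      by (auto simp: D_def diff_mass_def g_def)
    finally show ?thesis .
  qed
  define V where "V = measure lborel (ball (0::'a) 1)"
  have V: "0 < V" by (simp add: V_def)
  have emA: "emeasure lborel A = ennreal (V * (t / 4) ^ DIM('a))"
    using t by (simp add: A_def V_def emeasure_ball content_ball)
  define \<beta> where "\<beta> = real DIM('a) + s * p"
  have "ennreal (V * (t / 4) ^ DIM('a)) * F = (\<integral>\<^sup>+z. F * indicator A z \<partial>lborel)"
    by (simp add: nn_integral_cmult_indicator emA mult.commute)
  also have "\<dots> \<le> (\<integral>\<^sup>+z. ennreal (2 powr p) * (D (h - z) * indicator A (h - z) + D z * indicator A z) \<partial>lborel)"
    using Fz A_refl by (intro nn_integral_mono) (auto simp: indicator_def)
  also have "\<dots> = ennreal (2 powr p) * ((\<integral>\<^sup>+z. D (h - z) * indicator A (h - z) \<partial>lborel) + (\<integral>\<^sup>+z\<in>A. D z \<partial>lborel))"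
    by (simp add: nn_integral_cmult nn_integral_add)
  also have "(\<integral>\<^sup>+z. D (h - z) * indicator A (h - z) \<partial>lborel) = (\<integral>\<^sup>+z\<in>A. D z \<partial>lborel)"
    by (rule nn_integral_reflect[of "\<lambda>z. D z * indicator A z"]) measurable
  also have "(\<integral>\<^sup>+z\<in>A. D z \<partial>lborel) \<le> (\<integral>\<^sup>+z. ennreal (t powr \<beta>) *
       (D z * ennreal (kern s p z) * indicator (shell t 0) z + D z * ennreal (kern s p z) * indicator (shell (t/2) 0) z) \<partial>lborel)"
  proof (rule nn_integral_mono)
    fix z
    show "D z * indicator A z \<le> ennreal (t powr \<beta>) *
       (D z * ennreal (kern s p z) * indicator (shell t 0) z + D z * ennreal (kern s p z) * indicator (shell (t/2) 0) z)"
    proof (cases "z \<in> A")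
      case True
      with A have z: "t / 4 < norm z" "norm z < t" by auto
      have "1 = t powr \<beta> * t powr (- \<beta>)" using t by (simp add: powr_minus)
      also have "\<dots> \<le> t powr \<beta> * kern s p z"
        unfolding kern_def \<beta>_def using z t s p mult_nonneg_nonneg[of s p]
        by (intro mult_left_mono powr_mono2') (auto simp del: mult_nonneg_nonneg)
      finally have "ennreal 1 \<le> ennreal (t powr \<beta>) * ennreal (kern s p z)"
        by (simp add: ennreal_mult' [symmetric] ennreal_leI del: ennreal_1)
      then have "D z * 1 \<le> D z * (ennreal (t powr \<beta>) * ennreal (kern s p z))"
        by (intro mult_left_mono) auto
      moreover have "z \<in> shell t 0 \<or> z \<in> shell (t / 2) 0"
        using z by (auto simp: shell_def)
      ultimately show ?thesis using True
        by (auto simp: indicator_def mult_ac distrib_left add_increasing add_increasing2)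
    qed simp
  qed
  also have "\<dots> = ennreal (t powr \<beta>) * ((\<integral>\<^sup>+z\<in>shell t 0. D z * ennreal (kern s p z) \<partial>lborel)
      + (\<integral>\<^sup>+z\<in>shell (t/2) 0. D z * ennreal (kern s p z) \<partial>lborel))"
    by (simp add: nn_integral_cmult nn_integral_add)
  also have "\<dots> \<le> ennreal (t powr \<beta>) * (ennreal (p * (1 - s)) * gagliardo s p B w + ennreal (p * (1 - s)) * gagliardo s p B w)"
    unfolding D_def using t s p B by (intro mult_left_mono add_mono shell_diff_mass_le) auto
  finally have "ennreal (V * (t / 4) ^ DIM('a)) * F \<le> ennreal (2 powr p) *
      (ennreal (t powr \<beta>) * (ennreal (p * (1 - s)) * gagliardo s p B w + ennreal (p * (1 - s)) * gagliardo s p B w) +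
       ennreal (t powr \<beta>) * (ennreal (p * (1 - s)) * gagliardo s p B w + ennreal (p * (1 - s)) * gagliardo s p B w))"
    by (simp add: add_mono mult_left_mono)
  also have "\<dots> = ennreal (4 * (2 powr p * t powr \<beta> * (p * (1 - s)))) * gagliardo s p B w"
    using s p by (simp add: ennreal_mult' mult_ac distrib_left [symmetric] flip: mult_2)
  finally have "F \<le> ennreal (1 / (V * (t / 4) ^ DIM('a))) * (ennreal (4 * (2 powr p * t powr \<beta> * (p * (1 - s)))) * gagliardo s p B w)"
    using V t by (intro ennreal_le_multD) auto
  also have "\<dots> = ennreal (1 / (V * (t / 4) ^ DIM('a)) * (4 * (2 powr p * t powr \<beta> * (p * (1 - s))))) * gagliardo s p B w"
  proof -
    have nn: "0 \<le> 1 / (V * (t / 4) ^ DIM('a))" using V t by simp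
    show ?thesis by (simp only: ennreal_mult'[OF nn] mult.assoc)
  qed
  also have "1 / (V * (t / 4) ^ DIM('a)) * (4 * (2 powr p * t powr \<beta> * (p * (1 - s))))
     = 2 powr (p + 2) * p * 4 ^ DIM('a) / V * t powr (s * p) * (1 - s)"
    using V t by (simp add: \<beta>_def powr_add powr_realpow power_divide field_simps)
  finally show ?thesis by (simp add: F_def B_def V_def t_def)
qed

section \<open>Solutions on the unit ball\<close>

text \<open>
  The equation after normalisation. The bound 2 on the test functions is the bound for a difference of
  two values of \<open>u\<close> in the unit ball. The energy of \<open>\<phi>\<close> is taken over the whole space, which makes the
  class of test functions invariant under small translations. The factor \<open>1 - s\<close> lets a
  single class contain the normalised solutions of all orders \<open>s\<close>.
\<close>

definition unit_solution :: "real \<Rightarrow> real \<Rightarrow> ('a::euclidean_space \<Rightarrow> real) \<Rightarrow> bool" where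
  "unit_solution s p u \<longleftrightarrow>
     u \<in> borel_measurable borel \<and> (\<forall>x\<in>ball 0 1. \<bar>u x\<bar> \<le> 1) \<and>
     (\<integral>\<^sup>+y\<in>- ball 0 1. ennreal (\<bar>u y\<bar> powr (p - 1) * kern s p y) \<partial>lborel) \<le> 1 \<and>
     ennreal (1 - s) * gagliardo s p (ball 0 1) u \<le> 1 \<and>
     (\<forall>\<phi> r. \<phi> \<in> borel_measurable borel \<and> r < 1 \<and> (\<forall>x. r \<le> norm x \<longrightarrow> \<phi> x = 0) \<and>
        (\<forall>x. \<bar>\<phi> x\<bar> \<le> 2) \<and> gagliardo s p UNIV \<phi> < \<infinity> \<longrightarrow>
        has_bochner_integral (lborel \<Otimes>\<^sub>M lborel)
          (\<lambda>(x, y). Jp p (u x - u y) * (\<phi> x - \<phi> y) * kern s p (x - y)) 0)"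

lemma Jp_measurable [measurable]: "Jp p \<in> borel_measurable borel"
  unfolding Jp_def by measurable

lemma pair_lborel_shift:
  fixes f :: "'a::euclidean_space \<times> 'a \<Rightarrow> ennreal"
  assumes "f \<in> borel_measurable borel"
  shows "(\<integral>\<^sup>+(x, y). f (x + h, y + k) \<partial>(lborel \<Otimes>\<^sub>M lborel)) = (\<integral>\<^sup>+z. f z \<partial>(lborel \<Otimes>\<^sub>M lborel))"
  using nn_integral_shift[OF assms, of "(h, k)"] by (simp add: lborel_prod case_prod_beta' plus_prod_def)

lemma has_bochner_integral_pair_shift:
  fixes f :: "'a::euclidean_space \<times> 'a \<Rightarrow> real"
  assumes "has_bochner_integral (lborel \<Otimes>\<^sub>M lborel) f I"
  shows "has_bochner_integral (lborel \<Otimes>\<^sub>M lborel) (\<lambda>(x, y). f (x + h, y + k)) I"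
  using has_bochner_integral_affine[of f I 1 "(h, k)"] assms
  by (simp add: lborel_prod case_prod_beta' plus_prod_def add.commute)

lemma nn_integral_convolution:
  fixes f g :: "'a::euclidean_space \<Rightarrow> ennreal"
  assumes [measurable]: "f \<in> borel_measurable borel" "g \<in> borel_measurable borel"
  shows "(\<integral>\<^sup>+(x, y). f x * g (x - y) \<partial>(lborel \<Otimes>\<^sub>M lborel)) = (\<integral>\<^sup>+x. f x \<partial>lborel) * (\<integral>\<^sup>+z. g z \<partial>lborel)"
proof -
  have "(\<integral>\<^sup>+(x, y). f x * g (x - y) \<partial>(lborel \<Otimes>\<^sub>M lborel)) = (\<integral>\<^sup>+x. \<integral>\<^sup>+y. f x * g (x - y) \<partial>lborel \<partial>lborel)"
    by (subst lborel.nn_integral_fst [symmetric]) auto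
  also have "\<dots> = (\<integral>\<^sup>+x. f x * (\<integral>\<^sup>+z. g z \<partial>lborel) \<partial>lborel)"
    by (intro nn_integral_cong) (simp add: nn_integral_cmult nn_integral_reflect)
  finally show ?thesis by (simp add: nn_integral_multc)
qed

lemma nn_integral_pair_swap:
  fixes f :: "'a::euclidean_space \<times> 'a \<Rightarrow> ennreal"
  assumes [measurable]: "f \<in> borel_measurable (lborel \<Otimes>\<^sub>M lborel)"
  shows "(\<integral>\<^sup>+(x, y). f (y, x) \<partial>(lborel \<Otimes>\<^sub>M lborel)) = (\<integral>\<^sup>+z. f z \<partial>(lborel \<Otimes>\<^sub>M lborel))"
  by (subst (2) lborel_pair.distr_pair_swap) (simp add: nn_integral_distr case_prod_beta')

lemma nn_integral_convolution':
  fixes f g :: "'a::euclidean_space \<Rightarrow> ennreal"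
  assumes [measurable]: "f \<in> borel_measurable borel" "g \<in> borel_measurable borel"
    and sym: "\<And>z. g (- z) = g z"
  shows "(\<integral>\<^sup>+(x, y). f y * g (x - y) \<partial>(lborel \<Otimes>\<^sub>M lborel)) = (\<integral>\<^sup>+x. f x \<partial>lborel) * (\<integral>\<^sup>+z. g z \<partial>lborel)"
proof -
  have g: "g (x - y) = g (y - x)" for x y using sym[of "x - y"] by simp
  have "(\<integral>\<^sup>+(x, y). f y * g (y - x) \<partial>(lborel \<Otimes>\<^sub>M lborel)) = (\<integral>\<^sup>+(x, y). f x * g (x - y) \<partial>(lborel \<Otimes>\<^sub>M lborel))"
    using nn_integral_pair_swap[of "\<lambda>(x, y). f x * g (x - y)"] by (simp add: case_prod_beta')
  then show ?thesis using nn_integral_convolution[OF assms(1,2)] by (simp add: g)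
qed

lemma gagliardo_mono:
  assumes "A \<subseteq> B"
  shows "gagliardo s p A w \<le> gagliardo s p B w"
  unfolding gagliardo_def using assms
  by (intro nn_integral_mono) (auto simp: indicator_def intro!: ennreal_leI split: prod.splits)

lemma gagliardo_shift:
  fixes w :: "'a::euclidean_space \<Rightarrow> real"
  assumes [measurable]: "B \<in> sets borel" "B' \<in> sets borel" "w \<in> borel_measurable borel"
    and sub: "\<And>x. x \<in> B \<Longrightarrow> x + h \<in> B'"
  shows "gagliardo s p B (\<lambda>x. w (x + h)) \<le> gagliardo s p B' w"
proof -
  define f where "f = (\<lambda>(x, y). ennreal (indicator B' x * indicator B' y * \<bar>w x - w y\<bar> powr p * kern s p (x - y)))"
  have fm: "f \<in> borel_measurable borel" unfolding f_def borel_prod [symmetric] by measurable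
  have "gagliardo s p B (\<lambda>x. w (x + h)) \<le> (\<integral>\<^sup>+(x, y). f (x + h, y + h) \<partial>(lborel \<Otimes>\<^sub>M lborel))"
    unfolding gagliardo_def using sub
    by (intro nn_integral_mono) (auto simp: indicator_def f_def intro!: ennreal_leI split: prod.splits)
  also have "\<dots> = (\<integral>\<^sup>+z. f z \<partial>(lborel \<Otimes>\<^sub>M lborel))"
    by (rule pair_lborel_shift[OF fm])
  also have "\<dots> = gagliardo s p B' w"
    by (simp add: gagliardo_def f_def)
  finally show ?thesis .
qed

text \<open>
  The increments of \<open>u\<close> and of its translate form the weight of \<open>energy_pointwise\<close>; the energy of \<open>u\<close>
  bounds the integral of its \<open>p\<close>-th power.
\<close>

lemma gagliardo_difference_le:
  fixes u :: "'a::euclidean_space \<Rightarrow> real"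
  assumes [measurable]: "B \<in> sets borel" "B' \<in> sets borel" "u \<in> borel_measurable borel"
    and sub: "B \<subseteq> B'" "\<And>x. x \<in> B \<Longrightarrow> x + h \<in> B'" and p: "0 \<le> p"
  shows "(\<integral>\<^sup>+(x, y). ennreal (indicator B x * indicator B y * (\<bar>u (x + h) - u (y + h)\<bar> + \<bar>u x - u y\<bar>) powr p * kern s p (x - y))
       \<partial>(lborel \<Otimes>\<^sub>M lborel)) \<le> ennreal (2 powr (p + 1)) * gagliardo s p B' u"
proof -
  define f where "f v = (\<lambda>(x, y). ennreal (indicator B x * indicator B y * \<bar>v x - v y\<bar> powr p * kern s p (x - y)))" for v :: "'a \<Rightarrow> real"
  have [measurable]: "f u \<in> borel_measurable (lborel \<Otimes>\<^sub>M lborel)" "f (\<lambda>x. u (x + h)) \<in> borel_measurable (lborel \<Otimes>\<^sub>M lborel)"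
    unfolding f_def by measurable
  have "(\<integral>\<^sup>+(x, y). ennreal (indicator B x * indicator B y * (\<bar>u (x + h) - u (y + h)\<bar> + \<bar>u x - u y\<bar>) powr p * kern s p (x - y)) \<partial>(lborel \<Otimes>\<^sub>M lborel))
    \<le> (\<integral>\<^sup>+z. ennreal (2 powr p) * (f (\<lambda>x. u (x + h)) z + f u z) \<partial>(lborel \<Otimes>\<^sub>M lborel))"
  proof (rule nn_integral_mono, clarify)
    fix x y
    have "indicator B x * indicator B y * (\<bar>u (x + h) - u (y + h)\<bar> + \<bar>u x - u y\<bar>) powr p * kern s p (x - y)
      \<le> indicator B x * indicator B y * (2 powr p * (\<bar>u (x + h) - u (y + h)\<bar> powr p + \<bar>u x - u y\<bar> powr p)) * kern s p (x - y)"
      using p by (intro mult_right_mono mult_left_mono powr_sum_le) (auto simp: indicator_def)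
    then show "ennreal (indicator B x * indicator B y * (\<bar>u (x + h) - u (y + h)\<bar> + \<bar>u x - u y\<bar>) powr p * kern s p (x - y))
      \<le> ennreal (2 powr p) * (f (\<lambda>x. u (x + h)) (x, y) + f u (x, y))"
      by (simp add: f_def ennreal_mult' [symmetric] ennreal_plus [symmetric] algebra_simps indicator_def del: ennreal_plus)
  qed
  also have "\<dots> = ennreal (2 powr p) * (gagliardo s p B (\<lambda>x. u (x + h)) + gagliardo s p B u)"
    by (simp add: nn_integral_cmult nn_integral_add) (simp add: gagliardo_def f_def)
  also have "\<dots> \<le> ennreal (2 powr p) * (gagliardo s p B' u + gagliardo s p B' u)"
    using sub by (intro mult_left_mono add_mono gagliardo_shift gagliardo_mono) auto
  also have "\<dots> = ennreal (2 powr (p + 1)) * gagliardo s p B' u"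
  proof -
    have "ennreal (2 powr (p + 1)) = ennreal (2 powr p) * 2"
      by (simp add: powr_add ennreal_mult' [symmetric] flip: ennreal_numeral)
    then show ?thesis by (simp add: mult.assoc mult_2)
  qed
  finally show ?thesis .
qed

definition cutoff :: "real \<Rightarrow> real \<Rightarrow> 'a::euclidean_space \<Rightarrow> real" where
  "cutoff a b x = max 0 (min 1 ((b - norm x) / (b - a)))"

lemma cutoff_measurable [measurable]: "cutoff a b \<in> borel_measurable borel"
  unfolding cutoff_def by measurable

lemma cutoff_bounds: "0 \<le> cutoff a b x" "cutoff a b x \<le> 1"
  by (auto simp: cutoff_def)

lemma cutoff_eq_1: "a < b \<Longrightarrow> norm x \<le> a \<Longrightarrow> cutoff a b x = 1"
  by (simp add: cutoff_def field_simps)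

lemma cutoff_eq_0: "a < b \<Longrightarrow> b \<le> norm x \<Longrightarrow> cutoff a b x = 0"
  by (simp add: cutoff_def field_simps)

lemma cutoff_lipschitz:
  assumes "a < b"
  shows "\<bar>cutoff a b x - cutoff a b y\<bar> \<le> norm (x - y) / (b - a)"
proof -
  have "\<bar>cutoff a b x - cutoff a b y\<bar> \<le> \<bar>(b - norm x) / (b - a) - (b - norm y) / (b - a)\<bar>"
    unfolding cutoff_def by linarith
  also have "\<dots> = \<bar>norm x - norm y\<bar> / (b - a)"
    using assms by (simp add: diff_divide_distrib [symmetric] abs_minus_commute)
  also have "\<dots> \<le> norm (x - y) / (b - a)"
    using assms by (intro divide_right_mono norm_triangle_ineq3) auto
  finally show ?thesis .
qed

lemma cutoff_lipschitz_min:
  assumes "a < b" "b - a \<le> 1"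
  shows "\<bar>cutoff a b x - cutoff a b y\<bar> \<le> min 1 (norm (x - y)) / (b - a)"
proof -
  have "\<bar>cutoff a b x - cutoff a b y\<bar> \<le> 1"
    using cutoff_bounds[of a b x] cutoff_bounds[of a b y] by linarith
  also have "1 \<le> 1 / (b - a)" using assms by simp
  finally show ?thesis using cutoff_lipschitz[OF assms(1), of x y] by (simp add: min_def)
qed

text \<open>
  If \<open>x\<close> lies in the unit ball at distance at least \<open>d\<close> from \<open>y\<close>, then \<open>norm y \<le> 2 / d * norm (x - y)\<close>. The
  kernel seen from \<open>x\<close> is thus comparable with the kernel seen from the origin, in which the tail is
  measured. The constant uses the exponent \<open>N + p\<close> in place of \<open>N + s * p\<close> to be independent of \<open>s\<close>.
\<close>

lemma kern_le_kern:
  fixes x y :: "'a::euclidean_space"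
  assumes d: "0 < d" "d \<le> 1" and x: "norm x \<le> 1" and y: "y \<noteq> 0" and xy: "d \<le> norm (x - y)"
    and s: "0 < s" "s < 1" and p: "0 \<le> p"
  shows "kern s p (x - y) \<le> (2 / d) powr (real DIM('a) + p) * kern s p y"
proof -
  have "norm y \<le> norm (x - y) + norm x"
    using norm_triangle_ineq[of "y - x" x] by (simp add: norm_minus_commute)
  also have "norm x \<le> norm (x - y) / d"
  proof -
    have "1 \<le> norm (x - y) / d" using xy d by simp
    with x show ?thesis by linarith
  qed
  also have "norm (x - y) + norm (x - y) / d \<le> 2 / d * norm (x - y)"
    using d mult_left_mono[of d 1 "norm (x - y)"] by (simp add: field_simps)
  finally have "norm y \<le> 2 / d * norm (x - y)" by simp
  then have le: "d / 2 * norm y \<le> norm (x - y)" using d by (simp add: field_simps)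
  have sp: "0 \<le> s * p" "s * p \<le> p" using s p by (auto simp: mult_left_le_one_le)
  have "kern s p (x - y) \<le> (d / 2 * norm y) powr (- (real DIM('a) + s * p))"
    unfolding kern_def using le d y sp by (intro powr_mono2') auto
  also have "\<dots> = (d / 2) powr (- (real DIM('a) + s * p)) * kern s p y"
    unfolding kern_def using d by (subst powr_mult) auto
  also have "(d / 2) powr (- (real DIM('a) + s * p)) = (2 / d) powr (real DIM('a) + s * p)"
    unfolding powr_minus_divide using d by (simp add: powr_divide)
  also have "\<dots> * kern s p y \<le> (2 / d) powr (real DIM('a) + p) * kern s p y"
    using d sp by (intro mult_right_mono powr_mono) auto
  finally show ?thesis .
qed

lemma powr_minus_diff_le:
  fixes a b d \<beta> :: real
  assumes "0 < d" "d \<le> a" "d \<le> b" "0 \<le> \<beta>"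
  shows "\<bar>a powr (- \<beta>) - b powr (- \<beta>)\<bar> \<le> \<beta> / d * (a powr (- \<beta>) + b powr (- \<beta>)) * \<bar>a - b\<bar>"
proof -
  have *: "\<bar>a powr (- \<beta>) - b powr (- \<beta>)\<bar> \<le> \<beta> / d * (a powr (- \<beta>) + b powr (- \<beta>)) * \<bar>a - b\<bar>"
    if ab: "d \<le> a" "a < b" for a b
  proof -
    have "\<exists>z>a. z < b \<and> b powr (- \<beta>) - a powr (- \<beta>) = (b - a) * (- \<beta> * z powr (- \<beta> - 1))"
      using ab assms by (intro MVT2) (auto intro!: derivative_eq_intros)
    then obtain z where z: "a < z" "z < b" "b powr (- \<beta>) - a powr (- \<beta>) = (b - a) * (- \<beta> * z powr (- \<beta> - 1))"
      by blast
    have "z powr (- \<beta> - 1) = z powr (- \<beta>) * (1 / z)" using z ab assms by (simp add: powr_diff)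
    also have "\<dots> \<le> a powr (- \<beta>) * (1 / d)"
      using z ab assms by (intro mult_mono powr_mono2' frac_le) auto
    finally have zle: "z powr (- \<beta> - 1) \<le> a powr (- \<beta>) * (1 / d)" .
    have "\<bar>a powr (- \<beta>) - b powr (- \<beta>)\<bar> = (b - a) * (\<beta> * z powr (- \<beta> - 1))"
      using z ab assms by (simp add: abs_minus_commute[of "a powr - \<beta>"] abs_mult)
    also have "\<dots> \<le> (b - a) * (\<beta> * (a powr (- \<beta>) * (1 / d)))"
      using ab assms zle by (intro mult_left_mono) auto
    also have "\<dots> \<le> (b - a) * (\<beta> * ((a powr (- \<beta>) + b powr (- \<beta>)) * (1 / d)))"
      using ab assms by (intro mult_left_mono mult_right_mono) auto
    finally show ?thesis using ab by (simp add: mult_ac)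
  qed
  show ?thesis
    using *[of a b] *[of b a] assms by (cases a b rule: linorder_cases) (auto simp: abs_minus_commute add.commute)
qed

text \<open>
  Away from its pole the kernel is Lipschitz relative to its own size, so that moving the pole by \<open>h\<close>
  gains a factor \<open>norm h\<close>.
\<close>

lemma kern_difference_le:
  fixes y z :: "'a::euclidean_space"
  assumes "0 < d" "d \<le> norm y" "d \<le> norm z" and s: "0 < s" "s < 1" and p: "0 \<le> p"
  shows "\<bar>kern s p y - kern s p z\<bar> \<le> (real DIM('a) + p) / d * (kern s p y + kern s p z) * norm (y - z)"
proof -
  have sp: "0 \<le> s * p" "s * p \<le> p" using s p by (auto simp: mult_left_le_one_le)
  have "\<bar>kern s p y - kern s p z\<bar> \<le> (real DIM('a) + s * p) / d * (kern s p y + kern s p z) * \<bar>norm y - norm z\<bar>"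
    unfolding kern_def using assms sp by (intro powr_minus_diff_le) auto
  also have "\<dots> \<le> (real DIM('a) + p) / d * (kern s p y + kern s p z) * norm (y - z)"
    using assms sp by (intro mult_mono divide_right_mono norm_triangle_ineq3) auto
  finally show ?thesis .
qed

lemma abs_Jp_le:
  assumes "2 \<le> p" "\<bar>a\<bar> \<le> 1"
  shows "\<bar>Jp p (a - b)\<bar> \<le> (1 + \<bar>b\<bar>) powr (p - 1)"
  unfolding Jp_abs using assms by (intro powr_mono2) auto

text \<open>
  For \<open>d \<le> norm y < 1\<close> the function is bounded and \<open>min 1 (norm y) \<ge> d\<close>, so \<open>kernel_integral\<close> applies; outside
  the unit ball the normalised tail takes over. The growth \<open>1 / (1 - s)\<close> is harmless,
  since energies carry the factor \<open>1 - s\<close>.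
\<close>

lemma tail_mass_bound:
  fixes p s0 d :: real
  assumes s0: "0 < s0" and p: "2 \<le> p" and d: "0 < d" "d \<le> 1"
  obtains C where "0 < C" "\<And>s (u :: 'a::euclidean_space \<Rightarrow> real). s0 \<le> s \<Longrightarrow> s < 1 \<Longrightarrow> unit_solution s p u \<Longrightarrow>
     (\<integral>\<^sup>+y\<in>- ball 0 d. ennreal ((1 + \<bar>u y\<bar>) powr (p - 1) * kern s p y) \<partial>lborel) \<le> ennreal (C / (1 - s))"
proof -
  obtain C0 where C0: "0 < C0" "\<And>s. s0 \<le> s \<Longrightarrow> s < 1 \<Longrightarrow>
     (\<integral>\<^sup>+z. ennreal (min 1 (norm z) powr p * kern s p (z::'a)) \<partial>lborel) \<le> ennreal (C0 / (1 - s))"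
    using kernel_integral[of s0 p, where 'a='a] s0 p by auto
  define C where "C = 2 powr p * ((1 / d) powr p * C0 + 1)"
  have "0 < C" using C0 by (simp add: C_def add_nonneg_pos)
  moreover have "(\<integral>\<^sup>+y\<in>- ball 0 d. ennreal ((1 + \<bar>u y\<bar>) powr (p - 1) * kern s p y) \<partial>lborel) \<le> ennreal (C / (1 - s))"
    if s: "s0 \<le> s" "s < 1" and u: "unit_solution s p u" for s and u :: "'a \<Rightarrow> real"
  proof -
    have [measurable]: "u \<in> borel_measurable borel" using u by (simp add: unit_solution_def)
    have [measurable]: "ball (0::'a) r \<in> sets borel" for r by simp
    have "(\<integral>\<^sup>+y\<in>- ball 0 d. ennreal ((1 + \<bar>u y\<bar>) powr (p - 1) * kern s p y) \<partial>lborel)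
      \<le> (\<integral>\<^sup>+y. ennreal (2 powr p * (1 / d) powr p) * ennreal (min 1 (norm y) powr p * kern s p y)
          + ennreal (2 powr p) * (ennreal (\<bar>u y\<bar> powr (p - 1) * kern s p y) * indicator (- ball 0 1) y) \<partial>lborel)"
    proof (rule nn_integral_mono)
      fix y :: 'a
      show "ennreal ((1 + \<bar>u y\<bar>) powr (p - 1) * kern s p y) * indicator (- ball 0 d) y
        \<le> ennreal (2 powr p * (1 / d) powr p) * ennreal (min 1 (norm y) powr p * kern s p y)
          + ennreal (2 powr p) * (ennreal (\<bar>u y\<bar> powr (p - 1) * kern s p y) * indicator (- ball 0 1) y)"
      proof (cases "y \<in> ball 0 d")
        case False
        then have y: "d \<le> norm y" by simp
        have "1 = (1 / d * d) powr p" using d by simp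
        also have "\<dots> \<le> (1 / d * min 1 (norm y)) powr p"
          using d y p by (intro powr_mono2 mult_left_mono) auto
        also have "\<dots> = (1 / d) powr p * min 1 (norm y) powr p"
          using d by (subst powr_mult) auto
        finally have one: "1 \<le> (1 / d) powr p * min 1 (norm y) powr p" .
        show ?thesis
        proof (cases "norm y < 1")
          case True
          then have "\<bar>u y\<bar> \<le> 1" using u by (auto simp: unit_solution_def)
          then have "(1 + \<bar>u y\<bar>) powr (p - 1) \<le> 2 powr (p - 1)" using p by (intro powr_mono2) auto
          also have "\<dots> \<le> 2 powr p" by simp
          also have "\<dots> \<le> 2 powr p * ((1 / d) powr p * min 1 (norm y) powr p)" using one by simp
          finally have "(1 + \<bar>u y\<bar>) powr (p - 1) * kern s p y \<le> 2 powr p * ((1 / d) powr p * min 1 (norm y) powr p) * kern s p y"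
            by (intro mult_right_mono) auto
          then show ?thesis using True y
            by (simp add: ennreal_mult' [symmetric] mult.assoc ennreal_leI)
        next
          case False
          have "(1 + \<bar>u y\<bar>) powr (p - 1) \<le> 2 powr (p - 1) * (1 powr (p - 1) + \<bar>u y\<bar> powr (p - 1))"
            using p by (intro powr_sum_le) auto
          also have "\<dots> \<le> 2 powr p * (1 + \<bar>u y\<bar> powr (p - 1))" by (intro mult_mono) auto
          also have "\<dots> \<le> 2 powr p * ((1 / d) powr p * min 1 (norm y) powr p + \<bar>u y\<bar> powr (p - 1))"
            using one by (intro mult_left_mono add_right_mono) auto
          finally have "(1 + \<bar>u y\<bar>) powr (p - 1) * kern s p y
              \<le> 2 powr p * ((1 / d) powr p * min 1 (norm y) powr p + \<bar>u y\<bar> powr (p - 1)) * kern s p y"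
            by (intro mult_right_mono) auto
          then show ?thesis using False y
            by (simp add: ennreal_mult' [symmetric] ennreal_plus [symmetric] algebra_simps ennreal_leI del: ennreal_plus)
        qed
      qed simp
    qed
    also have "\<dots> = ennreal (2 powr p * (1 / d) powr p) * (\<integral>\<^sup>+y. ennreal (min 1 (norm y) powr p * kern s p (y::'a)) \<partial>lborel)
        + ennreal (2 powr p) * (\<integral>\<^sup>+y\<in>- ball 0 1. ennreal (\<bar>u y\<bar> powr (p - 1) * kern s p y) \<partial>lborel)"
      by (simp add: nn_integral_add nn_integral_cmult)
    also have "\<dots> \<le> ennreal (2 powr p * (1 / d) powr p) * ennreal (C0 / (1 - s)) + ennreal (2 powr p) * 1"
      using u by (intro add_mono mult_left_mono C0 s) (auto simp: unit_solution_def)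
    also have "\<dots> = ennreal (2 powr p * (1 / d) powr p * (C0 / (1 - s)) + 2 powr p)"
      using C0 s by (simp add: ennreal_mult' [symmetric])
    also have "\<dots> \<le> ennreal (C / (1 - s))"
    proof (rule ennreal_leI)
      have "2 powr p \<le> 2 powr p / (1 - s)" using s s0 by (simp add: field_simps)
      then show "2 powr p * (1 / d) powr p * (C0 / (1 - s)) + 2 powr p \<le> C / (1 - s)"
        by (simp add: C_def add_divide_distrib distrib_left)
    qed
    finally show ?thesis .
  qed
  ultimately show ?thesis using that by blast
qed

section \<open>The energy estimate for differences\<close>

text \<open>
  Splits the weak formulation into a local part, with weight \<open>c x * c y\<close>, and a far part. As \<open>c = 1\<close>
  wherever \<open>\<zeta> \<noteq> 0\<close>, one has \<open>(\<zeta> x - \<zeta> y) * (1 - c x * c y) = \<zeta> x * (1 - c y) - \<zeta> y * (1 - c x)\<close>, and exchanging \<open>x\<close>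
  and \<open>y\<close> turns one term of the far part into the other, since \<open>Jp\<close> is odd and the kernel even.
  The weight is a product of Lipschitz cutoffs and not an indicator, because \<open>nonlocal_pointwise\<close>
  needs the far part to vary in a Lipschitz way under translations.
\<close>

lemma cutoff_identity:
  fixes u \<zeta> c :: "'a::euclidean_space \<Rightarrow> real"
  assumes F: "has_bochner_integral (lborel \<Otimes>\<^sub>M lborel) (\<lambda>(x, y). Jp p (u x - u y) * (\<zeta> x - \<zeta> y) * kern s p (x - y)) 0"
    and c: "\<And>x. \<zeta> x \<noteq> 0 \<Longrightarrow> c x = 1"
    and G: "integrable (lborel \<Otimes>\<^sub>M lborel) (\<lambda>(x, y). Jp p (u x - u y) * kern s p (x - y) * \<zeta> x * (1 - c y))"
  shows "has_bochner_integral (lborel \<Otimes>\<^sub>M lborel)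
      (\<lambda>(x, y). Jp p (u x - u y) * (\<zeta> x - \<zeta> y) * kern s p (x - y) * (c x * c y))
      (- 2 * (\<integral>(x, y). Jp p (u x - u y) * kern s p (x - y) * \<zeta> x * (1 - c y) \<partial>(lborel \<Otimes>\<^sub>M lborel)))"
proof -
  define g where "g = (\<lambda>(x, y). Jp p (u x - u y) * kern s p (x - y) * \<zeta> x * (1 - c y))"
  have gi: "integrable (lborel \<Otimes>\<^sub>M lborel) g" using G by (simp add: g_def)
  have sw: "has_bochner_integral (lborel \<Otimes>\<^sub>M lborel) (\<lambda>(x, y). g (y, x)) (integral\<^sup>L (lborel \<Otimes>\<^sub>M lborel) g)"
    using lborel_pair.integrable_product_swap[OF gi] lborel_pair.integral_product_swap[of g] gi
    by (simp add: has_bochner_integral_iff borel_measurable_integrable)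
  have eq: "(\<lambda>(x, y). Jp p (u x - u y) * (\<zeta> x - \<zeta> y) * kern s p (x - y) * (c x * c y))
     = (\<lambda>z. (case z of (x, y) \<Rightarrow> Jp p (u x - u y) * (\<zeta> x - \<zeta> y) * kern s p (x - y)) - (g z + (case z of (x, y) \<Rightarrow> g (y, x))))"
  proof (intro ext, clarify)
    fix x y
    have J: "Jp p (u y - u x) = - Jp p (u x - u y)" using Jp_minus[of p "u x - u y"] by simp
    have z: "\<zeta> x * c x = \<zeta> x" "\<zeta> y * c y = \<zeta> y" using c[of x] c[of y] by auto
    have "(\<zeta> x - \<zeta> y) * (c x * c y) = (\<zeta> x * c x) * c y - (\<zeta> y * c y) * c x" by (simp add: algebra_simps)
    also have "\<dots> = \<zeta> x - \<zeta> y - \<zeta> x * (1 - c y) + \<zeta> y * (1 - c x)" unfolding z by (simp add: algebra_simps)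
    finally have "(\<zeta> x - \<zeta> y) * (c x * c y) = \<zeta> x - \<zeta> y - \<zeta> x * (1 - c y) + \<zeta> y * (1 - c x)" .
    then have "Jp p (u x - u y) * kern s p (x - y) * ((\<zeta> x - \<zeta> y) * (c x * c y))
       = Jp p (u x - u y) * kern s p (x - y) * (\<zeta> x - \<zeta> y - \<zeta> x * (1 - c y) + \<zeta> y * (1 - c x))" by simp
    then show "Jp p (u x - u y) * (\<zeta> x - \<zeta> y) * kern s p (x - y) * (c x * c y)
      = Jp p (u x - u y) * (\<zeta> x - \<zeta> y) * kern s p (x - y) - (g (x, y) + g (y, x))"
      unfolding g_def J prod.case kern_commute[of s p y x] by (simp add: algebra_simps)
  qed
  have "has_bochner_integral (lborel \<Otimes>\<^sub>M lborel)
     (\<lambda>z. (case z of (x, y) \<Rightarrow> Jp p (u x - u y) * (\<zeta> x - \<zeta> y) * kern s p (x - y)) - (g z + (case z of (x, y) \<Rightarrow> g (y, x))))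
     (0 - (integral\<^sup>L (lborel \<Otimes>\<^sub>M lborel) g + integral\<^sup>L (lborel \<Otimes>\<^sub>M lborel) g))"
    using gi by (intro has_bochner_integral_diff has_bochner_integral_add F sw has_bochner_integral_integrable)
  then show ?thesis unfolding eq by (simp add: g_def)
qed

text \<open>
  When the supports of \<open>\<zeta>\<close> and \<open>\<kappa>\<close> are a distance \<open>d\<close> apart, the integrand is at most a bounded function of \<open>x\<close>
  with support in the unit ball times the tail density in \<open>y\<close>.
\<close>

lemma nonlocal_integrable:
  fixes u \<zeta> \<kappa> :: "'a::euclidean_space \<Rightarrow> real"
  assumes u: "unit_solution s p u" and s: "0 < s" "s < 1" and p: "2 \<le> p" and d: "0 < d" "d \<le> 1"
    and [measurable]: "\<zeta> \<in> borel_measurable borel" "\<kappa> \<in> borel_measurable borel"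
    and \<zeta>: "\<And>x. \<bar>\<zeta> x\<bar> \<le> 2" and \<kappa>: "\<And>y. \<bar>\<kappa> y\<bar> \<le> 1"
    and sep: "\<And>x y. \<zeta> x \<noteq> 0 \<Longrightarrow> \<kappa> y \<noteq> 0 \<Longrightarrow> norm x < 1 \<and> d \<le> norm (x - y) \<and> d \<le> norm y"
  shows "integrable (lborel \<Otimes>\<^sub>M lborel) (\<lambda>(x, y). Jp p (u x - u y) * kern s p (x - y) * \<zeta> x * \<kappa> y)"
proof -
  have um [measurable]: "u \<in> borel_measurable borel" using u by (simp add: unit_solution_def)
  have [measurable]: "ball (0::'a) r \<in> sets borel" for r by simp
  obtain C where C: "0 < C" "(\<integral>\<^sup>+y\<in>- ball 0 d. ennreal ((1 + \<bar>u y\<bar>) powr (p - 1) * kern s p y) \<partial>lborel) \<le> ennreal (C / (1 - s))"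
  proof -
    obtain C where "0 < C" "\<And>s' (u :: 'a \<Rightarrow> real). s \<le> s' \<Longrightarrow> s' < 1 \<Longrightarrow> unit_solution s' p u \<Longrightarrow>
       (\<integral>\<^sup>+y\<in>- ball 0 d. ennreal ((1 + \<bar>u y\<bar>) powr (p - 1) * kern s' p y) \<partial>lborel) \<le> ennreal (C / (1 - s'))"
      using tail_mass_bound[of s p d, where 'a='a] s p d by blast
    then show ?thesis using that[of C] u s by blast
  qed
  define c where "c = (2 / d) powr (real DIM('a) + p)"
  define v where "v y = ennreal ((1 + \<bar>u y\<bar>) powr (p - 1) * kern s p y) * indicator (- ball 0 d) y" for y
  have [measurable]: "v \<in> borel_measurable borel" unfolding v_def by measurable
  show ?thesis
  proof (rule integrableI_bounded)
    show "(\<lambda>(x, y). Jp p (u x - u y) * kern s p (x - y) * \<zeta> x * \<kappa> y) \<in> borel_measurable (lborel \<Otimes>\<^sub>M lborel)"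
      by measurable
    have "(\<integral>\<^sup>+z. ennreal (norm (case z of (x, y) \<Rightarrow> Jp p (u x - u y) * kern s p (x - y) * \<zeta> x * \<kappa> y)) \<partial>(lborel \<Otimes>\<^sub>M lborel))
      \<le> (\<integral>\<^sup>+(x, y). ennreal (2 * c) * indicator (ball (0::'a) 1) x * v y \<partial>(lborel \<Otimes>\<^sub>M lborel))"
    proof (rule nn_integral_mono)
      fix z :: "'a \<times> 'a"
      obtain x y where z: "z = (x, y)" by (cases z)
      have "ennreal (norm (Jp p (u x - u y) * kern s p (x - y) * \<zeta> x * \<kappa> y)) \<le> ennreal (2 * c) * indicator (ball (0::'a) 1) x * v y"
      proof (cases "\<zeta> x \<noteq> 0 \<and> \<kappa> y \<noteq> 0")
        case True
        with sep have xy: "norm x < 1" "d \<le> norm (x - y)" "d \<le> norm y" by auto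
        then have "\<bar>u x\<bar> \<le> 1" using u by (auto simp: unit_solution_def)
        then have J: "\<bar>Jp p (u x - u y)\<bar> \<le> (1 + \<bar>u y\<bar>) powr (p - 1)" using p by (intro abs_Jp_le)
        have K: "kern s p (x - y) \<le> c * kern s p y"
          unfolding c_def using xy d s p by (intro kern_le_kern) auto
        have "norm (Jp p (u x - u y) * kern s p (x - y) * \<zeta> x * \<kappa> y)
           = \<bar>Jp p (u x - u y)\<bar> * kern s p (x - y) * \<bar>\<zeta> x\<bar> * \<bar>\<kappa> y\<bar>" by (simp add: abs_mult)
        also have "\<dots> \<le> (1 + \<bar>u y\<bar>) powr (p - 1) * (c * kern s p y) * 2 * 1"
          by (intro mult_mono J K \<zeta> \<kappa>) (auto simp: c_def)
        finally have "ennreal (norm (Jp p (u x - u y) * kern s p (x - y) * \<zeta> x * \<kappa> y)) \<le> ennreal (2 * c * ((1 + \<bar>u y\<bar>) powr (p - 1) * kern s p y))"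
          by (intro ennreal_leI) (simp add: mult_ac)
        then show ?thesis using xy by (simp add: v_def ennreal_mult' [symmetric] c_def)
      qed auto
      then show "ennreal (norm (case z of (x, y) \<Rightarrow> Jp p (u x - u y) * kern s p (x - y) * \<zeta> x * \<kappa> y))
          \<le> (case z of (x, y) \<Rightarrow> ennreal (2 * c) * indicator (ball (0::'a) 1) x * v y)" by (simp add: z)
    qed
    also have "\<dots> = (\<integral>\<^sup>+x. \<integral>\<^sup>+y. ennreal (2 * c) * indicator (ball (0::'a) 1) x * v y \<partial>lborel \<partial>lborel)"
      by (subst lborel.nn_integral_fst [symmetric]) auto
    also have "\<dots> = ennreal (2 * c) * emeasure lborel (ball (0::'a) 1) * (\<integral>\<^sup>+y. v y \<partial>lborel)"
      by (simp add: nn_integral_cmult nn_integral_multc nn_integral_cmult_indicator)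
    also have "\<dots> \<le> ennreal (2 * c) * emeasure lborel (ball (0::'a) 1) * ennreal (C / (1 - s))"
      using C by (intro mult_left_mono) (auto simp: v_def)
    also have "\<dots> < \<infinity>" by (simp add: ennreal_mult_less_top emeasure_ball)
    finally show "(\<integral>\<^sup>+z. ennreal (norm (case z of (x, y) \<Rightarrow> Jp p (u x - u y) * kern s p (x - y) * \<zeta> x * \<kappa> y)) \<partial>(lborel \<Otimes>\<^sub>M lborel)) < \<infinity>" .
  qed
qed

text \<open>
  Compares the far parts of the translated and of the original equation at the same far point \<open>y\<close>. Three
  things change: the value \<open>u x\<close>, the pole of the kernel and the cutoff. Each dependence is Lipschitz,
  so the difference gains the factor \<open>\<bar>u (x + h) - u x\<bar> + norm h\<close>. Together with the test function, the far
  part becomes quadratic in \<open>d\<^sub>h u\<close> and \<open>h\<close>. Estimated separately, the two far parts would be only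
  linear and yield \<open>norm h powr \<sigma>\<close> in place of \<open>norm h powr (2 * \<sigma>)\<close>.
\<close>

lemma nonlocal_pointwise:
  fixes u \<kappa> :: "'a::euclidean_space \<Rightarrow> real"
  assumes s: "0 < s" "s < 1" and p: "2 \<le> p" and d: "0 < d" "d \<le> 1"
    and x: "norm x \<le> 1" "norm (x + h) \<le> 1" and ux: "\<bar>u x\<bar> \<le> 1" "\<bar>u (x + h)\<bar> \<le> 1"
    and \<kappa>: "\<And>y. 0 \<le> \<kappa> y" "\<And>y. \<kappa> y \<le> 1" "\<And>y z. \<bar>\<kappa> y - \<kappa> z\<bar> \<le> norm (y - z) / d"
    and sep: "\<kappa> (y - h) \<noteq> 0 \<or> \<kappa> y \<noteq> 0 \<Longrightarrow> d \<le> norm (x - y) \<and> d \<le> norm (x + h - y) \<and> d \<le> norm y"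
  shows "\<bar>Jp p (u (x + h) - u y) * kern s p (x + h - y) * \<kappa> (y - h) - Jp p (u x - u y) * kern s p (x - y) * \<kappa> y\<bar>
     \<le> (2 / d) powr (real DIM('a) + p) * ((p - 1) * 2 powr (p - 2) + 2 * (real DIM('a) + p) / d + 1 / d)
         * (\<bar>u (x + h) - u x\<bar> + norm h) * ((1 + \<bar>u y\<bar>) powr (p - 1) * kern s p y * indicator (- ball 0 d) y)"
proof (cases "\<kappa> (y - h) \<noteq> 0 \<or> \<kappa> y \<noteq> 0")
  case True
  with sep have xy: "d \<le> norm (x - y)" "d \<le> norm (x + h - y)" "d \<le> norm y" by auto
  then have y: "y \<noteq> 0" using d by auto
  define c where "c = (2 / d) powr (real DIM('a) + p)"
  define U where "U = (1 + \<bar>u y\<bar>) powr (p - 1)"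
  have c0: "0 \<le> c" "0 \<le> U" by (auto simp: c_def U_def)
  have K1: "kern s p (x - y) \<le> c * kern s p y"
    unfolding c_def using xy y d s p x by (intro kern_le_kern) auto
  have K2: "kern s p (x + h - y) \<le> c * kern s p y"
    unfolding c_def using xy y d s p x by (intro kern_le_kern) auto
  have J1: "\<bar>Jp p (u (x + h) - u y) - Jp p (u x - u y)\<bar> \<le> (p - 1) * 2 powr (p - 2) * U * \<bar>u (x + h) - u x\<bar>"
  proof -
    have "\<bar>Jp p (u (x + h) - u y) - Jp p (u x - u y)\<bar>
        \<le> (p - 1) * (\<bar>u (x + h) - u y\<bar> + \<bar>u x - u y\<bar>) powr (p - 2) * \<bar>u (x + h) - u x\<bar>"
      using Jp_lipschitz[OF p, of "u (x + h) - u y" "u x - u y"] by simp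
    also have "\<dots> \<le> (p - 1) * (2 * (1 + \<bar>u y\<bar>)) powr (p - 2) * \<bar>u (x + h) - u x\<bar>"
      using ux p by (intro mult_right_mono mult_left_mono powr_mono2) auto
    also have "(2 * (1 + \<bar>u y\<bar>)) powr (p - 2) = 2 powr (p - 2) * (1 + \<bar>u y\<bar>) powr (p - 2)"
      by (subst powr_mult) auto
    also have "(p - 1) * (2 powr (p - 2) * (1 + \<bar>u y\<bar>) powr (p - 2)) * \<bar>u (x + h) - u x\<bar>
       \<le> (p - 1) * (2 powr (p - 2) * U) * \<bar>u (x + h) - u x\<bar>"
      unfolding U_def using p by (intro mult_right_mono mult_left_mono powr_mono) auto
    finally show ?thesis by (simp add: mult.assoc)
  qed
  have J2: "\<bar>Jp p (u x - u y)\<bar> \<le> U" unfolding U_def using p ux by (intro abs_Jp_le)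
  have K3: "\<bar>kern s p (x + h - y) - kern s p (x - y)\<bar> \<le> 2 * (real DIM('a) + p) / d * (c * kern s p y) * norm h"
  proof -
    have "\<bar>kern s p (x + h - y) - kern s p (x - y)\<bar>
      \<le> (real DIM('a) + p) / d * (kern s p (x + h - y) + kern s p (x - y)) * norm (x + h - y - (x - y))"
      using xy d s p by (intro kern_difference_le) auto
    also have "\<dots> \<le> (real DIM('a) + p) / d * (c * kern s p y + c * kern s p y) * norm h"
      using K1 K2 d p c0 by (intro mult_mono mult_left_mono add_mono) (auto intro!: divide_nonneg_pos mult_nonneg_nonneg)
    finally show ?thesis by (simp add: algebra_simps add_divide_distrib)
  qed
  have k: "\<bar>\<kappa> (y - h) - \<kappa> y\<bar> \<le> norm h / d" using \<kappa>(3)[of "y - h" y] by simp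
  \<comment> \<open>The difference telescopes through the change of u, of the kernel and of the cutoff.\<close>
  define D1 where "D1 = (Jp p (u (x + h) - u y) - Jp p (u x - u y)) * kern s p (x + h - y) * \<kappa> (y - h)"
  define D2 where "D2 = Jp p (u x - u y) * ((kern s p (x + h - y) - kern s p (x - y)) * \<kappa> (y - h))"
  define D3 where "D3 = Jp p (u x - u y) * (kern s p (x - y) * (\<kappa> (y - h) - \<kappa> y))"
  have "Jp p (u (x + h) - u y) * kern s p (x + h - y) * \<kappa> (y - h) - Jp p (u x - u y) * kern s p (x - y) * \<kappa> y = D1 + D2 + D3"
    by (simp add: D1_def D2_def D3_def algebra_simps)
  moreover have "\<bar>D1\<bar> \<le> (p - 1) * 2 powr (p - 2) * U * \<bar>u (x + h) - u x\<bar> * (c * kern s p y) * 1"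
    unfolding D1_def abs_mult using \<kappa> p c0 by (intro mult_mono J1 K2) (auto simp: K2)
  moreover have "\<bar>D2\<bar> \<le> U * (2 * (real DIM('a) + p) / d * (c * kern s p y) * norm h * 1)"
    unfolding D2_def abs_mult using \<kappa> p c0 d by (intro mult_mono J2 K3) auto
  moreover have "\<bar>D3\<bar> \<le> U * (c * kern s p y * (norm h / d))"
    unfolding D3_def abs_mult using \<kappa> p c0 d by (intro mult_mono J2 k) (auto simp: K1)
  ultimately have "\<bar>Jp p (u (x + h) - u y) * kern s p (x + h - y) * \<kappa> (y - h) - Jp p (u x - u y) * kern s p (x - y) * \<kappa> y\<bar>
     \<le> c * ((p - 1) * 2 powr (p - 2) * \<bar>u (x + h) - u x\<bar> + (2 * (real DIM('a) + p) / d + 1 / d) * norm h) * (U * kern s p y)"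
    by (simp add: algebra_simps)
  also have "\<dots> \<le> c * ((p - 1) * 2 powr (p - 2) + 2 * (real DIM('a) + p) / d + 1 / d) * (\<bar>u (x + h) - u x\<bar> + norm h) * (U * kern s p y)"
  proof -
    define k1 where "k1 = (p - 1) * 2 powr (p - 2)"
    define k2 where "k2 = 2 * (real DIM('a) + p) / d + 1 / d"
    have "0 \<le> k1" "0 \<le> k2" using p d by (auto simp: k1_def k2_def)
    then have "k1 * \<bar>u (x + h) - u x\<bar> + k2 * norm h \<le> (k1 + k2) * (\<bar>u (x + h) - u x\<bar> + norm h)"
      by (simp add: algebra_simps)
    then have "c * (k1 * \<bar>u (x + h) - u x\<bar> + k2 * norm h) * (U * kern s p y)
       \<le> c * ((k1 + k2) * (\<bar>u (x + h) - u x\<bar> + norm h)) * (U * kern s p y)"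
      using c0 by (intro mult_right_mono mult_left_mono) auto
    then show ?thesis by (simp only: k1_def k2_def mult.assoc add.assoc)
  qed
  finally show ?thesis using xy by (simp add: c_def U_def)
next
  case False
  have "0 \<le> (p - 1) * 2 powr (p - 2) + 2 * (real DIM('a) + p) / d + 1 / d" using p d by simp
  then show ?thesis using False by simp
qed

text \<open>
  The only issue is the energy of \<open>\<phi>\<close>. If both points lie in the ball of radius \<open>r + 5 * d\<close>, the product rule
  bounds the increment of \<open>\<phi>\<close> by an increment of \<open>u (x + h) - u x\<close> plus a Lipschitz term. If one of them
  lies outside, then either \<open>\<phi>\<close> vanishes at both points or the two points are at least \<open>d\<close> apart, and the
  bound 2 is itself at most a multiple of \<open>min 1 (norm (x - y))\<close>.
\<close>

lemma test_function_admissible: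
  fixes u :: "'a::euclidean_space \<Rightarrow> real"
  assumes u: "unit_solution s p u" and s: "0 < s" "s < 1" and p: "2 \<le> p" and r: "0 < r" "0 < d" "d \<le> 1" "r + 6 * d < 1"
    and h: "norm h \<le> d"
  defines "\<phi> \<equiv> \<lambda>x. (cutoff (r + d) (r + 2 * d) x)\<^sup>2 * (u (x + h) - u x)"
  shows "\<phi> \<in> borel_measurable borel" "\<And>x. r + 2 * d \<le> norm x \<Longrightarrow> \<phi> x = 0" "\<And>x. \<bar>\<phi> x\<bar> \<le> 2"
    "gagliardo s p UNIV \<phi> < \<infinity>"
proof -
  have um [measurable]: "u \<in> borel_measurable borel" using u by (simp add: unit_solution_def)
  have ub: "\<bar>u x\<bar> \<le> 1" if "norm x < 1" for x using u that by (auto simp: unit_solution_def)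
  show m [measurable]: "\<phi> \<in> borel_measurable borel" unfolding \<phi>_def by measurable
  define \<eta> :: "'a \<Rightarrow> real" where "\<eta> = cutoff (r + d) (r + 2 * d)"
  define w where "w x = u (x + h) - u x" for x
  define B where "B = ball (0::'a) (r + 5 * d)"
  have [measurable]: "B \<in> sets borel" by (simp add: B_def)
  have \<eta>: "0 \<le> \<eta> x" "\<eta> x \<le> 1" for x by (auto simp: \<eta>_def cutoff_bounds)
  have \<eta>0: "\<eta> x = 0" if "r + 2 * d \<le> norm x" for x using that r by (simp add: \<eta>_def cutoff_eq_0)
  have Bh: "norm x < 1" "norm (x + h) < 1" if "x \<in> B" for x
    using that r h norm_triangle_ineq[of x h] by (auto simp: B_def)
  have w2: "\<bar>w x\<bar> \<le> 2" if "x \<in> B" for x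
    using ub[OF Bh(1)[OF that]] ub[OF Bh(2)[OF that]] by (simp add: w_def)
  show z: "\<phi> x = 0" if "r + 2 * d \<le> norm x" for x using \<eta>0[OF that] by (simp add: \<phi>_def \<eta>_def)
  have \<eta>B: "x \<in> B" if "\<eta> x \<noteq> 0" for x using \<eta>0[of x] that r by (force simp: B_def)
  have \<phi>w: "\<bar>\<phi> x\<bar> \<le> \<bar>w x\<bar>" for x
    using \<eta>[of x] by (simp add: \<phi>_def \<eta>_def w_def abs_mult mult_left_le_one_le power_le_one)
  show b: "\<bar>\<phi> x\<bar> \<le> 2" for x
    using \<phi>w[of x] w2[of x] \<eta>B[of x] by (cases "\<eta> x = 0") (auto simp: \<phi>_def \<eta>_def)
  define m where "m = (\<lambda>z::'a. min 1 (norm z))"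
  have m0: "0 \<le> m z" for z by (simp add: m_def)
  have key: "\<bar>\<phi> x - \<phi> y\<bar> \<le> indicator B x * indicator B y * \<bar>w x - w y\<bar> + 4 / d * ((indicator B x + indicator B y) * m (x - y))"
    for x y
  proof -
    have out: "\<bar>\<phi> x\<bar> \<le> 4 / d * m (x - y)" if "x \<in> B" "y \<notin> B" for x y
    proof (cases "\<eta> x = 0")
      case False
      then have "norm x < r + 2 * d" using \<eta>0[of x] by force
      moreover have "r + 5 * d \<le> norm y" using that by (simp add: B_def)
      ultimately have "d \<le> norm (x - y)" using norm_triangle_ineq2[of y x] r by (simp add: norm_minus_commute)
      then have "d \<le> m (x - y)" using r by (simp add: m_def)
      then have "2 \<le> 4 / d * m (x - y)" using r by (simp add: field_simps)
      with b[of x] show ?thesis by linarith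
    qed (use m0 r in \<open>simp add: \<phi>_def \<eta>_def\<close>)
    consider "x \<in> B" "y \<in> B" | "x \<in> B" "y \<notin> B" | "x \<notin> B" "y \<in> B" | "x \<notin> B" "y \<notin> B" by blast
    then show ?thesis
    proof cases
      case 1
      have "\<phi> x - \<phi> y = (\<eta> x)\<^sup>2 * (w x - w y) + ((\<eta> x + \<eta> y) * (\<eta> x - \<eta> y)) * w y"
        by (simp add: \<phi>_def \<eta>_def w_def power2_eq_square algebra_simps)
      then have "\<bar>\<phi> x - \<phi> y\<bar> \<le> \<bar>(\<eta> x)\<^sup>2 * (w x - w y)\<bar> + \<bar>((\<eta> x + \<eta> y) * (\<eta> x - \<eta> y)) * w y\<bar>"
        by (simp add: abs_triangle_ineq)
      also have "\<dots> \<le> 1 * \<bar>w x - w y\<bar> + 2 * (m (x - y) / d) * 2"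
        unfolding abs_mult
      proof (intro add_mono mult_mono w2 1)
        show "\<bar>\<eta> x - \<eta> y\<bar> \<le> m (x - y) / d"
          using cutoff_lipschitz_min[of "r + d" "r + 2 * d" x y] r by (simp add: \<eta>_def m_def)
      qed (use \<eta>[of x] \<eta>[of y] r m0 in \<open>auto simp: power_le_one\<close>)
      also have "\<dots> \<le> \<bar>w x - w y\<bar> + 4 / d * (2 * m (x - y))"
        using m0[of "x - y"] r by (simp add: field_simps)
      finally show ?thesis using 1 by simp
    next
      case 2
      then have "\<phi> y = 0" using z[of y] r by (simp add: B_def)
      then show ?thesis using out[OF 2] 2 by simp
    next
      case 3
      then have "\<phi> x = 0" using z[of x] r by (simp add: B_def)
      then show ?thesis using out[OF 3(2,1)] 3 by (simp add: m_def norm_minus_commute)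
    next
      case 4
      then have "\<phi> x = 0" "\<phi> y = 0" using z[of x] z[of y] r by (auto simp: B_def)
      then show ?thesis using 4 by simp
    qed
  qed
  obtain C0 where C0: "(\<integral>\<^sup>+z. ennreal (min 1 (norm z) powr p * kern s p (z::'a)) \<partial>lborel) \<le> ennreal (C0 / (1 - s))"
  proof -
    have "1 \<le> p" using p by simp
    then obtain C where "\<And>s'. s \<le> s' \<Longrightarrow> s' < 1 \<Longrightarrow>
       (\<integral>\<^sup>+z. ennreal (min 1 (norm z) powr p * kern s' p (z::'a)) \<partial>lborel) \<le> ennreal (C / (1 - s'))"
      using kernel_integral[of s p, where 'a='a] s by blast
    then show ?thesis using that[of C] s by blast
  qed
  define g where "g = (\<lambda>z::'a. ennreal (m z powr p * kern s p z))"
  have [measurable]: "g \<in> borel_measurable borel" unfolding g_def m_def by measurable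
  have gfin: "(\<integral>\<^sup>+z. g z \<partial>lborel) < \<infinity>" using C0 by (auto simp: g_def m_def intro: le_less_trans)
  define f where "f = (\<lambda>(x, y). ennreal (indicator B x * indicator B y * (\<bar>u (x + h) - u (y + h)\<bar> + \<bar>u x - u y\<bar>) powr p * kern s p (x - y)))"
  have fm [measurable]: "f \<in> borel_measurable (lborel \<Otimes>\<^sub>M lborel)" unfolding f_def by measurable
  define k where "k = 2 powr p * (4 / d) powr p * 2 powr p"
  have "gagliardo s p UNIV \<phi> \<le> (\<integral>\<^sup>+z. ennreal (2 powr p) * f z + ennreal k * ((case z of (x, y) \<Rightarrow> indicator B x * g (x - y)) + (case z of (x, y) \<Rightarrow> indicator B y * g (x - y))) \<partial>(lborel \<Otimes>\<^sub>M lborel))"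
    unfolding gagliardo_def
  proof (rule nn_integral_mono, clarify)
    fix x y
    define I where "I = (indicator B x + indicator B y :: real)"
    have I: "I powr p \<le> 2 powr p * I" "0 \<le> I"
      using p ge_one_powr_ge_zero[of 2 p] by (auto simp: I_def indicator_def)
    define a where "a = indicator B x * indicator B y * \<bar>w x - w y\<bar>"
    define e where "e = 4 / d * (I * m (x - y))"
    have e0: "0 \<le> e" "0 \<le> a" unfolding e_def a_def using r I(2) m0[of "x - y"] by auto
    have "\<bar>\<phi> x - \<phi> y\<bar> powr p \<le> (a + e) powr p"
      using key[of x y] p by (intro powr_mono2) (auto simp: a_def e_def I_def)
    also have "\<dots> \<le> 2 powr p * (a powr p + e powr p)"
      using e0 p by (intro powr_sum_le) auto
    also have "e powr p = (4 / d) powr p * (I powr p * m (x - y) powr p)"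
      by (simp only: e_def powr_mult)
    also have "2 powr p * (a powr p + (4 / d) powr p * (I powr p * m (x - y) powr p))
       \<le> 2 powr p * (a powr p + (4 / d) powr p * ((2 powr p * I) * m (x - y) powr p))"
      using I by (intro mult_left_mono add_left_mono mult_right_mono) auto
    also have "a powr p \<le> indicator B x * indicator B y * (\<bar>u (x + h) - u (y + h)\<bar> + \<bar>u x - u y\<bar>) powr p"
      unfolding a_def w_def using p by (auto simp: indicator_def intro!: powr_mono2)
    finally have le: "\<bar>\<phi> x - \<phi> y\<bar> powr p \<le> 2 powr p * (indicator B x * indicator B y * (\<bar>u (x + h) - u (y + h)\<bar> + \<bar>u x - u y\<bar>) powr p
        + (4 / d) powr p * ((2 powr p * I) * m (x - y) powr p))"
      by simp
    have "ennreal (indicator UNIV x * indicator UNIV y * \<bar>\<phi> x - \<phi> y\<bar> powr p * kern s p (x - y))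
       \<le> ennreal ((2 powr p * (indicator B x * indicator B y * (\<bar>u (x + h) - u (y + h)\<bar> + \<bar>u x - u y\<bar>) powr p
        + (4 / d) powr p * ((2 powr p * I) * m (x - y) powr p))) * kern s p (x - y))"
      using le by (intro ennreal_leI mult_right_mono) auto
    also have "\<dots> = ennreal (2 powr p) * f (x, y) + ennreal k * (indicator B x * g (x - y) + indicator B y * g (x - y))"
    proof -
      have "ennreal k * (indicator B x * g (x - y) + indicator B y * g (x - y)) = ennreal (k * (I * (m (x - y) powr p * kern s p (x - y))))"
        by (auto simp: I_def g_def indicator_def ennreal_mult' [symmetric] ennreal_plus [symmetric] k_def distrib_left simp del: ennreal_plus)
      then show ?thesis
        by (simp add: f_def k_def ennreal_mult' [symmetric] ennreal_plus [symmetric] I(2) algebra_simps del: ennreal_plus)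
    qed
    finally show "ennreal (indicator UNIV x * indicator UNIV y * \<bar>\<phi> x - \<phi> y\<bar> powr p * kern s p (x - y))
       \<le> ennreal (2 powr p) * f (x, y) + ennreal k * (indicator B x * g (x - y) + indicator B y * g (x - y))" .
  qed
  also have "\<dots> = ennreal (2 powr p) * (\<integral>\<^sup>+z. f z \<partial>(lborel \<Otimes>\<^sub>M lborel))
      + ennreal k * ((\<integral>\<^sup>+(x, y). indicator B x * g (x - y) \<partial>(lborel \<Otimes>\<^sub>M lborel)) + (\<integral>\<^sup>+(x, y). indicator B y * g (x - y) \<partial>(lborel \<Otimes>\<^sub>M lborel)))"
    by (simp add: nn_integral_add nn_integral_cmult)
  also have "(\<integral>\<^sup>+(x, y). indicator B x * g (x - y) \<partial>(lborel \<Otimes>\<^sub>M lborel)) = emeasure lborel B * (\<integral>\<^sup>+z. g z \<partial>lborel)"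
    by (subst nn_integral_convolution) auto
  also have "(\<integral>\<^sup>+(x, y). indicator B y * g (x - y) \<partial>(lborel \<Otimes>\<^sub>M lborel)) = emeasure lborel B * (\<integral>\<^sup>+z. g z \<partial>lborel)"
    by (subst nn_integral_convolution') (auto simp: g_def m_def kern_minus)
  also have "(\<integral>\<^sup>+z. f z \<partial>(lborel \<Otimes>\<^sub>M lborel)) \<le> ennreal (2 powr (p + 1)) * gagliardo s p (ball 0 1) u"
    unfolding f_def using Bh p by (intro gagliardo_difference_le) auto
  also have "ennreal (2 powr p) * (ennreal (2 powr (p + 1)) * gagliardo s p (ball 0 1) u)
     + ennreal k * (emeasure lborel B * (\<integral>\<^sup>+z. g z \<partial>lborel) + emeasure lborel B * (\<integral>\<^sup>+z. g z \<partial>lborel)) < \<infinity>"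
  proof -
    have "gagliardo s p (ball 0 1) u \<le> ennreal (1 / (1 - s)) * 1"
      using u s by (intro ennreal_le_multD) (auto simp: unit_solution_def)
    then have "gagliardo s p (ball 0 1) u < \<infinity>" by (auto intro: le_less_trans)
    then show ?thesis using gfin r by (simp add: ennreal_mult_less_top B_def emeasure_ball)
  qed
  finally show "gagliardo s p UNIV \<phi> < \<infinity>" by (simp add: add_right_mono mult_left_mono)
qed

text \<open>
  Integrates \<open>P \<le> F + Q\<close> when only the integral of the signed function \<open>F\<close> is under control, and not that
  of its absolute value: this is how the equation enters.
\<close>

lemma nn_integral_le_signed:
  assumes F: "integrable M F" "integral\<^sup>L M F \<le> a" "0 \<le> a"
    and [measurable]: "P \<in> borel_measurable M" "Q \<in> borel_measurable M"
    and PQ: "\<And>z. 0 \<le> P z" "\<And>z. 0 \<le> Q z" "\<And>z. P z \<le> F z + Q z"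
    and Q: "(\<integral>\<^sup>+z. ennreal (Q z) \<partial>M) \<le> ennreal b" and b: "0 \<le> b"
  shows "(\<integral>\<^sup>+z. ennreal (P z) \<partial>M) \<le> ennreal (a + b)"
proof -
  have Qi: "integrable M Q"
    using Q PQ by (intro integrableI_bounded) (auto intro: le_less_trans)
  have "integral\<^sup>L M Q \<le> b"
    using Q PQ b by (subst (asm) nn_integral_eq_integral[OF Qi]) auto
  have Pi: "integrable M P"
  proof (rule Bochner_Integration.integrable_bound[of M "\<lambda>z. F z + Q z"])
    show "integrable M (\<lambda>z. F z + Q z)" using F(1) Qi by simp
    show "AE z in M. norm (P z) \<le> norm (F z + Q z)"
    proof (rule AE_I2)
      fix z show "norm (P z) \<le> norm (F z + Q z)"
        using PQ(1)[of z] PQ(3)[of z] by simp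
    qed
  qed simp
  have "integral\<^sup>L M P \<le> integral\<^sup>L M (\<lambda>z. F z + Q z)"
    using Pi F Qi PQ by (intro integral_mono) auto
  also have "\<dots> \<le> a + b" using F Qi \<open>integral\<^sup>L M Q \<le> b\<close> by simp
  finally show ?thesis
    using PQ by (subst nn_integral_eq_integral[OF Pi]) (auto intro: ennreal_leI)
qed

lemma powr_le_two_powr_sum:
  fixes a b c p :: real
  assumes "0 \<le> a" "0 \<le> b" "0 \<le> c" "0 \<le> p"
  shows "(c * (a + b)) powr p \<le> (2 * c) powr p * (a powr p + b powr p)"
proof -
  have "(c * (a + b)) powr p = c powr p * (a + b) powr p" by (simp only: powr_mult)
  also have "\<dots> \<le> c powr p * (2 powr p * (a powr p + b powr p))"
    using assms by (intro mult_left_mono powr_sum_le) auto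
  finally show ?thesis by (simp add: powr_mult mult_ac)
qed

lemma unit_solution_weak:
  assumes "unit_solution s p u" "\<phi> \<in> borel_measurable borel" "r < 1" "\<And>x. r \<le> norm x \<Longrightarrow> \<phi> x = 0"
    "\<And>x. \<bar>\<phi> x\<bar> \<le> 2" "gagliardo s p UNIV \<phi> < \<infinity>"
  shows "has_bochner_integral (lborel \<Otimes>\<^sub>M lborel) (\<lambda>(x, y). Jp p (u x - u y) * (\<phi> x - \<phi> y) * kern s p (x - y)) 0"
  using assms unfolding unit_solution_def by blast

text \<open>
  Let \<open>\<eta>\<close> be 1 on the ball of radius \<open>r + d\<close> and supported in the ball of radius \<open>r + 2 * d\<close>, and let \<open>\<theta>\<close> be 1 on
  the ball of radius \<open>r + 4 * d\<close> and supported in the ball of radius \<open>r + 5 * d\<close>. The test function is \<open>\<phi> = \<eta>\<^sup>2 * w\<close>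
  with \<open>w = d\<^sub>h u\<close>; its translate by \<open>h\<close> stays in the ball of radius \<open>r + 3 * d\<close>, at distance at least \<open>d\<close> from
  the far region, where \<open>\<theta> < 1\<close>; and \<open>r + 6 * d < 1\<close> leaves room to evaluate \<open>u (x + h)\<close> on the support of \<open>\<theta>\<close>.

  The difference of the two equations, localised by \<open>\<theta> x * \<theta> y\<close>, has the integrand \<open>F\<close>. Its integral
  consists of far parts and is at most \<open>2 * a\<close> by \<open>nonlocal_pointwise\<close>. By \<open>energy_pointwise\<close>, \<open>F\<close> controls
  the energy density \<open>P\<close> of \<open>w\<close> up to a cutoff error \<open>Q\<close> with integral at most \<open>b\<close>. By \<open>powr_young\<close> with
  parameter \<open>t\<close>, both \<open>a\<close> and \<open>b\<close> are of order \<open>A * t\<^sup>2 / (1 - s)\<close>.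
\<close>

lemma energy_estimate_explicit:
  fixes u :: "'a::euclidean_space \<Rightarrow> real" and h :: 'a
  assumes u: "unit_solution s p u" and s: "0 < s" "s < 1" and p: "2 \<le> p"
    and r: "0 < r" "0 < d" "d \<le> 1" "r + 6 * d < 1"
    and h: "norm h \<le> d" and t: "0 < t" "norm h \<le> t" and A: "1 \<le> A" and C: "0 < C0" "0 < C1"
    and kernel: "(\<integral>\<^sup>+z. ennreal (min 1 (norm z) powr p * kern s p (z::'a)) \<partial>lborel) \<le> ennreal (C0 / (1 - s))"
    and tail: "(\<integral>\<^sup>+y\<in>- ball 0 d. ennreal ((1 + \<bar>u y\<bar>) powr (p - 1) * kern s p y) \<partial>lborel) \<le> ennreal (C1 / (1 - s))"
    and w: "(\<integral>\<^sup>+x\<in>ball 0 (r + 5 * d). ennreal (\<bar>u (x + h) - u x\<bar> powr p) \<partial>lborel) \<le> ennreal (A * t powr p)"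
  defines "c4 \<equiv> (2 / d) powr (real DIM('a) + p) * ((p - 1) * 2 powr (p - 2) + 2 * (real DIM('a) + p) / d + 1 / d)"
    and "Cq \<equiv> (p - 1)\<^sup>2 * 2 powr (p - 2)" and "V \<equiv> measure lborel (ball (0::'a) 1)"
  shows "ennreal (1 - s) * gagliardo s p (ball 0 (r + d)) (\<lambda>x. u (x + h) - u x)
     \<le> ennreal (2 powr p * (2 * (c4 * (3 * V + 2) * C1) + Cq * (2 powr (p + 1) + (2 / d) powr p * 2 * C0)) * A * t\<^sup>2)"
proof -
  let ?M = "lborel \<Otimes>\<^sub>M lborel :: ('a \<times> 'a) measure"
  have um [measurable]: "u \<in> borel_measurable borel" using u by (simp add: unit_solution_def)
  have ub: "\<bar>u x\<bar> \<le> 1" if "norm x < 1" for x using u that by (auto simp: unit_solution_def)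
  have [measurable]: "ball (0::'a) r \<in> sets borel" for r by simp
  define B where "B = ball (0::'a) (r + 5 * d)"
  have [measurable]: "B \<in> sets borel" by (simp add: B_def)
  define w where "w = (\<lambda>x. u (x + h) - u x)"
  have [measurable]: "w \<in> borel_measurable borel" unfolding w_def by measurable
  define \<eta> :: "'a \<Rightarrow> real" where "\<eta> = cutoff (r + d) (r + 2 * d)"
  define \<theta> :: "'a \<Rightarrow> real" where "\<theta> = cutoff (r + 4 * d) (r + 5 * d)"
  have [measurable]: "\<eta> \<in> borel_measurable borel" "\<theta> \<in> borel_measurable borel" unfolding \<eta>_def \<theta>_def by measurable
  have \<eta>: "0 \<le> \<eta> x" "\<eta> x \<le> 1" for x by (auto simp: \<eta>_def cutoff_bounds)
  have \<theta>: "0 \<le> \<theta> x" "\<theta> x \<le> 1" for x by (auto simp: \<theta>_def cutoff_bounds)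
  have \<eta>0: "norm x < r + 2 * d" if "\<eta> x \<noteq> 0" for x
    using that r cutoff_eq_0[of "r + d" "r + 2 * d" x] by (force simp: \<eta>_def)
  have \<theta>1: "r + 4 * d < norm x" if "1 - \<theta> x \<noteq> 0" for x
    using that r cutoff_eq_1[of "r + 4 * d" "r + 5 * d" x] by (force simp: \<theta>_def)
  have \<theta>0: "x \<in> B" if "\<theta> x \<noteq> 0" for x
    using that r cutoff_eq_0[of "r + 4 * d" "r + 5 * d" x] by (force simp: \<theta>_def B_def)
  have Bh: "norm x < 1" "norm (x + h) < 1" if "x \<in> B" for x
    using that r h norm_triangle_ineq[of x h] by (auto simp: B_def)
  define \<phi> where "\<phi> = (\<lambda>x. (\<eta> x)\<^sup>2 * w x)"
  \<comment> \<open>The equation for the translate tested with \<phi> is the equation for u tested with the translate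
    of \<phi>.\<close>
  define \<psi> where "\<psi> = (\<lambda>x. \<phi> (x - h))"
  note adm = test_function_admissible[OF u s p r h, folded \<eta>_def]
  have \<phi>eq: "\<phi> = (\<lambda>x. (\<eta> x)\<^sup>2 * (u (x + h) - u x))" by (simp add: \<phi>_def w_def)
  have \<phi>m [measurable]: "\<phi> \<in> borel_measurable borel" and \<phi>2: "\<And>x. \<bar>\<phi> x\<bar> \<le> 2"
    and \<phi>z: "\<And>x. r + 2 * d \<le> norm x \<Longrightarrow> \<phi> x = 0" and \<phi>g: "gagliardo s p UNIV \<phi> < \<infinity>"
    using adm unfolding \<phi>eq by auto
  have \<phi>0: "norm x < r + 2 * d" if "\<phi> x \<noteq> 0" for x using \<phi>z[of x] that by force
  have \<psi>m [measurable]: "\<psi> \<in> borel_measurable borel" unfolding \<psi>_def by measurable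
  have \<psi>0: "norm (x - h) < r + 2 * d" if "\<psi> x \<noteq> 0" for x using \<phi>0[of "x - h"] that by (simp add: \<psi>_def)
  have \<psi>g: "gagliardo s p UNIV \<psi> < \<infinity>"
    using gagliardo_shift[of UNIV UNIV \<phi> "- h" s p] \<phi>g by (auto simp: \<psi>_def intro: le_less_trans)
  have \<psi>z: "\<psi> x = 0" if "r + 3 * d \<le> norm x" for x
    using \<psi>0[of x] that h r norm_triangle_ineq[of "x - h" h] by force
  have F2: "has_bochner_integral ?M (\<lambda>(x, y). Jp p (u x - u y) * (\<phi> x - \<phi> y) * kern s p (x - y)) 0"
    by (rule unit_solution_weak[OF u \<phi>m _ \<phi>z \<phi>2 \<phi>g]) (use r in auto)
  have F1: "has_bochner_integral ?M (\<lambda>(x, y). Jp p (u x - u y) * (\<psi> x - \<psi> y) * kern s p (x - y)) 0"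
    by (rule unit_solution_weak[OF u \<psi>m _ \<psi>z _ \<psi>g]) (use r \<phi>2 in \<open>auto simp: \<psi>_def\<close>)
  define \<kappa> where "\<kappa> y = 1 - \<theta> y" for y
  have \<kappa>: "0 \<le> \<kappa> y" "\<kappa> y \<le> 1" "\<bar>\<kappa> y\<bar> \<le> 1" for y using \<theta>[of y] by (auto simp: \<kappa>_def)
  have [measurable]: "\<kappa> \<in> borel_measurable borel" unfolding \<kappa>_def by measurable
  have far: "d \<le> norm (x - y) \<and> d \<le> norm (x + h - y) \<and> d \<le> norm y"
    if x: "norm x < r + 2 * d" and y: "\<kappa> (y - h) \<noteq> 0 \<or> \<kappa> y \<noteq> 0" for x y
    using y
  proof
    assume "\<kappa> (y - h) \<noteq> 0"
    then have "r + 4 * d < norm (y - h)" using \<theta>1[of "y - h"] by (simp add: \<kappa>_def)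
    moreover have "norm (y - h) \<le> norm y + norm h" by (rule norm_triangle_ineq4)
    moreover have "norm (y - h) - norm x \<le> norm (x + h - y)"
      using norm_triangle_ineq2[of "y - h" x] norm_minus_commute[of "y - h" x] by (simp add: algebra_simps)
    moreover have "norm y - norm x \<le> norm (x - y)"
      using norm_triangle_ineq2[of y x] by (simp add: norm_minus_commute)
    ultimately show ?thesis using x r h by linarith
  next
    assume "\<kappa> y \<noteq> 0"
    then have "r + 4 * d < norm y" using \<theta>1[of y] by (simp add: \<kappa>_def)
    moreover have "norm y - norm (x + h) \<le> norm (x + h - y)"
      using norm_triangle_ineq2[of y "x + h"] by (simp add: norm_minus_commute)
    moreover have "norm (x + h) \<le> norm x + norm h" by (rule norm_triangle_ineq)
    moreover have "norm y - norm x \<le> norm (x - y)"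
      using norm_triangle_ineq2[of y x] by (simp add: norm_minus_commute)
    ultimately show ?thesis using x r h by linarith
  qed
  define G2 where "G2 = (\<lambda>(x, y). Jp p (u x - u y) * kern s p (x - y) * \<phi> x * (1 - \<theta> y))"
  define G1 where "G1 = (\<lambda>(x, y). Jp p (u x - u y) * kern s p (x - y) * \<psi> x * (1 - \<theta> (y - h)))"
  have G2i: "integrable ?M G2"
    unfolding G2_def \<kappa>_def [symmetric]
  proof (rule nonlocal_integrable[OF u s p r(2,3) \<phi>m _ \<phi>2 \<kappa>(3)])
    fix x y assume "\<phi> x \<noteq> 0" "\<kappa> y \<noteq> 0"
    then show "norm x < 1 \<and> d \<le> norm (x - y) \<and> d \<le> norm y"
      using far[of x y] \<phi>0[of x] r by auto
  qed measurable
  have G1i: "integrable ?M G1"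
    unfolding G1_def \<kappa>_def [symmetric]
  proof (rule nonlocal_integrable[OF u s p r(2,3) \<psi>m])
    fix x y assume "\<psi> x \<noteq> 0" "\<kappa> (y - h) \<noteq> 0"
    then show "norm x < 1 \<and> d \<le> norm (x - y) \<and> d \<le> norm y"
      using far[of "x - h" y] \<psi>0[of x] \<psi>z[of x] r by force
  qed (use \<phi>2 \<kappa>(3) in \<open>auto simp: \<psi>_def\<close>)
  define I1 where "I1 = integral\<^sup>L ?M G1"
  define I2 where "I2 = integral\<^sup>L ?M G2"
  have i2: "has_bochner_integral ?M (\<lambda>(x, y). Jp p (u x - u y) * (\<phi> x - \<phi> y) * kern s p (x - y) * (\<theta> x * \<theta> y)) (- 2 * I2)"
    unfolding I2_def G2_def
  proof (rule cutoff_identity[OF F2])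
    fix x assume "\<phi> x \<noteq> 0"
    then show "\<theta> x = 1" using \<phi>0[of x] \<theta>1[of x] r by force
  qed (use G2i in \<open>simp add: G2_def\<close>)
  have i1: "has_bochner_integral ?M (\<lambda>(x, y). Jp p (u x - u y) * (\<psi> x - \<psi> y) * kern s p (x - y) * (\<theta> (x - h) * \<theta> (y - h))) (- 2 * I1)"
    unfolding I1_def G1_def
  proof (rule cutoff_identity[OF F1])
    fix x assume "\<psi> x \<noteq> 0"
    then show "\<theta> (x - h) = 1" using \<psi>0[of x] \<theta>1[of "x - h"] r by force
  qed (use G1i in \<open>simp add: G1_def\<close>)
  define F where "F = (\<lambda>(x, y). (Jp p (u (x + h) - u (y + h)) - Jp p (u x - u y)) * (\<phi> x - \<phi> y) * kern s p (x - y) * (\<theta> x * \<theta> y))"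
  have "has_bochner_integral ?M (\<lambda>(x, y). Jp p (u (x + h) - u (y + h)) * (\<phi> x - \<phi> y) * kern s p (x - y) * (\<theta> x * \<theta> y)) (- 2 * I1)"
    using has_bochner_integral_pair_shift[OF i1, of h h] by (simp add: \<psi>_def)
  then have "has_bochner_integral ?M (\<lambda>z. (case z of (x, y) \<Rightarrow> Jp p (u (x + h) - u (y + h)) * (\<phi> x - \<phi> y) * kern s p (x - y) * (\<theta> x * \<theta> y))
       - (case z of (x, y) \<Rightarrow> Jp p (u x - u y) * (\<phi> x - \<phi> y) * kern s p (x - y) * (\<theta> x * \<theta> y))) (- 2 * I1 - (- 2 * I2))"
    by (intro has_bochner_integral_diff i2)
  then have Fi: "has_bochner_integral ?M F (- 2 * I1 - (- 2 * I2))"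
    by (simp add: F_def case_prod_beta' left_diff_distrib)
  \<comment> \<open>Translating the first variable alone aligns the two far parts at the same far point y.\<close>
  define G where "G = (\<lambda>(x, y). \<phi> x * (Jp p (u (x + h) - u y) * kern s p (x + h - y) * \<kappa> (y - h) - Jp p (u x - u y) * kern s p (x - y) * \<kappa> y))"
  have "has_bochner_integral ?M (\<lambda>(x, y). Jp p (u (x + h) - u y) * kern s p (x + h - y) * \<phi> x * (1 - \<theta> (y - h))) I1"
    using has_bochner_integral_pair_shift[OF has_bochner_integral_integrable[OF G1i], of h 0]
    by (simp add: G1_def \<psi>_def I1_def)
  then have "has_bochner_integral ?M (\<lambda>z. (case z of (x, y) \<Rightarrow> Jp p (u (x + h) - u y) * kern s p (x + h - y) * \<phi> x * (1 - \<theta> (y - h))) - G2 z) (I1 - I2)"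
    unfolding I2_def by (intro has_bochner_integral_diff has_bochner_integral_integrable G2i)
  then have Gi: "has_bochner_integral ?M G (I1 - I2)"
    by (simp add: G_def G2_def \<kappa>_def case_prod_beta' right_diff_distrib mult_ac)
  define a where "a = c4 * ((3 * V + 2) * A * t\<^sup>2) * (C1 / (1 - s))"
  have V0: "0 < V" by (simp add: V_def)
  have c40: "0 \<le> c4" unfolding c4_def using p r by (intro mult_nonneg_nonneg) auto
  have BV: "emeasure lborel B \<le> ennreal V"
  proof -
    have "emeasure lborel B \<le> emeasure lborel (ball (0::'a) 1)"
      using r by (intro emeasure_mono) (auto simp: B_def)
    then show ?thesis by (simp add: V_def emeasure_ball content_ball)
  qed
  have tt: "t powr (2 - p) * (A * t powr p) = A * t\<^sup>2"
  proof -
    have "t powr (2 - p) * t powr p = t powr 2" unfolding powr_add [symmetric] by simp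
    then show ?thesis using t by simp
  qed
  have wB: "(\<integral>\<^sup>+x. ennreal (\<bar>w x\<bar> powr p) * indicator B x \<partial>lborel) \<le> ennreal (A * t powr p)"
    using w by (simp add: w_def B_def)
  define g where "g = (\<lambda>x. ennreal (indicator B x * (\<bar>w x\<bar> * (\<bar>w x\<bar> + norm h))))"
  have [measurable]: "g \<in> borel_measurable borel" unfolding g_def by measurable
  have gle: "(\<integral>\<^sup>+x. g x \<partial>lborel) \<le> ennreal ((3 * V + 2) * A * t\<^sup>2)"
  proof -
    have "(\<integral>\<^sup>+x. g x \<partial>lborel) \<le> (\<integral>\<^sup>+x. ennreal (3 * t\<^sup>2) * indicator B x + ennreal (2 * t powr (2 - p)) * (ennreal (\<bar>w x\<bar> powr p) * indicator B x) \<partial>lborel)"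
    proof (rule nn_integral_mono)
      fix x
      have sq: "\<bar>w x\<bar>\<^sup>2 \<le> t\<^sup>2 + t powr (2 - p) * \<bar>w x\<bar> powr p" using t p by (intro sq_le_powr) auto
      have hh: "(norm h)\<^sup>2 \<le> t\<^sup>2" using t by (intro power_mono) auto
      have "2 * (\<bar>w x\<bar> * norm h) \<le> \<bar>w x\<bar>\<^sup>2 + (norm h)\<^sup>2" using zero_le_power2[of "\<bar>w x\<bar> - norm h"]
        by (simp add: power2_eq_square algebra_simps)
      moreover have "0 \<le> \<bar>w x\<bar> * norm h" by simp
      moreover have "\<bar>w x\<bar> * (\<bar>w x\<bar> + norm h) = \<bar>w x\<bar>\<^sup>2 + \<bar>w x\<bar> * norm h"
        by (simp add: power2_eq_square distrib_left)
      ultimately have "\<bar>w x\<bar> * (\<bar>w x\<bar> + norm h) \<le> 2 * \<bar>w x\<bar>\<^sup>2 + (norm h)\<^sup>2"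
        by linarith
      also have "\<dots> \<le> 3 * t\<^sup>2 + 2 * t powr (2 - p) * \<bar>w x\<bar> powr p" using sq hh by (simp add: mult.assoc)
      finally have "ennreal (\<bar>w x\<bar> * (\<bar>w x\<bar> + norm h)) \<le> ennreal (3 * t\<^sup>2 + 2 * t powr (2 - p) * \<bar>w x\<bar> powr p)"
        by (intro ennreal_leI)
      then show "g x \<le> ennreal (3 * t\<^sup>2) * indicator B x + ennreal (2 * t powr (2 - p)) * (ennreal (\<bar>w x\<bar> powr p) * indicator B x)"
        by (auto simp: g_def indicator_def ennreal_mult' [symmetric])
    qed
    also have "\<dots> = ennreal (3 * t\<^sup>2) * emeasure lborel B + ennreal (2 * t powr (2 - p)) * (\<integral>\<^sup>+x. ennreal (\<bar>w x\<bar> powr p) * indicator B x \<partial>lborel)"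
      by (simp add: nn_integral_add nn_integral_cmult nn_integral_cmult_indicator)
    also have "\<dots> \<le> ennreal (3 * t\<^sup>2) * ennreal V + ennreal (2 * t powr (2 - p)) * ennreal (A * t powr p)"
      by (intro add_mono mult_left_mono BV wB) auto
    also have "\<dots> = ennreal (3 * t\<^sup>2 * V + 2 * (t powr (2 - p) * (A * t powr p)))"
      using V0 A t by (simp add: ennreal_mult' [symmetric] mult_ac)
    also have "\<dots> \<le> ennreal ((3 * V + 2) * A * t\<^sup>2)"
    proof (rule ennreal_leI)
      have "3 * t\<^sup>2 * V * 1 \<le> 3 * t\<^sup>2 * V * A" using A V0 by (intro mult_left_mono) auto
      then show "3 * t\<^sup>2 * V + 2 * (t powr (2 - p) * (A * t powr p)) \<le> (3 * V + 2) * A * t\<^sup>2"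
        unfolding tt by (simp add: algebra_simps)
    qed
    finally show ?thesis .
  qed
  define v where "v = (\<lambda>y. ennreal ((1 + \<bar>u y\<bar>) powr (p - 1) * kern s p y) * indicator (- ball 0 d) y)"
  have [measurable]: "v \<in> borel_measurable borel" unfolding v_def by measurable
  have Ga: "ennreal \<bar>I1 - I2\<bar> \<le> ennreal a"
  proof -
    have "ennreal \<bar>I1 - I2\<bar> = ennreal (norm (integral\<^sup>L ?M G))"
      using Gi by (simp add: has_bochner_integral_integral_eq)
    also have "\<dots> \<le> (\<integral>\<^sup>+z. ennreal (norm (G z)) \<partial>?M)"
      using Gi by (intro integral_norm_bound_ennreal) (auto simp: has_bochner_integral_iff)
    also have "\<dots> \<le> (\<integral>\<^sup>+(x, y). ennreal c4 * g x * v y \<partial>?M)"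
    proof (rule nn_integral_mono)
      fix z :: "'a \<times> 'a"
      obtain x y where z: "z = (x, y)" by (cases z)
      have "ennreal (norm (G (x, y))) \<le> ennreal c4 * g x * v y"
      proof (cases "\<phi> x = 0")
        case False
        have x: "norm x < r + 2 * d" using \<phi>0[OF False] .
        then have xB: "x \<in> B" using r by (simp add: B_def)
        have "\<bar>\<kappa> y - \<kappa> z\<bar> \<le> norm (y - z) / d" for y z
          using cutoff_lipschitz[of "r + 4 * d" "r + 5 * d" z y] r
          by (simp add: \<kappa>_def \<theta>_def norm_minus_commute)
        then have "\<bar>Jp p (u (x + h) - u y) * kern s p (x + h - y) * \<kappa> (y - h) - Jp p (u x - u y) * kern s p (x - y) * \<kappa> y\<bar>
          \<le> c4 * (\<bar>u (x + h) - u x\<bar> + norm h) * ((1 + \<bar>u y\<bar>) powr (p - 1) * kern s p y * indicator (- ball 0 d) y)"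
          unfolding c4_def using Bh[OF xB] ub[of x] ub[of "x + h"] far[OF x] \<kappa>
          by (intro nonlocal_pointwise s p r) auto
        moreover have "\<bar>\<phi> x\<bar> \<le> \<bar>w x\<bar>"
          using \<eta>[of x] by (simp add: \<phi>_def abs_mult mult_left_le_one_le power_le_one)
        ultimately have "\<bar>G (x, y)\<bar> \<le> \<bar>w x\<bar> * (c4 * (\<bar>u (x + h) - u x\<bar> + norm h) * ((1 + \<bar>u y\<bar>) powr (p - 1) * kern s p y * indicator (- ball 0 d) y))"
          unfolding G_def prod.case abs_mult[of "\<phi> x"] by (intro mult_mono) auto
        then have "ennreal (norm (G (x, y))) \<le> ennreal (\<bar>w x\<bar> * (c4 * (\<bar>u (x + h) - u x\<bar> + norm h) * ((1 + \<bar>u y\<bar>) powr (p - 1) * kern s p y * indicator (- ball 0 d) y)))"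
          by (intro ennreal_leI) simp
        also have "\<dots> = ennreal c4 * g x * v y"
          using c40 xB by (auto simp: g_def v_def w_def indicator_def ennreal_mult' [symmetric] mult_ac)
        finally show ?thesis .
      qed (simp add: G_def)
      then show "ennreal (norm (G z)) \<le> (case z of (x, y) \<Rightarrow> ennreal c4 * g x * v y)" by (simp add: z)
    qed
    also have "\<dots> = (\<integral>\<^sup>+x. \<integral>\<^sup>+y. ennreal c4 * g x * v y \<partial>lborel \<partial>lborel)"
      by (subst lborel.nn_integral_fst [symmetric]) auto
    also have "\<dots> = ennreal c4 * (\<integral>\<^sup>+x. g x \<partial>lborel) * (\<integral>\<^sup>+y. v y \<partial>lborel)"
      by (simp add: nn_integral_cmult nn_integral_multc)
    also have "\<dots> \<le> ennreal c4 * ennreal ((3 * V + 2) * A * t\<^sup>2) * ennreal (C1 / (1 - s))"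
      using gle tail by (intro mult_mono) (auto simp: v_def)
    also have "\<dots> = ennreal a"
      using c40 V0 A C s by (simp add: a_def ennreal_mult' [symmetric])
    finally show ?thesis .
  qed
  have a0: "0 \<le> a" using c40 V0 A C s by (simp add: a_def)
  have Ia: "\<bar>I1 - I2\<bar> \<le> a" using Ga a0 by simp
  have Cq0: "0 \<le> Cq" by (simp add: Cq_def)
  define \<alpha> where "\<alpha> x y = \<bar>u (x + h) - u (y + h)\<bar> + \<bar>u x - u y\<bar>" for x y
  define \<beta> where "\<beta> x y = \<bar>\<eta> x - \<eta> y\<bar> * (\<bar>w x\<bar> + \<bar>w y\<bar>)" for x y
  \<comment> \<open>The splitting of powr_young with parameter t; \<beta> contains w, whose p-th power has an integral
    of order t powr p.\<close>
  define E where "E x y = t\<^sup>2 * \<alpha> x y powr p + t powr (2 - p) * \<beta> x y powr p" for x y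
  define Q where "Q = (\<lambda>(x, y). Cq * E x y * (indicator B x * indicator B y) * kern s p (x - y))"
  define B1 where "B1 = ball (0::'a) (r + d)"
  have [measurable]: "B1 \<in> sets borel" by (simp add: B1_def)
  define P where "P = (\<lambda>(x, y). 2 powr (- p) * (indicator B1 x * indicator B1 y * \<bar>w x - w y\<bar> powr p * kern s p (x - y)))"
  have E0: "0 \<le> E x y" for x y using t by (simp add: E_def)
  have PFQ: "P z \<le> F z + Q z" for z
  proof -
    obtain x y where z: "z = (x, y)" by (cases z)
    define L where "L = 2 powr (-1 - p) * ((\<eta> x)\<^sup>2 + (\<eta> y)\<^sup>2) * \<bar>w x - w y\<bar> powr p"
    have L0: "0 \<le> L" by (simp add: L_def)
    have "L \<le> (Jp p (u (x + h) - u (y + h)) - Jp p (u x - u y)) * ((\<eta> x)\<^sup>2 * w x - (\<eta> y)\<^sup>2 * w y)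
        + Cq * (\<alpha> x y powr (p - 2) * (\<beta> x y)\<^sup>2)"
      using energy_pointwise[OF p, of "u (x + h) - u (y + h)" "u x - u y" "w x" "w y" "\<eta> x" "\<eta> y"] \<eta>
      by (simp add: L_def Cq_def \<alpha>_def \<beta>_def w_def mult.assoc)
    also have "\<alpha> x y powr (p - 2) * (\<beta> x y)\<^sup>2 \<le> E x y"
      unfolding E_def using t p by (intro powr_young) (auto simp: \<alpha>_def \<beta>_def)
    finally have LE: "L \<le> (Jp p (u (x + h) - u (y + h)) - Jp p (u x - u y)) * (\<phi> x - \<phi> y) + Cq * E x y"
      using Cq0 by (simp add: \<phi>_def mult_left_mono)
    define k where "k = kern s p (x - y) * (\<theta> x * \<theta> y)"
    have k0: "0 \<le> k" using \<theta> by (simp add: k_def)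
    have "L * k \<le> ((Jp p (u (x + h) - u (y + h)) - Jp p (u x - u y)) * (\<phi> x - \<phi> y) + Cq * E x y) * k"
      using LE k0 by (rule mult_right_mono)
    also have "\<dots> = F (x, y) + Cq * E x y * k"
      by (simp add: F_def k_def algebra_simps)
    also have "Cq * E x y * k \<le> Q (x, y)"
    proof -
      have "\<theta> x * \<theta> y \<le> indicator B x * indicator B y"
      proof (cases "x \<in> B \<and> y \<in> B")
        case True
        then show ?thesis using \<theta>[of x] \<theta>[of y] by (simp add: mult_le_one)
      next
        case False
        then have "\<theta> x = 0 \<or> \<theta> y = 0" using \<theta>0[of x] \<theta>0[of y] by blast
        then show ?thesis by auto
      qed
      then have "Cq * E x y * (kern s p (x - y) * (\<theta> x * \<theta> y)) \<le> Cq * E x y * (kern s p (x - y) * (indicator B x * indicator B y))"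
        using Cq0 E0 by (intro mult_left_mono) auto
      then show ?thesis by (simp add: Q_def k_def mult_ac)
    qed
    finally have LFQ: "L * k \<le> F (x, y) + Q (x, y)" by simp
    have "P (x, y) \<le> L * k"
    proof (cases "x \<in> B1 \<and> y \<in> B1")
      case True
      then have "\<eta> x = 1" "\<eta> y = 1" "\<theta> x = 1" "\<theta> y = 1"
        using r by (auto simp: B1_def \<eta>_def \<theta>_def intro!: cutoff_eq_1)
      moreover have "2 powr (-1 - p) * 2 = (2::real) powr (- p)" by (simp add: powr_diff powr_minus inverse_eq_divide)
      ultimately show ?thesis using True by (simp add: P_def L_def k_def)
    next
      case False
      then have "P (x, y) = 0" by (auto simp: P_def)
      then show ?thesis using L0 k0 by simp
    qed
    with LFQ show ?thesis by (simp add: z)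
  qed
  define b where "b = Cq * t\<^sup>2 * (2 powr (p + 1) * (1 / (1 - s))) + Cq * t powr (2 - p) * (2 / d) powr p * (2 * (A * t powr p) * (C0 / (1 - s)))"
  have Qb: "(\<integral>\<^sup>+z. ennreal (Q z) \<partial>?M) \<le> ennreal b"
  proof -
    define f where "f = (\<lambda>(x, y). ennreal (indicator B x * indicator B y * (\<bar>u (x + h) - u (y + h)\<bar> + \<bar>u x - u y\<bar>) powr p * kern s p (x - y)))"
    define K where "K = (\<lambda>z::'a. ennreal (min 1 (norm z) powr p * kern s p z))"
    define W where "W = (\<lambda>x. ennreal (\<bar>w x\<bar> powr p) * indicator B x)"
    have [measurable]: "K \<in> borel_measurable borel" "W \<in> borel_measurable borel" "f \<in> borel_measurable ?M"
      unfolding K_def W_def f_def by measurable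
    have "(\<integral>\<^sup>+z. ennreal (Q z) \<partial>?M) \<le> (\<integral>\<^sup>+z. ennreal (Cq * t\<^sup>2) * f z
        + ennreal (Cq * t powr (2 - p) * (2 / d) powr p) * ((case z of (x, y) \<Rightarrow> W x * K (x - y)) + (case z of (x, y) \<Rightarrow> W y * K (x - y))) \<partial>?M)"
    proof (rule nn_integral_mono)
      fix z :: "'a \<times> 'a"
      obtain x y where z: "z = (x, y)" by (cases z)
      have "\<beta> x y \<le> min 1 (norm (x - y)) / d * (\<bar>w x\<bar> + \<bar>w y\<bar>)"
        unfolding \<beta>_def \<eta>_def using cutoff_lipschitz_min[of "r + d" "r + 2 * d" x y] r
        by (intro mult_right_mono) auto
      then have "\<beta> x y powr p \<le> (min 1 (norm (x - y)) / d * (\<bar>w x\<bar> + \<bar>w y\<bar>)) powr p"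
        using p by (intro powr_mono2) (auto simp: \<beta>_def)
      also have "\<dots> \<le> (2 * (min 1 (norm (x - y)) / d)) powr p * (\<bar>w x\<bar> powr p + \<bar>w y\<bar> powr p)"
        using r p by (intro powr_le_two_powr_sum) auto
      also have "2 * (min 1 (norm (x - y)) / d) = 2 / d * min 1 (norm (x - y))" by simp
      also have "(2 / d * min 1 (norm (x - y))) powr p = (2 / d) powr p * min 1 (norm (x - y)) powr p"
        by (simp only: powr_mult)
      finally have \<beta>le: "\<beta> x y powr p \<le> (2 / d) powr p * min 1 (norm (x - y)) powr p * (\<bar>w x\<bar> powr p + \<bar>w y\<bar> powr p)" .
      have "ennreal (Q (x, y)) \<le> ennreal (Cq * t\<^sup>2) * f (x, y)
        + ennreal (Cq * t powr (2 - p) * (2 / d) powr p) * (W x * K (x - y) + W y * K (x - y))"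
      proof (cases "x \<in> B \<and> y \<in> B")
        case True
        have "Q (x, y) = Cq * t\<^sup>2 * (\<alpha> x y powr p * kern s p (x - y)) + Cq * t powr (2 - p) * kern s p (x - y) * \<beta> x y powr p"
          using True by (simp add: Q_def E_def algebra_simps)
        also have "\<dots> \<le> Cq * t\<^sup>2 * (\<alpha> x y powr p * kern s p (x - y)) + Cq * t powr (2 - p) * kern s p (x - y) *
            ((2 / d) powr p * min 1 (norm (x - y)) powr p * (\<bar>w x\<bar> powr p + \<bar>w y\<bar> powr p))"
          using \<beta>le Cq0 by (intro add_left_mono mult_left_mono) auto
        also have "\<dots> = Cq * t\<^sup>2 * (\<alpha> x y powr p * kern s p (x - y)) + Cq * t powr (2 - p) * (2 / d) powr p *
            (\<bar>w x\<bar> powr p * (min 1 (norm (x - y)) powr p * kern s p (x - y)) + \<bar>w y\<bar> powr p * (min 1 (norm (x - y)) powr p * kern s p (x - y)))"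
          by (simp add: algebra_simps)
        finally have "ennreal (Q (x, y)) \<le> ennreal \<dots>" by (rule ennreal_leI)
        also have "\<dots> = ennreal (Cq * t\<^sup>2) * f (x, y)
            + ennreal (Cq * t powr (2 - p) * (2 / d) powr p) * (W x * K (x - y) + W y * K (x - y))"
          using True Cq0 unfolding f_def W_def K_def prod.case
          by (simp add: \<alpha>_def ennreal_mult' ennreal_plus)
        finally show ?thesis .
      qed (auto simp: Q_def)
      then show "ennreal (Q z) \<le> ennreal (Cq * t\<^sup>2) * f z
        + ennreal (Cq * t powr (2 - p) * (2 / d) powr p) * ((case z of (x, y) \<Rightarrow> W x * K (x - y)) + (case z of (x, y) \<Rightarrow> W y * K (x - y)))"
        by (simp add: z)
    qed
    also have "\<dots> = ennreal (Cq * t\<^sup>2) * (\<integral>\<^sup>+z. f z \<partial>?M) + ennreal (Cq * t powr (2 - p) * (2 / d) powr p) *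
        ((\<integral>\<^sup>+(x, y). W x * K (x - y) \<partial>?M) + (\<integral>\<^sup>+(x, y). W y * K (x - y) \<partial>?M))"
      by (simp add: nn_integral_add nn_integral_cmult)
    also have "(\<integral>\<^sup>+(x, y). W x * K (x - y) \<partial>?M) = (\<integral>\<^sup>+x. W x \<partial>lborel) * (\<integral>\<^sup>+z. K z \<partial>lborel)"
      by (rule nn_integral_convolution) measurable
    also have "(\<integral>\<^sup>+(x, y). W y * K (x - y) \<partial>?M) = (\<integral>\<^sup>+x. W x \<partial>lborel) * (\<integral>\<^sup>+z. K z \<partial>lborel)"
      by (rule nn_integral_convolution') (auto simp: K_def kern_minus)
    also have "ennreal (Cq * t\<^sup>2) * (\<integral>\<^sup>+z. f z \<partial>?M) + ennreal (Cq * t powr (2 - p) * (2 / d) powr p) *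
        ((\<integral>\<^sup>+x. W x \<partial>lborel) * (\<integral>\<^sup>+z. K z \<partial>lborel) + (\<integral>\<^sup>+x. W x \<partial>lborel) * (\<integral>\<^sup>+z. K z \<partial>lborel))
      \<le> ennreal (Cq * t\<^sup>2) * ennreal (2 powr (p + 1) * (1 / (1 - s))) + ennreal (Cq * t powr (2 - p) * (2 / d) powr p) *
        (ennreal (A * t powr p) * ennreal (C0 / (1 - s)) + ennreal (A * t powr p) * ennreal (C0 / (1 - s)))"
    proof (intro add_mono mult_left_mono mult_mono)
      have "gagliardo s p (ball 0 1) u \<le> ennreal (1 / (1 - s)) * 1"
        using u s by (intro ennreal_le_multD) (auto simp: unit_solution_def)
      then have "ennreal (2 powr (p + 1)) * gagliardo s p (ball 0 1) u \<le> ennreal (2 powr (p + 1)) * ennreal (1 / (1 - s))"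
        by (intro mult_left_mono) auto
      moreover have "(\<integral>\<^sup>+z. f z \<partial>?M) \<le> ennreal (2 powr (p + 1)) * gagliardo s p (ball 0 1) u"
        unfolding f_def using Bh p by (intro gagliardo_difference_le) auto
      ultimately show "(\<integral>\<^sup>+z. f z \<partial>?M) \<le> ennreal (2 powr (p + 1) * (1 / (1 - s)))"
        by (subst ennreal_mult') (auto intro: order_trans)
    qed (use wB kernel in \<open>auto simp: W_def K_def\<close>)
    also have "\<dots> = ennreal b"
      using A C s t Cq0 by (simp add: b_def ennreal_mult' [symmetric] ennreal_plus [symmetric] del: ennreal_plus)
    finally show ?thesis .
  qed
  have b0: "0 \<le> b" using A C s t Cq0 by (simp add: b_def)
  have [measurable]: "P \<in> borel_measurable ?M" "Q \<in> borel_measurable ?M"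
    unfolding P_def Q_def E_def \<alpha>_def \<beta>_def by measurable
  have "(\<integral>\<^sup>+z. ennreal (P z) \<partial>?M) \<le> ennreal (2 * a + b)"
  proof (rule nn_integral_le_signed)
    show "integrable ?M F" using Fi by (simp add: has_bochner_integral_iff)
    show "integral\<^sup>L ?M F \<le> 2 * a" using Fi Ia by (simp add: has_bochner_integral_integral_eq abs_le_iff)
    show "0 \<le> P z" "0 \<le> Q z" for z using Cq0 E0 by (auto simp: P_def Q_def split: prod.splits)
  qed (use a0 b0 Qb PFQ in auto)
  moreover have "(\<integral>\<^sup>+z. ennreal (P z) \<partial>?M) = ennreal (2 powr (- p)) * gagliardo s p B1 w"
    unfolding gagliardo_def by (subst nn_integral_cmult [symmetric]) (auto simp: P_def ennreal_mult' case_prod_beta')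
  ultimately have "gagliardo s p B1 w \<le> ennreal (1 / 2 powr (- p)) * ennreal (2 * a + b)"
    by (intro ennreal_le_multD) auto
  then have "ennreal (1 - s) * gagliardo s p B1 w \<le> ennreal (1 - s) * (ennreal (1 / 2 powr (- p)) * ennreal (2 * a + b))"
    by (intro mult_left_mono) auto
  also have "\<dots> = ennreal ((1 - s) * (1 / 2 powr (- p) * (2 * a + b)))"
    using s by (subst ennreal_mult', simp, subst ennreal_mult', simp, simp)
  also have "\<dots> \<le> ennreal (2 powr p * (2 * (c4 * (3 * V + 2) * C1) + Cq * (2 powr (p + 1) + (2 / d) powr p * 2 * C0)) * A * t\<^sup>2)"
  proof (rule ennreal_leI)
    have a1: "(1 - s) * (2 * a) = 2 * (c4 * (3 * V + 2) * C1) * A * t\<^sup>2" using s by (simp add: a_def)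
    have "(1 - s) * b = Cq * t\<^sup>2 * 2 powr (p + 1) + Cq * (2 / d) powr p * 2 * C0 * (t powr (2 - p) * (A * t powr p))"
      using s by (simp add: b_def distrib_left)
    also have "\<dots> = Cq * 2 powr (p + 1) * t\<^sup>2 * 1 + Cq * (2 / d) powr p * 2 * C0 * (A * t\<^sup>2)"
      unfolding tt by simp
    also have "\<dots> \<le> Cq * 2 powr (p + 1) * t\<^sup>2 * A + Cq * (2 / d) powr p * 2 * C0 * (A * t\<^sup>2)"
      using A Cq0 by (intro add_right_mono mult_left_mono) auto
    finally have "(1 - s) * (2 * a + b) \<le> 2 * (c4 * (3 * V + 2) * C1) * A * t\<^sup>2
       + (Cq * 2 powr (p + 1) * t\<^sup>2 * A + Cq * (2 / d) powr p * 2 * C0 * (A * t\<^sup>2))"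
      unfolding distrib_left[of "1 - s"] using a1 by linarith
    then have "2 powr p * ((1 - s) * (2 * a + b)) \<le> 2 powr p * (2 * (c4 * (3 * V + 2) * C1) * A * t\<^sup>2
       + (Cq * 2 powr (p + 1) * t\<^sup>2 * A + Cq * (2 / d) powr p * 2 * C0 * (A * t\<^sup>2)))"
      by (intro mult_left_mono) auto
    also have "2 powr p * (2 * (c4 * (3 * V + 2) * C1) * A * t\<^sup>2
       + (Cq * 2 powr (p + 1) * t\<^sup>2 * A + Cq * (2 / d) powr p * 2 * C0 * (A * t\<^sup>2)))
       = 2 powr p * (2 * (c4 * (3 * V + 2) * C1) + Cq * (2 powr (p + 1) + (2 / d) powr p * 2 * C0)) * A * t\<^sup>2"
    proof -
      have "k * (2 * Z * A * T + (Cq * x * T * A + Cq * y * 2 * C0 * (A * T))) = k * (2 * Z + Cq * (x + y * 2 * C0)) * A * T"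
        for k Z T x y :: real by (simp add: algebra_simps)
      then show ?thesis .
    qed
    also have "2 powr p * ((1 - s) * (2 * a + b)) = (1 - s) * (1 / 2 powr (- p) * (2 * a + b))"
      by (simp add: powr_minus inverse_eq_divide)
    finally show "(1 - s) * (1 / 2 powr (- p) * (2 * a + b)) \<le> 2 powr p * (2 * (c4 * (3 * V + 2) * C1) + Cq * (2 powr (p + 1) + (2 / d) powr p * 2 * C0)) * A * t\<^sup>2" .
  qed
  finally show ?thesis by (simp add: B1_def w_def)
qed

text \<open>
  The parameter \<open>t\<close> stands for the size \<open>norm h powr \<sigma>\<close> of the first differences, and \<open>norm h \<le> t\<close> expresses
  \<open>\<sigma> \<le> 1\<close> for \<open>norm h \<le> 1\<close>. A first difference of order \<open>t\<close> in \<open>L\<^sup>p\<close> has an energy of order \<open>t\<^sup>2\<close>, with the same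
  constant for all \<open>s \<ge> s0\<close>.
\<close>

lemma energy_estimate:
  fixes p s0 r d :: real
  assumes s0: "0 < s0" and p: "2 \<le> p" and r: "0 < r" "0 < d" "d \<le> 1" "r + 6 * d < 1"
  obtains C where "0 < C" "\<And>s (u :: 'a::euclidean_space \<Rightarrow> real) h t A.
     s0 \<le> s \<Longrightarrow> s < 1 \<Longrightarrow> unit_solution s p u \<Longrightarrow> norm h \<le> d \<Longrightarrow> 0 < t \<Longrightarrow> norm h \<le> t \<Longrightarrow> 1 \<le> A \<Longrightarrow>
     (\<integral>\<^sup>+x\<in>ball 0 (r + 5 * d). ennreal (\<bar>u (x + h) - u x\<bar> powr p) \<partial>lborel) \<le> ennreal (A * t powr p) \<Longrightarrow>
     ennreal (1 - s) * gagliardo s p (ball 0 (r + d)) (\<lambda>x. u (x + h) - u x) \<le> ennreal (C * A * t\<^sup>2)"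
proof -
  have p1: "1 \<le> p" using p by simp
  obtain C0 where C0: "0 < C0" "\<And>s. s0 \<le> s \<Longrightarrow> s < 1 \<Longrightarrow>
     (\<integral>\<^sup>+z. ennreal (min 1 (norm z) powr p * kern s p (z::'a)) \<partial>lborel) \<le> ennreal (C0 / (1 - s))"
    using kernel_integral[OF s0 p1, where 'a='a] by blast
  obtain C1 where C1: "0 < C1" "\<And>s (u :: 'a \<Rightarrow> real). s0 \<le> s \<Longrightarrow> s < 1 \<Longrightarrow> unit_solution s p u \<Longrightarrow>
     (\<integral>\<^sup>+y\<in>- ball 0 d. ennreal ((1 + \<bar>u y\<bar>) powr (p - 1) * kern s p y) \<partial>lborel) \<le> ennreal (C1 / (1 - s))"
    using tail_mass_bound[OF s0 p r(2,3), where 'a='a] by blast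
  define c4 where "c4 = (2 / d) powr (real DIM('a) + p) * ((p - 1) * 2 powr (p - 2) + 2 * (real DIM('a) + p) / d + 1 / d)"
  define Cq where "Cq = (p - 1)\<^sup>2 * 2 powr (p - 2)"
  define V where "V = measure lborel (ball (0::'a) 1)"
  define C where "C = 2 powr p * (2 * (c4 * (3 * V + 2) * C1) + Cq * (2 powr (p + 1) + (2 / d) powr p * 2 * C0))"
  have "0 \<le> c4" unfolding c4_def using p r by (intro mult_nonneg_nonneg) auto
  moreover have "0 < Cq" using p by (simp add: Cq_def)
  moreover have "0 < V" by (simp add: V_def)
  ultimately have "0 < C" unfolding C_def using C0(1) C1(1)
    by (intro mult_pos_pos add_nonneg_pos add_pos_nonneg) auto
  moreover have "ennreal (1 - s) * gagliardo s p (ball 0 (r + d)) (\<lambda>x. u (x + h) - u x) \<le> ennreal (C * A * t\<^sup>2)"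
    if "s0 \<le> s" "s < 1" "unit_solution s p u" "norm h \<le> d" "0 < t" "norm h \<le> t" "1 \<le> A"
     "(\<integral>\<^sup>+x\<in>ball 0 (r + 5 * d). ennreal (\<bar>u (x + h) - u x\<bar> powr p) \<partial>lborel) \<le> ennreal (A * t powr p)"
    for s h t A and u :: "'a \<Rightarrow> real"
    unfolding C_def c4_def Cq_def V_def
    using that s0 C0 C1 p r by (intro energy_estimate_explicit) auto
  ultimately show ?thesis using that by blast
qed

section \<open>First and second differences\<close>

definition diff1 :: "real \<Rightarrow> 'a::euclidean_space set \<Rightarrow> ('a \<Rightarrow> real) \<Rightarrow> 'a \<Rightarrow> ennreal" where
  "diff1 p B u h = (\<integral>\<^sup>+x\<in>B. ennreal (\<bar>u (x + h) - u x\<bar> powr p) \<partial>lborel)"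

definition diff2 :: "real \<Rightarrow> 'a::euclidean_space set \<Rightarrow> ('a \<Rightarrow> real) \<Rightarrow> 'a \<Rightarrow> ennreal" where
  "diff2 p B u h = (\<integral>\<^sup>+x\<in>B. ennreal (\<bar>u (x + 2 *\<^sub>R h) - 2 * u (x + h) + u x\<bar> powr p) \<partial>lborel)"

text \<open>
  The identity \<open>u (x + h) - u x = ((u (x + 2h) - u x) - (u (x + 2h) - 2 u (x + h) + u x)) / 2\<close>.
\<close>

lemma diff1_half_step:
  fixes u :: "'a::euclidean_space \<Rightarrow> real"
  assumes [measurable]: "u \<in> borel_measurable borel" "B \<in> sets borel" and p: "1 \<le> p" and ab: "0 < a" "0 < b"
    and d1: "diff1 p B u (2 *\<^sub>R h) \<le> ennreal (a powr p)" and d2: "diff2 p B u h \<le> ennreal (b powr p)"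
  shows "diff1 p B u h \<le> ennreal (((a + b) / 2) powr p)"
proof -
  have half: "(\<integral>\<^sup>+x. ennreal (\<bar>f x / 2 * indicator B x\<bar> powr p) \<partial>lborel) \<le> ennreal ((c / 2) powr p)"
    if [measurable]: "f \<in> borel_measurable borel" and c: "(\<integral>\<^sup>+x\<in>B. ennreal (\<bar>f x\<bar> powr p) \<partial>lborel) \<le> ennreal (c powr p)"
    for f c
  proof -
    have e: "ennreal (\<bar>f x / 2 * indicator B x\<bar> powr p) = ennreal ((1/2) powr p) * (ennreal (\<bar>f x\<bar> powr p) * indicator B x)" for x
    proof -
      have "(\<bar>f x\<bar> / 2) powr p = (1/2) powr p * \<bar>f x\<bar> powr p" using powr_mult[of "1/2" "\<bar>f x\<bar>" p] by simp
      then show ?thesis by (auto simp: indicator_def ennreal_mult')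
    qed
    have "(\<integral>\<^sup>+x. ennreal (\<bar>f x / 2 * indicator B x\<bar> powr p) \<partial>lborel) = ennreal ((1/2) powr p) * (\<integral>\<^sup>+x\<in>B. ennreal (\<bar>f x\<bar> powr p) \<partial>lborel)"
      unfolding e by (rule nn_integral_cmult) measurable
    also have "\<dots> \<le> ennreal ((1/2) powr p) * ennreal (c powr p)" by (intro mult_left_mono c) auto
    also have "\<dots> = ennreal ((c / 2) powr p)" using powr_mult[of "1/2" c p] by (simp add: ennreal_mult' [symmetric])
    finally show ?thesis .
  qed
  define f where "f x = (u (x + 2 *\<^sub>R h) - u x) / 2 * indicator B x" for x
  define g where "g x = (- (u (x + 2 *\<^sub>R h) - 2 * u (x + h) + u x)) / 2 * indicator B x" for x
  have [measurable]: "f \<in> borel_measurable borel" "g \<in> borel_measurable borel" unfolding f_def g_def by measurable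
  have "(\<integral>\<^sup>+x. ennreal (\<bar>f x + g x\<bar> powr p) \<partial>lborel) \<le> ennreal ((a / 2 + b / 2) powr p)"
  proof (rule powr_minkowski)
    show "(\<integral>\<^sup>+x. ennreal (\<bar>f x\<bar> powr p) \<partial>lborel) \<le> ennreal ((a / 2) powr p)"
      unfolding f_def using d1 by (intro half) (auto simp: diff1_def)
    have "\<bar>- (u (x + 2 *\<^sub>R h) - 2 * u (x + h) + u x)\<bar> = \<bar>u (x + 2 *\<^sub>R h) - 2 * u (x + h) + u x\<bar>" for x
      by (rule abs_minus_cancel)
    then show "(\<integral>\<^sup>+x. ennreal (\<bar>g x\<bar> powr p) \<partial>lborel) \<le> ennreal ((b / 2) powr p)"
      unfolding g_def using d2 by (intro half) (simp_all only: diff2_def, measurable)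
  qed (use ab p in auto)
  moreover have "diff1 p B u h = (\<integral>\<^sup>+x. ennreal (\<bar>f x + g x\<bar> powr p) \<partial>lborel)"
    unfolding diff1_def
    by (intro nn_integral_cong) (auto simp: f_def g_def indicator_def diff_divide_distrib add_divide_distrib algebra_simps)
  ultimately show ?thesis by (simp add: add_divide_distrib)
qed

text \<open>
  An inequality of Marchaud type. A bound \<open>b\<close> for first differences passes from the scale \<open>2 * t\<close> to the
  scale \<open>t\<close> by \<open>diff1_half_step\<close>, provided \<open>b\<close> satisfies the stated doubling inequality. The induction runs
  over the number of doublings that take \<open>h\<close> to a scale between \<open>\<delta> / 2\<close> and \<open>\<delta>\<close>.
\<close>

lemma marchaud:
  fixes u :: "'a::euclidean_space \<Rightarrow> real"
  assumes um: "u \<in> borel_measurable borel" "B \<in> sets borel" and p: "1 \<le> p" and K: "0 < K"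
    and d2: "\<And>h. h \<noteq> 0 \<Longrightarrow> norm h \<le> \<delta> \<Longrightarrow> diff2 p B u h \<le> ennreal ((K * norm h powr \<tau>) powr p)"
    and base: "\<And>h. \<delta> / 2 < norm h \<Longrightarrow> norm h \<le> \<delta> \<Longrightarrow> diff1 p B u h \<le> ennreal (b (norm h) powr p)"
    and b: "\<And>t. 0 < t \<Longrightarrow> t \<le> \<delta> \<Longrightarrow> 0 < b t"
      "\<And>t. 0 < t \<Longrightarrow> t \<le> \<delta> / 2 \<Longrightarrow> (b (2 * t) + K * t powr \<tau>) / 2 \<le> b t"
    and h: "h \<noteq> 0" "norm h \<le> \<delta>"
  shows "diff1 p B u h \<le> ennreal (b (norm h) powr p)"
proof -
  have d: "0 < \<delta>" using h by (smt (verit) zero_less_norm_iff)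
  have *: "diff1 p B u h \<le> ennreal (b (norm h) powr p)" if "h \<noteq> 0" "norm h \<le> \<delta>" "\<delta> < 2 ^ Suc n * norm h" for n h
    using that
  proof (induction n arbitrary: h)
    case 0
    then show ?case by (intro base) auto
  next
    case (Suc n)
    show ?case
    proof (cases "\<delta> / 2 < norm h")
      case True
      then show ?thesis using Suc by (intro base) auto
    next
      case False
      have h0: "0 < norm h" using Suc by simp
      have n2: "norm (2 *\<^sub>R h) = 2 * norm h" by simp
      have "diff1 p B u (2 *\<^sub>R h) \<le> ennreal (b (2 * norm h) powr p)"
        using Suc.IH[of "2 *\<^sub>R h"] Suc.prems False unfolding n2 by (simp add: mult.assoc)
      moreover have "diff2 p B u h \<le> ennreal ((K * norm h powr \<tau>) powr p)" using Suc.prems by (intro d2)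
      moreover have "0 < b (2 * norm h)" using b(1) h0 False by simp
      ultimately have "diff1 p B u h \<le> ennreal (((b (2 * norm h) + K * norm h powr \<tau>) / 2) powr p)"
        using um p K h0 by (intro diff1_half_step) auto
      also have "\<dots> \<le> ennreal (b (norm h) powr p)"
        using b(2)[of "norm h"] b(1)[of "2 * norm h"] h0 False p K
        by (intro ennreal_leI powr_mono2) (auto intro!: add_nonneg_nonneg less_imp_le)
      finally show ?thesis .
    qed
  qed
  obtain n where "\<delta> / norm h < 2 ^ n" using real_arch_pow[of 2 "\<delta> / norm h"] by auto
  then have "\<delta> < 2 ^ n * norm h" using h by (simp add: field_simps)
  also have "\<dots> \<le> 2 ^ Suc n * norm h" by simp
  finally show ?thesis using * h by blast
qed

lemma diff1_trivial:
  fixes u :: "'a::euclidean_space \<Rightarrow> real"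
  assumes [measurable]: "B \<in> sets borel" and ub: "\<And>x. x \<in> B \<Longrightarrow> \<bar>u x\<bar> \<le> 1 \<and> \<bar>u (x + h)\<bar> \<le> 1"
    and p: "1 \<le> p" and V: "emeasure lborel B \<le> ennreal V" "1 \<le> V"
  shows "diff1 p B u h \<le> ennreal ((2 * V) powr p)"
proof -
  have "diff1 p B u h \<le> (\<integral>\<^sup>+x. ennreal (2 powr p) * indicator B x \<partial>lborel)"
    unfolding diff1_def
  proof (rule nn_integral_mono)
    fix x
    have "\<bar>u (x + h) - u x\<bar> powr p \<le> 2 powr p" if "x \<in> B"
      using ub[OF that] p by (intro powr_mono2) auto
    then show "ennreal (\<bar>u (x + h) - u x\<bar> powr p) * indicator B x \<le> ennreal (2 powr p) * indicator B x"
      by (auto simp: indicator_def ennreal_leI)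
  qed
  also have "\<dots> = ennreal (2 powr p) * emeasure lborel B" by (rule nn_integral_cmult_indicator) simp
  also have "\<dots> \<le> ennreal (2 powr p) * ennreal V" by (intro mult_left_mono V) auto
  also have "\<dots> = ennreal (2 powr p * V)" by (simp add: ennreal_mult')
  also have "\<dots> \<le> ennreal (2 powr p * V powr p)"
    using V p powr_mono[of 1 p V] by (intro ennreal_leI mult_left_mono) auto
  finally show ?thesis by (simp only: powr_mult)
qed

text \<open>
  The choice \<open>b t = C * t powr \<tau>\<close> satisfies the doubling inequality when \<open>K \<le> C * (2 - 2 powr \<tau>)\<close>, which a large
  \<open>C\<close> achieves for \<open>\<tau> < 1\<close>.
\<close>

lemma marchaud_sublinear:
  fixes \<tau> K \<delta> V p :: real
  assumes t: "0 < \<tau>" "\<tau> < 1" and K: "0 < K" and d: "0 < \<delta>" and V: "1 \<le> V" and p: "1 \<le> p"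
  obtains C where "0 < C" "\<And>(u::'a::euclidean_space \<Rightarrow> real) B h. u \<in> borel_measurable borel \<Longrightarrow> B \<in> sets borel \<Longrightarrow>
    emeasure lborel B \<le> ennreal V \<Longrightarrow> (\<And>x h. x \<in> B \<Longrightarrow> norm h \<le> \<delta> \<Longrightarrow> \<bar>u (x + h)\<bar> \<le> 1) \<Longrightarrow>
    (\<And>h. h \<noteq> 0 \<Longrightarrow> norm h \<le> \<delta> \<Longrightarrow> diff2 p B u h \<le> ennreal ((K * norm h powr \<tau>) powr p)) \<Longrightarrow>
    h \<noteq> 0 \<Longrightarrow> norm h \<le> \<delta> \<Longrightarrow> diff1 p B u h \<le> ennreal ((C * norm h powr \<tau>) powr p)"
proof -
  have t2: "2 powr \<tau> < (2::real)" using powr_less_mono[of \<tau> 1 2] t by simp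
  define C where "C = K / (2 - 2 powr \<tau>) + 2 * V / (\<delta> / 2) powr \<tau>"
  have C: "0 < C" using K t2 V d by (simp add: C_def add_pos_pos)
  have CK: "K \<le> C * (2 - 2 powr \<tau>)"
  proof -
    have "K = K / (2 - 2 powr \<tau>) * (2 - 2 powr \<tau>)" using t2 by simp
    also have "\<dots> \<le> C * (2 - 2 powr \<tau>)" unfolding C_def using t2 V d by (intro mult_right_mono) auto
    finally show ?thesis .
  qed
  have CV: "2 * V \<le> C * s powr \<tau>" if "\<delta> / 2 < s" for s
  proof -
    have "2 * V = 2 * V / (\<delta> / 2) powr \<tau> * (\<delta> / 2) powr \<tau>" using d by simp
    also have "\<dots> \<le> C * (\<delta> / 2) powr \<tau>" unfolding C_def using K t2 d by (intro mult_right_mono) auto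
    also have "\<dots> \<le> C * s powr \<tau>" using that C d t by (intro mult_left_mono powr_mono2) auto
    finally show ?thesis .
  qed
  have "diff1 p B u h \<le> ennreal ((C * norm h powr \<tau>) powr p)"
    if um: "u \<in> borel_measurable borel" "B \<in> sets borel" and BV: "emeasure lborel B \<le> ennreal V"
      and ub: "\<And>x h. x \<in> B \<Longrightarrow> norm h \<le> \<delta> \<Longrightarrow> \<bar>u (x + h)\<bar> \<le> 1"
      and d2: "\<And>h. h \<noteq> 0 \<Longrightarrow> norm h \<le> \<delta> \<Longrightarrow> diff2 p B u h \<le> ennreal ((K * norm h powr \<tau>) powr p)"
      and h: "h \<noteq> 0" "norm h \<le> \<delta>" for u :: "'a \<Rightarrow> real" and B h
  proof (rule marchaud[OF um p K d2, where b = "\<lambda>t. C * t powr \<tau>"])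
    fix h :: 'a assume h: "\<delta> / 2 < norm h" "norm h \<le> \<delta>"
    have "diff1 p B u h \<le> ennreal ((2 * V) powr p)"
    proof (rule diff1_trivial[OF um(2) _ p BV V])
      fix x assume "x \<in> B"
      then show "\<bar>u x\<bar> \<le> 1 \<and> \<bar>u (x + h)\<bar> \<le> 1" using ub[of x 0] ub[of x h] h d by simp
    qed
    also have "\<dots> \<le> ennreal ((C * norm h powr \<tau>) powr p)"
      using CV[OF h(1)] V p by (intro ennreal_leI powr_mono2) auto
    finally show "diff1 p B u h \<le> ennreal ((C * norm h powr \<tau>) powr p)" .
  next
    fix t :: real assume t: "0 < t" "t \<le> \<delta> / 2"
    have "(C * (2 * t) powr \<tau> + K * t powr \<tau>) = (C * 2 powr \<tau> + K) * t powr \<tau>"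
      by (simp add: powr_mult algebra_simps)
    also have "\<dots> \<le> (C * 2) * t powr \<tau>" using CK by (intro mult_right_mono) (auto simp: algebra_simps)
    finally show "(C * (2 * t) powr \<tau> + K * t powr \<tau>) / 2 \<le> C * t powr \<tau>" by simp
  qed (use C h in auto)
  with C show ?thesis using that by blast
qed

text \<open>
  A linear \<open>b\<close> satisfies the doubling inequality only without the second differences. The corrected
  bound \<open>b t = C * t - C2 * t powr \<tau>\<close> has room for them: halving \<open>b (2 * t)\<close> preserves the linear term and lowers
  the rest by \<open>C2 * (2 powr \<tau> - 2) * t powr \<tau> / 2\<close>, which equals \<open>K * t powr \<tau> / 2\<close> for the \<open>C2\<close> chosen.
\<close>

lemma marchaud_superlinear:
  fixes \<tau> K \<delta> V p :: real
  assumes t: "1 < \<tau>" and K: "0 < K" and d: "0 < \<delta>" "\<delta> \<le> 1" and V: "1 \<le> V" and p: "1 \<le> p"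
  obtains C where "0 < C" "\<And>(u::'a::euclidean_space \<Rightarrow> real) B h. u \<in> borel_measurable borel \<Longrightarrow> B \<in> sets borel \<Longrightarrow>
    emeasure lborel B \<le> ennreal V \<Longrightarrow> (\<And>x h. x \<in> B \<Longrightarrow> norm h \<le> \<delta> \<Longrightarrow> \<bar>u (x + h)\<bar> \<le> 1) \<Longrightarrow>
    (\<And>h. h \<noteq> 0 \<Longrightarrow> norm h \<le> \<delta> \<Longrightarrow> diff2 p B u h \<le> ennreal ((K * norm h powr \<tau>) powr p)) \<Longrightarrow>
    h \<noteq> 0 \<Longrightarrow> norm h \<le> \<delta> \<Longrightarrow> diff1 p B u h \<le> ennreal ((C * norm h) powr p)"
proof -
  have t2: "(2::real) < 2 powr \<tau>" using powr_less_mono[of 1 \<tau> 2] t by simp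
  define C2 where "C2 = K / (2 powr \<tau> - 2)"
  have C2: "0 < C2" using K t2 by (simp add: C2_def)
  define C where "C = C2 + 4 * V / \<delta>"
  have C: "0 < C" using C2 V d by (simp add: C_def add_pos_pos)
  define b where "b t = C * t - C2 * t powr \<tau>" for t
  have blow: "4 * V / \<delta> * t \<le> b t" if "0 < t" "t \<le> \<delta>" for t
  proof -
    have "t powr \<tau> \<le> t powr 1" using that d t by (intro powr_mono') auto
    then have "C2 * t powr \<tau> \<le> C2 * t" using that C2 by simp
    then show ?thesis by (simp add: b_def C_def algebra_simps)
  qed
  have bpos: "0 < b t" if "0 < t" "t \<le> \<delta>" for t
  proof -
    have "0 < 4 * V / \<delta> * t" using that V by simp
    with blow[OF that] show ?thesis by linarith
  qed
  have "diff1 p B u h \<le> ennreal ((C * norm h) powr p)"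
    if um: "u \<in> borel_measurable borel" "B \<in> sets borel" and BV: "emeasure lborel B \<le> ennreal V"
      and ub: "\<And>x h. x \<in> B \<Longrightarrow> norm h \<le> \<delta> \<Longrightarrow> \<bar>u (x + h)\<bar> \<le> 1"
      and d2: "\<And>h. h \<noteq> 0 \<Longrightarrow> norm h \<le> \<delta> \<Longrightarrow> diff2 p B u h \<le> ennreal ((K * norm h powr \<tau>) powr p)"
      and h: "h \<noteq> 0" "norm h \<le> \<delta>" for u :: "'a \<Rightarrow> real" and B h
  proof -
    have "diff1 p B u h \<le> ennreal (b (norm h) powr p)"
    proof (rule marchaud[OF um p K d2])
      fix h :: 'a assume h: "\<delta> / 2 < norm h" "norm h \<le> \<delta>"
      have "diff1 p B u h \<le> ennreal ((2 * V) powr p)"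
      proof (rule diff1_trivial[OF um(2) _ p BV V])
        fix x assume "x \<in> B"
        then show "\<bar>u x\<bar> \<le> 1 \<and> \<bar>u (x + h)\<bar> \<le> 1" using ub[of x 0] ub[of x h] h d by simp
      qed
      also have "\<dots> \<le> ennreal (b (norm h) powr p)"
      proof (intro ennreal_leI powr_mono2)
        have "2 * V = 4 * V / \<delta> * (\<delta> / 2)" using d by simp
        also have "\<dots> \<le> 4 * V / \<delta> * norm h" using h V d by (intro mult_left_mono) auto
        also have "\<dots> \<le> b (norm h)" using h d by (intro blow) auto
        finally show "2 * V \<le> b (norm h)" .
      qed (use p V in auto)
      finally show "diff1 p B u h \<le> ennreal (b (norm h) powr p)" .
    next
      fix t :: real assume t: "0 < t" "t \<le> \<delta> / 2"
      have "K = C2 * (2 powr \<tau> - 2)" using t2 by (simp add: C2_def)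
      then have "C2 * 2 powr \<tau> - K = 2 * C2" by (simp add: algebra_simps)
      moreover have "b (2 * t) + K * t powr \<tau> = 2 * C * t - (C2 * 2 powr \<tau> - K) * t powr \<tau>"
        by (simp add: b_def powr_mult algebra_simps)
      ultimately have "b (2 * t) + K * t powr \<tau> = 2 * b t"
        by (simp add: b_def)
      then show "(b (2 * t) + K * t powr \<tau>) / 2 \<le> b t" by simp
    qed (use h bpos in auto)
    also have "\<dots> \<le> ennreal ((C * norm h) powr p)"
      using bpos[of "norm h"] h C2 p by (intro ennreal_leI powr_mono2) (auto simp: b_def)
    finally show ?thesis .
  qed
  with C show ?thesis using that by blast
qed

section \<open>Iteration of the energy estimate\<close>

type_synonym 'a difference_mass = "real \<Rightarrow> 'a set \<Rightarrow> ('a \<Rightarrow> real) \<Rightarrow> 'a \<Rightarrow> ennreal"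

text \<open>
  Normalised solutions have differences of size \<open>norm h powr \<sigma>\<close> in \<open>L\<^sup>p\<close> on all smaller balls, uniformly in the
  solution and in \<open>s \<ge> s0\<close>. Quantifying over all radii allows each step of the iteration to shrink the ball.
  As \<open>D\<close> is the \<open>p\<close>-th power of a norm, the right-hand side is a \<open>p\<close>-th power as well.
\<close>

definition difference_rate :: "'a::euclidean_space difference_mass \<Rightarrow> real \<Rightarrow> real \<Rightarrow> real \<Rightarrow> bool" where
  "difference_rate D p s0 \<sigma> \<longleftrightarrow> (\<forall>r. 0 < r \<and> r < 1 \<longrightarrow> (\<exists>A \<delta>. 1 \<le> A \<and> 0 < \<delta> \<and>
     (\<forall>s u h. s0 \<le> s \<and> s < 1 \<and> unit_solution s p u \<and> h \<noteq> 0 \<and> norm h \<le> \<delta> \<longrightarrow>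
        D p (ball 0 r) u h \<le> ennreal ((A * norm h powr \<sigma>) powr p))))"

lemma difference_rateD:
  fixes D :: "'a::euclidean_space difference_mass"
  assumes "difference_rate D p s0 \<sigma>" "0 < r" "r < 1"
  obtains A \<delta> where "1 \<le> A" "0 < \<delta>" "\<And>s u h. s0 \<le> s \<Longrightarrow> s < 1 \<Longrightarrow> unit_solution s p u \<Longrightarrow> h \<noteq> 0 \<Longrightarrow> norm h \<le> \<delta> \<Longrightarrow>
        D p (ball 0 r) u h \<le> ennreal ((A * norm h powr \<sigma>) powr p)"
proof -
  have "\<exists>A \<delta>. 1 \<le> A \<and> 0 < \<delta> \<and>
     (\<forall>s u h. s0 \<le> s \<and> s < 1 \<and> unit_solution s p u \<and> h \<noteq> 0 \<and> norm h \<le> \<delta> \<longrightarrow>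
        D p (ball 0 r) u h \<le> ennreal ((A * norm h powr \<sigma>) powr p))"
    using assms(1)[unfolded difference_rate_def, rule_format, of r] assms(2,3) by auto
  then show ?thesis using that by (elim exE conjE) simp
qed

lemma difference_rateI:
  fixes D :: "'a::euclidean_space difference_mass"
  assumes "\<And>r. 0 < r \<Longrightarrow> r < 1 \<Longrightarrow> \<exists>A \<delta>. 1 \<le> A \<and> 0 < \<delta> \<and>
     (\<forall>s u h. s0 \<le> s \<longrightarrow> s < 1 \<longrightarrow> unit_solution s p u \<longrightarrow> h \<noteq> 0 \<longrightarrow> norm h \<le> \<delta> \<longrightarrow>
        D p (ball 0 r) u h \<le> ennreal ((A * norm h powr \<sigma>) powr p))"
  shows "difference_rate D p s0 \<sigma>"
  unfolding difference_rate_def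
proof (intro allI impI)
  fix r :: real assume "0 < r \<and> r < 1"
  then show "\<exists>A \<delta>. 1 \<le> A \<and> 0 < \<delta> \<and>
     (\<forall>s u h. s0 \<le> s \<and> s < 1 \<and> unit_solution s p u \<and> h \<noteq> 0 \<and> norm h \<le> \<delta> \<longrightarrow>
        D p (ball 0 r) u h \<le> ennreal ((A * norm h powr \<sigma>) powr p))"
    using assms[of r] by (elim conjE exE) blast
qed

lemma difference_rate_mono:
  fixes D :: "'a::euclidean_space difference_mass"
  assumes rate: "difference_rate D p s0 \<tau>" and le: "\<tau>' \<le> \<tau>" and p: "0 \<le> p"
  shows "difference_rate D p s0 \<tau>'"
proof (rule difference_rateI)
  fix r :: real assume r: "0 < r" "r < 1"
  from difference_rateD[OF rate r]
  obtain A \<delta> where A: "1 \<le> A" "0 < \<delta>" and H: "\<And>s u h. s0 \<le> s \<Longrightarrow> s < 1 \<Longrightarrow> unit_solution s p u \<Longrightarrow> h \<noteq> 0 \<Longrightarrow> norm h \<le> \<delta> \<Longrightarrow>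
        D p (ball 0 r) u h \<le> ennreal ((A * norm h powr \<tau>) powr p)"
    by blast
  have "D p (ball 0 r) u h \<le> ennreal ((A * norm h powr \<tau>') powr p)"
    if a: "s0 \<le> s" "s < 1" "unit_solution s p u" "h \<noteq> 0" "norm h \<le> min 1 \<delta>" for s u h
  proof -
    have "D p (ball 0 r) u h \<le> ennreal ((A * norm h powr \<tau>) powr p)" using a by (intro H[of s]) auto
    also have "\<dots> \<le> ennreal ((A * norm h powr \<tau>') powr p)"
      using a A le p by (intro ennreal_leI powr_mono2 mult_left_mono powr_mono') auto
    finally show ?thesis .
  qed
  moreover have "0 < min 1 \<delta>" using A by simp
  ultimately show "\<exists>A \<delta>. 1 \<le> A \<and> 0 < \<delta> \<and>
     (\<forall>s u h. s0 \<le> s \<longrightarrow> s < 1 \<longrightarrow> unit_solution s p u \<longrightarrow> h \<noteq> 0 \<longrightarrow> norm h \<le> \<delta> \<longrightarrow>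
        D p (ball 0 r) u h \<le> ennreal ((A * norm h powr \<tau>') powr p))"
    using A(1) by blast
qed

text \<open>
  The constant of \<open>gagliardo_imp_difference\<close>, enlarged to be at least 1 so that its \<open>p\<close>-th power is no
  smaller than itself.
\<close>

definition emb_const :: "'a::euclidean_space itself \<Rightarrow> real \<Rightarrow> real" where
  "emb_const _ p = 1 + 2 powr (p + 2) * p * 4 ^ DIM('a) / measure lborel (ball (0::'a) 1)"

lemma emb_const_ge_1: "0 \<le> p \<Longrightarrow> 1 \<le> emb_const TYPE('a::euclidean_space) p"
  unfolding emb_const_def by simp

lemma gagliardo_imp_diff1:
  fixes w :: "'a::euclidean_space \<Rightarrow> real"
  assumes "w \<in> borel_measurable borel" and p: "1 \<le> p"
    and s: "0 < s" "s < 1" and h: "h \<noteq> 0" and r: "0 < r" "r + norm h \<le> \<rho>"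
    and b: "ennreal (1 - s) * gagliardo s p (ball 0 \<rho>) w \<le> ennreal b"
  shows "diff1 p (ball 0 r) w h \<le> ennreal (emb_const TYPE('a) p * norm h powr (s * p) * b)"
proof -
  define c where "c = 2 powr (p + 2) * p * 4 ^ DIM('a) / measure lborel (ball (0::'a) 1)"
  have c: "0 \<le> c" "c \<le> emb_const TYPE('a) p" using p by (auto simp: c_def emb_const_def)
  have "diff1 p (ball 0 r) w h \<le> ennreal (c * norm h powr (s * p) * (1 - s)) * gagliardo s p (ball 0 \<rho>) w"
    unfolding diff1_def c_def using assms by (intro gagliardo_imp_difference) auto
  also have "\<dots> = ennreal (c * norm h powr (s * p)) * (ennreal (1 - s) * gagliardo s p (ball 0 \<rho>) w)"
    using c s by (simp add: ennreal_mult' mult.assoc)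
  also have "\<dots> \<le> ennreal (emb_const TYPE('a) p * norm h powr (s * p)) * ennreal b"
    using c by (intro mult_mono b ennreal_leI mult_right_mono) auto
  also have "\<dots> = ennreal (emb_const TYPE('a) p * norm h powr (s * p) * b)"
    using c by (subst ennreal_mult') auto
  finally show ?thesis .
qed

text \<open>
  The starting point: the normalisation bounds the energy of \<open>u\<close>, which gives the rate \<open>s\<close>, hence \<open>s0\<close>.
\<close>

lemma first_difference_rate_initial:
  assumes s0: "0 < s0" and p: "2 \<le> p"
  shows "difference_rate (diff1 :: 'a::euclidean_space difference_mass) p s0 s0"
proof (rule difference_rateI)
  fix r :: real assume r: "0 < r" "r < 1"
  define E where "E = emb_const TYPE('a) p"
  have E: "1 \<le> E" using p by (simp add: E_def emb_const_ge_1)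
  show "\<exists>A \<delta>. 1 \<le> A \<and> 0 < \<delta> \<and>
     (\<forall>s (u :: 'a \<Rightarrow> real) h. s0 \<le> s \<longrightarrow> s < 1 \<longrightarrow> unit_solution s p u \<longrightarrow> h \<noteq> 0 \<longrightarrow> norm h \<le> \<delta> \<longrightarrow>
        diff1 p (ball 0 r) u h \<le> ennreal ((A * norm h powr s0) powr p))"
  proof (rule exI[of _ E], rule exI[of _ "1 - r"], intro conjI allI impI)
    fix s :: real and h :: 'a and u :: "'a \<Rightarrow> real"
    assume a: "s0 \<le> s" "s < 1" "unit_solution s p u" "h \<noteq> 0" "norm h \<le> 1 - r"
    have "diff1 p (ball 0 r) u h \<le> ennreal (E * norm h powr (s * p) * 1)"
      unfolding E_def using a r s0 p by (intro gagliardo_imp_diff1[of u p s h r 1]) (auto simp: unit_solution_def)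
    also have "\<dots> \<le> ennreal ((E * norm h powr s0) powr p)"
    proof (rule ennreal_leI)
      have "E * norm h powr (s * p) \<le> E powr p * norm h powr (s0 * p)"
      proof (intro mult_mono)
        show "E \<le> E powr p" using E p powr_mono[of 1 p E] by simp
        show "norm h powr (s * p) \<le> norm h powr (s0 * p)" using a r p by (intro powr_mono') (auto intro: mult_right_mono)
      qed (use E in auto)
      then show "E * norm h powr (s * p) * 1 \<le> (E * norm h powr s0) powr p"
        by (simp add: powr_mult powr_powr)
    qed
    finally show "diff1 p (ball 0 r) u h \<le> ennreal ((E * norm h powr s0) powr p)" .
  qed (use E r in auto)
qed

text \<open>
  The energy estimate bounds the energy of \<open>d\<^sub>h u\<close> by \<open>norm h powr (2 * \<sigma>)\<close>, and the embedding, applied to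
  \<open>d\<^sub>h u\<close> with the same increment \<open>h\<close>, adds \<open>norm h powr (s * p)\<close>. Taking \<open>p\<close>-th roots gives the exponent.
\<close>

lemma second_difference_rate_of_first:
  assumes s0: "0 < s0" and p: "2 \<le> p" and \<sigma>: "0 < \<sigma>" "\<sigma> \<le> 1"
    and rate: "difference_rate (diff1 :: 'a::euclidean_space difference_mass) p s0 \<sigma>"
  shows "difference_rate (diff2 :: 'a difference_mass) p s0 (s0 + 2 * \<sigma> / p)"
proof (rule difference_rateI)
  fix r :: real assume r: "0 < r" "r < 1"
  \<comment> \<open>The energy estimate uses six annuli of width d between the radii r and 1.\<close>
  define d where "d = (1 - r) / 8"
  have "8 * d = 1 - r" by (simp add: d_def)
  then have d: "0 < d" "d \<le> 1" "r + 6 * d < 1" using r by linarith+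
  have r5: "0 < r + 5 * d" "r + 5 * d < 1" using r d by auto
  obtain A \<delta> where A: "1 \<le> A" "0 < \<delta>" and H: "\<And>s (u :: 'a \<Rightarrow> real) h. s0 \<le> s \<Longrightarrow> s < 1 \<Longrightarrow> unit_solution s p u \<Longrightarrow> h \<noteq> 0 \<Longrightarrow> norm h \<le> \<delta> \<Longrightarrow>
        diff1 p (ball 0 (r + 5 * d)) u h \<le> ennreal ((A * norm h powr \<sigma>) powr p)"
    using difference_rateD[OF rate r5] by metis
  from energy_estimate[OF s0 p r(1) d, where 'a='a]
  obtain C where C: "0 < C" and EE: "\<And>s (u :: 'a \<Rightarrow> real) h t A.
     s0 \<le> s \<Longrightarrow> s < 1 \<Longrightarrow> unit_solution s p u \<Longrightarrow> norm h \<le> d \<Longrightarrow> 0 < t \<Longrightarrow> norm h \<le> t \<Longrightarrow> 1 \<le> A \<Longrightarrow>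
     (\<integral>\<^sup>+x\<in>ball 0 (r + 5 * d). ennreal (\<bar>u (x + h) - u x\<bar> powr p) \<partial>lborel) \<le> ennreal (A * t powr p) \<Longrightarrow>
     ennreal (1 - s) * gagliardo s p (ball 0 (r + d)) (\<lambda>x. u (x + h) - u x) \<le> ennreal (C * A * t\<^sup>2)"
    by blast
  define E where "E = emb_const TYPE('a) p"
  have E: "1 \<le> E" using p by (simp add: E_def emb_const_ge_1)
  define A' where "A' = 1 + E * (C * A powr p)"
  have A': "1 \<le> A'" using E C by (simp add: A'_def)
  show "\<exists>A \<delta>. 1 \<le> A \<and> 0 < \<delta> \<and>
     (\<forall>s (u :: 'a \<Rightarrow> real) h. s0 \<le> s \<longrightarrow> s < 1 \<longrightarrow> unit_solution s p u \<longrightarrow> h \<noteq> 0 \<longrightarrow> norm h \<le> \<delta> \<longrightarrow>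
        diff2 p (ball 0 r) u h \<le> ennreal ((A * norm h powr (s0 + 2 * \<sigma> / p)) powr p))"
  proof (rule exI[of _ A'], rule exI[of _ "min \<delta> d"], intro conjI allI impI)
    fix s :: real and h :: 'a and u :: "'a \<Rightarrow> real"
    assume a: "s0 \<le> s" "s < 1" "unit_solution s p u" "h \<noteq> 0" "norm h \<le> min \<delta> d"
    then have um [measurable]: "u \<in> borel_measurable borel" by (simp add: unit_solution_def)
    define t where "t = norm h powr \<sigma>"
    have h: "0 < norm h" "norm h \<le> 1" using a d by auto
    have t: "0 < t" "norm h \<le> t"
      using h \<sigma> powr_mono'[of \<sigma> 1 "norm h"] by (auto simp: t_def)
    define w where "w = (\<lambda>x. u (x + h) - u x)"
    have wm: "w \<in> borel_measurable borel" unfolding w_def by measurable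
    have "diff1 p (ball 0 (r + 5 * d)) u h \<le> ennreal (A powr p * t powr p)"
      using H[of s u h] a by (simp add: t_def powr_mult)
    then have en: "ennreal (1 - s) * gagliardo s p (ball 0 (r + d)) w \<le> ennreal (C * A powr p * t\<^sup>2)"
      unfolding w_def diff1_def using a t A p by (intro EE) (auto intro!: ge_one_powr_ge_zero)
    have "diff1 p (ball 0 r) w h \<le> ennreal (E * norm h powr (s * p) * (C * A powr p * t\<^sup>2))"
      unfolding E_def using a r s0 p by (intro gagliardo_imp_diff1[OF wm _ _ _ _ _ _ en]) auto
    also have "diff1 p (ball 0 r) w h = diff2 p (ball 0 r) u h"
      unfolding diff1_def diff2_def w_def by (simp add: scaleR_2 add.assoc diff_diff_eq2 algebra_simps)
    also have "ennreal (E * norm h powr (s * p) * (C * A powr p * t\<^sup>2)) \<le> ennreal ((A' * norm h powr (s0 + 2 * \<sigma> / p)) powr p)"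
    proof (rule ennreal_leI)
      have t2: "t\<^sup>2 = norm h powr (2 * \<sigma>)"
        using t h by (simp add: t_def powr_powr flip: powr_numeral) (simp add: mult.commute)
      have "E * norm h powr (s * p) * (C * A powr p * t\<^sup>2) \<le> E * norm h powr (s0 * p) * (C * A powr p * t\<^sup>2)"
        using E C h a p by (intro mult_right_mono mult_left_mono powr_mono') (auto intro: mult_right_mono)
      also have "\<dots> = (E * (C * A powr p)) * (norm h powr (s0 * p) * norm h powr (2 * \<sigma>))"
        unfolding t2 by simp
      also have "norm h powr (s0 * p) * norm h powr (2 * \<sigma>) = (norm h powr (s0 + 2 * \<sigma> / p)) powr p"
        using p by (simp add: powr_powr distrib_right flip: powr_add)
      also have "(E * (C * A powr p)) * (norm h powr (s0 + 2 * \<sigma> / p)) powr p \<le> A' powr p * (norm h powr (s0 + 2 * \<sigma> / p)) powr p"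
      proof (rule mult_right_mono)
        have "E * (C * A powr p) \<le> A'" by (simp add: A'_def)
        also have "\<dots> \<le> A' powr p" using A' p powr_mono[of 1 p A'] by simp
        finally show "E * (C * A powr p) \<le> A' powr p" .
      qed simp
      finally show "E * norm h powr (s * p) * (C * A powr p * t\<^sup>2) \<le> (A' * norm h powr (s0 + 2 * \<sigma> / p)) powr p"
        by (simp add: powr_mult)
    qed
    finally show "diff2 p (ball 0 r) u h \<le> ennreal ((A' * norm h powr (s0 + 2 * \<sigma> / p)) powr p)" .
  qed (use A' A d in auto)
qed

lemma unit_solution_bound_shift:
  assumes "unit_solution s p u" "x \<in> ball 0 r" "norm h \<le> 1 - r"
  shows "\<bar>u (x + h)\<bar> \<le> 1"
proof -
  have "norm (x + h) < 1" using assms norm_triangle_ineq[of x h] by auto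
  then show ?thesis using assms by (auto simp: unit_solution_def)
qed

lemma emeasure_ball_le:
  assumes "r < 1"
  shows "emeasure lborel (ball (0::'a::euclidean_space) r) \<le> ennreal (1 + measure lborel (ball (0::'a) 1))"
proof -
  have "emeasure lborel (ball (0::'a) r) \<le> emeasure lborel (ball (0::'a) 1)"
    using assms by (intro emeasure_mono) auto
  also have "\<dots> = ennreal (measure lborel (ball (0::'a) 1))" by (simp add: emeasure_ball content_ball)
  also have "\<dots> \<le> ennreal (1 + measure lborel (ball (0::'a) 1))" by (intro ennreal_leI) simp
  finally show ?thesis .
qed

lemma first_difference_rate_of_second:
  assumes p: "2 \<le> p" and \<tau>: "0 < \<tau>" "\<tau> < 1"
    and rate: "difference_rate (diff2 :: 'a::euclidean_space difference_mass) p s0 \<tau>"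
  shows "difference_rate (diff1 :: 'a difference_mass) p s0 \<tau>"
proof (rule difference_rateI)
  fix r :: real assume r: "0 < r" "r < 1"
  obtain A \<delta> where A: "1 \<le> A" "0 < \<delta>" and H: "\<And>s (u :: 'a \<Rightarrow> real) h. s0 \<le> s \<Longrightarrow> s < 1 \<Longrightarrow> unit_solution s p u \<Longrightarrow> h \<noteq> 0 \<Longrightarrow> norm h \<le> \<delta> \<Longrightarrow>
        diff2 p (ball 0 r) u h \<le> ennreal ((A * norm h powr \<tau>) powr p)"
    using difference_rateD[OF rate r] by metis
  define V where "V = 1 + measure lborel (ball (0::'a) 1)"
  define d where "d = min \<delta> (1 - r)"
  have d: "0 < d" "d \<le> \<delta>" "d \<le> 1 - r" using A r by (auto simp: d_def)
  have "0 < A" "1 \<le> V" "1 \<le> p" using A p by (auto simp: V_def)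
  from marchaud_sublinear[OF \<tau> this(1) d(1) this(2,3), where 'a='a]
  obtain C where C: "0 < C" and M: "\<And>(u::'a \<Rightarrow> real) B h. u \<in> borel_measurable borel \<Longrightarrow> B \<in> sets borel \<Longrightarrow>
    emeasure lborel B \<le> ennreal V \<Longrightarrow> (\<And>x h. x \<in> B \<Longrightarrow> norm h \<le> d \<Longrightarrow> \<bar>u (x + h)\<bar> \<le> 1) \<Longrightarrow>
    (\<And>h. h \<noteq> 0 \<Longrightarrow> norm h \<le> d \<Longrightarrow> diff2 p B u h \<le> ennreal ((A * norm h powr \<tau>) powr p)) \<Longrightarrow>
    h \<noteq> 0 \<Longrightarrow> norm h \<le> d \<Longrightarrow> diff1 p B u h \<le> ennreal ((C * norm h powr \<tau>) powr p)"
    by blast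
  show "\<exists>A \<delta>. 1 \<le> A \<and> 0 < \<delta> \<and>
     (\<forall>s (u :: 'a \<Rightarrow> real) h. s0 \<le> s \<longrightarrow> s < 1 \<longrightarrow> unit_solution s p u \<longrightarrow> h \<noteq> 0 \<longrightarrow> norm h \<le> \<delta> \<longrightarrow>
        diff1 p (ball 0 r) u h \<le> ennreal ((A * norm h powr \<tau>) powr p))"
  proof (rule exI[of _ "1 + C"], rule exI[of _ d], intro conjI allI impI)
    fix s :: real and h :: 'a and u :: "'a \<Rightarrow> real"
    assume a: "s0 \<le> s" "s < 1" "unit_solution s p u" "h \<noteq> 0" "norm h \<le> d"
    have "diff1 p (ball 0 r) u h \<le> ennreal ((C * norm h powr \<tau>) powr p)"
    proof (rule M)
      show "u \<in> borel_measurable borel" using a by (simp add: unit_solution_def)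
      show "emeasure lborel (ball 0 r :: 'a set) \<le> ennreal V" unfolding V_def using r by (intro emeasure_ball_le) auto
      show "\<bar>u (x + h)\<bar> \<le> 1" if "x \<in> ball 0 r" "norm h \<le> d" for x h
        using a that d unit_solution_bound_shift[of s p u x r h] by auto
      show "diff2 p (ball 0 r) u h \<le> ennreal ((A * norm h powr \<tau>) powr p)" if "h \<noteq> 0" "norm h \<le> d" for h
        using that a d by (intro H[of s]) auto
    qed (use a in auto)
    also have "\<dots> \<le> ennreal (((1 + C) * norm h powr \<tau>) powr p)"
      using C p by (intro ennreal_leI powr_mono2 mult_right_mono) auto
    finally show "diff1 p (ball 0 r) u h \<le> ennreal (((1 + C) * norm h powr \<tau>) powr p)" .
  qed (use C d in auto)
qed

text \<open>
  As \<open>\<sigma> \<le> 1\<close>, the exponent \<open>s0 + 2 * \<sigma> / p\<close> is at least \<open>\<sigma> + e\<close> with \<open>e = s0 - (p - 2) / p > 0\<close>. Until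
  second differences have an exponent above 1, every round raises the exponent of first differences by
  \<open>e / 2\<close> and keeps it at most 1, so there are only finitely many such rounds.
\<close>

lemma second_difference_rate_superlinear:
  assumes s0: "(p - 2) / p < s0" "s0 < 1" and p: "2 \<le> p"
  obtains \<tau> where "1 < \<tau>" "difference_rate (diff2 :: 'a::euclidean_space difference_mass) p s0 \<tau>"
proof -
  define e where "e = s0 - (p - 2) / p"
  have e: "0 < e" using s0 by (simp add: e_def)
  have s0': "0 < s0" using s0 p by (smt (verit) divide_nonneg_nonneg)
  have gain: "difference_rate (diff2 :: 'a difference_mass) p s0 (\<sigma> + e)" if "0 < \<sigma>" "\<sigma> \<le> 1" "difference_rate (diff1 :: 'a difference_mass) p s0 \<sigma>" for \<sigma>
  proof (rule difference_rate_mono[OF second_difference_rate_of_first[OF s0' p that]])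
    have "\<sigma> * ((p - 2) / p) \<le> 1 * ((p - 2) / p)" using that p by (intro mult_right_mono) auto
    then show "\<sigma> + e \<le> s0 + 2 * \<sigma> / p" using p by (simp add: e_def field_simps)
  qed (use p in auto)
  have "(\<exists>\<tau>>1. difference_rate (diff2 :: 'a difference_mass) p s0 \<tau>) \<or> (\<exists>\<sigma>. 0 < \<sigma> \<and> \<sigma> \<le> 1 \<and> s0 + real n * (e / 2) \<le> \<sigma> \<and> difference_rate (diff1 :: 'a difference_mass) p s0 \<sigma>)" for n
  proof (induction n)
    case 0
    then show ?case using s0 s0' p first_difference_rate_initial[of s0 p, where 'a='a] by auto
  next
    case (Suc n)
    then show ?case
    proof
      assume "\<exists>\<sigma>. 0 < \<sigma> \<and> \<sigma> \<le> 1 \<and> s0 + real n * (e / 2) \<le> \<sigma> \<and> difference_rate (diff1 :: 'a difference_mass) p s0 \<sigma>"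
      then obtain \<sigma> where \<sigma>: "0 < \<sigma>" "\<sigma> \<le> 1" "s0 + real n * (e / 2) \<le> \<sigma>" "difference_rate (diff1 :: 'a difference_mass) p s0 \<sigma>" by blast
      have d2: "difference_rate (diff2 :: 'a difference_mass) p s0 (\<sigma> + e)" using gain \<sigma> by blast
      show ?case
      proof (cases "1 < \<sigma> + e")
        case True
        with d2 show ?thesis by blast
      next
        case False
        \<comment> \<open>Half of the gain is given up to keep the exponent strictly below 1: at the exponent 1 a
          linear bound violates the doubling inequality of marchaud.\<close>
        have "difference_rate (diff2 :: 'a difference_mass) p s0 (\<sigma> + e / 2)" using difference_rate_mono[OF d2] e p by simp
        then have "difference_rate (diff1 :: 'a difference_mass) p s0 (\<sigma> + e / 2)" using False \<sigma> e p by (intro first_difference_rate_of_second) auto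
        moreover have "s0 + real (Suc n) * (e / 2) \<le> \<sigma> + e / 2"
        proof -
          have "real (Suc n) * (e / 2) = real n * (e / 2) + e / 2" by (simp add: algebra_simps add_divide_distrib)
          with \<sigma>(3) show ?thesis by linarith
        qed
        ultimately show ?thesis using False \<sigma> e by (intro disjI2 exI[of _ "\<sigma> + e / 2"]) auto
      qed
    qed blast
  qed
  moreover obtain n where "1 / (e / 2) < real n" using reals_Archimedean2 by blast
  then have "1 < s0 + real n * (e / 2)" using e s0' by (simp add: field_simps)
  ultimately show ?thesis using that by (metis less_le_trans not_le)
qed

text \<open>
  The outcome of the iteration. The bound \<open>M\<close> will become the bound on the gradient; \<open>K\<close> and \<open>\<tau> > 1\<close>
  are responsible for the convergence of the difference quotients.
\<close>

lemma unit_solution_difference_bounds: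
  assumes s0: "(p - 2) / p < s0" "s0 < 1" and p: "2 \<le> p" and r: "0 < r" "r < 1"
  obtains M K \<tau> \<delta> where "0 < M" "0 < K" "1 < \<tau>" "0 < \<delta>"
    "\<And>s (u :: 'a::euclidean_space \<Rightarrow> real) h. s0 \<le> s \<Longrightarrow> s < 1 \<Longrightarrow> unit_solution s p u \<Longrightarrow> h \<noteq> 0 \<Longrightarrow> norm h \<le> \<delta> \<Longrightarrow>
        diff1 p (ball 0 r) u h \<le> ennreal ((M * norm h) powr p) \<and>
        diff2 p (ball 0 r) u h \<le> ennreal ((K * norm h powr \<tau>) powr p)"
proof -
  obtain \<tau> where \<tau>: "1 < \<tau>" "difference_rate (diff2 :: 'a difference_mass) p s0 \<tau>" using second_difference_rate_superlinear[OF s0 p, where 'a='a] .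
  obtain A \<delta> where A: "1 \<le> A" "0 < \<delta>" and H: "\<And>s (u :: 'a \<Rightarrow> real) h. s0 \<le> s \<Longrightarrow> s < 1 \<Longrightarrow> unit_solution s p u \<Longrightarrow> h \<noteq> 0 \<Longrightarrow> norm h \<le> \<delta> \<Longrightarrow>
        diff2 p (ball 0 r) u h \<le> ennreal ((A * norm h powr \<tau>) powr p)"
    using difference_rateD[OF \<tau>(2) r] by metis
  define V where "V = 1 + measure lborel (ball (0::'a) 1)"
  define d where "d = min \<delta> (1 - r)"
  have d: "0 < d" "d \<le> 1" "d \<le> \<delta>" "d \<le> 1 - r" using A r by (auto simp: d_def)
  have AV: "0 < A" "1 \<le> V" "1 \<le> p" using A p by (auto simp: V_def)
  from marchaud_superlinear[OF \<tau>(1) AV(1) d(1,2) AV(2,3), where 'a='a]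
  obtain C where C: "0 < C" and M: "\<And>(u::'a \<Rightarrow> real) B h. u \<in> borel_measurable borel \<Longrightarrow> B \<in> sets borel \<Longrightarrow>
    emeasure lborel B \<le> ennreal V \<Longrightarrow> (\<And>x h. x \<in> B \<Longrightarrow> norm h \<le> d \<Longrightarrow> \<bar>u (x + h)\<bar> \<le> 1) \<Longrightarrow>
    (\<And>h. h \<noteq> 0 \<Longrightarrow> norm h \<le> d \<Longrightarrow> diff2 p B u h \<le> ennreal ((A * norm h powr \<tau>) powr p)) \<Longrightarrow>
    h \<noteq> 0 \<Longrightarrow> norm h \<le> d \<Longrightarrow> diff1 p B u h \<le> ennreal ((C * norm h) powr p)"
    by blast
  have "diff1 p (ball 0 r) u h \<le> ennreal ((C * norm h) powr p) \<and>
        diff2 p (ball 0 r) u h \<le> ennreal ((A * norm h powr \<tau>) powr p)"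
    if a: "s0 \<le> s" "s < 1" "unit_solution s p u" "h \<noteq> 0" "norm h \<le> d" for s h and u :: "'a \<Rightarrow> real"
  proof
    show "diff2 p (ball 0 r) u h \<le> ennreal ((A * norm h powr \<tau>) powr p)"
      using a d by (intro H[of s]) auto
    show "diff1 p (ball 0 r) u h \<le> ennreal ((C * norm h) powr p)"
    proof (rule M)
      show "u \<in> borel_measurable borel" using a by (simp add: unit_solution_def)
      show "emeasure lborel (ball 0 r :: 'a set) \<le> ennreal V" unfolding V_def using r by (intro emeasure_ball_le) auto
      show "\<bar>u (x + h)\<bar> \<le> 1" if "x \<in> ball 0 r" "norm h \<le> d" for x h
        using a that d unit_solution_bound_shift[of s p u x r h] by auto
      show "diff2 p (ball 0 r) u h \<le> ennreal ((A * norm h powr \<tau>) powr p)" if "h \<noteq> 0" "norm h \<le> d" for h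
        using that a d by (intro H[of s]) auto
    qed (use a in auto)
  qed
  then show ?thesis using that[OF C AV(1) \<tau>(1) d(1)] by blast
qed

section \<open>Weak derivatives from difference quotients\<close>

text \<open>
  The pointwise inequality \<open>\<bar>a\<bar> \<le> l + l powr (1 - p) * \<bar>a\<bar> powr p\<close>, with the norm bound \<open>l\<close> as threshold, replaces
  Hoelder's inequality on a set of finite measure.
\<close>

lemma nn_integral_L1_of_Lp:
  fixes a :: "'a::euclidean_space \<Rightarrow> real"
  assumes [measurable]: "a \<in> borel_measurable borel" "E \<in> sets borel"
    and l: "0 < l" and p: "1 \<le> p" and V: "emeasure lborel E \<le> ennreal V" "0 \<le> V"
    and a: "(\<integral>\<^sup>+x\<in>E. ennreal (\<bar>a x\<bar> powr p) \<partial>lborel) \<le> ennreal (l powr p)"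
  shows "(\<integral>\<^sup>+x\<in>E. ennreal \<bar>a x\<bar> \<partial>lborel) \<le> ennreal (l * (V + 1))"
proof -
  have "(\<integral>\<^sup>+x\<in>E. ennreal \<bar>a x\<bar> \<partial>lborel) \<le> (\<integral>\<^sup>+x. ennreal l * indicator E x
      + ennreal (l powr (1 - p)) * (ennreal (\<bar>a x\<bar> powr p) * indicator E x) \<partial>lborel)"
  proof (rule nn_integral_mono)
    fix x
    have "\<bar>a x\<bar> \<le> l + l powr (1 - p) * \<bar>a x\<bar> powr p"
    proof (cases "\<bar>a x\<bar> \<le> l")
      case True
      then show ?thesis by (simp add: add_increasing2)
    next
      case False
      then have ax: "0 < \<bar>a x\<bar>" using l by linarith
      have "\<bar>a x\<bar> = \<bar>a x\<bar> powr (1 - p) * \<bar>a x\<bar> powr p"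
        unfolding powr_add [symmetric] using ax by simp
      also have "\<dots> \<le> l powr (1 - p) * \<bar>a x\<bar> powr p"
        using False l p by (intro mult_right_mono powr_mono2') auto
      finally show ?thesis using l by linarith
    qed
    then have "ennreal \<bar>a x\<bar> \<le> ennreal l + ennreal (l powr (1 - p)) * ennreal (\<bar>a x\<bar> powr p)"
      using l by (simp add: ennreal_mult' [symmetric] ennreal_plus [symmetric] del: ennreal_plus)
    then show "ennreal \<bar>a x\<bar> * indicator E x \<le> ennreal l * indicator E x
      + ennreal (l powr (1 - p)) * (ennreal (\<bar>a x\<bar> powr p) * indicator E x)"
      by (auto simp: indicator_def)
  qed
  also have "\<dots> = ennreal l * emeasure lborel E + ennreal (l powr (1 - p)) * (\<integral>\<^sup>+x\<in>E. ennreal (\<bar>a x\<bar> powr p) \<partial>lborel)"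
    by (simp add: nn_integral_add nn_integral_cmult nn_integral_cmult_indicator)
  also have "\<dots> \<le> ennreal l * ennreal V + ennreal (l powr (1 - p)) * ennreal (l powr p)"
    by (intro add_mono mult_left_mono V a) auto
  also have "\<dots> = ennreal (l * V + l powr (1 - p) * l powr p)"
    using l V by (simp add: ennreal_mult' [symmetric])
  also have "l powr (1 - p) * l powr p = l" unfolding powr_add [symmetric] using l by simp
  finally show ?thesis by (simp add: distrib_left)
qed

lemma derivative_along_line:
  fixes \<phi> :: "'a::euclidean_space \<Rightarrow> real"
  assumes "\<phi> differentiable_on UNIV"
  shows "((\<lambda>s. \<phi> (x - s *\<^sub>R i)) has_real_derivative (- frechet_derivative \<phi> (at (x - s *\<^sub>R i)) i)) (at s)"
proof -
  have 1: "(\<phi> has_derivative frechet_derivative \<phi> (at (x - s *\<^sub>R i))) (at (x - s *\<^sub>R i))"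
    using assms by (simp add: differentiable_on_def frechet_derivative_works [symmetric])
  have 2: "((\<lambda>s. x - s *\<^sub>R i) has_derivative (\<lambda>r. - (r *\<^sub>R i))) (at s)"
    by (auto intro!: derivative_eq_intros)
  have *: "((\<lambda>s. \<phi> (x - s *\<^sub>R i)) has_derivative (\<lambda>r. frechet_derivative \<phi> (at (x - s *\<^sub>R i)) (- (r *\<^sub>R i)))) (at s)"
    by (rule has_derivative_compose[OF 2 1])
  have "linear (frechet_derivative \<phi> (at (x - s *\<^sub>R i)))"
    using assms by (intro linear_frechet_derivative) (simp add: differentiable_on_def)
  then have "(\<lambda>r. frechet_derivative \<phi> (at (x - s *\<^sub>R i)) (- (r *\<^sub>R i))) = (\<lambda>r. r * - frechet_derivative \<phi> (at (x - s *\<^sub>R i)) i)"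
    by (simp add: linear_neg linear_scale)
  with * have "((\<lambda>s. \<phi> (x - s *\<^sub>R i)) has_derivative (\<lambda>r. r * - frechet_derivative \<phi> (at (x - s *\<^sub>R i)) i)) (at s)"
    by (simp only:)
  moreover have "(\<lambda>r. r * - frechet_derivative \<phi> (at (x - s *\<^sub>R i)) i) = (*) (- frechet_derivative \<phi> (at (x - s *\<^sub>R i)) i)"
    by (rule ext, rule mult.commute)
  ultimately show ?thesis unfolding has_field_derivative_def by (simp only:)
qed

lemma integrable_shift:
  fixes f :: "'a::euclidean_space \<Rightarrow> real"
  assumes "integrable lborel f"
  shows "integrable lborel (\<lambda>x. f (x + t))" "integral\<^sup>L lborel (\<lambda>x. f (x + t)) = integral\<^sup>L lborel f"
proof -
  have "has_bochner_integral lborel (\<lambda>x. f (t + 1 *\<^sub>R x)) (integral\<^sup>L lborel f / \<bar>1\<bar> ^ DIM('a))"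
    using has_bochner_integral_integrable[OF assms] by (rule has_bochner_integral_affine) simp
  then have "has_bochner_integral lborel (\<lambda>x. f (x + t)) (integral\<^sup>L lborel f)" by (simp add: add.commute)
  then show "integrable lborel (\<lambda>x. f (x + t))" "integral\<^sup>L lborel (\<lambda>x. f (x + t)) = integral\<^sup>L lborel f"
    by (simp_all add: has_bochner_integral_iff)
qed

text \<open>
  Discrete integration by parts. Once the step is smaller than the distance from the support of \<open>\<phi>\<close> to the
  complement of \<open>E\<close>, a translation moves the difference quotient from \<open>f\<close> to \<open>\<phi>\<close> without boundary terms. The
  backward quotients of \<open>\<phi>\<close> converge to \<open>- \<partial>\<^sub>i \<phi>\<close> and are dominated by a bound for this derivative.
\<close>

lemma difference_quotient_integral_tendsto:
  fixes f \<phi> :: "'a::euclidean_space \<Rightarrow> real"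
  assumes [measurable]: "f \<in> borel_measurable borel" and E: "E = ball c \<rho>" and \<delta>: "0 < \<delta>"
    and bd: "\<And>x h. x \<in> E \<Longrightarrow> norm h \<le> \<delta> \<Longrightarrow> \<bar>f (x + h)\<bar> \<le> L" and i: "norm i = 1"
    and t: "\<And>k. 0 < t k" "\<And>k. t k \<le> \<delta>" "t \<longlonglongrightarrow> 0"
    and \<phi>: "\<phi> differentiable_on UNIV" "continuous_on UNIV (\<lambda>x. frechet_derivative \<phi> (at x) i)"
    and supp: "compactly_supported_in E \<phi>"
  shows "(\<lambda>k. \<integral>x. indicator E x * ((f (x + t k *\<^sub>R i) - f x) / t k) * \<phi> x \<partial>lborel)
     \<longlonglongrightarrow> - (\<integral>x. indicator E x * (f x * frechet_derivative \<phi> (at x) i) \<partial>lborel)"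
proof -
  have [measurable]: "E \<in> sets borel" by (simp add: E)
  have Efin: "emeasure lborel E < \<infinity>"
    unfolding E using emeasure_lborel_ball_finite[of c \<rho>] by simp
  have \<phi>c: "continuous_on UNIV \<phi>" using \<phi>(1) by (rule differentiable_imp_continuous_on)
  have [measurable]: "\<phi> \<in> borel_measurable borel" using \<phi>c by (rule borel_measurable_continuous_onI)
  define \<phi>' where "\<phi>' = (\<lambda>x. frechet_derivative \<phi> (at x) i)"
  have \<phi>'c: "continuous_on UNIV \<phi>'" using \<phi>(2) by (simp add: \<phi>'_def)
  have [measurable]: "\<phi>' \<in> borel_measurable borel" using \<phi>'c by (rule borel_measurable_continuous_onI)
  define S where "S = closure {x. \<phi> x \<noteq> 0}"
  have S: "compact S" "S \<subseteq> E" using supp by (auto simp: compactly_supported_in_def S_def)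
  have \<phi>S: "x \<in> S" if "\<phi> x \<noteq> 0" for x using that subsetD[OF closure_subset, of x "{x. \<phi> x \<noteq> 0}"] by (simp add: S_def)
  obtain e where e: "0 < e" "\<And>x h. x \<in> S \<Longrightarrow> norm h < e \<Longrightarrow> x + h \<in> E"
  proof -
    have "\<exists>e>0. \<forall>x\<in>S. ball x e \<subseteq> E"
    proof (cases "S = {}")
      case False
      have "open E" by (simp add: E)
      then have "S \<inter> - E = {}" "closed (- E)" using S by auto
      then obtain e where "0 < e" "\<And>x y. x \<in> S \<Longrightarrow> y \<in> - E \<Longrightarrow> e \<le> dist x y"
        using separate_compact_closed[of S "- E"] S by metis
      then show ?thesis by (intro exI[of _ e]) (force simp: subset_eq not_le[symmetric])
    qed (auto intro: exI[of _ 1])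
    then obtain e where e: "0 < e" "\<And>x. x \<in> S \<Longrightarrow> ball x e \<subseteq> E" by blast
    show ?thesis
    proof (rule that[OF e(1)])
      fix x h assume "x \<in> S" "norm (h :: 'a) < e"
      then have "x + h \<in> ball x e" by (simp add: dist_norm)
      then show "x + h \<in> E" using e(2)[OF \<open>x \<in> S\<close>] by blast
    qed
  qed
  obtain P where P: "\<And>x. x \<in> cball c (\<rho> + \<delta>) \<Longrightarrow> \<bar>\<phi>' x\<bar> \<le> P"
  proof -
    have "bounded (\<phi>' ` cball c (\<rho> + \<delta>))"
      by (intro compact_imp_bounded compact_continuous_image continuous_on_subset[OF \<phi>'c]) auto
    then obtain a where "\<And>y. y \<in> \<phi>' ` cball c (\<rho> + \<delta>) \<Longrightarrow> norm y \<le> a" unfolding bounded_iff by blast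
    then show ?thesis using that[of a] by auto
  qed
  define Q where "Q k x = (\<phi> (x - t k *\<^sub>R i) - \<phi> x) / t k" for k x
  have [measurable]: "Q k \<in> borel_measurable borel" for k unfolding Q_def by measurable
  have Qb: "\<bar>Q k x\<bar> \<le> P" if "x \<in> E" for k x
  proof -
    have "\<exists>z>0. z < t k \<and> \<phi> (x - t k *\<^sub>R i) - \<phi> (x - 0 *\<^sub>R i) = (t k - 0) * (- \<phi>' (x - z *\<^sub>R i))"
      unfolding \<phi>'_def using t by (intro MVT2 derivative_along_line \<phi>) auto
    then obtain z where z: "0 < z" "z < t k" "\<phi> (x - t k *\<^sub>R i) - \<phi> x = - t k * \<phi>' (x - z *\<^sub>R i)" by auto
    have "norm (c - (x - z *\<^sub>R i)) \<le> norm (c - x) + norm (z *\<^sub>R i)"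
      using norm_triangle_ineq[of "c - x" "z *\<^sub>R i"] by (simp add: algebra_simps)
    then have "x - z *\<^sub>R i \<in> cball c (\<rho> + \<delta>)" using that z t(2)[of k] i by (simp add: E dist_norm)
    then show ?thesis using P z t(1)[of k] by (simp add: Q_def)
  qed
  have Qlim: "(\<lambda>k. Q k x) \<longlonglongrightarrow> - \<phi>' x" for x
  proof -
    have "((\<lambda>s. \<phi> (x - s *\<^sub>R i)) has_real_derivative (- \<phi>' x)) (at 0)"
      using derivative_along_line[OF \<phi>(1), of x i 0] by (simp add: \<phi>'_def)
    then have "((\<lambda>s. (\<phi> (x - s *\<^sub>R i) - \<phi> x) / s) \<longlongrightarrow> - \<phi>' x) (at 0)"
      by (simp add: has_field_derivative_iff)
    moreover have "filterlim t (at 0) sequentially"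
      using t(1,3) by (auto simp: filterlim_at intro!: always_eventually less_imp_neq[THEN not_sym])
    ultimately show ?thesis unfolding Q_def by (rule filterlim_compose)
  qed
  have ev: "eventually (\<lambda>k. (\<integral>x. indicator E x * ((f (x + t k *\<^sub>R i) - f x) / t k) * \<phi> x \<partial>lborel) = (\<integral>x. indicator E x * (f x * Q k x) \<partial>lborel)) sequentially"
  proof -
    have "eventually (\<lambda>k. t k < e) sequentially" using t(3) e(1) by (rule order_tendstoD)
    then show ?thesis
    proof eventually_elim
      case (elim k)
      have nt: "norm (t k *\<^sub>R i) = t k" using i t(1)[of k] by simp
      obtain P0 where P0: "\<And>x. \<bar>\<phi> x\<bar> \<le> P0"
      proof -
        have "bounded (\<phi> ` S)" using S by (intro compact_imp_bounded compact_continuous_image continuous_on_subset[OF \<phi>c]) auto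
        then obtain B where B: "\<And>x. x \<in> S \<Longrightarrow> \<bar>\<phi> x\<bar> \<le> B" by (auto simp: bounded_iff)
        have "\<bar>\<phi> x\<bar> \<le> max B 0" for x using B[of x] \<phi>S[of x] by (cases "\<phi> x = 0") auto
        then show ?thesis using that by blast
      qed
      have i1: "integrable lborel (\<lambda>x. f x * \<phi> x)"
      proof (rule integrableI_bounded_set[of E _ _ "L * P0"])
        show "AE x in lborel. x \<in> E \<longrightarrow> norm (f x * \<phi> x) \<le> L * P0"
        proof (intro AE_I2 impI)
          fix x assume x: "x \<in> E"
          have "\<bar>f x\<bar> \<le> L" using bd[OF x, of 0] \<delta> by simp
          then show "norm (f x * \<phi> x) \<le> L * P0" using P0[of x] by (simp add: abs_mult mult_mono)
        qed
        show "AE x in lborel. x \<notin> E \<longrightarrow> f x * \<phi> x = 0" using S \<phi>S by (intro AE_I2) auto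
      qed (use Efin in auto)
      have i2: "integrable lborel (\<lambda>x. f x * \<phi> (x - t k *\<^sub>R i))"
      proof (rule integrableI_bounded_set[of E _ _ "L * P0"])
        show "AE x in lborel. x \<in> E \<longrightarrow> norm (f x * \<phi> (x - t k *\<^sub>R i)) \<le> L * P0"
        proof (intro AE_I2 impI)
          fix x assume x: "x \<in> E"
          have "\<bar>f x\<bar> \<le> L" using bd[OF x, of 0] \<delta> by simp
          then show "norm (f x * \<phi> (x - t k *\<^sub>R i)) \<le> L * P0" using P0[of "x - t k *\<^sub>R i"] by (simp add: abs_mult mult_mono)
        qed
        show "AE x in lborel. x \<notin> E \<longrightarrow> f x * \<phi> (x - t k *\<^sub>R i) = 0"
        proof (intro AE_I2 impI)
          fix x assume "x \<notin> E"
          then show "f x * \<phi> (x - t k *\<^sub>R i) = 0"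
            using e(2)[of "x - t k *\<^sub>R i" "t k *\<^sub>R i"] \<phi>S[of "x - t k *\<^sub>R i"] elim nt by auto
        qed
      qed (use Efin in auto)
      note i3 = integrable_shift[OF i2, of "t k *\<^sub>R i"]
      have "(\<integral>x. indicator E x * ((f (x + t k *\<^sub>R i) - f x) / t k) * \<phi> x \<partial>lborel)
        = (\<integral>x. (f (x + t k *\<^sub>R i) * \<phi> x - f x * \<phi> x) / t k \<partial>lborel)"
        using S \<phi>S by (intro Bochner_Integration.integral_cong) (auto simp: indicator_def algebra_simps diff_divide_distrib)
      also have "\<dots> = ((\<integral>x. f (x + t k *\<^sub>R i) * \<phi> x \<partial>lborel) - (\<integral>x. f x * \<phi> x \<partial>lborel)) / t k"
        using i1 i3 by simp
      also have "(\<integral>x. f (x + t k *\<^sub>R i) * \<phi> x \<partial>lborel) = (\<integral>x. f x * \<phi> (x - t k *\<^sub>R i) \<partial>lborel)"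
        using i3(2) by simp
      also have "((\<integral>x. f x * \<phi> (x - t k *\<^sub>R i) \<partial>lborel) - (\<integral>x. f x * \<phi> x \<partial>lborel)) / t k
         = (\<integral>x. (f x * \<phi> (x - t k *\<^sub>R i) - f x * \<phi> x) / t k \<partial>lborel)"
        using i1 i2 by simp
      also have "\<dots> = (\<integral>x. indicator E x * (f x * Q k x) \<partial>lborel)"
      proof (intro Bochner_Integration.integral_cong refl)
        fix x
        have "\<phi> x = 0 \<and> \<phi> (x - t k *\<^sub>R i) = 0" if "x \<notin> E"
          using that S \<phi>S[of x] e(2)[of "x - t k *\<^sub>R i" "t k *\<^sub>R i"] \<phi>S[of "x - t k *\<^sub>R i"] elim nt by auto
        then show "(f x * \<phi> (x - t k *\<^sub>R i) - f x * \<phi> x) / t k = indicator E x * (f x * Q k x)"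
          by (auto simp: Q_def indicator_def algebra_simps diff_divide_distrib)
      qed
      finally show ?case .
    qed
  qed
  have "(\<lambda>k. \<integral>x. indicator E x * (f x * Q k x) \<partial>lborel) \<longlonglongrightarrow> (\<integral>x. indicator E x * (f x * - \<phi>' x) \<partial>lborel)"
  proof (rule integral_dominated_convergence[where w = "\<lambda>x. L * P * indicator E x"])
    show "integrable lborel (\<lambda>x. L * P * indicator E x)" using Efin by simp
    show "AE x in lborel. (\<lambda>k. indicator E x * (f x * Q k x)) \<longlonglongrightarrow> indicator E x * (f x * - \<phi>' x)"
      by (intro AE_I2 tendsto_mult tendsto_const Qlim)
    show "AE x in lborel. norm (indicator E x * (f x * Q k x)) \<le> L * P * indicator E x" for k
    proof (rule AE_I2)
      fix x
      show "norm (indicator E x * (f x * Q k x)) \<le> L * P * indicator E x"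
      proof (cases "x \<in> E")
        case True
        have "\<bar>f x\<bar> \<le> L" using bd[OF True, of 0] \<delta> by simp
        then show ?thesis using Qb[OF True, of k] True by (simp add: abs_mult mult_mono)
      qed simp
    qed
  qed measurable
  also have "(\<integral>x. indicator E x * (f x * - \<phi>' x) \<partial>lborel) = - (\<integral>x. indicator E x * (f x * \<phi>' x) \<partial>lborel)"
    by simp
  finally show ?thesis unfolding \<phi>'_def using tendsto_cong[OF ev] by simp
qed

text \<open>
  Let \<open>D k\<close> be the difference quotient with the step \<open>t k = \<delta> / 2 ^ k\<close>. The difference of \<open>D (Suc k)\<close> and
  \<open>D k\<close> is a second difference divided by \<open>2 * t (Suc k)\<close>, hence of order \<open>t (Suc k) powr (\<tau> - 1)\<close> in \<open>L\<^sup>1\<close>. This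
  decays geometrically since \<open>\<tau> > 1\<close>, so \<open>D k\<close> converges almost everywhere and in \<open>L\<^sup>1\<close> to some \<open>g\<close>. Fatou's
  lemma transfers the bound \<open>M\<close> to \<open>g\<close>, and \<open>difference_quotient_integral_tendsto\<close> identifies \<open>g\<close> as the
  weak derivative.
\<close>

lemma directional_weak_derivative:
  fixes f :: "'a::euclidean_space \<Rightarrow> real"
  assumes fm [measurable]: "f \<in> borel_measurable borel" and E: "E = ball c \<rho>" and \<delta>: "0 < \<delta>" and p: "1 \<le> p"
    and bd: "\<And>x h. x \<in> E \<Longrightarrow> norm h \<le> \<delta> \<Longrightarrow> \<bar>f (x + h)\<bar> \<le> L" and i: "norm i = 1"
    and MK: "0 < M" "0 < K" "1 < \<tau>"
    and d1: "\<And>h. h \<noteq> 0 \<Longrightarrow> norm h \<le> \<delta> \<Longrightarrow> diff1 p E f h \<le> ennreal ((M * norm h) powr p)"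
    and d2: "\<And>h. h \<noteq> 0 \<Longrightarrow> norm h \<le> \<delta> \<Longrightarrow> diff2 p E f h \<le> ennreal ((K * norm h powr \<tau>) powr p)"
  obtains g where "g \<in> borel_measurable borel" "(\<integral>\<^sup>+x\<in>E. ennreal (\<bar>g x\<bar> powr p) \<partial>lborel) \<le> ennreal (M powr p)"
    "\<And>\<phi>. \<phi> differentiable_on UNIV \<Longrightarrow> continuous_on UNIV (\<lambda>x. frechet_derivative \<phi> (at x) i) \<Longrightarrow> compactly_supported_in E \<phi> \<Longrightarrow>
      (\<integral>x. indicator E x * (f x * frechet_derivative \<phi> (at x) i) \<partial>lborel) = - (\<integral>x. indicator E x * (g x * \<phi> x) \<partial>lborel)"
proof -
  have [measurable]: "E \<in> sets borel" by (simp add: E)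
  define V where "V = measure lborel E"
  have EV: "emeasure lborel E \<le> ennreal V" "0 \<le> V"
    using emeasure_eq_ennreal_measure[of lborel E] emeasure_lborel_ball_finite[of c \<rho>] by (auto simp: V_def E)
  have Efin: "emeasure lborel E < \<infinity>"
    unfolding E using emeasure_lborel_ball_finite[of c \<rho>] by simp
  define t where "t k = \<delta> * (1/2) ^ k" for k :: nat
  have t: "0 < t k" "t k \<le> \<delta>" "t k = 2 * t (Suc k)" for k
    using \<delta> by (auto simp: t_def power_le_one mult_left_le)
  have t0: "t \<longlonglongrightarrow> 0" unfolding t_def by (auto intro!: tendsto_mult_right_zero LIMSEQ_power_zero)
  have nt: "norm (t k *\<^sub>R i) = t k" "t k *\<^sub>R i \<noteq> 0" for k using t(1)[of k] i by auto
  define D where "D k x = indicator E x * ((f (x + t k *\<^sub>R i) - f x) / t k)" for k x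
  have [measurable]: "D k \<in> borel_measurable borel" for k unfolding D_def by measurable
  define q where "q = (1/2) powr (\<tau> - 1)"
  have q: "0 < q" "q < 1" using MK powr_less_mono'[of "1/2" 0 "\<tau> - 1"] by (auto simp: q_def)
  define c0 where "c0 = K * (V + 1) / 2 * (t 1) powr (\<tau> - 1)"
  have step: "(\<integral>\<^sup>+x. ennreal \<bar>D (Suc k) x - D k x\<bar> \<partial>lborel) \<le> ennreal (c0 * q ^ k)" for k
  proof -
    let ?h = "t (Suc k) *\<^sub>R i"
    have "t k *\<^sub>R i = 2 *\<^sub>R ?h" using t(3)[of k] by simp
    then have eq: "\<bar>D (Suc k) x - D k x\<bar> = indicator E x * (\<bar>f (x + 2 *\<^sub>R ?h) - 2 * f (x + ?h) + f x\<bar> / (2 * t (Suc k)))" for x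
    proof -
      have "D (Suc k) x - D k x = indicator E x * ((f (x + ?h) - f x) / t (Suc k) - (f (x + 2 *\<^sub>R ?h) - f x) / (2 * t (Suc k)))"
        unfolding D_def t(3)[of k] \<open>t k *\<^sub>R i = 2 *\<^sub>R ?h\<close>[unfolded t(3)[of k]] by (simp only: right_diff_distrib)
      also have "\<dots> = - (indicator E x * ((f (x + 2 *\<^sub>R ?h) - 2 * f (x + ?h) + f x) / (2 * t (Suc k))))"
        using t(1)[of "Suc k"] by (simp add: field_simps)
      finally show ?thesis using t(1)[of "Suc k"] by (simp add: abs_mult)
    qed
    have "(\<integral>\<^sup>+x. ennreal \<bar>D (Suc k) x - D k x\<bar> \<partial>lborel)
       = ennreal (1 / (2 * t (Suc k))) * (\<integral>\<^sup>+x\<in>E. ennreal \<bar>f (x + 2 *\<^sub>R ?h) - 2 * f (x + ?h) + f x\<bar> \<partial>lborel)"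
      unfolding eq using t(1)[of "Suc k"]
      by (subst nn_integral_cmult [symmetric]) (auto intro!: nn_integral_cong simp: indicator_def ennreal_mult' [symmetric])
    also have "\<dots> \<le> ennreal (1 / (2 * t (Suc k))) * ennreal ((K * t (Suc k) powr \<tau>) * (V + 1))"
    proof (intro mult_left_mono nn_integral_L1_of_Lp[OF _ _ _ p EV])
      show "(\<integral>\<^sup>+x\<in>E. ennreal (\<bar>f (x + 2 *\<^sub>R ?h) - 2 * f (x + ?h) + f x\<bar> powr p) \<partial>lborel) \<le> ennreal ((K * t (Suc k) powr \<tau>) powr p)"
        using d2[of ?h] nt[of "Suc k"] t(2)[of "Suc k"] unfolding diff2_def by simp
    qed (use MK t(1)[of "Suc k"] in auto)
    also have "\<dots> = ennreal (1 / (2 * t (Suc k)) * ((K * t (Suc k) powr \<tau>) * (V + 1)))"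
      using t(1)[of "Suc k"] by (subst ennreal_mult') auto
    also have "1 / (2 * t (Suc k)) * ((K * t (Suc k) powr \<tau>) * (V + 1)) = K * (V + 1) / 2 * t (Suc k) powr (\<tau> - 1)"
      using t(1)[of "Suc k"] by (simp add: powr_diff)
    also have "t (Suc k) powr (\<tau> - 1) = t 1 powr (\<tau> - 1) * q ^ k"
    proof -
      have "t (Suc k) = t 1 * (1/2) ^ k" by (simp add: t_def)
      then have "t (Suc k) powr (\<tau> - 1) = t 1 powr (\<tau> - 1) * ((1/2) ^ k) powr (\<tau> - 1)" by (simp only: powr_mult)
      also have "((1/2) ^ k) powr (\<tau> - 1) = q powr real k"
        by (simp add: q_def powr_powr mult.commute flip: powr_realpow)
      finally show ?thesis using q by (simp add: powr_realpow)
    qed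
    finally show ?thesis by (simp add: c0_def mult.assoc)
  qed
  have c0: "0 \<le> c0" using MK EV by (simp add: c0_def)
  define d where "d k x = D (Suc k) x - D k x" for k x
  have [measurable]: "d k \<in> borel_measurable borel" for k unfolding d_def by measurable
  have di: "integrable lborel (d k)" for k
    using step[of k] by (intro integrableI_bounded) (auto simp: d_def intro: le_less_trans)
  have dn: "(\<integral>x. norm (d k x) \<partial>lborel) \<le> c0 * q ^ k" for k
  proof -
    have "ennreal (\<integral>x. norm (d k x) \<partial>lborel) = (\<integral>\<^sup>+x. ennreal (norm (d k x)) \<partial>lborel)"
      using di by (intro nn_integral_eq_integral [symmetric]) auto
    also have "\<dots> \<le> ennreal (c0 * q ^ k)" using step[of k] by (simp add: d_def)
    finally show ?thesis using c0 q by simp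
  qed
  have gs: "summable (\<lambda>k. c0 * q ^ k)" using q by (intro summable_mult summable_geometric) auto
  have sn: "summable (\<lambda>k. \<integral>x. norm (d k x) \<partial>lborel)"
    using dn by (intro summable_comparison_test'[OF gs, of 0]) auto
  have aes: "AE x in lborel. summable (\<lambda>k. norm (d k x))"
  proof -
    have "(\<integral>\<^sup>+x. (\<Sum>k. ennreal (norm (d k x))) \<partial>lborel) = (\<Sum>k. \<integral>\<^sup>+x. ennreal (norm (d k x)) \<partial>lborel)"
      by (rule nn_integral_suminf) measurable
    also have "\<dots> \<le> (\<Sum>k. ennreal (c0 * q ^ k))"
      using step by (intro suminf_le) (auto simp: d_def)
    also have "\<dots> < \<infinity>"
    proof -
      have "(\<Sum>k. ennreal (c0 * q ^ k)) \<noteq> top" by (rule ennreal_suminf_neq_top[OF gs]) (use c0 q in simp)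
      then show ?thesis by (simp add: less_top)
    qed
    finally have "(\<integral>\<^sup>+x. (\<Sum>k. ennreal (norm (d k x))) \<partial>lborel) \<noteq> \<infinity>" by (rule less_imp_neq)
    then have "AE x in lborel. (\<Sum>k. ennreal (norm (d k x))) \<noteq> \<infinity>"
      by (intro nn_integral_PInf_AE) auto
    then show ?thesis by eventually_elim (auto intro!: summable_suminf_not_top)
  qed
  define g where "g x = D 0 x + (\<Sum>k. d k x)" for x
  have gm [measurable]: "g \<in> borel_measurable borel" unfolding g_def by measurable
  have telescope: "(\<Sum>j<k. d j x) = D k x - D 0 x" for k x
    unfolding d_def by (rule sum_lessThan_telescope)
  have lim: "AE x in lborel. (\<lambda>k. D k x) \<longlonglongrightarrow> g x"
    using aes
  proof eventually_elim
    case (elim x)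
    then have "(\<lambda>k. d k x) sums (\<Sum>k. d k x)" by (rule summable_sums[OF summable_norm_cancel])
    then have "(\<lambda>k. D 0 x + (D k x - D 0 x)) \<longlonglongrightarrow> g x"
      unfolding sums_def telescope g_def by (intro tendsto_add tendsto_const)
    then show ?case by simp
  qed
  have "(\<integral>\<^sup>+x\<in>E. ennreal (\<bar>g x\<bar> powr p) \<partial>lborel) \<le> (\<integral>\<^sup>+x. liminf (\<lambda>k. ennreal (\<bar>D k x\<bar> powr p)) \<partial>lborel)"
  proof (rule nn_integral_mono_AE)
    show "AE x in lborel. ennreal (\<bar>g x\<bar> powr p) * indicator E x \<le> liminf (\<lambda>k. ennreal (\<bar>D k x\<bar> powr p))"
      using lim
    proof eventually_elim
      case (elim x)
      then have "(\<lambda>k. ennreal (\<bar>D k x\<bar> powr p)) \<longlonglongrightarrow> ennreal (\<bar>g x\<bar> powr p)"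
        using p by (intro tendsto_ennrealI tendsto_powr' tendsto_rabs tendsto_const) auto
      then have "liminf (\<lambda>k. ennreal (\<bar>D k x\<bar> powr p)) = ennreal (\<bar>g x\<bar> powr p)"
        by (intro lim_imp_Liminf) auto
      then show ?case by (auto simp: indicator_def)
    qed
  qed
  also have "\<dots> \<le> liminf (\<lambda>k. \<integral>\<^sup>+x. ennreal (\<bar>D k x\<bar> powr p) \<partial>lborel)"
    by (rule nn_integral_liminf) measurable
  also have "\<dots> \<le> liminf (\<lambda>k. ennreal (M powr p))"
  proof (intro Liminf_mono always_eventually allI)
    fix k
    have "(\<integral>\<^sup>+x. ennreal (\<bar>D k x\<bar> powr p) \<partial>lborel) = ennreal ((1 / t k) powr p) * diff1 p E f (t k *\<^sub>R i)"
    proof -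
      have "ennreal (\<bar>D k x\<bar> powr p) = ennreal ((1 / t k) powr p) * (ennreal (\<bar>f (x + t k *\<^sub>R i) - f x\<bar> powr p) * indicator E x)" for x
        using t(1)[of k] powr_mult[of "1 / t k" "\<bar>f (x + t k *\<^sub>R i) - f x\<bar>" p]
        by (auto simp: D_def indicator_def ennreal_mult' [symmetric] abs_mult)
      then show ?thesis unfolding diff1_def by (simp add: nn_integral_cmult)
    qed
    also have "\<dots> \<le> ennreal ((1 / t k) powr p) * ennreal ((M * t k) powr p)"
      using d1[OF nt(2), of k] nt(1)[of k] t(2)[of k] by (intro mult_left_mono) auto
    also have "\<dots> = ennreal (M powr p)"
      using t(1)[of k] powr_mult[of "1 / t k" "M * t k" p] by (simp add: ennreal_mult' [symmetric])
    finally show "(\<integral>\<^sup>+x. ennreal (\<bar>D k x\<bar> powr p) \<partial>lborel) \<le> ennreal (M powr p)" .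
  qed
  also have "\<dots> = ennreal (M powr p)" by (rule Liminf_const) simp
  finally have gM: "(\<integral>\<^sup>+x\<in>E. ennreal (\<bar>g x\<bar> powr p) \<partial>lborel) \<le> ennreal (M powr p)" .
  have "(\<integral>x. indicator E x * (f x * frechet_derivative \<phi> (at x) i) \<partial>lborel) = - (\<integral>x. indicator E x * (g x * \<phi> x) \<partial>lborel)"
    if \<phi>: "\<phi> differentiable_on UNIV" "continuous_on UNIV (\<lambda>x. frechet_derivative \<phi> (at x) i)" "compactly_supported_in E \<phi>" for \<phi>
  proof -
    have \<phi>c: "continuous_on UNIV \<phi>" using \<phi>(1) by (rule differentiable_imp_continuous_on)
    have [measurable]: "\<phi> \<in> borel_measurable borel" using \<phi>c by (rule borel_measurable_continuous_onI)
    obtain P0 where P0: "\<And>x. \<bar>\<phi> x\<bar> \<le> P0"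
    proof -
      define S where "S = closure {x. \<phi> x \<noteq> 0}"
      have S: "compact S" using \<phi>(3) by (auto simp: compactly_supported_in_def S_def)
      have "bounded (\<phi> ` S)" using S by (intro compact_imp_bounded compact_continuous_image continuous_on_subset[OF \<phi>c]) auto
      then obtain B where B: "\<And>x. x \<in> S \<Longrightarrow> \<bar>\<phi> x\<bar> \<le> B" by (auto simp: bounded_iff)
      have "\<bar>\<phi> x\<bar> \<le> max B 0" for x
        using B[of x] closure_subset[of "{x. \<phi> x \<noteq> 0}"] by (cases "\<phi> x = 0") (auto simp: S_def)
      then show ?thesis using that by blast
    qed
    have D0i: "integrable lborel (D 0)"
    proof (rule integrableI_bounded_set[of E _ _ "(L + L) / t 0"])
      show "AE x in lborel. x \<in> E \<longrightarrow> norm (D 0 x) \<le> (L + L) / t 0"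
      proof (intro AE_I2 impI)
        fix x assume x: "x \<in> E"
        have "\<bar>f (x + t 0 *\<^sub>R i) - f x\<bar> \<le> L + L"
          using bd[OF x, of 0] bd[OF x, of "t 0 *\<^sub>R i"] nt(1)[of 0] t(2)[of 0] \<delta> by auto
        then show "norm (D 0 x) \<le> (L + L) / t 0" using x t(1)[of 0] by (simp add: D_def divide_right_mono)
      qed
    qed (use Efin in \<open>auto simp: D_def\<close>)
    have mi: "integrable lborel (\<lambda>x. v x * \<phi> x)" if "integrable lborel v" for v
    proof (rule Bochner_Integration.integrable_bound[of _ "\<lambda>x. P0 * v x"])
      show "AE x in lborel. norm (v x * \<phi> x) \<le> norm (P0 * v x)"
      proof (rule AE_I2)
        fix x
        have "\<bar>\<phi> x\<bar> \<le> \<bar>P0\<bar>" using P0[of x] by linarith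
        then show "norm (v x * \<phi> x) \<le> norm (P0 * v x)" by (simp add: abs_mult mult.commute mult_right_mono)
      qed
    qed (use that in \<open>auto dest: borel_measurable_integrable\<close>)
    have dsum: "integrable lborel (\<lambda>x. \<Sum>k. d k x)"
      by (rule integrable_suminf[OF di aes sn])
    have sn': "summable (\<lambda>k. \<integral>x. norm (d k x * \<phi> x) \<partial>lborel)"
    proof (rule summable_comparison_test'[of "\<lambda>k. \<bar>P0\<bar> * (\<integral>x. norm (d k x) \<partial>lborel)" 0])
      show "summable (\<lambda>k. \<bar>P0\<bar> * (\<integral>x. norm (d k x) \<partial>lborel))" using sn by (rule summable_mult)
      fix k
      have "(\<integral>x. norm (d k x * \<phi> x) \<partial>lborel) \<le> (\<integral>x. \<bar>P0\<bar> * norm (d k x) \<partial>lborel)"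
      proof (rule integral_mono)
        show "integrable lborel (\<lambda>x. norm (d k x * \<phi> x))" using mi[OF di] by (rule integrable_norm)
        show "norm (d k x * \<phi> x) \<le> \<bar>P0\<bar> * norm (d k x)" for x
          using P0[of x] by (simp add: abs_mult mult.commute mult_right_mono)
      qed (use di in auto)
      then show "norm (\<integral>x. norm (d k x * \<phi> x) \<partial>lborel) \<le> \<bar>P0\<bar> * (\<integral>x. norm (d k x) \<partial>lborel)" by simp
    qed
    have aes': "AE x in lborel. summable (\<lambda>k. norm (d k x * \<phi> x))"
      using aes by eventually_elim (auto simp: abs_mult intro: summable_mult2)
    have "(\<lambda>k. \<integral>x. d k x * \<phi> x \<partial>lborel) sums (\<integral>x. (\<Sum>k. d k x * \<phi> x) \<partial>lborel)"
      by (rule sums_integral[OF mi[OF di] aes' sn'])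
    also have "(\<integral>x. (\<Sum>k. d k x * \<phi> x) \<partial>lborel) = (\<integral>x. (\<Sum>k. d k x) * \<phi> x \<partial>lborel)"
    proof (rule integral_cong_AE)
      show "AE x in lborel. (\<Sum>k. d k x * \<phi> x) = (\<Sum>k. d k x) * \<phi> x"
        using aes by eventually_elim (rule suminf_mult2 [symmetric, OF summable_norm_cancel])
    qed measurable
    finally have "(\<lambda>k. (\<integral>x. D 0 x * \<phi> x \<partial>lborel) + (\<Sum>j<k. \<integral>x. d j x * \<phi> x \<partial>lborel)) \<longlonglongrightarrow>
        (\<integral>x. D 0 x * \<phi> x \<partial>lborel) + (\<integral>x. (\<Sum>k. d k x) * \<phi> x \<partial>lborel)"
      unfolding sums_def by (intro tendsto_add tendsto_const)
    moreover have "(\<integral>x. D 0 x * \<phi> x \<partial>lborel) + (\<Sum>j<k. \<integral>x. d j x * \<phi> x \<partial>lborel) = (\<integral>x. D k x * \<phi> x \<partial>lborel)" for k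
    proof -
      have "(\<Sum>j<k. \<integral>x. d j x * \<phi> x \<partial>lborel) = (\<integral>x. (\<Sum>j<k. d j x * \<phi> x) \<partial>lborel)"
        using mi[OF di] by (intro Bochner_Integration.integral_sum [symmetric]) auto
      also have "(\<lambda>x. \<Sum>j<k. d j x * \<phi> x) = (\<lambda>x. (\<Sum>j<k. d j x) * \<phi> x)" by (simp add: sum_distrib_right)
      finally have "(\<integral>x. D 0 x * \<phi> x \<partial>lborel) + (\<Sum>j<k. \<integral>x. d j x * \<phi> x \<partial>lborel)
         = (\<integral>x. D 0 x * \<phi> x + (\<Sum>j<k. d j x) * \<phi> x \<partial>lborel)"
        using mi[OF D0i] di by (simp add: Bochner_Integration.integral_add mi)
      then show ?thesis by (simp add: telescope algebra_simps)
    qed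
    moreover have "(\<integral>x. D 0 x * \<phi> x \<partial>lborel) + (\<integral>x. (\<Sum>k. d k x) * \<phi> x \<partial>lborel) = (\<integral>x. g x * \<phi> x \<partial>lborel)"
      using mi[OF D0i] mi[OF dsum] by (simp add: g_def distrib_right)
    ultimately have "(\<lambda>k. \<integral>x. D k x * \<phi> x \<partial>lborel) \<longlonglongrightarrow> (\<integral>x. g x * \<phi> x \<partial>lborel)" by simp
    moreover have "(\<lambda>k. \<integral>x. D k x * \<phi> x \<partial>lborel)
     \<longlonglongrightarrow> - (\<integral>x. indicator E x * (f x * frechet_derivative \<phi> (at x) i) \<partial>lborel)"
      unfolding D_def by (rule difference_quotient_integral_tendsto[OF fm E \<delta> bd i t(1,2) t0 \<phi>])
    ultimately have "(\<integral>x. g x * \<phi> x \<partial>lborel) = - (\<integral>x. indicator E x * (f x * frechet_derivative \<phi> (at x) i) \<partial>lborel)"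
      by (rule LIMSEQ_unique)
    moreover have z: "(\<lambda>x. indicator E x * (g x * \<phi> x)) = (\<lambda>x. g x * \<phi> x)"
      using \<phi>(3) closure_subset[of "{x. \<phi> x \<noteq> 0}"] by (auto simp: fun_eq_iff compactly_supported_in_def indicator_def)
    ultimately show ?thesis unfolding z by simp
  qed
  then show ?thesis using that gm gM by blast
qed

section \<open>Smooth test functions and uniqueness of the weak gradient\<close>

text \<open>
  The functions \<open>P (1 / t) * exp (- 1 / t)\<close>, extended by 0, form a family that is closed under differentiation,
  and \<open>P = 1\<close> is the usual smooth function that is flat at 0.
\<close>

definition flat_exp :: "real poly \<Rightarrow> real \<Rightarrow> real" where
  "flat_exp P t = (if 0 < t then poly P (1 / t) * exp (- (1 / t)) else 0)"

lemma poly_times_exp_tendsto_0: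
  fixes P :: "real poly"
  shows "((\<lambda>y. poly P y * exp (- y)) \<longlongrightarrow> 0) at_top"
proof -
  have "((\<lambda>y. \<Sum>i\<le>degree P. coeff P i * (y ^ i / exp y)) \<longlongrightarrow> (\<Sum>i\<le>degree P. coeff P i * 0)) at_top"
    by (intro tendsto_sum tendsto_mult tendsto_const tendsto_power_div_exp_0)
  then show ?thesis
    by (simp add: poly_altdef sum_distrib_right exp_minus divide_inverse mult.assoc)
qed

text \<open>
  At 0 the difference quotient is \<open>Q (1 / t) * exp (- 1 / t)\<close> for the polynomial \<open>Q y = y * P y\<close>, and this
  tends to 0.
\<close>

lemma flat_exp_derivative:
  "(flat_exp P has_real_derivative flat_exp ([:0, 0, 1:] * (P - pderiv P)) t) (at t)"
proof (cases t "0::real" rule: linorder_cases)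
  case less
  have "eventually (\<lambda>s. s \<in> {..<0}) (nhds t)" using less by (intro eventually_nhds_in_open) auto
  then have ev: "eventually (\<lambda>s. flat_exp P s = 0) (nhds t)"
    by eventually_elim (simp add: flat_exp_def)
  have "((\<lambda>_. 0) has_real_derivative 0) (at t)" by simp
  then have "(flat_exp P has_real_derivative 0) (at t)"
    using DERIV_cong_ev[OF refl ev refl] by simp
  then show ?thesis using less by (simp add: flat_exp_def)
next
  case greater
  have "eventually (\<lambda>s. s \<in> {0<..}) (nhds t)" using greater by (intro eventually_nhds_in_open) auto
  then have ev: "eventually (\<lambda>s. flat_exp P s = poly P (1 / s) * exp (- (1 / s))) (nhds t)"
    by eventually_elim (simp add: flat_exp_def)
  have "((\<lambda>s. poly P (1 / s) * exp (- (1 / s))) has_real_derivative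
      (poly (pderiv P) (1 / t) * (- (1 / t\<^sup>2))) * exp (- (1 / t)) + exp (- (1 / t)) * (1 / t\<^sup>2) * poly P (1 / t)) (at t)"
    using greater by (auto intro!: derivative_eq_intros DERIV_chain'[OF _ poly_DERIV] simp: power2_eq_square field_simps)
  moreover have "(poly (pderiv P) (1 / t) * (- (1 / t\<^sup>2))) * exp (- (1 / t)) + exp (- (1 / t)) * (1 / t\<^sup>2) * poly P (1 / t)
      = flat_exp ([:0, 0, 1:] * (P - pderiv P)) t"
    using greater by (simp add: flat_exp_def power2_eq_square field_simps)
  ultimately show ?thesis using DERIV_cong_ev[OF refl ev refl] by simp
next
  case equal
  have "((\<lambda>y. poly ([:0, 1:] * P) y * exp (- y)) \<longlongrightarrow> 0) at_top" by (rule poly_times_exp_tendsto_0)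
  then have "((\<lambda>s. poly ([:0, 1:] * P) (inverse s) * exp (- inverse s)) \<longlongrightarrow> 0) (at_right 0)"
    by (rule filterlim_compose[OF _ filterlim_inverse_at_top_right])
  moreover have "eventually (\<lambda>s. poly ([:0, 1:] * P) (inverse s) * exp (- inverse s) = flat_exp P s / s) (at_right (0::real))"
    using eventually_at_right_less[of 0]
    by eventually_elim (simp add: flat_exp_def field_simps)
  ultimately have "((\<lambda>s. flat_exp P s / s) \<longlongrightarrow> 0) (at_right 0)"
    by (rule Lim_transform_eventually)
  moreover have "((\<lambda>s. flat_exp P s / s) \<longlongrightarrow> 0) (at_left 0)"
  proof (rule Lim_transform_eventually[OF tendsto_const])
    show "eventually (\<lambda>s. 0 = flat_exp P s / s) (at_left 0)"
      by (auto simp: eventually_at_filter flat_exp_def)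
  qed
  ultimately have "((\<lambda>s. flat_exp P s / s) \<longlongrightarrow> 0) (at 0)" by (simp add: filterlim_split_at)
  then show ?thesis using equal by (simp add: has_field_derivative_iff flat_exp_def)
qed

text \<open>
  An algebra of functions that is large enough for bump functions and closed under directional derivatives
  (\<open>smooth_class_derivative\<close>). Differentiability of all orders then follows by a single induction.
\<close>

inductive_set smooth_class :: "('a::euclidean_space \<Rightarrow> real) set" where
  const: "(\<lambda>_. c) \<in> smooth_class"
| coord: "(\<lambda>x. x \<bullet> v) \<in> smooth_class"
| add: "f \<in> smooth_class \<Longrightarrow> g \<in> smooth_class \<Longrightarrow> (\<lambda>x. f x + g x) \<in> smooth_class"
| mult: "f \<in> smooth_class \<Longrightarrow> g \<in> smooth_class \<Longrightarrow> (\<lambda>x. f x * g x) \<in> smooth_class"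
| flat: "f \<in> smooth_class \<Longrightarrow> (\<lambda>x. flat_exp P (f x)) \<in> smooth_class"

lemma smooth_class_derivative:
  assumes "f \<in> smooth_class"
  shows "\<exists>F. (\<forall>x. (f has_derivative F x) (at x)) \<and> (\<forall>j. (\<lambda>x. F x j) \<in> smooth_class)"
  using assms
proof induction
  case (const c)
  show ?case by (intro exI[of _ "\<lambda>_ _. 0"]) (auto intro: smooth_class.const)
next
  case (coord v)
  show ?case by (intro exI[of _ "\<lambda>_ j. j \<bullet> v"]) (auto intro!: smooth_class.const derivative_eq_intros)
next
  case (add f g)
  then obtain F G where "\<And>x. (f has_derivative F x) (at x)" "\<And>j. (\<lambda>x. F x j) \<in> smooth_class"
    "\<And>x. (g has_derivative G x) (at x)" "\<And>j. (\<lambda>x. G x j) \<in> smooth_class" by metis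
  then show ?case
    by (intro exI[of _ "\<lambda>x j. F x j + G x j"]) (auto intro!: smooth_class.add has_derivative_add)
next
  case (mult f g)
  then obtain F G where FG: "\<And>x. (f has_derivative F x) (at x)" "\<And>j. (\<lambda>x. F x j) \<in> smooth_class"
    "\<And>x. (g has_derivative G x) (at x)" "\<And>j. (\<lambda>x. G x j) \<in> smooth_class" by metis
  show ?case
  proof (intro exI[of _ "\<lambda>x j. f x * G x j + F x j * g x"] conjI allI)
    show "((\<lambda>x. f x * g x) has_derivative (\<lambda>j. f x * G x j + F x j * g x)) (at x)" for x
      by (rule has_derivative_mult[OF FG(1,3)])
    show "(\<lambda>x. f x * G x j + F x j * g x) \<in> smooth_class" for j
      by (intro smooth_class.add smooth_class.mult FG mult.hyps)
  qed
next
  case (flat f P)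
  then obtain F where F: "\<And>x. (f has_derivative F x) (at x)" "\<And>j. (\<lambda>x. F x j) \<in> smooth_class" by metis
  show ?case
  proof (intro exI[of _ "\<lambda>x j. flat_exp ([:0, 0, 1:] * (P - pderiv P)) (f x) * F x j"] conjI allI)
    show "((\<lambda>x. flat_exp P (f x)) has_derivative (\<lambda>j. flat_exp ([:0, 0, 1:] * (P - pderiv P)) (f x) * F x j)) (at x)" for x
      using has_derivative_compose[OF F(1), of "flat_exp P" "(*) (flat_exp ([:0, 0, 1:] * (P - pderiv P)) (f x))" x]
        flat_exp_derivative[of P "f x"] by (simp add: has_field_derivative_def)
    show "(\<lambda>x. flat_exp ([:0, 0, 1:] * (P - pderiv P)) (f x) * F x j) \<in> smooth_class" for j
      by (intro smooth_class.mult smooth_class.flat F flat.hyps)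
  qed
qed

lemma smooth_class_cont_diff: "f \<in> smooth_class \<Longrightarrow> cont_diff k f"
proof (induction k arbitrary: f)
  case 0
  obtain F where "\<And>x. (f has_derivative F x) (at x)" using smooth_class_derivative[OF 0] by blast
  then have "f differentiable_on UNIV" by (auto simp: differentiable_on_def differentiable_def)
  then show ?case by (simp add: differentiable_imp_continuous_on)
next
  case (Suc k)
  obtain F where F: "\<And>x. (f has_derivative F x) (at x)" "\<And>j. (\<lambda>x. F x j) \<in> smooth_class"
    using smooth_class_derivative[OF Suc.prems] by blast
  have "frechet_derivative f (at x) = F x" for x by (rule frechet_derivative_at [symmetric, OF F(1)])
  then show ?case using F Suc.IH by (auto simp: differentiable_on_def differentiable_def)
qed

lemma smooth_class_prod:
  assumes "finite I" "\<And>i. i \<in> I \<Longrightarrow> f i \<in> smooth_class"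
  shows "(\<lambda>x. \<Prod>i\<in>I. f i x) \<in> smooth_class"
  using assms
proof (induction I rule: finite_induct)
  case empty
  then show ?case by (simp add: smooth_class.const)
next
  case (insert i I)
  then show ?case by (simp add: smooth_class.mult)
qed

text \<open>
  As \<open>n\<close> grows the arguments of the flat functions become large inside the box, so these bumps increase to
  the indicator of the box while their supports remain inside it.
\<close>

definition box_bump :: "'a::euclidean_space \<Rightarrow> 'a \<Rightarrow> nat \<Rightarrow> 'a \<Rightarrow> real" where
  "box_bump a b n x = (\<Prod>i\<in>Basis. flat_exp 1 (real (Suc n) * (x \<bullet> i - a \<bullet> i)) * flat_exp 1 (real (Suc n) * (b \<bullet> i - x \<bullet> i)))"

lemma box_bump_smooth: "box_bump a b n \<in> smooth_class"
proof -
  have lin: "(\<lambda>x. real (Suc n) * (x \<bullet> i - c)) \<in> smooth_class" "(\<lambda>x. real (Suc n) * (c - x \<bullet> i)) \<in> smooth_class" for i :: 'a and c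
  proof -
    have "(\<lambda>x. real (Suc n) * (x \<bullet> i + - c)) \<in> smooth_class"
      by (intro smooth_class.mult smooth_class.add smooth_class.const smooth_class.coord)
    then show "(\<lambda>x. real (Suc n) * (x \<bullet> i - c)) \<in> smooth_class" by simp
    have "(\<lambda>x. real (Suc n) * (c + x \<bullet> (- i))) \<in> smooth_class"
      by (intro smooth_class.mult smooth_class.add smooth_class.const smooth_class.coord)
    then show "(\<lambda>x. real (Suc n) * (c - x \<bullet> i)) \<in> smooth_class" by simp
  qed
  have "(\<lambda>x. \<Prod>i\<in>Basis. flat_exp 1 (real (Suc n) * (x \<bullet> i - a \<bullet> i)) * flat_exp 1 (real (Suc n) * (b \<bullet> i - x \<bullet> i))) \<in> smooth_class"
    by (intro smooth_class_prod smooth_class.mult smooth_class.flat lin) auto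
  then show ?thesis unfolding box_bump_def[abs_def] .
qed

lemma flat_exp_1: "0 \<le> flat_exp 1 t" "flat_exp 1 t \<le> 1" "flat_exp 1 t \<noteq> 0 \<longleftrightarrow> 0 < t"
  by (auto simp: flat_exp_def)

lemma box_bump_nonzero: "box_bump a b n x \<noteq> 0 \<longleftrightarrow> x \<in> box a b"
  by (auto simp: box_bump_def flat_exp_1 mem_box zero_less_mult_iff)

lemma box_bump_bounds: "0 \<le> box_bump a b n x" "box_bump a b n x \<le> 1"
  unfolding box_bump_def by (auto intro!: prod_nonneg prod_le_1 mult_le_one simp: flat_exp_1)

lemma flat_exp_1_tendsto:
  assumes "0 < c"
  shows "(\<lambda>n. flat_exp 1 (real (Suc n) * c)) \<longlonglongrightarrow> 1"
proof -
  have "(\<lambda>n. exp (- (1 / real (Suc n) * (1 / c)))) \<longlonglongrightarrow> exp (- (0 * (1 / c)))"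
    using LIMSEQ_Suc[OF lim_1_over_n] by (intro tendsto_intros) (simp add: field_simps)
  moreover have "flat_exp 1 (real (Suc n) * c) = exp (- (1 / real (Suc n) * (1 / c)))" for n
    using assms by (simp add: flat_exp_def zero_less_mult_iff)
  ultimately show ?thesis by simp
qed

lemma box_bump_tendsto: "(\<lambda>n. box_bump a b n x) \<longlonglongrightarrow> indicator (box a b) x"
proof (cases "x \<in> box a b")
  case True
  have "(\<lambda>n. box_bump a b n x) \<longlonglongrightarrow> (\<Prod>i\<in>(Basis::'a set). 1 * 1)"
    unfolding box_bump_def using True by (intro tendsto_prod tendsto_mult flat_exp_1_tendsto) (auto simp: mem_box)
  then show ?thesis using True by simp
next
  case False
  then have "box_bump a b n x = 0" for n using box_bump_nonzero[of a b n x] by blast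
  then show ?thesis using False by simp
qed

lemma box_bump_test_function:
  assumes "cbox a b \<subseteq> E"
  shows "smooth_test_function E (box_bump a b n)"
proof -
  have "{x. box_bump a b n x \<noteq> 0} = box a b" by (auto simp: box_bump_nonzero)
  moreover have "closure (box a b) \<subseteq> cbox a b" by (intro closure_minimal box_subset_cbox closed_cbox)
  moreover from this have "compact (closure (box a b))"
    by (meson closed_closure compact_Int_closed compact_cbox compact_closure bounded_box)
  ultimately show ?thesis using assms
    by (auto simp: smooth_test_function_def compactly_supported_in_def smooth_class_cont_diff box_bump_smooth)
qed

text \<open>
  The positive and the negative part of \<open>v\<close> are densities of two finite measures that agree on boxes. Boxes
  generate the Borel sets and are stable under intersection, so the measures, and with them the
  densities, agree.
\<close>

lemma AE_zero_if_box_integrals_zero: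
  fixes v :: "'a::euclidean_space \<Rightarrow> real"
  assumes vi: "integrable lborel v" and zero: "\<And>a b. (\<integral>x. indicator (box a b) x * v x \<partial>lborel) = 0"
  shows "AE x in lborel. v x = 0"
proof -
  have [measurable]: "v \<in> borel_measurable borel" using borel_measurable_integrable[OF vi] by simp
  define P where "P x = ennreal (max 0 (v x))" for x
  define N where "N x = ennreal (max 0 (- v x))" for x
  have [measurable]: "P \<in> borel_measurable borel" "N \<in> borel_measurable borel" unfolding P_def N_def by measurable
  have pn: "integrable lborel (\<lambda>x. max 0 (v x))" "integrable lborel (\<lambda>x. max 0 (- v x))" using vi by auto
  have eqbox: "emeasure (density lborel P) (box a b) = emeasure (density lborel N) (box a b)" for a b
  proof -
    have i1: "integrable lborel (\<lambda>x. indicator (box a b) x * max 0 (v x))"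
      "integrable lborel (\<lambda>x. indicator (box a b) x * max 0 (- v x))"
      using integrable_mult_indicator[of "box a b" lborel, OF _ pn(1)]
        integrable_mult_indicator[of "box a b" lborel, OF _ pn(2)] by simp_all
    have "(\<integral>x. indicator (box a b) x * v x \<partial>lborel) = (\<integral>x. indicator (box a b) x * max 0 (v x) - indicator (box a b) x * max 0 (- v x) \<partial>lborel)"
      by (intro Bochner_Integration.integral_cong) (auto simp: max_def indicator_def)
    then have eq: "(\<integral>x. indicator (box a b) x * max 0 (v x) \<partial>lborel) = (\<integral>x. indicator (box a b) x * max 0 (- v x) \<partial>lborel)"
      using zero i1 by simp
    have "emeasure (density lborel P) (box a b) = (\<integral>\<^sup>+x. ennreal (indicator (box a b) x * max 0 (v x)) \<partial>lborel)"
      by (subst emeasure_density) (auto intro!: nn_integral_cong simp: P_def indicator_def)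
    also have "\<dots> = ennreal (\<integral>x. indicator (box a b) x * max 0 (v x) \<partial>lborel)"
      using i1 by (intro nn_integral_eq_integral) auto
    also have "\<dots> = (\<integral>\<^sup>+x. ennreal (indicator (box a b) x * max 0 (- v x)) \<partial>lborel)"
      unfolding eq using i1 by (intro nn_integral_eq_integral [symmetric]) auto
    also have "\<dots> = emeasure (density lborel N) (box a b)"
      by (subst emeasure_density) (auto intro!: nn_integral_cong simp: N_def indicator_def)
    finally show ?thesis .
  qed
  have Pfin: "emeasure (density lborel P) A \<noteq> \<infinity>" for A
  proof -
    have "emeasure (density lborel P) A \<le> emeasure (density lborel P) (space (density lborel P))" by (rule emeasure_space)
    also have "\<dots> = (\<integral>\<^sup>+x. P x \<partial>lborel)" by (subst emeasure_density) auto
    also have "\<dots> = ennreal (\<integral>x. max 0 (v x) \<partial>lborel)"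
      unfolding P_def using pn by (intro nn_integral_eq_integral) auto
    also have "\<dots> < \<infinity>" by simp
    finally show ?thesis by simp
  qed
  have "density lborel P = density lborel N"
  proof (rule measure_eqI_generator_eq)
    let ?E = "range (\<lambda>(a, b). box a b :: 'a set)"
    show "Int_stable ?E" by (auto simp: Int_stable_def box_Int_box)
    show "?E \<subseteq> Pow UNIV" "sets (density lborel P) = sigma_sets UNIV ?E" "sets (density lborel N) = sigma_sets UNIV ?E"
      by (simp_all add: borel_eq_box)
    let ?A = "\<lambda>n::nat. box (- (real n *\<^sub>R One)) (real n *\<^sub>R One) :: 'a set"
    show "range ?A \<subseteq> ?E" "(\<Union>i. ?A i) = UNIV" unfolding UN_box_eq_UNIV by auto
    show "emeasure (density lborel P) (?A i) \<noteq> \<infinity>" for i by (rule Pfin)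
    show "emeasure (density lborel P) X = emeasure (density lborel N) X" if "X \<in> ?E" for X
      using that eqbox by auto
  qed
  then have "AE x in lborel. P x = N x" by (intro sigma_finite_measure.density_unique[OF sigma_finite_lborel]) auto
  then show ?thesis
  proof eventually_elim
    case (elim x)
    then show ?case by (auto simp: P_def N_def max_def split: if_splits)
  qed
qed

text \<open>
  Testing with the bumps of a box and dominated convergence show that \<open>v\<close> has integral 0 over every box
  whose closure lies in \<open>E\<close>; so \<open>v\<close> vanishes on it, and \<open>E\<close> is a countable union of closed boxes.
\<close>

lemma fundamental_lemma_calculus_of_variations:
  fixes v :: "'a::euclidean_space \<Rightarrow> real"
  assumes vm [measurable]: "v \<in> borel_measurable borel" and E: "open E"
    and li: "\<And>a b. cbox a b \<subseteq> E \<Longrightarrow> integrable lborel (\<lambda>x. indicator (cbox a b) x * v x)"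
    and zero: "\<And>\<phi>. smooth_test_function E \<phi> \<Longrightarrow> (\<integral>x. indicator E x * (v x * \<phi> x) \<partial>lborel) = 0"
  shows "AE x in lborel. x \<in> E \<longrightarrow> v x = 0"
proof -
  have box0: "(\<integral>x. indicator (box a b) x * v x \<partial>lborel) = 0" if ab: "cbox a b \<subseteq> E" for a b
  proof -
    have "(\<lambda>n. \<integral>x. indicator (cbox a b) x * v x * box_bump a b n x \<partial>lborel)
        \<longlonglongrightarrow> (\<integral>x. indicator (cbox a b) x * v x * indicator (box a b) x \<partial>lborel)"
    proof (rule integral_dominated_convergence[where w = "\<lambda>x. norm (indicator (cbox a b) x * v x)"])
      have "continuous_on UNIV (box_bump a b n)" for n
        using smooth_class_cont_diff[OF box_bump_smooth, of 0 a b n] by simp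
      then have [measurable]: "box_bump a b n \<in> borel_measurable borel" for n
        by (rule borel_measurable_continuous_onI)
      show "(\<lambda>x. indicator (cbox a b) x * v x * box_bump a b n x) \<in> borel_measurable lborel" for n by measurable
      show "integrable lborel (\<lambda>x. norm (indicator (cbox a b) x * v x))" using li[OF ab] by (rule integrable_norm)
      show "AE x in lborel. (\<lambda>n. indicator (cbox a b) x * v x * box_bump a b n x) \<longlonglongrightarrow> indicator (cbox a b) x * v x * indicator (box a b) x"
        by (intro AE_I2 tendsto_mult tendsto_const box_bump_tendsto)
      show "AE x in lborel. norm (indicator (cbox a b) x * v x * box_bump a b n x) \<le> norm (indicator (cbox a b) x * v x)" for n
        using box_bump_bounds[of a b n] by (intro AE_I2) (simp add: abs_mult mult_left_le)
    qed measurable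
    moreover have "(\<lambda>x. indicator (cbox a b) x * v x * box_bump a b n x) = (\<lambda>x. indicator E x * (v x * box_bump a b n x))" for n
    proof (rule ext)
      fix x
      show "indicator (cbox a b) x * v x * box_bump a b n x = indicator E x * (v x * box_bump a b n x)"
        using box_bump_nonzero[of a b n x] box_subset_cbox[of a b] ab
        by (cases "x \<in> box a b") (auto simp: indicator_def)
    qed
    ultimately have "(\<lambda>n. 0) \<longlonglongrightarrow> (\<integral>x. indicator (cbox a b) x * v x * indicator (box a b) x \<partial>lborel)"
      using zero[OF box_bump_test_function[OF ab]] by simp
    then have "(\<integral>x. indicator (cbox a b) x * v x * indicator (box a b) x \<partial>lborel) = 0"
      by (simp add: LIMSEQ_const_iff)
    moreover have "(\<lambda>x. indicator (cbox a b) x * v x * indicator (box a b) x) = (\<lambda>x. indicator (box a b) x * v x)"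
      using box_subset_cbox[of a b] by (auto simp: indicator_def fun_eq_iff)
    ultimately show ?thesis by simp
  qed
  have cb: "AE x in lborel. x \<in> cbox a b \<longrightarrow> v x = 0" if ab: "cbox a b \<subseteq> E" for a b
  proof -
    have "AE x in lborel. indicator (cbox a b) x * v x = 0"
    proof (rule AE_zero_if_box_integrals_zero[OF li[OF ab]])
      fix c d
      \<comment> \<open>The intersection of two boxes is the box with these corners.\<close>
      define a' where "a' = (\<Sum>i\<in>Basis. max (a \<bullet> i) (c \<bullet> i) *\<^sub>R i)"
      define b' where "b' = (\<Sum>i\<in>Basis. min (b \<bullet> i) (d \<bullet> i) *\<^sub>R i)"
      have "cbox a' b' \<subseteq> cbox a b" by (auto simp: a'_def b'_def mem_box)
      with ab have "(\<integral>x. indicator (box a' b') x * v x \<partial>lborel) = 0" by (intro box0) auto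
      moreover have "AE x in lborel. indicator (box c d) x * (indicator (cbox a b) x * v x) = indicator (box a' b') x * v x"
      proof -
        have "negligible (cbox a b - box a b)" by (rule negligible_frontier_interval)
        then have "cbox a b - box a b \<in> null_sets lborel"
          by (simp add: negligible_iff_null_sets null_sets_completion_iff)
        then have "AE x in lborel. x \<notin> cbox a b - box a b" by (rule AE_not_in)
        then show ?thesis
        proof eventually_elim
          case (elim x)
          have "x \<in> box c d \<and> x \<in> box a b \<longleftrightarrow> x \<in> box a' b'"
            by (auto simp: a'_def b'_def mem_box)
          then show ?case using elim box_subset_cbox[of a b] by (auto simp: indicator_def)
        qed
      qed
      ultimately show "(\<integral>x. indicator (box c d) x * (indicator (cbox a b) x * v x) \<partial>lborel) = 0"
        by (subst integral_cong_AE[where g = "\<lambda>x. indicator (box a' b') x * v x"]) auto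
    qed
    then show ?thesis by eventually_elim (auto simp: indicator_def split: if_splits)
  qed
  obtain \<D> where D: "countable \<D>" "\<And>X. X \<in> \<D> \<Longrightarrow> \<exists>a b. X = cbox a b" "\<Union>\<D> = E"
    using open_countable_Union_open_cbox[OF E] by (metis (no_types, lifting))
  have "AE x in lborel. \<forall>X\<in>\<D>. x \<in> X \<longrightarrow> v x = 0"
  proof (subst AE_ball_countable[OF D(1)], rule ballI)
    fix X assume X: "X \<in> \<D>"
    then obtain a b where "X = cbox a b" using D(2) by blast
    moreover have "X \<subseteq> E" using X D(3) by auto
    ultimately show "AE x in lborel. x \<in> X \<longrightarrow> v x = 0" using cb by blast
  qed
  then show ?thesis
  proof eventually_elim
    case (elim x)
    then show ?case using D(3) by blast
  qed
qed

section \<open>Reduction to the unit ball\<close>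

text \<open>
  The solution concept speaks of Lebesgue measurable functions and the completed measure, whereas product
  measures and translations are handled with Borel functions. This and the next lemma pass from \<open>w\<close> to a
  Borel version \<open>F\<close>.
\<close>

lemma lebesgue_borel_version_integral:
  fixes w F :: "'a::euclidean_space \<Rightarrow> real"
  assumes F: "F \<in> borel_measurable borel" and ae: "AE x in lborel. w x = F x" and w: "integrable lebesgue w"
  shows "integrable lborel F" "integral\<^sup>L lebesgue w = integral\<^sup>L lborel F"
proof -
  have Fl: "F \<in> borel_measurable lborel" using F by simp
  have Fm: "F \<in> borel_measurable lebesgue" using Fl by (rule measurable_completion)
  have ae': "AE x in lebesgue. w x = F x" using ae by (rule AE_completion)
  have "integrable lebesgue F" by (rule integrable_cong_AE_imp[OF w Fm ae'])
  then show "integrable lborel F" using integrable_completion[OF Fl] by simp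
  have "integral\<^sup>L lebesgue w = integral\<^sup>L lebesgue F"
    by (rule integral_cong_AE[OF borel_measurable_integrable[OF w] Fm ae'])
  then show "integral\<^sup>L lebesgue w = integral\<^sup>L lborel F" by (simp add: integral_completion[OF Fl])
qed

lemma lebesgue_borel_version_nn_integral:
  fixes w F :: "'a::euclidean_space \<Rightarrow> real"
  assumes F: "F \<in> borel_measurable borel" and ae: "AE x in lborel. w x = F x" and w: "integrable lebesgue w"
    and nn: "\<And>x. 0 \<le> F x"
  shows "(\<integral>\<^sup>+x. ennreal (F x) \<partial>lborel) = ennreal (integral\<^sup>L lebesgue w)"
  using lebesgue_borel_version_integral[OF F ae w] nn by (simp add: nn_integral_eq_integral)

lemma AE_lborel_pair:
  fixes P :: "'a::euclidean_space \<Rightarrow> bool"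
  assumes "AE x in lborel. P x"
  shows "AE z in (lborel :: ('a \<times> 'a) measure). P (fst z) \<and> P (snd z)"
proof -
  obtain N where N: "N \<in> null_sets lborel" "{x. \<not> P x} \<subseteq> N" using assms by (auto simp: eventually_ae_filter)
  have "N \<times> UNIV \<in> null_sets (lborel \<Otimes>\<^sub>M (lborel :: 'a measure))" "UNIV \<times> N \<in> null_sets ((lborel :: 'a measure) \<Otimes>\<^sub>M lborel)"
    using N(1) by (auto simp: lborel.times_in_null_sets1 lborel.times_in_null_sets2)
  then have "N \<times> UNIV \<union> UNIV \<times> N \<in> null_sets (lborel :: ('a \<times> 'a) measure)"
    unfolding lborel_prod by (rule null_sets.Un)
  then have "AE z in (lborel :: ('a \<times> 'a) measure). z \<notin> N \<times> UNIV \<union> UNIV \<times> N" by (rule AE_not_in)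
  then show ?thesis by eventually_elim (use N(2) in auto)
qed

text \<open>
  The two volume elements and the kernel are homogeneous of total degree \<open>2 * N - (N + s * p)\<close>.
\<close>

lemma gagliardo_affine:
  fixes f :: "'a::euclidean_space \<Rightarrow> real"
  assumes [measurable]: "f \<in> borel_measurable borel" "B \<in> sets borel" and R: "0 < R"
    and B': "\<And>y. y \<in> B' \<longleftrightarrow> x0 + R *\<^sub>R y \<in> B"
  shows "gagliardo s p B f = ennreal (R powr (real DIM('a) - s * p)) * gagliardo s p B' (\<lambda>y. f (x0 + R *\<^sub>R y))"
proof -
  define F where "F = (\<lambda>(x, y). ennreal (indicator B x * indicator B y * \<bar>f x - f y\<bar> powr p * kern s p (x - y)))"
  have Fm: "F \<in> borel_measurable borel" unfolding F_def borel_prod [symmetric] by measurable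
  have dim: "\<bar>R\<bar> ^ DIM('a \<times> 'a) = R powr (2 * real DIM('a))"
    using R by (simp add: powr_realpow [symmetric] powr_add [symmetric] power_add)
  have B'm [measurable]: "B' \<in> sets borel"
  proof -
    have "B' = (\<lambda>y. x0 + R *\<^sub>R y) -` B \<inter> space borel" using B' by auto
    moreover have "(\<lambda>y. x0 + R *\<^sub>R y) \<in> borel_measurable borel" by measurable
    ultimately show ?thesis using measurable_sets assms(2) by metis
  qed
  have "gagliardo s p B f = (\<integral>\<^sup>+z. F z \<partial>lborel)" by (simp add: gagliardo_def F_def lborel_prod)
  also have "\<dots> = ennreal (R powr (2 * real DIM('a))) * (\<integral>\<^sup>+z. F ((x0, x0) + R *\<^sub>R z) \<partial>lborel)"
    unfolding dim [symmetric] using R by (intro nn_integral_affine[OF Fm]) auto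
  also have "(\<integral>\<^sup>+z. F ((x0, x0) + R *\<^sub>R z) \<partial>lborel) = (\<integral>\<^sup>+z. ennreal (R powr (- (real DIM('a) + s * p))) *
     (case z of (x, y) \<Rightarrow> ennreal (indicator B' x * indicator B' y * \<bar>f (x0 + R *\<^sub>R x) - f (x0 + R *\<^sub>R y)\<bar> powr p * kern s p (x - y))) \<partial>(lborel \<Otimes>\<^sub>M lborel))"
    unfolding lborel_prod
  proof (rule nn_integral_cong)
    fix z :: "'a \<times> 'a"
    obtain x y where z: "z = (x, y)" by (cases z)
    have k: "kern s p (R *\<^sub>R x - R *\<^sub>R y) = R powr (- (real DIM('a) + s * p)) * kern s p (x - y)"
      using kern_scale[OF R, of s p "x - y"] by (simp add: scaleR_diff_right)
    have "F ((x0, x0) + R *\<^sub>R z) = ennreal (indicator B' x * indicator B' y * \<bar>f (x0 + R *\<^sub>R x) - f (x0 + R *\<^sub>R y)\<bar> powr p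
        * (R powr (- (real DIM('a) + s * p)) * kern s p (x - y)))"
      unfolding F_def z by (simp add: k indicator_def B')
    also have "\<dots> = ennreal (R powr (- (real DIM('a) + s * p)) * (indicator B' x * indicator B' y * \<bar>f (x0 + R *\<^sub>R x) - f (x0 + R *\<^sub>R y)\<bar> powr p * kern s p (x - y)))"
      by (simp add: mult_ac)
    finally show "F ((x0, x0) + R *\<^sub>R z) = ennreal (R powr (- (real DIM('a) + s * p))) *
     (case z of (x, y) \<Rightarrow> ennreal (indicator B' x * indicator B' y * \<bar>f (x0 + R *\<^sub>R x) - f (x0 + R *\<^sub>R y)\<bar> powr p * kern s p (x - y)))"
      by (simp add: z ennreal_mult')
  qed
  also have "\<dots> = ennreal (R powr (- (real DIM('a) + s * p))) * gagliardo s p B' (\<lambda>y. f (x0 + R *\<^sub>R y))"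
    unfolding gagliardo_def by (rule nn_integral_cmult) measurable
  also have "ennreal (R powr (2 * real DIM('a))) * (ennreal (R powr (- (real DIM('a) + s * p))) * gagliardo s p B' (\<lambda>y. f (x0 + R *\<^sub>R y)))
     = ennreal (R powr (2 * real DIM('a)) * R powr (- (real DIM('a) + s * p))) * gagliardo s p B' (\<lambda>y. f (x0 + R *\<^sub>R y))"
    by (simp add: ennreal_mult' mult.assoc)
  also have "R powr (2 * real DIM('a)) * R powr (- (real DIM('a) + s * p)) = R powr (real DIM('a) - s * p)"
    unfolding powr_add [symmetric] by (simp add: algebra_simps)
  finally show ?thesis .
qed

lemma gagliardo_divide:
  fixes f :: "'a::euclidean_space \<Rightarrow> real"
  assumes [measurable]: "f \<in> borel_measurable borel" "B \<in> sets borel" and l: "0 < l"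
  shows "gagliardo s p B (\<lambda>x. f x / l) = ennreal (l powr (- p)) * gagliardo s p B f"
  unfolding gagliardo_def
proof (subst nn_integral_cmult [symmetric])
  have "\<bar>f x / l - f y / l\<bar> powr p = l powr (- p) * \<bar>f x - f y\<bar> powr p" for x y
    using l by (simp add: diff_divide_distrib [symmetric] powr_divide powr_minus field_simps)
  then show "(\<integral>\<^sup>+(x, y). ennreal (indicator B x * indicator B y * \<bar>f x / l - f y / l\<bar> powr p * kern s p (x - y)) \<partial>(lborel \<Otimes>\<^sub>M lborel))
    = (\<integral>\<^sup>+z. ennreal (l powr (- p)) * (case z of (x, y) \<Rightarrow> ennreal (indicator B x * indicator B y * \<bar>f x - f y\<bar> powr p * kern s p (x - y))) \<partial>(lborel \<Otimes>\<^sub>M lborel))"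
    by (intro nn_integral_cong) (auto simp: ennreal_mult' [symmetric] mult_ac split: prod.splits)
qed measurable

lemma kern_eq_inverse: "kern s p (z :: 'a::euclidean_space) = 1 / norm z powr (real DIM('a) + s * p)"
  by (simp only: kern_def powr_minus_divide)

lemma gagliardo_kernel_eq: "gagliardo_kernel s p w (x, y) = \<bar>w x - w y\<bar> powr p * kern s p (x - y)"
  by (simp add: gagliardo_kernel_def kern_eq_inverse)

lemma gagliardo_eq_seminorm:
  fixes u f :: "'a::euclidean_space \<Rightarrow> real"
  assumes u: "u \<in> frac_sobolev s p B" and [measurable]: "f \<in> borel_measurable borel" "B \<in> sets borel"
    and ae: "AE x in lborel. u x = f x" and p: "0 < p"
  shows "gagliardo s p B f = ennreal (gagliardo_seminorm s p B u powr p)"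
proof -
  define F where "F = (\<lambda>(x, y). indicator B x * indicator B y * \<bar>f x - f y\<bar> powr p * kern s p (x - y))"
  have Fm: "F \<in> borel_measurable borel" unfolding F_def borel_prod [symmetric] by measurable
  define w where "w = (\<lambda>z. indicator (B \<times> B) z *\<^sub>R gagliardo_kernel s p u z)"
  have wi: "integrable lebesgue w" using u by (simp add: frac_sobolev_def set_integrable_def w_def)
  have wF: "AE z in lborel. w z = F z"
    using AE_lborel_pair[OF ae]
  proof eventually_elim
    case (elim z)
    then show ?case by (cases z) (simp add: w_def F_def gagliardo_kernel_eq indicator_times)
  qed
  have "gagliardo s p B f = (\<integral>\<^sup>+z. ennreal (F z) \<partial>lborel)"
    by (simp add: gagliardo_def F_def lborel_prod case_prod_beta')
  also have "\<dots> = ennreal (integral\<^sup>L lebesgue w)"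
    by (rule lebesgue_borel_version_nn_integral[OF Fm wF wi]) (auto simp: F_def split: prod.splits)
  also have "integral\<^sup>L lebesgue w = gagliardo_seminorm s p B u powr p"
  proof -
    have "0 \<le> integral\<^sup>L lebesgue w"
      by (intro integral_nonneg_AE AE_I2) (auto simp: w_def gagliardo_kernel_def split: prod.splits)
    moreover have "(LINT z:B \<times> B|lebesgue. gagliardo_kernel s p u z) = integral\<^sup>L lebesgue w"
      by (simp add: set_lebesgue_integral_def w_def)
    ultimately show ?thesis
      using p by (simp add: gagliardo_seminorm_def powr_powr)
  qed
  finally show ?thesis .
qed

text \<open>
  Membership in the local space gives measurability on balls only; countably many of them cover the space.
\<close>

lemma tail_space_measurable:
  fixes u :: "'a::euclidean_space \<Rightarrow> real"
  assumes "u \<in> tail_space s p"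
  shows "u \<in> borel_measurable lebesgue"
proof (rule measurable_piecewise_restrict[of "range (\<lambda>n::nat. ball (0::'a) (real (Suc n)))"])
  show "space lebesgue \<subseteq> \<Union> (range (\<lambda>n::nat. ball (0::'a) (real (Suc n))))"
  proof
    fix x :: 'a
    obtain n where "norm x < real n" using reals_Archimedean2 by blast
    then have "x \<in> ball 0 (real (Suc n))" by simp
    then show "x \<in> \<Union> (range (\<lambda>n::nat. ball (0::'a) (real (Suc n))))" by blast
  qed
  fix \<Omega> :: "'a set" assume "\<Omega> \<in> range (\<lambda>n::nat. ball (0::'a) (real (Suc n)))"
  then obtain n where n: "\<Omega> = ball 0 (real (Suc n))" by blast
  show "\<Omega> \<inter> space lebesgue \<in> sets lebesgue" unfolding n by simp
  show "u \<in> borel_measurable (lebesgue_on \<Omega>)"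
    using assms unfolding n tail_space_def local_space_def Lp_space_def by auto
qed simp

text \<open>
  The norm is the real part of an extended real number, so finiteness and nonnegativity of the essential
  supremum have to be established first; the latter uses that the ball has positive measure.
\<close>

lemma Linf_norm_bound:
  assumes "u \<in> Linf_space (ball x0 R)" and R: "0 < R"
  shows "AE x in lborel. x \<in> ball (x0::'a::euclidean_space) R \<longrightarrow> \<bar>u x\<bar> \<le> Linf_norm (ball x0 R) u" "0 \<le> Linf_norm (ball x0 R) u"
proof -
  define e where "e = esssup (lebesgue_on (ball x0 R)) (\<lambda>x. ereal \<bar>u x\<bar>)"
  have e: "e < \<infinity>" and um: "u \<in> borel_measurable (lebesgue_on (ball x0 R))"
    using assms by (auto simp: Linf_space_def e_def)
  have "0 = esssup (lebesgue_on (ball x0 R)) (\<lambda>x. 0::ereal)"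
  proof (rule esssup_const [symmetric])
    have "emeasure (lebesgue_on (ball x0 R)) (space (lebesgue_on (ball x0 R))) = ennreal (measure lborel (ball x0 R))"
      using R by (simp add: emeasure_restrict_space emeasure_ball content_ball)
    then show "emeasure (lebesgue_on (ball x0 R)) (space (lebesgue_on (ball x0 R))) \<noteq> 0" using R by simp
  qed
  also have "\<dots> \<le> e" unfolding e_def using um by (intro esssup_mono) auto
  finally have e0: "0 \<le> e" .
  then obtain r where r: "e = ereal r" "0 \<le> r" using e by (cases e) auto
  have L: "Linf_norm (ball x0 R) u = r" using r by (simp add: Linf_norm_def e_def [symmetric])
  show "0 \<le> Linf_norm (ball x0 R) u" using r L by simp
  have "AE x in lebesgue_on (ball x0 R). ereal \<bar>u x\<bar> \<le> e" unfolding e_def by (rule esssup_AE)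
  then have "AE x in lebesgue. x \<in> ball x0 R \<longrightarrow> ereal \<bar>u x\<bar> \<le> e"
    by (subst (asm) AE_restrict_space_iff) auto
  then have "AE x in lborel. x \<in> ball x0 R \<longrightarrow> ereal \<bar>u x\<bar> \<le> e" by (simp add: AE_completion_iff)
  then show "AE x in lborel. x \<in> ball x0 R \<longrightarrow> \<bar>u x\<bar> \<le> Linf_norm (ball x0 R) u" by (simp add: r L)
qed

text \<open>
  Off the ball, \<open>1 + norm x\<close> is at most a multiple of \<open>norm (x - x0)\<close>, so the tail integral converges.
  The substitution \<open>x = x0 + R y\<close> then turns it into the tail of the rescaled function, and the powers
  of \<open>R\<close> agree with those in the definition of the tail.
\<close>

lemma tail_scaled:
  fixes u f :: "'a::euclidean_space \<Rightarrow> real"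
  assumes u: "u \<in> tail_space s p" and fm [measurable]: "f \<in> borel_measurable borel" and ae: "AE x in lborel. u x = f x"
    and s: "0 < s" and p: "2 \<le> p" and R: "0 < R" and l: "0 < l" and T: "Tail s p u x0 R \<le> l"
  shows "(\<integral>\<^sup>+y\<in>- ball 0 1. ennreal (\<bar>f (x0 + R *\<^sub>R y) / l\<bar> powr (p - 1) * kern s p y) \<partial>lborel) \<le> 1"
proof -
  define \<beta> where "\<beta> = real DIM('a) + s * p"
  have \<beta>: "0 < \<beta>" using s p by (simp add: \<beta>_def add_pos_pos)
  have [measurable]: "ball (y::'a) r \<in> sets borel" for y r by simp
  define w where "w = (\<lambda>x. indicator (- ball x0 R) x *\<^sub>R (\<bar>u x\<bar> powr (p - 1) / norm (x - x0) powr \<beta>))"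
  define F where "F = (\<lambda>x. indicator (- ball x0 R) x * (\<bar>f x\<bar> powr (p - 1) * kern s p (x - x0)))"
  have Fm [measurable]: "F \<in> borel_measurable borel" unfolding F_def by measurable
  have wF: "AE x in lborel. w x = F x"
    using ae by eventually_elim (simp add: w_def F_def kern_eq_inverse \<beta>_def)
  have um: "u \<in> borel_measurable lebesgue" using u by (rule tail_space_measurable)
  have wi: "integrable lebesgue w"
  proof (rule Bochner_Integration.integrable_bound)
    define C where "C = ((1 + norm x0) / R + 1) powr \<beta>"
    show "integrable lebesgue (\<lambda>x. C * (\<bar>u x\<bar> powr (p - 1) / (1 + norm x) powr \<beta>))"
      using u by (intro integrable_mult_right) (simp add: tail_space_def \<beta>_def)
    have bm: "(\<lambda>x. norm (x - x0) powr \<beta>) \<in> borel_measurable lebesgue"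
      by (rule measurable_completion) simp
    show "w \<in> borel_measurable lebesgue"
    proof -
      note [measurable] = um bm
      have [measurable]: "- ball x0 R \<in> sets lebesgue" by simp
      show ?thesis unfolding w_def by measurable
    qed
    show "AE x in lebesgue. norm (w x) \<le> norm (C * (\<bar>u x\<bar> powr (p - 1) / (1 + norm x) powr \<beta>))"
    proof (rule AE_I2)
      fix x
      show "norm (w x) \<le> norm (C * (\<bar>u x\<bar> powr (p - 1) / (1 + norm x) powr \<beta>))"
      proof (cases "x \<in> ball x0 R")
        case False
        then have n: "R \<le> norm (x - x0)" by (simp add: dist_norm norm_minus_commute)
        have "norm x \<le> norm (x - x0) + norm x0" using norm_triangle_ineq[of "x - x0" x0] by simp
        moreover have "1 + norm x0 \<le> (1 + norm x0) / R * norm (x - x0)"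
          using n R mult_left_mono[OF n, of "(1 + norm x0) / R"] by simp
        ultimately have "1 + norm x \<le> ((1 + norm x0) / R + 1) * norm (x - x0)" by (simp add: distrib_right)
        then have "(1 + norm x) powr \<beta> \<le> (((1 + norm x0) / R + 1) * norm (x - x0)) powr \<beta>"
          using \<beta> by (intro powr_mono2) auto
        also have "\<dots> = C * norm (x - x0) powr \<beta>" by (simp add: C_def powr_mult)
        finally have le: "(1 + norm x) powr \<beta> \<le> C * norm (x - x0) powr \<beta>" .
        have pos: "0 < (1 + norm x) powr \<beta>" "0 < norm (x - x0) powr \<beta>"
          using n R by (auto simp: add_pos_nonneg) (smt (verit) norm_ge_zero)
        have "1 / norm (x - x0) powr \<beta> \<le> C / (1 + norm x) powr \<beta>"
          using le pos by (simp add: field_simps)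
        then have "\<bar>u x\<bar> powr (p - 1) * (1 / norm (x - x0) powr \<beta>) \<le> \<bar>u x\<bar> powr (p - 1) * (C / (1 + norm x) powr \<beta>)"
          by (intro mult_left_mono) auto
        then show ?thesis using False by (simp add: w_def C_def mult.commute)
      qed (simp add: w_def)
    qed
  qed
  have I: "(\<integral>\<^sup>+x. ennreal (F x) \<partial>lborel) = ennreal (integral\<^sup>L lebesgue w)"
    by (rule lebesgue_borel_version_nn_integral[OF Fm wF wi]) (simp add: F_def)
  have w0: "0 \<le> integral\<^sup>L lebesgue w"
    by (intro integral_nonneg_AE AE_I2) (simp add: w_def)
  have "R powr (s * p) * integral\<^sup>L lebesgue w = Tail s p u x0 R powr (p - 1)"
    using w0 p by (simp add: Tail_def set_lebesgue_integral_def w_def \<beta>_def powr_powr)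
  also have "\<dots> \<le> l powr (p - 1)" using T p by (intro powr_mono2) (auto simp: Tail_def)
  finally have TI: "R powr (s * p) * integral\<^sup>L lebesgue w \<le> l powr (p - 1)" .
  define v where "v = (\<lambda>y. ennreal (\<bar>f (x0 + R *\<^sub>R y) / l\<bar> powr (p - 1) * kern s p y) * indicator (- ball 0 1) y)"
  have [measurable]: "v \<in> borel_measurable borel" unfolding v_def by measurable
  have "(\<integral>\<^sup>+x. ennreal (F x) \<partial>lborel) = ennreal (R powr real DIM('a)) * (\<integral>\<^sup>+y. ennreal (F (x0 + R *\<^sub>R y)) \<partial>lborel)"
    using nn_integral_affine[of "\<lambda>x. ennreal (F x)" R x0] R by (simp add: powr_realpow)
  also have "(\<integral>\<^sup>+y. ennreal (F (x0 + R *\<^sub>R y)) \<partial>lborel) = (\<integral>\<^sup>+y. ennreal (l powr (p - 1) * R powr (- \<beta>)) * v y \<partial>lborel)"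
  proof (rule nn_integral_cong)
    fix y :: 'a
    have b: "x0 + R *\<^sub>R y \<in> ball x0 R \<longleftrightarrow> y \<in> ball 0 1" using R by (simp add: dist_norm)
    have "\<bar>f (x0 + R *\<^sub>R y)\<bar> powr (p - 1) = l powr (p - 1) * \<bar>f (x0 + R *\<^sub>R y) / l\<bar> powr (p - 1)"
      using l powr_mult[of l "\<bar>f (x0 + R *\<^sub>R y)\<bar> / l" "p - 1"] by simp
    moreover have "kern s p (R *\<^sub>R y) = R powr (- \<beta>) * kern s p y" using kern_scale[OF R, of s p y] by (simp add: \<beta>_def)
    ultimately have "F (x0 + R *\<^sub>R y) = l powr (p - 1) * R powr (- \<beta>) * (indicator (- ball 0 1) y * (\<bar>f (x0 + R *\<^sub>R y) / l\<bar> powr (p - 1) * kern s p y))"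
      unfolding F_def using b by (simp add: indicator_def mult_ac)
    then show "ennreal (F (x0 + R *\<^sub>R y)) = ennreal (l powr (p - 1) * R powr (- \<beta>)) * v y"
      by (auto simp: v_def ennreal_mult' indicator_def)
  qed
  also have "\<dots> = ennreal (l powr (p - 1) * R powr (- \<beta>)) * (\<integral>\<^sup>+y. v y \<partial>lborel)"
    by (rule nn_integral_cmult) measurable
  also have "ennreal (R powr real DIM('a)) * (ennreal (l powr (p - 1) * R powr (- \<beta>)) * (\<integral>\<^sup>+y. v y \<partial>lborel))
     = ennreal (R powr real DIM('a) * (l powr (p - 1) * R powr (- \<beta>))) * (\<integral>\<^sup>+y. v y \<partial>lborel)"
    by (simp add: ennreal_mult' mult.assoc)
  also have "R powr real DIM('a) * (l powr (p - 1) * R powr (- \<beta>)) = l powr (p - 1) * R powr (- (s * p))"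
  proof -
    have "R powr real DIM('a) * R powr (- \<beta>) = R powr (- (s * p))"
      unfolding powr_add [symmetric] by (simp add: \<beta>_def)
    then show ?thesis by (simp add: mult.left_commute)
  qed
  finally have "ennreal (l powr (p - 1) * R powr (- (s * p))) * (\<integral>\<^sup>+y. v y \<partial>lborel) \<le> ennreal (integral\<^sup>L lebesgue w)"
    unfolding I by simp
  then have "(\<integral>\<^sup>+y. v y \<partial>lborel) \<le> ennreal (1 / (l powr (p - 1) * R powr (- (s * p)))) * ennreal (integral\<^sup>L lebesgue w)"
    using l R by (intro ennreal_le_multD) auto
  also have "\<dots> = ennreal (1 / (l powr (p - 1) * R powr (- (s * p))) * integral\<^sup>L lebesgue w)"
    by (subst ennreal_mult') auto
  also have "1 / (l powr (p - 1) * R powr (- (s * p))) * integral\<^sup>L lebesgue w = (R powr (s * p) * integral\<^sup>L lebesgue w) / l powr (p - 1)"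
    by (simp add: powr_minus field_simps)
  also have "ennreal \<dots> \<le> ennreal 1" using TI l by (intro ennreal_leI) simp
  finally show ?thesis by (simp add: v_def)
qed

text \<open>
  The equation is invariant under translation, dilation and multiplication by constants, because \<open>Jp\<close> and the
  kernel are homogeneous. A test function on the unit ball is transported to \<open>\<Omega>\<close> by the inverse map.
\<close>

lemma weak_formulation_scaled:
  fixes u f :: "'a::euclidean_space \<Rightarrow> real"
  assumes u: "local_weak_solution s p \<Omega> u" and fm [measurable]: "f \<in> borel_measurable borel" and ae: "AE x in lborel. u x = f x"
    and \<Omega>: "open \<Omega>" "bounded \<Omega>" and p: "2 \<le> p" and R: "0 < R" "cball x0 R \<subseteq> \<Omega>" and l: "0 < l"
    and \<phi>m [measurable]: "\<phi> \<in> borel_measurable borel" and r: "r < 1" "\<And>x. r \<le> norm x \<Longrightarrow> \<phi> x = 0"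
    and \<phi>2: "\<And>x. \<bar>\<phi> x\<bar> \<le> 2" and \<phi>g: "gagliardo s p UNIV \<phi> < \<infinity>"
  shows "has_bochner_integral (lborel \<Otimes>\<^sub>M lborel)
     (\<lambda>(x, y). Jp p (f (x0 + R *\<^sub>R x) / l - f (x0 + R *\<^sub>R y) / l) * (\<phi> x - \<phi> y) * kern s p (x - y)) 0"
proof -
  define \<psi> where "\<psi> x = \<phi> ((1 / R) *\<^sub>R (x - x0))" for x
  have \<psi>m [measurable]: "\<psi> \<in> borel_measurable borel" unfolding \<psi>_def by measurable
  have \<psi>\<phi>: "\<psi> (x0 + R *\<^sub>R y) = \<phi> y" for y using R by (simp add: \<psi>_def)
  have om: "\<Omega> \<in> sets lborel" using \<Omega> by simp
  have supp: "compactly_supported_in \<Omega> \<psi>"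
  proof -
    have "{x. \<psi> x \<noteq> 0} \<subseteq> cball x0 R"
    proof
      fix x assume "x \<in> {x. \<psi> x \<noteq> 0}"
      then have "norm ((1 / R) *\<^sub>R (x - x0)) < r" using r(2)[of "(1 / R) *\<^sub>R (x - x0)"] by (force simp: \<psi>_def)
      then have "norm (x - x0) / R < r" using R by simp
      then have "norm (x - x0) / R < 1" using r by linarith
      then show "x \<in> cball x0 R" using R by (simp add: dist_norm norm_minus_commute)
    qed
    then have "closure {x. \<psi> x \<noteq> 0} \<subseteq> cball x0 R" by (intro closure_minimal) auto
    then show ?thesis unfolding compactly_supported_in_def using R
      by (meson bounded_cball bounded_subset closed_closure compact_eq_bounded_closed order_trans)
  qed
  have fin: "emeasure lborel \<Omega> < \<infinity>" using \<Omega> by (intro emeasure_bounded_finite)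
  have Lp: "\<psi> \<in> Lp_space p \<Omega>"
  proof -
    have m: "\<psi> \<in> borel_measurable lebesgue" using \<psi>m by (intro measurable_completion) simp
    have "integrable lborel (\<lambda>x. indicator \<Omega> x *\<^sub>R (norm (\<psi> x) powr p))"
    proof (rule integrableI_bounded_set[of \<Omega> _ _ "2 powr p"])
      show "AE x in lborel. x \<in> \<Omega> \<longrightarrow> norm (indicator \<Omega> x *\<^sub>R (norm (\<psi> x) powr p)) \<le> 2 powr p"
        using \<phi>2 p by (intro AE_I2) (auto simp: \<psi>_def intro!: powr_mono2)
    qed (use om fin in auto)
    moreover have "(\<lambda>x. indicator \<Omega> x *\<^sub>R (norm (\<psi> x) powr p)) \<in> borel_measurable lborel" using om by measurable
    ultimately have "integrable lebesgue (\<lambda>x. indicator \<Omega> x *\<^sub>R (norm (\<psi> x) powr p))" by (simp add: integrable_completion)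
    then show ?thesis using m by (simp add: Lp_space_def set_integrable_def measurable_restrict_space1)
  qed
  have gag: "set_integrable lebesgue (\<Omega> \<times> \<Omega>) (gagliardo_kernel s p \<psi>)"
  proof -
    define F where "F = (\<lambda>z. indicator (\<Omega> \<times> \<Omega>) z *\<^sub>R gagliardo_kernel s p \<psi> z)"
    have Feq: "F = (\<lambda>(x, y). indicator \<Omega> x * indicator \<Omega> y * \<bar>\<psi> x - \<psi> y\<bar> powr p * kern s p (x - y))"
      by (auto simp: F_def fun_eq_iff gagliardo_kernel_eq indicator_times)
    have [measurable]: "\<Omega> \<in> sets borel" using \<Omega> by simp
    have Fm: "F \<in> borel_measurable borel" unfolding Feq borel_prod [symmetric] by measurable
    have "integrable lborel F"
    proof (rule integrableI_bounded)
      have "(\<integral>\<^sup>+z. ennreal (norm (F z)) \<partial>lborel) = gagliardo s p \<Omega> \<psi>"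
        unfolding Feq gagliardo_def lborel_prod by (intro nn_integral_cong) (auto split: prod.splits)
      also have "\<dots> \<le> gagliardo s p UNIV \<psi>" by (rule gagliardo_mono) simp
      also have "\<dots> = ennreal (R powr (real DIM('a) - s * p)) * gagliardo s p UNIV \<phi>"
        using gagliardo_affine[of \<psi> UNIV R UNIV x0 s p] R by (simp add: \<psi>\<phi>)
      also have "\<dots> < \<infinity>" using \<phi>g by (simp add: ennreal_mult_less_top)
      finally show "(\<integral>\<^sup>+z. ennreal (norm (F z)) \<partial>lborel) < \<infinity>" .
    qed (use Fm in simp)
    then have "integrable lebesgue F" using Fm by (simp add: integrable_completion)
    then show ?thesis by (simp add: set_integrable_def F_def)
  qed
  have "\<psi> \<in> frac_sobolev s p \<Omega>" using Lp gag by (simp add: frac_sobolev_def)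
  with u supp have weak: "has_bochner_integral lebesgue
      (\<lambda>(x, y). \<bar>u x - u y\<bar> powr (p - 2) * (u x - u y) * (\<psi> x - \<psi> y) / norm (x - y) powr (real DIM('a) + s * p)) 0"
    (is "has_bochner_integral _ ?w 0")
    unfolding local_weak_solution_def by blast
  define F where "F = (\<lambda>(x, y). Jp p (f x - f y) * (\<psi> x - \<psi> y) * kern s p (x - y))"
  have Fm: "F \<in> borel_measurable borel" unfolding F_def borel_prod [symmetric] by measurable
  have wF: "AE z in lborel. ?w z = F z"
    using AE_lborel_pair[OF ae]
  proof eventually_elim
    case (elim z)
    then show ?case by (cases z) (simp add: F_def Jp_def kern_eq_inverse)
  qed
  have "has_bochner_integral lborel F 0"
    using lebesgue_borel_version_integral[OF Fm wF] weak by (simp add: has_bochner_integral_iff)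
  then have "has_bochner_integral lborel (\<lambda>z. F ((x0, x0) + R *\<^sub>R z)) (0 / \<bar>R\<bar> ^ DIM('a \<times> 'a))"
    by (rule has_bochner_integral_affine) (use R in simp)
  then have h: "has_bochner_integral lborel (\<lambda>z. F ((x0, x0) + R *\<^sub>R z)) 0" by simp
  define k where "k = 1 / (l powr (p - 1) * R powr (- (real DIM('a) + s * p)))"
  have "has_bochner_integral lborel (\<lambda>z. k * F ((x0, x0) + R *\<^sub>R z)) (k * 0)"
    using h by (intro has_bochner_integral_mult_right) auto
  moreover have "(\<lambda>z. k * F ((x0, x0) + R *\<^sub>R z)) =
     (\<lambda>(x, y). Jp p (f (x0 + R *\<^sub>R x) / l - f (x0 + R *\<^sub>R y) / l) * (\<phi> x - \<phi> y) * kern s p (x - y))"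
  proof (rule ext)
    fix z :: "'a \<times> 'a"
    obtain x y where z: "z = (x, y)" by (cases z)
    define a where "a = f (x0 + R *\<^sub>R x) - f (x0 + R *\<^sub>R y)"
    have J: "Jp p a = l powr (p - 1) * Jp p (a / l)"
    proof -
      have "\<bar>a\<bar> powr (p - 2) = l powr (p - 2) * \<bar>a / l\<bar> powr (p - 2)"
        using l powr_mult[of l "\<bar>a\<bar> / l" "p - 2"] by simp
      moreover have "l powr (p - 1) = l powr (p - 2) * l"
        using l powr_add[of l "p - 2" 1] by simp
      ultimately show ?thesis using l by (simp add: Jp_def)
    qed
    have K: "kern s p (x0 + R *\<^sub>R x - (x0 + R *\<^sub>R y)) = R powr (- (real DIM('a) + s * p)) * kern s p (x - y)"
      using kern_scale[OF R(1), of s p "x - y"] by (simp add: scaleR_diff_right)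
    have "F ((x0, x0) + R *\<^sub>R z) = Jp p a * (\<phi> x - \<phi> y) * (R powr (- (real DIM('a) + s * p)) * kern s p (x - y))"
      unfolding K [symmetric] by (simp add: F_def z \<psi>\<phi> a_def)
    also have "\<dots> = (l powr (p - 1) * R powr (- (real DIM('a) + s * p))) * (Jp p (a / l) * (\<phi> x - \<phi> y) * kern s p (x - y))"
      unfolding J by simp
    finally have "k * F ((x0, x0) + R *\<^sub>R z) = Jp p (a / l) * (\<phi> x - \<phi> y) * kern s p (x - y)"
      using l R by (simp add: k_def)
    then show "k * F ((x0, x0) + R *\<^sub>R z) = (case z of (x, y) \<Rightarrow> Jp p (f (x0 + R *\<^sub>R x) / l - f (x0 + R *\<^sub>R y) / l) * (\<phi> x - \<phi> y) * kern s p (x - y))"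
      by (simp add: z a_def diff_divide_distrib)
  qed
  ultimately show ?thesis by (simp add: lborel_prod)
qed

text \<open>
  Division by any \<open>l\<close> that dominates the bound, the tail and the scale invariant seminorm of \<open>u\<close> normalises the
  solution. The function \<open>f\<close> is a Borel version of \<open>u\<close>.
\<close>

lemma reduction_to_unit_ball:
  fixes u :: "'a::euclidean_space \<Rightarrow> real"
  assumes p: "2 \<le> p" and s: "0 < s" "s < 1" and \<Omega>: "open \<Omega>" "bounded \<Omega>"
    and ub: "u \<in> local_space Linf_space \<Omega>" and u: "local_weak_solution s p \<Omega> u"
    and R: "0 < R" "cball x0 R \<subseteq> \<Omega>" and l: "0 < l" "Linf_norm (ball x0 R) u \<le> l" "Tail s p u x0 R \<le> l"
      "R powr (s - real DIM('a) / p) * (1 - s) powr (1 / p) * gagliardo_seminorm s p (ball x0 R) u \<le> l"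
  obtains f where "f \<in> borel_measurable borel" "AE x in lborel. u x = f x" "\<And>x. x \<in> ball x0 R \<Longrightarrow> \<bar>f x\<bar> \<le> l"
    "unit_solution s p (\<lambda>y. f (x0 + R *\<^sub>R y) / l)"
proof -
  have [measurable]: "ball (y::'a) r \<in> sets borel" for y r by simp
  have ts: "u \<in> tail_space s p" and ls: "u \<in> local_space (frac_sobolev s p) \<Omega>"
    using u by (auto simp: local_weak_solution_def)
  have uB: "u \<in> frac_sobolev s p (ball x0 R)" "u \<in> Linf_space (ball x0 R)"
    using ls ub R by (auto simp: local_space_def)
  have "u \<in> borel_measurable lebesgue" using ts by (rule tail_space_measurable)
  then obtain f0 where f0: "f0 \<in> borel_measurable lborel" "AE x in lborel. u x = f0 x"
    using completion_ex_borel_measurable_real by blast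
  have [measurable]: "f0 \<in> borel_measurable borel" using f0(1) by simp
  \<comment> \<open>The bound by l holds almost everywhere only. Setting f to 0 where it fails changes a null set.\<close>
  define f where "f x = (if x \<in> ball x0 R \<and> l < \<bar>f0 x\<bar> then 0 else f0 x)" for x
  have fm [measurable]: "f \<in> borel_measurable borel" unfolding f_def by measurable
  have ae: "AE x in lborel. u x = f x"
    using f0(2) Linf_norm_bound(1)[OF uB(2) R(1)]
    by eventually_elim (use l in \<open>auto simp: f_def\<close>)
  have fl: "\<bar>f x\<bar> \<le> l" if "x \<in> ball x0 R" for x using that l by (auto simp: f_def)
  define v where "v y = f (x0 + R *\<^sub>R y) / l" for y
  have vm: "v \<in> borel_measurable borel" unfolding v_def by measurable
  have b: "x0 + R *\<^sub>R y \<in> ball x0 R \<longleftrightarrow> y \<in> ball 0 1" for y using R by (simp add: dist_norm)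
  have p0: "0 < p" using p by simp
  have "unit_solution s p v"
    unfolding unit_solution_def
  proof (intro conjI vm)
    show "\<forall>x\<in>ball 0 1. \<bar>v x\<bar> \<le> 1"
    proof
      fix y :: 'a assume "y \<in> ball 0 1"
      then have "\<bar>f (x0 + R *\<^sub>R y)\<bar> \<le> l" using b fl by blast
      then show "\<bar>v y\<bar> \<le> 1" using l by (simp add: v_def)
    qed
    show "(\<integral>\<^sup>+y\<in>- ball 0 1. ennreal (\<bar>v y\<bar> powr (p - 1) * kern s p y) \<partial>lborel) \<le> 1"
      unfolding v_def by (rule tail_scaled[OF ts fm ae s(1) p R(1) l(1) l(3)])
    show "ennreal (1 - s) * gagliardo s p (ball 0 1) v \<le> 1"
    proof -
      define S where "S = gagliardo_seminorm s p (ball x0 R) u"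
      have S0: "0 \<le> S" by (simp add: S_def gagliardo_seminorm_def)
      define g1 where "g1 = gagliardo s p (ball 0 1) (\<lambda>y. f (x0 + R *\<^sub>R y))"
      have "ennreal (S powr p) = gagliardo s p (ball x0 R) f"
        unfolding S_def by (rule gagliardo_eq_seminorm [symmetric, OF uB(1) fm _ ae p0]) simp
      also have "\<dots> = ennreal (R powr (real DIM('a) - s * p)) * g1"
        unfolding g1_def using b by (intro gagliardo_affine[OF fm _ R(1)]) auto
      finally have "g1 \<le> ennreal (1 / R powr (real DIM('a) - s * p)) * ennreal (S powr p)"
        using R by (intro ennreal_le_multD) auto
      then have "ennreal (1 - s) * gagliardo s p (ball 0 1) v \<le> ennreal (1 - s) * (ennreal (l powr (- p)) * (ennreal (1 / R powr (real DIM('a) - s * p)) * ennreal (S powr p)))"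
        unfolding v_def g1_def by (subst gagliardo_divide) (use l in \<open>auto intro!: mult_left_mono\<close>)
      also have "\<dots> = ennreal ((1 - s) * (l powr (- p) * (1 / R powr (real DIM('a) - s * p) * S powr p)))"
      proof -
        have nn: "0 \<le> 1 - s" "0 \<le> l powr (- p)" "0 \<le> 1 / R powr (real DIM('a) - s * p)" using s by auto
        show ?thesis by (simp only: ennreal_mult'[OF nn(1)] ennreal_mult'[OF nn(2)] ennreal_mult'[OF nn(3)])
      qed
      also have "\<dots> \<le> ennreal 1"
      proof (rule ennreal_leI)
        have "(R powr (s - real DIM('a) / p) * (1 - s) powr (1 / p) * S) powr p \<le> l powr p"
          using l S0 p s by (intro powr_mono2) (auto simp: S_def)
        also have "(R powr (s - real DIM('a) / p) * (1 - s) powr (1 / p) * S) powr p = R powr (s * p - real DIM('a)) * (1 - s) * S powr p"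
          using p s by (simp add: powr_mult powr_powr left_diff_distrib)
        finally have le: "R powr (s * p - real DIM('a)) * (1 - s) * S powr p \<le> l powr p" .
        have "1 / R powr (real DIM('a) - s * p) = R powr (s * p - real DIM('a))"
          using powr_minus_divide[of R "real DIM('a) - s * p"] by simp
        then have "(1 - s) * (l powr (- p) * (1 / R powr (real DIM('a) - s * p) * S powr p)) = (R powr (s * p - real DIM('a)) * (1 - s) * S powr p) / l powr p"
          by (simp add: powr_minus divide_inverse mult_ac)
        also have "\<dots> \<le> 1" using le l by simp
        finally show "(1 - s) * (l powr (- p) * (1 / R powr (real DIM('a) - s * p) * S powr p)) \<le> 1" .
      qed
      finally show ?thesis by simp
    qed
    show "\<forall>\<phi> r. \<phi> \<in> borel_measurable borel \<and> r < 1 \<and> (\<forall>x. r \<le> norm x \<longrightarrow> \<phi> x = 0) \<and>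
        (\<forall>x. \<bar>\<phi> x\<bar> \<le> 2) \<and> gagliardo s p UNIV \<phi> < \<infinity> \<longrightarrow>
        has_bochner_integral (lborel \<Otimes>\<^sub>M lborel) (\<lambda>(x, y). Jp p (v x - v y) * (\<phi> x - \<phi> y) * kern s p (x - y)) 0"
    proof (intro allI impI)
      fix \<phi> :: "'a \<Rightarrow> real" and r
      assume "\<phi> \<in> borel_measurable borel \<and> r < 1 \<and> (\<forall>x. r \<le> norm x \<longrightarrow> \<phi> x = 0) \<and> (\<forall>x. \<bar>\<phi> x\<bar> \<le> 2) \<and> gagliardo s p UNIV \<phi> < \<infinity>"
      then show "has_bochner_integral (lborel \<Otimes>\<^sub>M lborel) (\<lambda>(x, y). Jp p (v x - v y) * (\<phi> x - \<phi> y) * kern s p (x - y)) 0"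
        unfolding v_def by (intro weak_formulation_scaled[OF u fm ae \<Omega> p R l(1), of \<phi> r]) auto
    qed
  qed
  then show ?thesis using that[OF fm ae fl] by (simp add: v_def[abs_def])
qed

section \<open>The gradient estimate\<close>

lemma diff1_affine:
  fixes f :: "'a::euclidean_space \<Rightarrow> real"
  assumes [measurable]: "f \<in> borel_measurable borel" and R: "0 < R" and l: "0 < l"
  shows "diff1 p (ball x0 (\<rho> * R)) f h
     = ennreal (R powr real DIM('a) * l powr p) * diff1 p (ball 0 \<rho>) (\<lambda>y. f (x0 + R *\<^sub>R y) / l) ((1 / R) *\<^sub>R h)"
proof -
  define v where "v y = f (x0 + R *\<^sub>R y) / l" for y
  have [measurable]: "v \<in> borel_measurable borel" unfolding v_def by measurable
  have [measurable]: "ball (y::'a) r \<in> sets borel" for y r by simp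
  have "diff1 p (ball x0 (\<rho> * R)) f h = ennreal (R powr real DIM('a)) *
     (\<integral>\<^sup>+y. ennreal (\<bar>f (x0 + R *\<^sub>R y + h) - f (x0 + R *\<^sub>R y)\<bar> powr p) * indicator (ball x0 (\<rho> * R)) (x0 + R *\<^sub>R y) \<partial>lborel)"
    unfolding diff1_def using R
    by (subst nn_integral_affine[of _ R x0]) (auto simp: powr_realpow)
  also have "(\<integral>\<^sup>+y. ennreal (\<bar>f (x0 + R *\<^sub>R y + h) - f (x0 + R *\<^sub>R y)\<bar> powr p) * indicator (ball x0 (\<rho> * R)) (x0 + R *\<^sub>R y) \<partial>lborel)
     = (\<integral>\<^sup>+y. ennreal (l powr p) * (ennreal (\<bar>v (y + (1 / R) *\<^sub>R h) - v y\<bar> powr p) * indicator (ball 0 \<rho>) y) \<partial>lborel)"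
  proof (rule nn_integral_cong)
    fix y :: 'a
    have b: "x0 + R *\<^sub>R y \<in> ball x0 (\<rho> * R) \<longleftrightarrow> y \<in> ball 0 \<rho>" using R by (simp add: dist_norm mult.commute)
    have "f (x0 + R *\<^sub>R y + h) - f (x0 + R *\<^sub>R y) = l * (v (y + (1 / R) *\<^sub>R h) - v y)"
      using R l by (simp add: v_def scaleR_add_right add.assoc right_diff_distrib)
    then have "\<bar>f (x0 + R *\<^sub>R y + h) - f (x0 + R *\<^sub>R y)\<bar> powr p = l powr p * \<bar>v (y + (1 / R) *\<^sub>R h) - v y\<bar> powr p"
      using l by (simp add: abs_mult powr_mult)
    then show "ennreal (\<bar>f (x0 + R *\<^sub>R y + h) - f (x0 + R *\<^sub>R y)\<bar> powr p) * indicator (ball x0 (\<rho> * R)) (x0 + R *\<^sub>R y)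
      = ennreal (l powr p) * (ennreal (\<bar>v (y + (1 / R) *\<^sub>R h) - v y\<bar> powr p) * indicator (ball 0 \<rho>) y)"
      using b by (simp add: indicator_def ennreal_mult')
  qed
  also have "\<dots> = ennreal (l powr p) * diff1 p (ball 0 \<rho>) v ((1 / R) *\<^sub>R h)"
    unfolding diff1_def by (rule nn_integral_cmult) measurable
  finally show ?thesis by (simp add: v_def[abs_def] ennreal_mult' mult.assoc)
qed

lemma diff2_affine:
  fixes f :: "'a::euclidean_space \<Rightarrow> real"
  assumes [measurable]: "f \<in> borel_measurable borel" and R: "0 < R" and l: "0 < l"
  shows "diff2 p (ball x0 (\<rho> * R)) f h
     = ennreal (R powr real DIM('a) * l powr p) * diff2 p (ball 0 \<rho>) (\<lambda>y. f (x0 + R *\<^sub>R y) / l) ((1 / R) *\<^sub>R h)"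
proof -
  define v where "v y = f (x0 + R *\<^sub>R y) / l" for y
  have [measurable]: "v \<in> borel_measurable borel" unfolding v_def by measurable
  have [measurable]: "ball (y::'a) r \<in> sets borel" for y r by simp
  let ?k = "(1 / R) *\<^sub>R h"
  have "diff2 p (ball x0 (\<rho> * R)) f h = ennreal (R powr real DIM('a)) *
     (\<integral>\<^sup>+y. ennreal (\<bar>f (x0 + R *\<^sub>R y + 2 *\<^sub>R h) - 2 * f (x0 + R *\<^sub>R y + h) + f (x0 + R *\<^sub>R y)\<bar> powr p) * indicator (ball x0 (\<rho> * R)) (x0 + R *\<^sub>R y) \<partial>lborel)"
    unfolding diff2_def using R
    by (subst nn_integral_affine[of _ R x0]) (auto simp: powr_realpow)
  also have "(\<integral>\<^sup>+y. ennreal (\<bar>f (x0 + R *\<^sub>R y + 2 *\<^sub>R h) - 2 * f (x0 + R *\<^sub>R y + h) + f (x0 + R *\<^sub>R y)\<bar> powr p) * indicator (ball x0 (\<rho> * R)) (x0 + R *\<^sub>R y) \<partial>lborel)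
     = (\<integral>\<^sup>+y. ennreal (l powr p) * (ennreal (\<bar>v (y + 2 *\<^sub>R ?k) - 2 * v (y + ?k) + v y\<bar> powr p) * indicator (ball 0 \<rho>) y) \<partial>lborel)"
  proof (rule nn_integral_cong)
    fix y :: 'a
    have b: "x0 + R *\<^sub>R y \<in> ball x0 (\<rho> * R) \<longleftrightarrow> y \<in> ball 0 \<rho>" using R by (simp add: dist_norm mult.commute)
    have "f (x0 + R *\<^sub>R y + 2 *\<^sub>R h) = l * v (y + 2 *\<^sub>R ?k)" "f (x0 + R *\<^sub>R y + h) = l * v (y + ?k)" "f (x0 + R *\<^sub>R y) = l * v y"
      using R l by (simp_all add: v_def scaleR_add_right add.assoc)
    then have "f (x0 + R *\<^sub>R y + 2 *\<^sub>R h) - 2 * f (x0 + R *\<^sub>R y + h) + f (x0 + R *\<^sub>R y) = l * (v (y + 2 *\<^sub>R ?k) - 2 * v (y + ?k) + v y)"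
      by (simp only: right_diff_distrib distrib_left mult.left_commute)
    then have "\<bar>f (x0 + R *\<^sub>R y + 2 *\<^sub>R h) - 2 * f (x0 + R *\<^sub>R y + h) + f (x0 + R *\<^sub>R y)\<bar> powr p = l powr p * \<bar>v (y + 2 *\<^sub>R ?k) - 2 * v (y + ?k) + v y\<bar> powr p"
      using l by (simp add: abs_mult powr_mult)
    then show "ennreal (\<bar>f (x0 + R *\<^sub>R y + 2 *\<^sub>R h) - 2 * f (x0 + R *\<^sub>R y + h) + f (x0 + R *\<^sub>R y)\<bar> powr p) * indicator (ball x0 (\<rho> * R)) (x0 + R *\<^sub>R y)
      = ennreal (l powr p) * (ennreal (\<bar>v (y + 2 *\<^sub>R ?k) - 2 * v (y + ?k) + v y\<bar> powr p) * indicator (ball 0 \<rho>) y)"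
      using b by (simp only: indicator_def ennreal_mult') (simp add: ennreal_mult')
  qed
  also have "\<dots> = ennreal (l powr p) * diff2 p (ball 0 \<rho>) v ?k"
    unfolding diff2_def by (rule nn_integral_cmult) measurable
  finally show ?thesis by (simp add: v_def[abs_def] ennreal_mult' mult.assoc)
qed

lemma set_integral_borel_version:
  fixes w k F :: "'a::euclidean_space \<Rightarrow> real"
  assumes w: "w \<in> borel_measurable lebesgue" and [measurable]: "F \<in> borel_measurable borel" "k \<in> borel_measurable borel" "E \<in> sets borel"
    and ae: "AE x in lborel. w x = F x"
  shows "(LINT x:E|lebesgue. w x * k x) = (\<integral>x. indicator E x * (F x * k x) \<partial>lborel)"
proof -
  have m: "(\<lambda>x. indicator E x * (F x * k x)) \<in> borel_measurable lborel" by measurable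
  have "(LINT x:E|lebesgue. w x * k x) = (\<integral>x. indicator E x * (F x * k x) \<partial>lebesgue)"
    unfolding set_lebesgue_integral_def
  proof (rule integral_cong_AE)
    have [measurable]: "k \<in> borel_measurable lebesgue" "E \<in> sets lebesgue" "w \<in> borel_measurable lebesgue"
      using w by (auto intro: measurable_completion)
    show "(\<lambda>x. indicator E x *\<^sub>R (w x * k x)) \<in> borel_measurable lebesgue" by measurable
    show "(\<lambda>x. indicator E x * (F x * k x)) \<in> borel_measurable lebesgue" using m by (rule measurable_completion)
    show "AE x in lebesgue. indicator E x *\<^sub>R (w x * k x) = indicator E x * (F x * k x)"
      using AE_completion[OF ae] by eventually_elim simp
  qed
  also have "\<dots> = (\<integral>x. indicator E x * (F x * k x) \<partial>lborel)" by (rule integral_completion[OF m])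
  finally show ?thesis .
qed

text \<open>
  The directional derivatives along the standard basis are collected into a vector. The norm of this
  vector is at most \<open>N\<close> times its largest component, and the sum of the \<open>p\<close>-th powers of the components accounts for
  the second factor \<open>N\<close>.
\<close>

lemma weak_gradient_of_differences:
  fixes u f :: "'a::euclidean_space \<Rightarrow> real"
  assumes um: "u \<in> borel_measurable lebesgue" and fm [measurable]: "f \<in> borel_measurable borel" and ae: "AE x in lborel. u x = f x"
    and \<delta>: "0 < \<delta>" and p: "1 \<le> p"
    and bd: "\<And>x h. x \<in> ball c \<rho> \<Longrightarrow> norm h \<le> \<delta> \<Longrightarrow> \<bar>f (x + h)\<bar> \<le> L"
    and MK: "0 < M" "0 < K" "1 < \<tau>"
    and d1: "\<And>h. h \<noteq> 0 \<Longrightarrow> norm h \<le> \<delta> \<Longrightarrow> diff1 p (ball c \<rho>) f h \<le> ennreal ((M * norm h) powr p)"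
    and d2: "\<And>h. h \<noteq> 0 \<Longrightarrow> norm h \<le> \<delta> \<Longrightarrow> diff2 p (ball c \<rho>) f h \<le> ennreal ((K * norm h powr \<tau>) powr p)"
  obtains g where "has_weak_gradient u g (ball c \<rho>)" "g \<in> Lp_space p (ball c \<rho>)"
    "Lp_norm p (ball c \<rho>) g \<le> real DIM('a) ^ 2 * M"
proof -
  define E where "E = ball c \<rho>"
  have Em [measurable]: "E \<in> sets borel" by (simp add: E_def)
  have Efin: "emeasure lborel E < \<infinity>" unfolding E_def using emeasure_lborel_ball_finite[of c \<rho>] by simp
  have "\<forall>i\<in>Basis. \<exists>g. g \<in> borel_measurable borel \<and> (\<integral>\<^sup>+x\<in>E. ennreal (\<bar>g x\<bar> powr p) \<partial>lborel) \<le> ennreal (M powr p) \<and>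
    (\<forall>\<phi>. \<phi> differentiable_on UNIV \<longrightarrow> continuous_on UNIV (\<lambda>x. frechet_derivative \<phi> (at x) i) \<longrightarrow> compactly_supported_in E \<phi> \<longrightarrow>
      (\<integral>x. indicator E x * (f x * frechet_derivative \<phi> (at x) i) \<partial>lborel) = - (\<integral>x. indicator E x * (g x * \<phi> x) \<partial>lborel))"
  proof
    fix i :: 'a assume i: "i \<in> Basis"
    then have ni: "norm i = 1" by simp
    show "\<exists>g. g \<in> borel_measurable borel \<and> (\<integral>\<^sup>+x\<in>E. ennreal (\<bar>g x\<bar> powr p) \<partial>lborel) \<le> ennreal (M powr p) \<and>
    (\<forall>\<phi>. \<phi> differentiable_on UNIV \<longrightarrow> continuous_on UNIV (\<lambda>x. frechet_derivative \<phi> (at x) i) \<longrightarrow> compactly_supported_in E \<phi> \<longrightarrow>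
      (\<integral>x. indicator E x * (f x * frechet_derivative \<phi> (at x) i) \<partial>lborel) = - (\<integral>x. indicator E x * (g x * \<phi> x) \<partial>lborel))"
    proof (rule directional_weak_derivative[OF fm E_def \<delta> p bd[folded E_def] ni MK d1[folded E_def] d2[folded E_def]], goal_cases)
      case (7 q)
      then show ?case by (intro exI[of _ q]) simp
    qed assumption+
  qed
  from bchoice[OF this] obtain G where G0: "\<forall>i\<in>Basis. G i \<in> borel_measurable borel \<and> (\<integral>\<^sup>+x\<in>E. ennreal (\<bar>G i x\<bar> powr p) \<partial>lborel) \<le> ennreal (M powr p) \<and>
    (\<forall>\<phi>. \<phi> differentiable_on UNIV \<longrightarrow> continuous_on UNIV (\<lambda>x. frechet_derivative \<phi> (at x) i) \<longrightarrow> compactly_supported_in E \<phi> \<longrightarrow>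
      (\<integral>x. indicator E x * (f x * frechet_derivative \<phi> (at x) i) \<partial>lborel) = - (\<integral>x. indicator E x * (G i x * \<phi> x) \<partial>lborel))"
    by (elim exE)
  have G: "\<And>i. i \<in> Basis \<Longrightarrow> G i \<in> borel_measurable borel"
    "\<And>i. i \<in> Basis \<Longrightarrow> (\<integral>\<^sup>+x\<in>E. ennreal (\<bar>G i x\<bar> powr p) \<partial>lborel) \<le> ennreal (M powr p)"
    "\<And>i \<phi>. i \<in> Basis \<Longrightarrow> \<phi> differentiable_on UNIV \<Longrightarrow> continuous_on UNIV (\<lambda>x. frechet_derivative \<phi> (at x) i) \<Longrightarrow> compactly_supported_in E \<phi> \<Longrightarrow>
      (\<integral>x. indicator E x * (f x * frechet_derivative \<phi> (at x) i) \<partial>lborel) = - (\<integral>x. indicator E x * (G i x * \<phi> x) \<partial>lborel)"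
    using G0 by simp_all
  define g where "g x = (\<Sum>i\<in>Basis. G i x *\<^sub>R i)" for x
  have gm [measurable]: "g \<in> borel_measurable borel" unfolding g_def using G(1) by (intro borel_measurable_sum borel_measurable_scaleR) auto
  have gi: "g x \<bullet> i = G i x" if "i \<in> Basis" for x i using that by (simp add: g_def inner_sum_left_Basis)
  have gmL: "g \<in> borel_measurable lebesgue" using gm by (intro measurable_completion) simp
  define d where "d = real DIM('a)"
  have d: "1 \<le> d" using DIM_positive[where 'a='a] by (simp add: d_def Suc_le_eq)
  have gn: "norm (g x) powr p \<le> d powr p * (\<Sum>i\<in>Basis. \<bar>G i x\<bar> powr p)" for x
  proof -
    define m where "m = Max ((\<lambda>i. \<bar>G i x\<bar>) ` Basis)"
    have mi: "\<bar>G i x\<bar> \<le> m" if "i \<in> Basis" for i using that by (auto simp: m_def)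
    have "m \<in> (\<lambda>i. \<bar>G i x\<bar>) ` Basis" unfolding m_def by (intro Max_in) auto
    then obtain j where j: "j \<in> Basis" "m = \<bar>G j x\<bar>" by auto
    have "norm (g x) \<le> (\<Sum>i\<in>Basis. \<bar>g x \<bullet> i\<bar>)" by (rule norm_le_l1)
    also have "\<dots> \<le> (\<Sum>i\<in>(Basis::'a set). m)" by (intro sum_mono) (simp add: gi mi)
    also have "\<dots> = d * m" by (simp add: d_def)
    finally have "norm (g x) powr p \<le> (d * m) powr p" using p by (intro powr_mono2) auto
    also have "\<dots> = d powr p * \<bar>G j x\<bar> powr p" using j d by (simp add: powr_mult)
    also have "\<dots> \<le> d powr p * (\<Sum>i\<in>Basis. \<bar>G i x\<bar> powr p)"
      using j member_le_sum[of j Basis "\<lambda>i. \<bar>G i x\<bar> powr p"] by (intro mult_left_mono) auto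
    finally show ?thesis .
  qed
  have gp: "(\<integral>\<^sup>+x. ennreal (indicator E x * norm (g x) powr p) \<partial>lborel) \<le> ennreal ((d ^ 2 * M) powr p)"
  proof -
    have "(\<integral>\<^sup>+x. ennreal (indicator E x * norm (g x) powr p) \<partial>lborel) \<le> (\<integral>\<^sup>+x. ennreal (d powr p) * (\<Sum>i\<in>Basis. ennreal (\<bar>G i x\<bar> powr p) * indicator E x) \<partial>lborel)"
    proof (rule nn_integral_mono)
      fix x
      show "ennreal (indicator E x * norm (g x) powr p) \<le> ennreal (d powr p) * (\<Sum>i\<in>Basis. ennreal (\<bar>G i x\<bar> powr p) * indicator E x)"
        using gn[of x] by (auto simp: indicator_def ennreal_mult' [symmetric] sum_nonneg intro!: ennreal_leI)
    qed
    also have "\<dots> = ennreal (d powr p) * (\<Sum>i\<in>Basis. (\<integral>\<^sup>+x\<in>E. ennreal (\<bar>G i x\<bar> powr p) \<partial>lborel))"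
    proof -
      have m: "(\<lambda>x. ennreal (\<bar>G i x\<bar> powr p) * indicator E x) \<in> borel_measurable lborel" if "i \<in> Basis" for i
      proof -
        note [measurable] = G(1)[OF that]
        show ?thesis by measurable
      qed
      have "(\<lambda>x. \<Sum>i\<in>Basis. ennreal (\<bar>G i x\<bar> powr p) * indicator E x) \<in> borel_measurable lborel"
        by (rule borel_measurable_sum) (rule m)
      then have "(\<integral>\<^sup>+x. ennreal (d powr p) * (\<Sum>i\<in>Basis. ennreal (\<bar>G i x\<bar> powr p) * indicator E x) \<partial>lborel)
          = ennreal (d powr p) * (\<integral>\<^sup>+x. (\<Sum>i\<in>Basis. ennreal (\<bar>G i x\<bar> powr p) * indicator E x) \<partial>lborel)"
        by (rule nn_integral_cmult)
      also have "(\<integral>\<^sup>+x. (\<Sum>i\<in>Basis. ennreal (\<bar>G i x\<bar> powr p) * indicator E x) \<partial>lborel)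
          = (\<Sum>i\<in>Basis. (\<integral>\<^sup>+x\<in>E. ennreal (\<bar>G i x\<bar> powr p) \<partial>lborel))"
        by (rule nn_integral_sum) (rule m)
      finally show ?thesis .
    qed
    also have "\<dots> \<le> ennreal (d powr p) * (\<Sum>i\<in>(Basis::'a set). ennreal (M powr p))"
      using G(2) by (intro mult_left_mono sum_mono) auto
    also have "\<dots> = ennreal (d powr p * (d * M powr p))"
      by (simp add: d_def ennreal_mult' ennreal_of_nat_eq_real_of_nat)
    also have "\<dots> \<le> ennreal ((d ^ 2 * M) powr p)"
    proof (rule ennreal_leI)
      have "d \<le> d powr p" using d p powr_mono[of 1 p d] by simp
      then have "d powr p * (d * M powr p) \<le> d powr p * (d powr p * M powr p)"
        by (intro mult_left_mono mult_right_mono) auto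
      then show "d powr p * (d * M powr p) \<le> (d ^ 2 * M) powr p"
        by (simp add: powr_mult power2_eq_square mult.assoc)
    qed
    finally show ?thesis .
  qed
  have gint: "integrable lborel (\<lambda>x. indicator E x * norm (g x) powr p)"
    using gp by (intro integrableI_bounded) (auto intro: le_less_trans)
  have gintL: "integrable lebesgue (\<lambda>x. indicator E x * norm (g x) powr p)"
    using gint by (subst integrable_completion) auto
  have gLp: "g \<in> Lp_space p E"
    using gintL gmL by (simp add: Lp_space_def set_integrable_def measurable_restrict_space1)
  have norm: "Lp_norm p E g \<le> d ^ 2 * M"
  proof -
    have "(LINT x:E|lebesgue. norm (g x) powr p) = (\<integral>x. indicator E x * norm (g x) powr p \<partial>lborel)"
      unfolding set_lebesgue_integral_def by (subst integral_completion) auto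
    also have "\<dots> \<le> (d ^ 2 * M) powr p"
    proof -
      have "ennreal (\<integral>x. indicator E x * norm (g x) powr p \<partial>lborel) \<le> ennreal ((d ^ 2 * M) powr p)"
        using gp gint by (subst (asm) nn_integral_eq_integral) auto
      then show ?thesis by simp
    qed
    finally have "Lp_norm p E g \<le> ((d ^ 2 * M) powr p) powr (1 / p)"
      unfolding Lp_norm_def using p
      by (intro powr_mono2) (auto simp: set_lebesgue_integral_def intro!: integral_nonneg_AE)
    also have "\<dots> = d ^ 2 * M" using p d MK by (simp add: powr_powr)
    finally show ?thesis .
  qed
  have loc1: "w \<in> local_space (Lp_space 1) E"
    if wm: "w \<in> borel_measurable lebesgue" and wi: "integrable lebesgue (\<lambda>x. indicator E x * norm (w x))"
    for w :: "'a \<Rightarrow> 'b::euclidean_space"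
    unfolding local_space_def
  proof (intro CollectI allI impI)
    fix y r assume "0 < r \<and> cball y r \<subseteq> E"
    then have sub: "ball y r \<subseteq> E" using ball_subset_cball by blast
    have "integrable lebesgue (\<lambda>x. indicator (ball y r) x *\<^sub>R norm (w x))"
    proof (rule Bochner_Integration.integrable_bound[OF wi])
      have [measurable]: "ball y r \<in> sets lebesgue" "w \<in> borel_measurable lebesgue" using wm by auto
      show "(\<lambda>x. indicator (ball y r) x *\<^sub>R norm (w x)) \<in> borel_measurable lebesgue" by measurable
      show "AE x in lebesgue. norm (indicator (ball y r) x *\<^sub>R norm (w x)) \<le> norm (indicator E x * norm (w x))"
        using sub by (intro AE_I2) (auto simp: indicator_def)
    qed
    then show "w \<in> Lp_space 1 (ball y r)"
      using wm by (simp add: Lp_space_def set_integrable_def measurable_restrict_space1)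
  qed
  have uloc: "u \<in> local_space (Lp_space 1) E"
  proof (rule loc1[OF um])
    have fi: "integrable lborel (\<lambda>x. indicator E x * norm (f x))"
    proof (rule integrableI_bounded_set[of E _ _ L])
      show "AE x in lborel. x \<in> E \<longrightarrow> norm (indicator E x * norm (f x)) \<le> L"
        using bd[of _ 0] \<delta> by (intro AE_I2) (auto simp: E_def)
    qed (use Efin in auto)
    have "integrable lebesgue (\<lambda>x. indicator E x * norm (f x))"
      using fi by (subst integrable_completion) auto
    then show "integrable lebesgue (\<lambda>x. indicator E x * norm (u x))"
    proof (rule integrable_cong_AE_imp)
      have [measurable]: "E \<in> sets lebesgue" "u \<in> borel_measurable lebesgue" using um by auto
      show "(\<lambda>x. indicator E x * norm (u x)) \<in> borel_measurable lebesgue" by measurable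
      show "AE x in lebesgue. indicator E x * norm (f x) = indicator E x * norm (u x)"
        using AE_completion[OF ae] by eventually_elim simp
    qed
  qed
  have gloc: "g \<in> local_space (Lp_space 1) E"
  proof (rule loc1[OF gmL])
    have "integrable lborel (\<lambda>x. indicator E x * norm (g x))"
    proof (rule Bochner_Integration.integrable_bound)
      show "integrable lborel (\<lambda>x. indicator E x + indicator E x * norm (g x) powr p)"
        using gint Efin by (intro Bochner_Integration.integrable_add) auto
      show "AE x in lborel. norm (indicator E x * norm (g x)) \<le> norm (indicator E x + indicator E x * norm (g x) powr p)"
      proof (rule AE_I2)
        fix x
        have "norm (g x) \<le> 1 + norm (g x) powr p"
        proof (cases "norm (g x) \<le> 1")
          case True
          then show ?thesis by (simp add: add_increasing2)
        next
          case False
          then show ?thesis using powr_mono[of 1 p "norm (g x)"] p by simp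
        qed
        then show "norm (indicator E x * norm (g x)) \<le> norm (indicator E x + indicator E x * norm (g x) powr p)"
          by (simp add: indicator_def)
      qed
    qed measurable
    then show "integrable lebesgue (\<lambda>x. indicator E x * norm (g x))"
      by (subst integrable_completion) auto
  qed
  have "has_weak_gradient u g E"
    unfolding has_weak_gradient_def
  proof (intro conjI uloc gloc allI impI ballI)
    fix \<phi> and i :: 'a assume \<phi>: "smooth_test_function E \<phi>" and i: "i \<in> Basis"
    have "cont_diff (Suc 0) \<phi>" using \<phi> by (simp add: smooth_test_function_def)
    then have df: "\<phi> differentiable_on UNIV" and cf: "continuous_on UNIV (\<lambda>x. frechet_derivative \<phi> (at x) i)"
      using i by auto
    have [measurable]: "\<phi> \<in> borel_measurable borel" "(\<lambda>x. frechet_derivative \<phi> (at x) i) \<in> borel_measurable borel"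
      using differentiable_imp_continuous_on[OF df] cf by (auto intro: borel_measurable_continuous_onI)
    have "(LINT x:E|lebesgue. u x * frechet_derivative \<phi> (at x) i) = (\<integral>x. indicator E x * (f x * frechet_derivative \<phi> (at x) i) \<partial>lborel)"
      by (rule set_integral_borel_version[OF um _ _ _ ae]) auto
    also have "\<dots> = - (\<integral>x. indicator E x * (G i x * \<phi> x) \<partial>lborel)"
      using \<phi> i df cf by (intro G(3)) (auto simp: smooth_test_function_def)
    also have "(\<integral>x. indicator E x * (G i x * \<phi> x) \<partial>lborel) = (LINT x:E|lebesgue. (g x \<bullet> i) * \<phi> x)"
    proof (rule set_integral_borel_version [symmetric])
      have "(\<lambda>x. g x \<bullet> i) \<in> borel_measurable lborel" by measurable
      then show "(\<lambda>x. g x \<bullet> i) \<in> borel_measurable lebesgue" by (rule measurable_completion)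
    qed (use G(1)[OF i] gi[OF i] in auto)
    finally show "(LINT x:E|lebesgue. u x * frechet_derivative \<phi> (at x) i) = - (LINT x:E|lebesgue. (g x \<bullet> i) * \<phi> x)" .
  qed
  then show ?thesis using that gLp norm by (simp add: E_def d_def)
qed

text \<open>
  The difference bounds for the rescaled solution are scaled back; the factor \<open>1 / R\<close> is that of the increment
  \<open>h / R\<close>, and \<open>R powr (N / p)\<close> comes from the volume element.
\<close>

lemma gradient_estimate:
  assumes s0: "(p - 2) / p < s0" "s0 < 1" and p: "2 \<le> p" and \<rho>: "0 < \<rho>" "\<rho> < 1"
  obtains C where "0 < C" "\<And>s (\<Omega> :: 'a::euclidean_space set) u x0 R l.
     s0 \<le> s \<Longrightarrow> s < 1 \<Longrightarrow> open \<Omega> \<Longrightarrow> bounded \<Omega> \<Longrightarrow> u \<in> local_space Linf_space \<Omega> \<Longrightarrow> local_weak_solution s p \<Omega> u \<Longrightarrow>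
     0 < R \<Longrightarrow> cball x0 R \<subseteq> \<Omega> \<Longrightarrow> 0 < l \<Longrightarrow> Linf_norm (ball x0 R) u \<le> l \<Longrightarrow> Tail s p u x0 R \<le> l \<Longrightarrow>
     R powr (s - real DIM('a) / p) * (1 - s) powr (1 / p) * gagliardo_seminorm s p (ball x0 R) u \<le> l \<Longrightarrow>
     \<exists>g. has_weak_gradient u g (ball x0 (\<rho> * R)) \<and> g \<in> Lp_space p (ball x0 (\<rho> * R)) \<and>
        Lp_norm p (ball x0 (\<rho> * R)) g \<le> C / R * (R powr (real DIM('a) / p) * l)"
proof -
  from unit_solution_difference_bounds[OF s0 p \<rho>, where 'a='a]
  obtain M K \<tau> \<delta> where MK: "0 < M" "0 < K" "1 < \<tau>" "0 < \<delta>" and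
    H: "\<And>s (v :: 'a \<Rightarrow> real) h. s0 \<le> s \<Longrightarrow> s < 1 \<Longrightarrow> unit_solution s p v \<Longrightarrow> h \<noteq> 0 \<Longrightarrow> norm h \<le> \<delta> \<Longrightarrow>
        diff1 p (ball 0 \<rho>) v h \<le> ennreal ((M * norm h) powr p) \<and> diff2 p (ball 0 \<rho>) v h \<le> ennreal ((K * norm h powr \<tau>) powr p)"
    by blast
  have s00: "0 < s0" using s0 p by (smt (verit) divide_nonneg_nonneg)
  define C where "C = real DIM('a) ^ 2 * M"
  have "0 < C" using MK DIM_positive[where 'a='a] by (simp add: C_def)
  moreover have "\<exists>g. has_weak_gradient u g (ball x0 (\<rho> * R)) \<and> g \<in> Lp_space p (ball x0 (\<rho> * R)) \<and>
        Lp_norm p (ball x0 (\<rho> * R)) g \<le> C / R * (R powr (real DIM('a) / p) * l)"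
    if a: "s0 \<le> s" "s < 1" "open \<Omega>" "bounded \<Omega>" "u \<in> local_space Linf_space \<Omega>" "local_weak_solution s p \<Omega> u"
     "0 < R" "cball x0 R \<subseteq> \<Omega>" "0 < l" "Linf_norm (ball x0 R) u \<le> l" "Tail s p u x0 R \<le> l"
     "R powr (s - real DIM('a) / p) * (1 - s) powr (1 / p) * gagliardo_seminorm s p (ball x0 R) u \<le> l"
    for s \<Omega> x0 R l and u :: "'a \<Rightarrow> real"
  proof -
    have s: "0 < s" using a(1) s00 by simp
    obtain f where f: "f \<in> borel_measurable borel" "AE x in lborel. u x = f x" "\<And>x. x \<in> ball x0 R \<Longrightarrow> \<bar>f x\<bar> \<le> l"
      "unit_solution s p (\<lambda>y. f (x0 + R *\<^sub>R y) / l)"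
      using reduction_to_unit_ball[OF p s a(2-12)] by blast
    have um: "u \<in> borel_measurable lebesgue"
      using a(6) tail_space_measurable[of u s p] by (auto simp: local_weak_solution_def)
    define \<delta>' where "\<delta>' = min (\<delta> * R) ((1 - \<rho>) * R)"
    have \<delta>': "0 < \<delta>'" "\<delta>' \<le> \<delta> * R" "\<delta>' \<le> (1 - \<rho>) * R" using MK a(7) \<rho> by (auto simp: \<delta>'_def)
    define k where "k = R powr (real DIM('a) / p) * l"
    have k: "0 < k" using a(7,9) by (simp add: k_def)
    have kp: "R powr real DIM('a) * l powr p = k powr p"
      using p by (simp add: k_def powr_mult powr_powr)
    define M' where "M' = k * M / R"
    define K' where "K' = k * K * (1 / R) powr \<tau>"
    have MK': "0 < M'" "0 < K'" using k MK a(7) by (auto simp: M'_def K'_def)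
    obtain g where g: "has_weak_gradient u g (ball x0 (\<rho> * R))" "g \<in> Lp_space p (ball x0 (\<rho> * R))"
      "Lp_norm p (ball x0 (\<rho> * R)) g \<le> real DIM('a) ^ 2 * M'"
    proof (rule weak_gradient_of_differences[OF um f(1,2) \<delta>'(1) _ _ MK' MK(3)])
      show "1 \<le> p" using p by simp
      show "\<bar>f (x + h)\<bar> \<le> l" if "x \<in> ball x0 (\<rho> * R)" "norm h \<le> \<delta>'" for x h
      proof (rule f(3))
        have "norm (x + h - x0) \<le> norm (x - x0) + norm h" using norm_triangle_ineq[of "x - x0" h] by (simp add: algebra_simps)
        also have "\<dots> < \<rho> * R + (1 - \<rho>) * R" using that \<delta>'(3) by (simp add: dist_norm norm_minus_commute)
        also have "\<dots> = R" by (simp add: algebra_simps)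
        finally show "x + h \<in> ball x0 R" by (simp add: dist_norm norm_minus_commute)
      qed
      fix h :: 'a assume h: "h \<noteq> 0" "norm h \<le> \<delta>'"
      have h': "(1 / R) *\<^sub>R h \<noteq> 0" "norm ((1 / R) *\<^sub>R h) \<le> \<delta>" "norm ((1 / R) *\<^sub>R h) = 1 / R * norm h"
        using h \<delta>'(2) a(7) by (auto simp: field_simps)
      have HH: "diff1 p (ball 0 \<rho>) (\<lambda>y. f (x0 + R *\<^sub>R y) / l) ((1 / R) *\<^sub>R h) \<le> ennreal ((M * (1 / R * norm h)) powr p)"
        "diff2 p (ball 0 \<rho>) (\<lambda>y. f (x0 + R *\<^sub>R y) / l) ((1 / R) *\<^sub>R h) \<le> ennreal ((K * (1 / R * norm h) powr \<tau>) powr p)"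
        using H[OF a(1,2) f(4) h'(1,2)] unfolding h'(3) by auto
      show "diff1 p (ball x0 (\<rho> * R)) f h \<le> ennreal ((M' * norm h) powr p)"
      proof -
        have "diff1 p (ball x0 (\<rho> * R)) f h \<le> ennreal (k powr p) * ennreal ((M * (1 / R * norm h)) powr p)"
          unfolding diff1_affine[OF f(1) a(7,9)] kp by (intro mult_left_mono HH) auto
        also have "\<dots> = ennreal ((k * (M * (1 / R * norm h))) powr p)" by (simp only: powr_mult ennreal_mult' powr_ge_zero)
        also have "k * (M * (1 / R * norm h)) = M' * norm h" by (simp add: M'_def)
        finally show ?thesis .
      qed
      show "diff2 p (ball x0 (\<rho> * R)) f h \<le> ennreal ((K' * norm h powr \<tau>) powr p)"
      proof -
        have "diff2 p (ball x0 (\<rho> * R)) f h \<le> ennreal (k powr p) * ennreal ((K * (1 / R * norm h) powr \<tau>) powr p)"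
          unfolding diff2_affine[OF f(1) a(7,9)] kp by (intro mult_left_mono HH) auto
        also have "\<dots> = ennreal ((k * (K * (1 / R * norm h) powr \<tau>)) powr p)" by (simp only: powr_mult[of k] ennreal_mult' powr_ge_zero)
        also have "k * (K * (1 / R * norm h) powr \<tau>) = K' * norm h powr \<tau>" by (simp only: K'_def powr_mult mult.assoc)
        finally show ?thesis .
      qed
    qed
    have "real DIM('a) ^ 2 * M' = C / R * (R powr (real DIM('a) / p) * l)" by (simp add: C_def M'_def k_def)
    with g show ?thesis by auto
  qed
  ultimately show ?thesis using that by blast
qed

lemma compact_subset_smaller_ball:
  fixes c :: "'a::euclidean_space"
  assumes S: "compact S" "S \<subseteq> ball c \<rho>" and \<rho>: "0 < \<rho>"
  obtains r where "0 < r" "cball c r \<subseteq> ball c \<rho>" "S \<subseteq> ball c r"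
proof (cases "S = {}")
  case True
  have "cball c (\<rho> / 2) \<subseteq> ball c \<rho>" using \<rho> by (auto simp: subset_eq)
  then show ?thesis using that[of "\<rho> / 2"] True \<rho> by auto
next
  case False
  have "continuous_on S (\<lambda>x. dist c x)" by (intro continuous_intros)
  then obtain y where y: "y \<in> S" "\<And>x. x \<in> S \<Longrightarrow> dist c x \<le> dist c y"
    using continuous_attains_sup[OF S(1) False] by blast
  have yr: "dist c y < \<rho>" using y S by auto
  define r where "r = (dist c y + \<rho>) / 2"
  have "dist c y < r" "r < \<rho>" "0 < r" using yr \<rho> by (auto simp: r_def add_nonneg_pos)
  moreover have "cball c r \<subseteq> ball c \<rho>" using \<open>r < \<rho>\<close> by (auto simp: subset_eq)
  moreover have "S \<subseteq> ball c r" using y(2) \<open>dist c y < r\<close> by (force simp: subset_eq)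
  ultimately show ?thesis using that by blast
qed

text \<open>
  The local space controls \<open>g\<close> only on balls with closure inside, so the ball is exhausted by smaller
  concentric ones.
\<close>

lemma local_L1_measurable:
  fixes g :: "'a::euclidean_space \<Rightarrow> 'b::euclidean_space"
  assumes g: "g \<in> local_space (Lp_space 1) (ball c \<rho>)" and \<rho>: "0 < \<rho>"
  shows "(\<lambda>x. indicator (ball c \<rho>) x *\<^sub>R g x) \<in> borel_measurable lebesgue"
proof -
  define r where "r n = \<rho> * (1 - 1 / real (n + 2))" for n :: nat
  have r: "0 < r n" "r n < \<rho>" for n
  proof -
    have "0 < 1 - 1 / real (n + 2)" "1 - 1 / real (n + 2) < 1" by auto
    then show "0 < r n" "r n < \<rho>" using \<rho> by (auto simp: r_def simp del: of_nat_add)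
  qed
  have "g \<in> borel_measurable (lebesgue_on (ball c \<rho>))"
  proof (rule measurable_piecewise_restrict[of "range (\<lambda>n. ball c (r n))"])
    show "space (lebesgue_on (ball c \<rho>)) \<subseteq> \<Union> (range (\<lambda>n. ball c (r n)))"
    proof
      fix x assume "x \<in> space (lebesgue_on (ball c \<rho>))"
      then have x: "dist c x < \<rho>" by simp
      have "r \<longlonglongrightarrow> \<rho> * (1 - 0)" unfolding r_def
        by (intro tendsto_intros LIMSEQ_ignore_initial_segment[OF lim_1_over_n, of 2])
      then have "eventually (\<lambda>n. dist c x < r n) sequentially" using x by (intro order_tendstoD) auto
      then obtain n where "dist c x < r n" by (auto simp: eventually_sequentially)
      then show "x \<in> \<Union> (range (\<lambda>n. ball c (r n)))" by auto
    qed
    fix B assume "B \<in> range (\<lambda>n. ball c (r n))"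
    then obtain n where n: "B = ball c (r n)" by blast
    show "B \<inter> space (lebesgue_on (ball c \<rho>)) \<in> sets (lebesgue_on (ball c \<rho>))"
      unfolding n by (auto simp: sets_restrict_space)
    have "cball c (r n) \<subseteq> ball c \<rho>" using r[of n] by (auto simp: subset_eq)
    then have "g \<in> borel_measurable (lebesgue_on (ball c (r n)))"
      using g r(1)[of n] by (auto simp: local_space_def Lp_space_def)
    moreover have "ball c \<rho> \<inter> ball c (r n) = ball c (r n)" using r[of n] by auto
    ultimately show "g \<in> borel_measurable (restrict_space (lebesgue_on (ball c \<rho>)) B)"
      unfolding n by (simp add: restrict_restrict_space)
  qed simp
  then show ?thesis by (subst (asm) borel_measurable_restrict_space_iff) auto
qed

lemma local_L1_integrable:
  fixes g :: "'a::euclidean_space \<Rightarrow> 'b::euclidean_space"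
  assumes g: "g \<in> local_space (Lp_space 1) (ball c \<rho>)" and \<rho>: "0 < \<rho>"
    and S: "compact S" "S \<subseteq> ball c \<rho>"
  shows "integrable lebesgue (\<lambda>x. indicator S x *\<^sub>R g x)"
proof -
  obtain r where r: "0 < r" "cball c r \<subseteq> ball c \<rho>" "S \<subseteq> ball c r"
    using compact_subset_smaller_ball[OF S \<rho>] .
  then have "g \<in> Lp_space 1 (ball c r)" using g by (auto simp: local_space_def)
  then have gi: "integrable lebesgue (\<lambda>x. indicator (ball c r) x *\<^sub>R norm (g x))"
    by (simp add: Lp_space_def set_integrable_def)
  have Sm: "S \<in> sets lebesgue" using S(1) by (simp add: compact_imp_closed)
  show ?thesis
  proof (rule Bochner_Integration.integrable_bound[OF gi])
    have "(\<lambda>x. indicator S x *\<^sub>R g x) = (\<lambda>x. indicator S x *\<^sub>R (indicator (ball c \<rho>) x *\<^sub>R g x))"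
      using S by (auto simp: indicator_def fun_eq_iff)
    also have "\<dots> \<in> borel_measurable lebesgue"
      by (rule borel_measurable_scaleR[OF borel_measurable_indicator[OF Sm] local_L1_measurable[OF g \<rho>]])
    finally show "(\<lambda>x. indicator S x *\<^sub>R g x) \<in> borel_measurable lebesgue" .
    show "AE x in lebesgue. norm (indicator S x *\<^sub>R g x) \<le> norm (indicator (ball c r) x *\<^sub>R norm (g x))"
      using r(3) by (intro AE_I2) (auto simp: indicator_def)
  qed
qed

text \<open>
  Each component of the difference of two weak gradients has vanishing integral against every smooth test function.
  The fundamental lemma is applied to a Borel version of this component.
\<close>

lemma weak_gradient_unique:
  fixes u :: "'a::euclidean_space \<Rightarrow> real"
  assumes g: "has_weak_gradient u g (ball c \<rho>)" and g': "has_weak_gradient u g' (ball c \<rho>)" and \<rho>: "0 < \<rho>"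
  shows "AE x in lebesgue. x \<in> ball c \<rho> \<longrightarrow> g x = g' x"
proof -
  define E where "E = ball c \<rho>"
  have Em: "E \<in> sets borel" by (simp add: E_def)
  have gl: "g \<in> local_space (Lp_space 1) E" "g' \<in> local_space (Lp_space 1) E"
    using g g' by (auto simp: has_weak_gradient_def E_def)
  have comp: "AE x in lebesgue. x \<in> E \<longrightarrow> g x \<bullet> i = g' x \<bullet> i" if i: "i \<in> Basis" for i
  proof -
    define w where "w x = (indicator E x *\<^sub>R g x - indicator E x *\<^sub>R g' x) \<bullet> i" for x
    have wm: "w \<in> borel_measurable lebesgue"
      unfolding w_def using local_L1_measurable[OF gl(1)[unfolded E_def] \<rho>] local_L1_measurable[OF gl(2)[unfolded E_def] \<rho>]
      by (intro borel_measurable_inner borel_measurable_diff borel_measurable_const) (auto simp: E_def)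
    have wE: "w x = g x \<bullet> i - g' x \<bullet> i" if "x \<in> E" for x using that by (simp add: w_def inner_diff_left)
    have wi: "integrable lebesgue (\<lambda>x. indicator S x * w x)" if S: "compact S" "S \<subseteq> E" for S
    proof -
      have "integrable lebesgue (\<lambda>x. (indicator S x *\<^sub>R g x) \<bullet> i - (indicator S x *\<^sub>R g' x) \<bullet> i)"
        using local_L1_integrable[OF gl(1)[unfolded E_def] \<rho>, of S] local_L1_integrable[OF gl(2)[unfolded E_def] \<rho>, of S] S
        by (intro Bochner_Integration.integrable_diff integrable_inner_left) (auto simp: E_def)
      moreover have "(\<lambda>x. (indicator S x *\<^sub>R g x) \<bullet> i - (indicator S x *\<^sub>R g' x) \<bullet> i) = (\<lambda>x. indicator S x * w x)"
        using S wE by (auto simp: fun_eq_iff indicator_def)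
      ultimately show ?thesis by simp
    qed
    obtain v where v: "v \<in> borel_measurable lborel" "AE x in lborel. w x = v x"
      using completion_ex_borel_measurable_real[OF wm] by blast
    have vm [measurable]: "v \<in> borel_measurable borel" using v(1) by simp
    have "AE x in lborel. x \<in> E \<longrightarrow> v x = 0"
    proof (rule fundamental_lemma_calculus_of_variations[OF vm])
      show "open E" by (simp add: E_def)
      show "integrable lborel (\<lambda>x. indicator (cbox a b) x * v x)" if "cbox a b \<subseteq> E" for a b
      proof (rule lebesgue_borel_version_integral(1))
        show "integrable lebesgue (\<lambda>x. indicator (cbox a b) x * w x)" using that by (intro wi) auto
        show "AE x in lborel. indicator (cbox a b) x * w x = indicator (cbox a b) x * v x" using v(2) by eventually_elim simp
      qed measurable
      fix \<phi> assume \<phi>: "smooth_test_function E \<phi>"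
      then have supp: "compactly_supported_in E \<phi>" and c: "continuous_on UNIV \<phi>"
        by (auto simp: smooth_test_function_def dest: spec[of _ 0])
      have [measurable]: "\<phi> \<in> borel_measurable borel" using c by (rule borel_measurable_continuous_onI)
      have \<phi>L: "\<phi> \<in> borel_measurable lebesgue" by (intro measurable_completion) simp
      define S where "S = closure {x. \<phi> x \<noteq> 0}"
      have S: "compact S" "S \<subseteq> E" using supp by (auto simp: compactly_supported_in_def S_def)
      have \<phi>S: "\<phi> x = 0" if "x \<notin> S" for x using that subsetD[OF closure_subset, of x "{x. \<phi> x \<noteq> 0}"] by (auto simp: S_def)
      obtain P where P: "\<And>x. x \<in> S \<Longrightarrow> \<bar>\<phi> x\<bar> \<le> P"
      proof -
        have "bounded (\<phi> ` S)" using S by (intro compact_imp_bounded compact_continuous_image continuous_on_subset[OF c]) auto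
        then obtain a where "\<And>y. y \<in> \<phi> ` S \<Longrightarrow> norm y \<le> a" unfolding bounded_iff by blast
        then show ?thesis using that[of a] by auto
      qed
      have int: "integrable lebesgue (\<lambda>x. indicator E x * ((q x \<bullet> i) * \<phi> x))" if q: "q \<in> local_space (Lp_space 1) E" for q :: "'a \<Rightarrow> 'a"
      proof -
        have qi: "integrable lebesgue (\<lambda>x. indicator S x *\<^sub>R q x)"
          using q S \<rho> by (intro local_L1_integrable[of _ c \<rho>]) (auto simp: E_def)
        have eq: "(\<lambda>x. indicator E x * ((q x \<bullet> i) * \<phi> x)) = (\<lambda>x. ((indicator S x *\<^sub>R q x) \<bullet> i) * \<phi> x)"
          using S \<phi>S by (auto simp: fun_eq_iff indicator_def)
        show ?thesis unfolding eq
        proof (rule Bochner_Integration.integrable_bound)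
          show "integrable lebesgue (\<lambda>x. P * ((indicator S x *\<^sub>R q x) \<bullet> i))"
            using qi by (intro integrable_mult_right integrable_inner_left) auto
          show "(\<lambda>x. ((indicator S x *\<^sub>R q x) \<bullet> i) * \<phi> x) \<in> borel_measurable lebesgue"
            using borel_measurable_integrable[OF qi] \<phi>L by (intro borel_measurable_times borel_measurable_inner borel_measurable_const)
          show "AE x in lebesgue. norm ((indicator S x *\<^sub>R q x) \<bullet> i * \<phi> x) \<le> norm (P * ((indicator S x *\<^sub>R q x) \<bullet> i))"
          proof (rule AE_I2)
            fix x
            show "norm ((indicator S x *\<^sub>R q x) \<bullet> i * \<phi> x) \<le> norm (P * ((indicator S x *\<^sub>R q x) \<bullet> i))"
              using P[of x] by (cases "x \<in> S") (auto simp: abs_mult mult.commute intro!: mult_right_mono)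
          qed
        qed
      qed
      have "(LINT x:E|lebesgue. (g x \<bullet> i) * \<phi> x) = (LINT x:E|lebesgue. (g' x \<bullet> i) * \<phi> x)"
      proof -
        have "(LINT x:E|lebesgue. u x * frechet_derivative \<phi> (at x) i) = - (LINT x:E|lebesgue. (g x \<bullet> i) * \<phi> x)"
          using g \<phi> i unfolding has_weak_gradient_def E_def [symmetric] by blast
        moreover have "(LINT x:E|lebesgue. u x * frechet_derivative \<phi> (at x) i) = - (LINT x:E|lebesgue. (g' x \<bullet> i) * \<phi> x)"
          using g' \<phi> i unfolding has_weak_gradient_def E_def [symmetric] by blast
        ultimately show ?thesis by simp
      qed
      then have "(\<integral>x. indicator E x * ((g x \<bullet> i) * \<phi> x) - indicator E x * ((g' x \<bullet> i) * \<phi> x) \<partial>lebesgue) = 0"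
        using int[OF gl(1)] int[OF gl(2)] by (simp add: set_lebesgue_integral_def)
      also have "(\<lambda>x. indicator E x * ((g x \<bullet> i) * \<phi> x) - indicator E x * ((g' x \<bullet> i) * \<phi> x)) = (\<lambda>x. indicator E x *\<^sub>R (w x * \<phi> x))"
        using wE by (auto simp: fun_eq_iff indicator_def left_diff_distrib)
      finally have "(LINT x:E|lebesgue. w x * \<phi> x) = 0" by (simp add: set_lebesgue_integral_def)
      then show "(\<integral>x. indicator E x * (v x * \<phi> x) \<partial>lborel) = 0"
        using set_integral_borel_version[OF wm vm _ Em v(2), of \<phi>] by simp
    qed
    with v(2) have "AE x in lborel. x \<in> E \<longrightarrow> w x = 0" by eventually_elim simp
    then have "AE x in lebesgue. x \<in> E \<longrightarrow> w x = 0" by (rule AE_completion)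
    then show ?thesis by eventually_elim (use wE in auto)
  qed
  have "AE x in lebesgue. \<forall>i\<in>Basis. x \<in> E \<longrightarrow> g x \<bullet> i = g' x \<bullet> i"
    using comp by (subst AE_ball_countable) (auto simp: countable_finite)
  then show ?thesis by eventually_elim (auto simp: E_def intro: euclidean_eqI)
qed

lemma Lp_norm_weak_gradient_unique:
  fixes u :: "'a::euclidean_space \<Rightarrow> real"
  assumes g: "has_weak_gradient u g (ball c \<rho>)" and g': "has_weak_gradient u g' (ball c \<rho>)" and \<rho>: "0 < \<rho>"
  shows "Lp_norm p (ball c \<rho>) g = Lp_norm p (ball c \<rho>) g'"
proof -
  have m: "(\<lambda>x. indicator (ball c \<rho>) x *\<^sub>R norm (q x) powr p) \<in> borel_measurable lebesgue"
    if "has_weak_gradient u q (ball c \<rho>)" for q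
  proof -
    have [measurable]: "(\<lambda>x. indicator (ball c \<rho>) x *\<^sub>R q x) \<in> borel_measurable lebesgue" "ball c \<rho> \<in> sets lebesgue"
      using local_L1_measurable[OF _ \<rho>] that by (auto simp: has_weak_gradient_def)
    have "(\<lambda>x. indicator (ball c \<rho>) x *\<^sub>R norm (indicator (ball c \<rho>) x *\<^sub>R q x) powr p) \<in> borel_measurable lebesgue"
      by measurable
    moreover have "(\<lambda>x. indicator (ball c \<rho>) x *\<^sub>R norm (indicator (ball c \<rho>) x *\<^sub>R q x) powr p) = (\<lambda>x. indicator (ball c \<rho>) x *\<^sub>R norm (q x) powr p)"
      by (auto simp: fun_eq_iff indicator_def)
    ultimately show ?thesis by simp
  qed
  have "(LINT x:ball c \<rho>|lebesgue. norm (g x) powr p) = (LINT x:ball c \<rho>|lebesgue. norm (g' x) powr p)"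
    unfolding set_lebesgue_integral_def
  proof (rule integral_cong_AE[OF m[OF g] m[OF g']])
    show "AE x in lebesgue. indicator (ball c \<rho>) x *\<^sub>R norm (g x) powr p = indicator (ball c \<rho>) x *\<^sub>R norm (g' x) powr p"
      using weak_gradient_unique[OF assms] by eventually_elim (auto simp: indicator_def)
  qed
  then show ?thesis by (simp add: Lp_norm_def)
qed

text \<open>
  The estimate for a single \<open>s\<close>, on concentric balls whose radii have the ratio \<open>\<rho>\<close>. Ratios close to 1 are used
  for local membership in the Sobolev space, the ratio \<open>1 / 2\<close> for the estimate itself.
\<close>

definition gradient_bound :: "'a::euclidean_space itself \<Rightarrow> real \<Rightarrow> real \<Rightarrow> real \<Rightarrow> real \<Rightarrow> bool" where
  "gradient_bound _ p \<rho> s C \<longleftrightarrow> (\<forall>(\<Omega> :: 'a set) u x0 R.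
     open \<Omega> \<and> bounded \<Omega> \<and> u \<in> local_space Linf_space \<Omega> \<and> local_weak_solution s p \<Omega> u \<and> 0 < R \<and> cball x0 R \<subseteq> \<Omega> \<longrightarrow>
     (\<exists>g. has_weak_gradient u g (ball x0 (\<rho> * R)) \<and> g \<in> Lp_space p (ball x0 (\<rho> * R))) \<and>
     (\<forall>g. has_weak_gradient u g (ball x0 (\<rho> * R)) \<longrightarrow>
        Lp_norm p (ball x0 (\<rho> * R)) g
          \<le> C / R * (R powr s * (1 - s) powr (1 / p) * gagliardo_seminorm s p (ball x0 R) u +
               R powr (real DIM('a) / p) * (Linf_norm (ball x0 R) u + Tail s p u x0 R))))"

text \<open>
  \<open>gradient_estimate\<close> is applied with \<open>l\<close> equal to the sum of the three normalised quantities plus a small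
  \<open>e > 0\<close>, which is needed because \<open>l\<close> must be positive even if all of them vanish; then \<open>e\<close> tends to 0. The
  constructed gradient may depend on \<open>e\<close>, but its norm is that of any given weak gradient.
\<close>

lemma gradient_bound_uniform:
  assumes s0: "(p - 2) / p < s0" "s0 < 1" and p: "2 \<le> p" and \<rho>: "0 < \<rho>" "\<rho> < 1"
  shows "\<exists>C. \<forall>s. s0 \<le> s \<and> s < 1 \<longrightarrow> gradient_bound TYPE('a::euclidean_space) p \<rho> s C"
proof -
  from gradient_estimate[OF s0 p \<rho>, where 'a='a]
  obtain C where C: "0 < C" and H: "\<And>s (\<Omega> :: 'a set) u x0 R l.
     s0 \<le> s \<Longrightarrow> s < 1 \<Longrightarrow> open \<Omega> \<Longrightarrow> bounded \<Omega> \<Longrightarrow> u \<in> local_space Linf_space \<Omega> \<Longrightarrow> local_weak_solution s p \<Omega> u \<Longrightarrow>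
     0 < R \<Longrightarrow> cball x0 R \<subseteq> \<Omega> \<Longrightarrow> 0 < l \<Longrightarrow> Linf_norm (ball x0 R) u \<le> l \<Longrightarrow> Tail s p u x0 R \<le> l \<Longrightarrow>
     R powr (s - real DIM('a) / p) * (1 - s) powr (1 / p) * gagliardo_seminorm s p (ball x0 R) u \<le> l \<Longrightarrow>
     \<exists>g. has_weak_gradient u g (ball x0 (\<rho> * R)) \<and> g \<in> Lp_space p (ball x0 (\<rho> * R)) \<and>
        Lp_norm p (ball x0 (\<rho> * R)) g \<le> C / R * (R powr (real DIM('a) / p) * l)"
    by blast
  have "gradient_bound TYPE('a) p \<rho> s C" if s: "s0 \<le> s \<and> s < 1" for s
    unfolding gradient_bound_def
  proof (intro allI impI)
    fix \<Omega> :: "'a set" and u x0 R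
    assume a: "open \<Omega> \<and> bounded \<Omega> \<and> u \<in> local_space Linf_space \<Omega> \<and> local_weak_solution s p \<Omega> u \<and> 0 < R \<and> cball x0 R \<subseteq> \<Omega>"
    then have R: "0 < R" by simp
    define B1 where "B1 = Linf_norm (ball x0 R) u"
    define B2 where "B2 = Tail s p u x0 R"
    define B3 where "B3 = (1 - s) powr (1 / p) * gagliardo_seminorm s p (ball x0 R) u"
    have "u \<in> Linf_space (ball x0 R)" using a by (auto simp: local_space_def)
    then have B: "0 \<le> B1" "0 \<le> B2" "0 \<le> B3"
      using Linf_norm_bound(2)[of u x0 R] R by (auto simp: B1_def B2_def B3_def Tail_def gagliardo_seminorm_def)
    define B3' where "B3' = R powr (s - real DIM('a) / p) * B3"
    have B3': "0 \<le> B3'" using B by (simp add: B3'_def)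
    have est: "\<exists>g. has_weak_gradient u g (ball x0 (\<rho> * R)) \<and> g \<in> Lp_space p (ball x0 (\<rho> * R)) \<and>
        Lp_norm p (ball x0 (\<rho> * R)) g \<le> C / R * (R powr (real DIM('a) / p) * (B1 + B2 + B3' + e))" if "0 < e" for e
    proof (rule H[of s \<Omega>])
      show "0 < B1 + B2 + B3' + e" using B B3' that by linarith
      show "Linf_norm (ball x0 R) u \<le> B1 + B2 + B3' + e" "Tail s p u x0 R \<le> B1 + B2 + B3' + e"
        using B B3' that by (simp_all add: B1_def B2_def)
      have "R powr (s - real DIM('a) / p) * (1 - s) powr (1 / p) * gagliardo_seminorm s p (ball x0 R) u = B3'"
        by (simp add: B3'_def B3_def)
      then show "R powr (s - real DIM('a) / p) * (1 - s) powr (1 / p) * gagliardo_seminorm s p (ball x0 R) u \<le> B1 + B2 + B3' + e"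
        using B B3' that by simp
    qed (use a s in auto)
    have "\<exists>g. has_weak_gradient u g (ball x0 (\<rho> * R)) \<and> g \<in> Lp_space p (ball x0 (\<rho> * R))"
      using est[of 1] by auto
    moreover have "Lp_norm p (ball x0 (\<rho> * R)) g \<le> C / R * (R powr s * (1 - s) powr (1 / p) * gagliardo_seminorm s p (ball x0 R) u +
               R powr (real DIM('a) / p) * (Linf_norm (ball x0 R) u + Tail s p u x0 R))"
      if g: "has_weak_gradient u g (ball x0 (\<rho> * R))" for g
    proof (rule field_le_epsilon)
      fix e :: real assume e: "0 < e"
      define k where "k = C / R * R powr (real DIM('a) / p)"
      have k: "0 < k" using C R by (simp add: k_def)
      obtain g' where g': "has_weak_gradient u g' (ball x0 (\<rho> * R))"
        "Lp_norm p (ball x0 (\<rho> * R)) g' \<le> C / R * (R powr (real DIM('a) / p) * (B1 + B2 + B3' + e / k))"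
        using est[of "e / k"] e k by auto
      have "Lp_norm p (ball x0 (\<rho> * R)) g = Lp_norm p (ball x0 (\<rho> * R)) g'"
        using R \<rho> by (intro Lp_norm_weak_gradient_unique[OF g g'(1)]) auto
      also have "\<dots> \<le> k * (B1 + B2 + B3' + e / k)" using g'(2) by (simp add: k_def)
      also have "\<dots> = k * B3' + k * (B1 + B2) + e" using k by (simp add: algebra_simps)
      also have "k * B3' = C / R * (R powr s * B3)"
      proof -
        have "R powr (real DIM('a) / p) * R powr (s - real DIM('a) / p) = R powr s"
          unfolding powr_add [symmetric] by simp
        then show ?thesis by (simp add: k_def B3'_def mult.assoc [symmetric])
      qed
      finally show "Lp_norm p (ball x0 (\<rho> * R)) g \<le> C / R * (R powr s * (1 - s) powr (1 / p) * gagliardo_seminorm s p (ball x0 R) u +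
               R powr (real DIM('a) / p) * (Linf_norm (ball x0 R) u + Tail s p u x0 R)) + e"
        by (simp add: k_def B1_def B2_def B3_def distrib_left mult.assoc)
    qed
    ultimately show "(\<exists>g. has_weak_gradient u g (ball x0 (\<rho> * R)) \<and> g \<in> Lp_space p (ball x0 (\<rho> * R))) \<and>
     (\<forall>g. has_weak_gradient u g (ball x0 (\<rho> * R)) \<longrightarrow>
        Lp_norm p (ball x0 (\<rho> * R)) g
          \<le> C / R * (R powr s * (1 - s) powr (1 / p) * gagliardo_seminorm s p (ball x0 R) u +
               R powr (real DIM('a) / p) * (Linf_norm (ball x0 R) u + Tail s p u x0 R)))" by blast
  qed
  then show ?thesis by blast
qed

text \<open>
  The compact ball has a positive distance from the complement of \<open>\<Omega>\<close>, and a point at distance at most \<open>r + e\<close>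
  from the centre is within \<open>e\<close> of the ball.
\<close>

lemma larger_cball_inside:
  fixes x :: "'a::euclidean_space"
  assumes "open \<Omega>" "0 < r" "cball x r \<subseteq> \<Omega>"
  obtains R where "r < R" "cball x R \<subseteq> \<Omega>"
proof -
  have "cball x r \<noteq> {}" using assms by auto
  then obtain e where e: "0 < e" "{y. infdist y (cball x r) \<le> e} \<subseteq> \<Omega>"
    using compact_in_open_separated[of "cball x r" \<Omega>] assms by auto
  have "cball x (r + e) \<subseteq> \<Omega>"
  proof
    fix y assume y: "y \<in> cball x (r + e)"
    have "infdist y (cball x r) \<le> e"
    proof (cases "y \<in> cball x r")
      case True
      then show ?thesis using e by simp
    next
      case False
      define t where "t = r / dist x y"
      have d: "0 < dist x y" "r < dist x y" using False assms by auto
      have "x + t *\<^sub>R (y - x) \<in> cball x r" using d assms by (simp add: dist_norm t_def norm_minus_commute)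
      then have "infdist y (cball x r) \<le> dist y (x + t *\<^sub>R (y - x))" by (rule infdist_le)
      also have "dist y (x + t *\<^sub>R (y - x)) = norm ((1 - t) *\<^sub>R (y - x))" by (simp add: dist_norm algebra_simps)
      also have "\<dots> = (1 - t) * dist x y" using d assms by (simp add: t_def dist_norm norm_minus_commute)
      also have "\<dots> = dist x y - r" using d by (simp add: t_def left_diff_distrib)
      also have "\<dots> \<le> e" using y by simp
      finally show ?thesis .
    qed
    then show "y \<in> \<Omega>" using e by blast
  qed
  then show ?thesis using that[of "r + e"] e by simp
qed

theorem theorem1p3:
  fixes p :: real
  assumes "DIM('a::euclidean_space) \<ge> 2" and "p \<ge> 2"
  shows
    "(\<forall>s (\<Omega> :: 'a set) u.
        (p - 2) / p < s \<and> s < 1 \<and> open \<Omega> \<and> bounded \<Omega> \<and>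
        u \<in> local_space Linf_space \<Omega> \<and> local_weak_solution s p \<Omega> u \<longrightarrow>
        u \<in> local_space (sobolev_W1 p) \<Omega>) \<and>
     (\<exists>C :: real \<Rightarrow> real.
        (\<forall>s (\<Omega> :: 'a set) u x0 R g.
           (p - 2) / p < s \<and> s < 1 \<and> open \<Omega> \<and> bounded \<Omega> \<and>
           u \<in> local_space Linf_space \<Omega> \<and> local_weak_solution s p \<Omega> u \<and>
           0 < R \<and> cball x0 R \<subseteq> \<Omega> \<and> has_weak_gradient u g (ball x0 (R / 2)) \<longrightarrow>
           Lp_norm p (ball x0 (R / 2)) g
             \<le> C s / R *
               (R powr s * (1 - s) powr (1 / p) * gagliardo_seminorm s p (ball x0 R) u +
                R powr (real DIM('a) / p) * (Linf_norm (ball x0 R) u + Tail s p u x0 R))) \<and>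
        Bfun C (at_left 1))"
proof (intro conjI allI impI)
  have p: "2 \<le> p" using assms by simp
  fix s and \<Omega> :: "'a set" and u :: "'a \<Rightarrow> real"
  assume a: "(p - 2) / p < s \<and> s < 1 \<and> open \<Omega> \<and> bounded \<Omega> \<and> u \<in> local_space Linf_space \<Omega> \<and> local_weak_solution s p \<Omega> u"
  show "u \<in> local_space (sobolev_W1 p) \<Omega>"
    unfolding local_space_def
  proof (intro CollectI allI impI)
    fix x :: 'a and r assume r: "0 < r \<and> cball x r \<subseteq> \<Omega>"
    \<comment> \<open>The gradient on the ball of radius r is obtained from a larger concentric ball inside \<Omega>.\<close>
    obtain R where R: "r < R" "cball x R \<subseteq> \<Omega>"
      using larger_cball_inside[of \<Omega> r x] a r by metis
    have \<rho>: "0 < r / R" "r / R < 1" and R0: "0 < R" using r R by auto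
    obtain C where "gradient_bound TYPE('a) p (r / R) s C"
      using gradient_bound_uniform[OF _ _ p \<rho>, of s, where 'a='a] a by auto
    then obtain g where g: "has_weak_gradient u g (ball x (r / R * R))" "g \<in> Lp_space p (ball x (r / R * R))"
      unfolding gradient_bound_def using a R R0 by metis
    have "u \<in> Lp_space p (ball x r)"
      using a r by (auto simp: local_weak_solution_def local_space_def frac_sobolev_def)
    then show "u \<in> sobolev_W1 p (ball x r)" using g R0 by (auto simp: sobolev_W1_def)
  qed
next
  have p: "2 \<le> p" using assms by simp
  have pp: "(p - 2) / p < 1" using p by (simp add: field_simps)
  have "\<forall>s0. \<exists>C. (p - 2) / p < s0 \<and> s0 < 1 \<longrightarrow> (\<forall>s. s0 \<le> s \<and> s < 1 \<longrightarrow> gradient_bound TYPE('a) p (1 / 2) s C)"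
    using gradient_bound_uniform[OF _ _ p, of _ "1 / 2", where 'a='a] by auto
  then obtain K where K: "\<And>s0 s. (p - 2) / p < s0 \<Longrightarrow> s0 < 1 \<Longrightarrow> s0 \<le> s \<Longrightarrow> s < 1 \<Longrightarrow> gradient_bound TYPE('a) p (1 / 2) s (K s0)"
    by metis
  define s1 where "s1 = ((p - 2) / p + 1) / 2"
  have s1: "(p - 2) / p < s1" "s1 < 1" 
  proof -
    have "k < (k + 1) / 2 \<and> (k + 1) / 2 < 1" if "k < 1" for k :: real using that by simp
    from this[OF pp] show "(p - 2) / p < s1" "s1 < 1" unfolding s1_def by auto
  qed
  \<comment> \<open>One constant serves all s from s1 upwards, so C is constant near 1; below s1 the constant
    obtained for s itself is used.\<close>
  define C where "C s = (if s1 \<le> s then K s1 else K s)" for s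
  have C: "gradient_bound TYPE('a) p (1 / 2) s (C s)" if "(p - 2) / p < s" "s < 1" for s
    using K[OF s1, of s] K[of s s] that by (simp add: C_def)
  have "eventually (\<lambda>s. norm (C s) \<le> \<bar>K s1\<bar>) (at_left 1)"
    using eventually_at_left_field[of "\<lambda>s. norm (C s) \<le> \<bar>K s1\<bar>" 1] s1(2) by (auto simp: C_def)
  then have bdd: "Bfun C (at_left 1)" by (rule BfunI)
  show "\<exists>C :: real \<Rightarrow> real.
        (\<forall>s (\<Omega> :: 'a set) u x0 R g.
           (p - 2) / p < s \<and> s < 1 \<and> open \<Omega> \<and> bounded \<Omega> \<and>
           u \<in> local_space Linf_space \<Omega> \<and> local_weak_solution s p \<Omega> u \<and>
           0 < R \<and> cball x0 R \<subseteq> \<Omega> \<and> has_weak_gradient u g (ball x0 (R / 2)) \<longrightarrow>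
           Lp_norm p (ball x0 (R / 2)) g
             \<le> C s / R *
               (R powr s * (1 - s) powr (1 / p) * gagliardo_seminorm s p (ball x0 R) u +
                R powr (real DIM('a) / p) * (Linf_norm (ball x0 R) u + Tail s p u x0 R))) \<and>
        Bfun C (at_left 1)"
  proof (rule exI[of _ C], intro conjI bdd allI impI)
    fix s and \<Omega> :: "'a set" and u x0 R g
    assume a: "(p - 2) / p < s \<and> s < 1 \<and> open \<Omega> \<and> bounded \<Omega> \<and>
           u \<in> local_space Linf_space \<Omega> \<and> local_weak_solution s p \<Omega> u \<and>
           0 < R \<and> cball x0 R \<subseteq> \<Omega> \<and> has_weak_gradient u g (ball x0 (R / 2))"
    have "gradient_bound TYPE('a) p (1 / 2) s (C s)" using a C by blast
    moreover have "1 / 2 * R = R / 2" by simp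
    ultimately show "Lp_norm p (ball x0 (R / 2)) g
             \<le> C s / R *
               (R powr s * (1 - s) powr (1 / p) * gagliardo_seminorm s p (ball x0 R) u +
                R powr (real DIM('a) / p) * (Linf_norm (ball x0 R) u + Tail s p u x0 R))"
      unfolding gradient_bound_def using a by metis
  qed
qed

end
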